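(* Let $n\ge 2$, let $\Omega\subset\mathbb{R}^{n-1}$ be a bounded star-shaped domain with a fixed star center $x_o\in\Omega$, and let $\psi:(0,1]\to(0,\infty)$ be a left continuous and increasing (i.e. non-decreasing) function. Define the outward cuspidal domain $$\Omega_\psi:=\left\{(t,x)\in(0,1)\times\mathbb{R}^{n-1}:\ \frac{x-x_o}{\psi(t)}+x_o\in\Omega\right\}\cup\left\{(t,x)\in[1,2)\times\mathbb{R}^{n-1}:\ \frac{x-x_o}{\psi(1)}+x_o\in\Omega\right\}\subset\mathbb{R}^n.$$ Then for every $1<p\le\infty$, $W^{1,p}(\Omega_\psi)=M^{1,p}(\Omega_\psi)$ if and only if $W^{1,p}(\Omega)=M^{1,p}(\Omega)$.
   Context: A domain is a nonempty connected open set. A domain $\Omega\subset\mathbb{R}^m$ is star-shaped if there is a point $x_o\in\Omega$ (a star center) such that for every $x\in\Omega$ the segment $[x,x_o]$ is contained in $\Omega$. For a domain $U\subset\mathbb{R}^m$ and $1\le p\le\infty$, $W^{1,p}(U)$ is the usual first order Sobolev space of all $u\in L^p(U)$ whose weak gradient $\nabla u$ belongs to $L^p(U;\mathbb{R}^m)$. For $u\in L^p(U)$, let $\mathcal{D}_p(u)$ be the class of functions $0\le g\in L^p(U)$ for which there is a set $E\subset U$ of Lebesgue measure zero with $|u(z_1)-u(z_2)|\le|z_1-z_2|\,(g(z_1)+g(z_2))$ for all $z_1,z_2\in U\setminus E$. The Hajłasz-Sobolev space is $M^{1,p}(U):=\{u\in L^p(U):\ \mathcal{D}_p(u)\neq\emptyset\}$.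 The equality $W^{1,p}(U)=M^{1,p}(U)$ means equality as sets of (a.e.-equivalence classes of) functions. *)

theory Defs
  imports "HOL-Analysis.Analysis"
begin

definition is_domain :: "'a::euclidean_space set \<Rightarrow> bool" where
  "is_domain U \<longleftrightarrow> U \<noteq> {} \<and> connected U \<and> open U"

definition star_center :: "'a::euclidean_space set \<Rightarrow> 'a \<Rightarrow> bool" where
  "star_center U x0 \<longleftrightarrow> x0 \<in> U \<and> (\<forall>x\<in>U. closed_segment x x0 \<subseteq> U)"

text \<open>Functions on \<open>U\<close> are represented by total functions whose values outside \<open>U\<close> are irrelevant:
  all conditions below only refer to points of \<open>U\<close>.\<close>

definition Lp :: "ennreal \<Rightarrow> 'a::euclidean_space set \<Rightarrow> ('a \<Rightarrow> 'b::euclidean_space) set" where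
  "Lp p U = {u \<in> borel_measurable (lebesgue_on U).
     if p = \<infinity> then \<exists>C. AE x in lebesgue_on U. norm (u x) \<le> C
     else integrable (lebesgue_on U) (\<lambda>x. norm (u x) powr enn2real p)}"

text \<open>\<open>C_diff k f\<close>: the function \<open>f\<close> is of class \<open>C^k\<close> on the whole space.\<close>

primrec C_diff :: "nat \<Rightarrow> ('a::euclidean_space \<Rightarrow> real) \<Rightarrow> bool" where
  "C_diff 0 f \<longleftrightarrow> continuous_on UNIV f"
| "C_diff (Suc k) f \<longleftrightarrow> (\<forall>x. f differentiable at x) \<and>
     (\<forall>i\<in>Basis. C_diff k (\<lambda>x. frechet_derivative f (at x) i))"

text \<open>The space \<open>C_c^\<infinity>(U)\<close>, each function being extended by zero.\<close>

definition test_functions :: "'a::euclidean_space set \<Rightarrow> ('a \<Rightarrow> real) set" where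
  "test_functions U = {\<phi>. (\<forall>k. C_diff k \<phi>) \<and>
     compact (closure {x. \<phi> x \<noteq> 0}) \<and> closure {x. \<phi> x \<noteq> 0} \<subseteq> U}"

text \<open>Only meaningful for locally integrable \<open>u\<close> and \<open>g\<close> (Bochner integrals of non-integrable
  functions are zero); below it is applied to members of \<open>Lp p U\<close> with \<open>1 \<le> p\<close>.\<close>

definition weak_gradient ::
  "'a::euclidean_space set \<Rightarrow> ('a \<Rightarrow> real) \<Rightarrow> ('a \<Rightarrow> 'a) \<Rightarrow> bool" where
  "weak_gradient U u g \<longleftrightarrow> (\<forall>\<phi>\<in>test_functions U. \<forall>i\<in>Basis.
     (\<integral>x. u x * frechet_derivative \<phi> (at x) i \<partial>lebesgue_on U)
       = - (\<integral>x. (g x \<bullet> i) * \<phi> x \<partial>lebesgue_on U))"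

definition W1p :: "ennreal \<Rightarrow> 'a::euclidean_space set \<Rightarrow> ('a \<Rightarrow> real) set" where
  "W1p p U = {u \<in> Lp p U. \<exists>g\<in>Lp p U. weak_gradient U u g}"

definition Hajlasz_gradients ::
  "ennreal \<Rightarrow> 'a::euclidean_space set \<Rightarrow> ('a \<Rightarrow> real) \<Rightarrow> ('a \<Rightarrow> real) set" where
  "Hajlasz_gradients p U u = {g \<in> Lp p U. (\<forall>z\<in>U. 0 \<le> g z) \<and>
     (\<exists>E\<in>null_sets lebesgue. E \<subseteq> U \<and>
        (\<forall>z1\<in>U - E. \<forall>z2\<in>U - E. \<bar>u z1 - u z2\<bar> \<le> norm (z1 - z2) * (g z1 + g z2)))}"

definition M1p :: "ennreal \<Rightarrow> 'a::euclidean_space set \<Rightarrow> ('a \<Rightarrow> real) set" where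
  "M1p p U = {u \<in> Lp p U. Hajlasz_gradients p U u \<noteq> {}}"

definition ae_eq_rel :: "'a::euclidean_space set \<Rightarrow> (('a \<Rightarrow> real) \<times> ('a \<Rightarrow> real)) set" where
  "ae_eq_rel U = {(u, v). AE x in lebesgue_on U. u x = v x}"

definition W1p_eq_M1p :: "ennreal \<Rightarrow> 'a::euclidean_space set \<Rightarrow> bool" where
  "W1p_eq_M1p p U \<longleftrightarrow> W1p p U // ae_eq_rel U = M1p p U // ae_eq_rel U"

definition cusp_domain ::
  "'a::euclidean_space set \<Rightarrow> 'a \<Rightarrow> (real \<Rightarrow> real) \<Rightarrow> (real \<times> 'a) set" where
  "cusp_domain \<Omega> x0 \<psi> =
     {(t, x). t \<in> {0<..<1} \<and> (x - x0) /\<^sub>R \<psi> t + x0 \<in> \<Omega>} \<union>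
     {(t, x). t \<in> {1..<2} \<and> (x - x0) /\<^sub>R \<psi> 1 + x0 \<in> \<Omega>}"

end

theory Submission
  imports Defs "HOL-Probability.Probability"
begin

text \<open>The inclusion of \<open>M\<close> in \<open>W\<close> holds on every bounded open set. If \<open>W = M\<close> on the cusp, a Sobolev function on the base
  is lifted to a function that does not depend on \<open>t\<close>, and a slice of a Hajlasz gradient at some \<open>t > 1\<close> is a
  Hajlasz gradient on the base. Conversely, if \<open>W = M\<close> on the base, a Baire category argument with the Poincare
  inequality makes the passage from a gradient to a Hajlasz gradient bounded, up to approximation, on functions of
  mean zero over a ball. Applied measurably to the rescaled slices of a Sobolev function on the cusp, this gives a function
  \<open>G\<close> controlling the increments in the horizontal directions; the increments in the direction of \<open>t\<close> are controlled by
  integrals of the gradient. Since the cusp is closed under increasing \<open>t\<close>, two points can be compared through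
  many common slices, and the one-dimensional maximal functions of \<open>G\<close> and of the gradient in the direction of \<open>t\<close>
  form a Hajlasz gradient. They are in \<open>L\<^sup>p\<close> because \<open>p > 1\<close>.\<close>

text \<open>Equality of the two spaces on the base is only qualitative: it gives no bound for a
  Hajlasz gradient, whereas a function on the cusp has uncountably many slices whose Hajlasz
  gradients must be bounded uniformly and depend measurably on \<open>t\<close>. Baire supplies the
  constant, but only for approximants. Exactness is regained by iterating the approximation, as in
  the open mapping theorem, along one countable dense sequence, which also makes the choice
  measurable in \<open>t\<close>. For p = \<infinity> the space is not separable; there the function
  \<open>K * n t\<close>, constant on each slice, with \<open>n t\<close> the norm of the slice
  gradient, already serves. Mean zero is imposed so that distances between gradients control the
  functions too. The constant does not deteriorate in thin slices: rescaling a slice to \<Omega>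
  multiplies its gradient by the width, and going back divides the Hajlasz gradient by it. Weak
  derivatives are handled through the integral formula along segments, which restricts to slices and
  is stable under affine changes of variables, so that nothing is mollified.\<close>

abbreviation Borel :: "('a::topological_space \<Rightarrow> 'b::topological_space) set" where
  "Borel \<equiv> borel_measurable borel"

abbreviation Borel2 :: "('a::topological_space \<times> 'b::topological_space \<Rightarrow> 'c::topological_space) set" where
  "Borel2 \<equiv> borel_measurable (borel \<Otimes>\<^sub>M borel)"

abbreviation pard :: "('a::real_normed_vector \<Rightarrow> real) \<Rightarrow> 'a \<Rightarrow> 'a \<Rightarrow> real" where
  "pard \<phi> i x \<equiv> frechet_derivative \<phi> (at x) i"

abbreviation lint :: "('a::euclidean_space \<Rightarrow> ennreal) \<Rightarrow> ennreal" (binder "NN " 10) where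
  "lint f \<equiv> integral\<^sup>N lborel f"

abbreviation bint :: "('a::euclidean_space \<Rightarrow> real) \<Rightarrow> real" (binder "BB " 10) where
  "bint f \<equiv> integral\<^sup>L lborel f"

section \<open>Lebesgue norms\<close>

definition epow :: "real => ennreal => ennreal" where
 "epow q x = (if x = \<infinity> then \<infinity> else ennreal (enn2real x powr q))"

lemma epow_measurable [measurable]: "epow q \<in> Borel"
 unfolding epow_def by measurable

lemma epow_ennreal: "0 \<le> x ==> epow q (ennreal x) = ennreal (x powr q)"
 by (simp add: epow_def)

lemma epow_simps [simp]: "epow q 0 = 0" "epow q \<infinity> = \<infinity>" "epow q top = top" "epow q 1 = 1"
 by (auto simp: epow_def)

lemma epow_eq_0_iff [simp]: "epow q x = 0 \<longleftrightarrow> x = 0"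
 by (cases x) (auto simp: epow_def)

lemma epow_mult:
 assumes "0 < q" shows "epow q (x * y) = epow q x * epow q y"
 by (cases x; cases y)
   (auto simp: epow_ennreal ennreal_mult[symmetric] powr_mult ennreal_top_mult ennreal_mult_top)

lemma epow_le_iff [simp]: "0 < q ==> epow q x \<le> epow q y \<longleftrightarrow> x \<le> y"
proof (cases x; cases y)
 fix a b assume *: "0 < q" "x = ennreal a" "0 \<le> a" "y = ennreal b" "0 \<le> b"
 have "a powr q \<le> b powr q \<longleftrightarrow> a \<le> b"
  using * powr_mono2[of q a b] powr_less_mono2[of q b a] by (auto simp flip: not_less)
 with * show ?thesis by (simp add: epow_ennreal)
qed (auto simp: epow_ennreal top_unique)

lemma epow_epow: "0 < q ==> epow (1/q) (epow q x) = x"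
 by (cases x) (auto simp: epow_ennreal powr_powr)

lemma epow_epow': "0 < q ==> epow q (epow (1/q) x) = x"
 by (cases x) (auto simp: epow_ennreal powr_powr)

lemma epow_eq_top_iff [simp]: "epow q x = top \<longleftrightarrow> x = top"
 by (cases x) (auto simp: epow_ennreal)

lemma epow_less_top_iff [simp]: "epow q x < top \<longleftrightarrow> x < top"
 by (metis epow_eq_top_iff less_top)

lemma epow_mono: "0 < q ==> x \<le> y ==> epow q x \<le> epow q y"
 by simp

text \<open>Convexity of the power function: its graph lies above the tangent at \<open>a\<close>.
  Homogeneity reduces this to the tangent at 1, and \<open>y = 0\<close> is treated apart because
  the tangent lemma lives on the open half line.\<close>

lemma powr_tangent:
 fixes a x q :: real
 assumes "0 < a" "0 \<le> x" "1 \<le> q"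
 shows "q * a powr (q - 1) * x \<le> x powr q + (q - 1) * a powr q"
proof -
 have "q * y \<le> y powr q + (q - 1)" if "0 \<le> y" for y :: real
 proof (cases "y = 0")
  case False
  have "(q * 1 powr (q - 1)) * (y - 1) \<le> y powr q - 1 powr q"
  proof (rule convex_on_imp_above_tangent[where A="{0<..}" and f = "\<lambda>x. x powr q"])
   show "convex_on {0<..} (\<lambda>x. x powr q)" using assms(3) by (rule powr_convex)
   show "((\<lambda>x. x powr q) has_real_derivative q * 1 powr (q - 1)) (at 1 within {0<..})"
    by (auto intro!: derivative_eq_intros)
  qed (use False that in \<open>auto simp: interior_open\<close>)
  then show ?thesis by (simp add: algebra_simps)
 qed (use assms in auto)
 from this[of "x/a"] have "q * (x/a) * a powr q \<le> ((x/a) powr q + (q - 1)) * a powr q"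
  using assms by (intro mult_right_mono) auto
 moreover have "q * (x/a) * a powr q = q * a powr (q - 1) * x"
  using assms by (simp add: powr_diff)
 moreover have "((x/a) powr q + (q - 1)) * a powr q = x powr q + (q - 1) * a powr q"
  using assms by (simp add: powr_divide field_simps)
 ultimately show ?thesis by simp
qed

lemma le_one_plus_epow: "1 \<le> q ==> x \<le> 1 + epow q x"
proof (cases x)
 case (real r)
 assume q: "1 \<le> q"
 have "r \<le> 1 + r powr q"
 proof (cases "r \<le> 1")
  case False
  then have "r powr 1 \<le> r powr q" using q by (intro powr_mono) auto
  then show ?thesis using False by simp
 qed (simp add: add_increasing2)
 then show ?thesis using real by (simp add: epow_ennreal flip: ennreal_1 ennreal_plus del: ennreal_1 )
qed simp

lemma epow_tangent:
 assumes "0 < a" "1 \<le> q"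
 shows "ennreal (q * a powr (q - 1)) * x \<le> epow q x + ennreal ((q - 1) * a powr q)"
proof (cases x)
 case (real r)
 then show ?thesis
  using powr_tangent[OF assms(1) real(1) assms(2)] assms real
  by (simp add: epow_ennreal flip: ennreal_mult ennreal_plus)
qed simp

text \<open>Integrating \<open>epow_tangent\<close> gives the inequality if the tangent is taken at
  the mean. The power of the total mass appears because the measure is not normalised. If the
  integral of \<open>f\<close> is infinite, \<open>le_one_plus_epow\<close> forces the integral of
  the power to be infinite too, since constants have finite integral.\<close>

lemma (in finite_measure) epow_jensen:
 assumes q: "1 \<le> q" and [measurable]: "f \<in> borel_measurable M"
 shows "epow q (\<integral>\<^sup>+x. f x \<partial>M) \<le> ennreal (measure M (space M) powr (q - 1)) * (\<integral>\<^sup>+x. epow q (f x) \<partial>M)"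
proof -
 define m where "m = measure M (space M)"
 have m: "emeasure M (space M) = ennreal m" "0 \<le> m"
  by (auto simp: m_def emeasure_eq_measure)
 show ?thesis
 proof (cases "\<integral>\<^sup>+x. f x \<partial>M")
  case top
  have "m \<noteq> 0"
  proof
   assume "m = 0"
   then have "(\<integral>\<^sup>+x. f x \<partial>M) = 0" using m by (intro nn_integral_null_measure[THEN trans, rotated] nn_integral_0_iff_AE[THEN iffD2]) (auto intro!: AE_I[of _ _ "space M"])
   with top show False by simp
  qed
  have "top \<le> (\<integral>\<^sup>+x. 1 + epow q (f x) \<partial>M)"
   unfolding top[symmetric] by (intro nn_integral_mono le_one_plus_epow q)
  also have "\<dots> = ennreal m + (\<integral>\<^sup>+x. epow q (f x) \<partial>M)" using m by (subst nn_integral_add) auto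
  finally have "(\<integral>\<^sup>+x. epow q (f x) \<partial>M) = top" by (simp add: top_unique)
  with \<open>m \<noteq> 0\<close> m show ?thesis by (simp add: m_def ennreal_mult_top)
 next
  case (real A)
  show ?thesis
  proof (cases "A = 0")
   case True then show ?thesis using real by simp
  next
   case False
   with real have A: "0 < A" by simp
   have m0: "0 < m"
   proof (rule ccontr)
    assume "\<not> 0 < m"
    then have "(\<integral>\<^sup>+x. f x \<partial>M) = 0" using m by (intro nn_integral_0_iff_AE[THEN iffD2]) (auto intro!: AE_I[of _ _ "space M"])
    with real A show False by simp
   qed
   \<comment> \<open>The mean of \<open>f\<close>; at this point the integrated tangent inequality
     is sharp.\<close>
   define a where "a = A / m"
   have a: "0 < a" using A m0 by (simp add: a_def)
   have "ennreal (q * a powr (q - 1)) * ennreal A = (\<integral>\<^sup>+x. ennreal (q * a powr (q - 1)) * f x \<partial>M)"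
    using real by (simp add: nn_integral_cmult)
   also have "\<dots> \<le> (\<integral>\<^sup>+x. epow q (f x) + ennreal ((q - 1) * a powr q) \<partial>M)"
    by (intro nn_integral_mono epow_tangent a q)
   also have "\<dots> = (\<integral>\<^sup>+x. epow q (f x) \<partial>M) + ennreal ((q - 1) * a powr q) * ennreal m"
    using m by (subst nn_integral_add) auto
   finally have *: "ennreal (q * a powr (q - 1) * A) \<le> (\<integral>\<^sup>+x. epow q (f x) \<partial>M) + ennreal ((q - 1) * a powr q * m)"
    using q m0 A by (simp add: ennreal_mult)
   show ?thesis
   proof (cases "\<integral>\<^sup>+x. epow q (f x) \<partial>M")
    case (real B)
    have "q * a powr (q - 1) * A \<le> B + (q - 1) * a powr q * m"
    proof -
     have "0 \<le> (q - 1) * a powr q * m" using q m0 by simp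
     then show ?thesis
      using * real(1) unfolding real(2) by (simp flip: ennreal_plus)
    qed
    moreover have "a powr (q - 1) * A = a powr q * m"
     using a m0 A by (simp add: powr_diff a_def)
    then have "q * a powr (q - 1) * A = q * (a powr q * m)" by (simp only: mult.assoc)
    moreover have "(q - 1) * a powr q * m = q * (a powr q * m) - a powr q * m"
     by (simp add: left_diff_distrib mult.assoc)
    ultimately have "a powr q * m \<le> B" by linarith
    then have "m powr (q - 1) * (a powr q * m) \<le> m powr (q - 1) * B" by (intro mult_left_mono) auto
    moreover have "m powr (q - 1) * (a powr q * m) = A powr q"
     using A m0 by (simp add: a_def powr_divide powr_diff)
    ultimately show ?thesis using real \<open>integral\<^sup>N M f = ennreal A\<close> A
     by (simp add: epow_ennreal m_def ennreal_mult[symmetric])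
   next
    case top then show ?thesis using m0 by (simp add: m_def ennreal_mult_top)
   qed
  qed
 qed
qed

text \<open>Norms take values in \<open>ennreal\<close>, so that Tonelli and the triangle
  inequalities need no integrability conditions and finiteness is a separate statement. Sobolev
  functions will be extended by zero, whence one norm over the whole space serves every
  domain.\<close>

definition Lnorm :: "ennreal => ('a::euclidean_space => ennreal) => ennreal" where
 "Lnorm p f = (if p = \<infinity> then Inf {c. AE x in lborel. f x \<le> c}
   else epow (1 / enn2real p) (NN x. epow (enn2real p) (f x)))"

text \<open>The infimum that defines the essential supremum is attained: it is the infimum of a
  countable family, and countably many exceptional null sets have a null union.\<close>

lemma Lnorm_infinity_le_iff: "Lnorm \<infinity> f \<le> c \<longleftrightarrow> (AE x in lborel. f x \<le> c)"
proof
 let ?S = "{c. AE x in lborel. f x \<le> c}"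
 have ne: "?S \<noteq> {}" by (auto intro!: exI[of _ top])
 obtain h :: "nat => ennreal" where h: "range h \<subseteq> ?S" "Inf ?S = (INF i. h i)"
  using ennreal_Inf_countable_INF[OF ne] by auto
 have "AE x in lborel. \<forall>i. f x \<le> h i" using h(1) by (subst AE_all_countable) auto
 then have *: "AE x in lborel. f x \<le> Inf ?S"
  by eventually_elim (auto simp: h(2) intro: INF_greatest)
 assume "Lnorm \<infinity> f \<le> c"
 then have "Inf ?S \<le> c" by (simp add: Lnorm_def)
 with * show "AE x in lborel. f x \<le> c" by (auto elim: eventually_mono)
qed (auto simp: Lnorm_def intro: Inf_lower)

lemma Lnorm_le_iff:
 assumes "p \<noteq> \<infinity>" "1 \<le> p"
 shows "Lnorm p f \<le> c \<longleftrightarrow> (NN x. epow (enn2real p) (f x)) \<le> epow (enn2real p) c"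
proof -
 have "0 < p" using assms(2) by (metis ennreal_zero_less_one order_less_le_trans)
 then have q: "0 < enn2real p" using assms by (auto simp: enn2real_positive_iff less_top)
 show ?thesis unfolding Lnorm_def
  using assms epow_le_iff[OF q, symmetric, of "epow (1 / enn2real p) (NN x. epow (enn2real p) (f x))" c] q
  by (auto simp: epow_epow')
qed

lemma enn2real_ge_1: "p \<noteq> \<infinity> ==> 1 \<le> p ==> 1 \<le> enn2real p"
 by (metis enn2real_1 enn2real_mono infinity_ennreal_def less_top)

lemma Lnorm_mono_AE:
 assumes "1 \<le> p" "AE x in lborel. f x \<le> g x" shows "Lnorm p f \<le> Lnorm p g"
proof (cases "p = \<infinity>")
 case True
 have "AE x in lborel. g x \<le> Lnorm \<infinity> g" using Lnorm_infinity_le_iff by blast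
 with assms(2) have "AE x in lborel. f x \<le> Lnorm \<infinity> g" by eventually_elim auto
 then show ?thesis using Lnorm_infinity_le_iff[of f "Lnorm \<infinity> g"] by (simp add: True)
next
 case False
 have q: "0 < enn2real p" using enn2real_ge_1[OF False assms(1)] by simp
 then show ?thesis using False assms(2)
  by (auto simp: Lnorm_def intro!: nn_integral_mono_AE)
qed

lemma Lnorm_mono: "1 \<le> p ==> (\<And>x. f x \<le> g x) ==> Lnorm p f \<le> Lnorm p g"
 by (intro Lnorm_mono_AE) auto

lemma Lnorm_cmult_le:
 assumes p: "1 \<le> p" and [measurable]: "f \<in> Borel"
 shows "Lnorm p (\<lambda>x. c * f x) \<le> c * Lnorm p f"
proof (cases "p = \<infinity>")
 case True
 have "AE x in lborel. f x \<le> Lnorm \<infinity> f" using Lnorm_infinity_le_iff by blast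
 then show ?thesis unfolding True Lnorm_infinity_le_iff by eventually_elim (auto intro: mult_left_mono)
next
 case False
 have q: "1 \<le> enn2real p" using enn2real_ge_1[OF False p] by simp
 have "(NN x. epow (enn2real p) (f x)) \<le> epow (enn2real p) (Lnorm p f)"
  using Lnorm_le_iff[OF False p] by blast
 then show ?thesis using q
  unfolding Lnorm_le_iff[OF False p]
  by (simp add: epow_mult nn_integral_cmult mult_left_mono)
qed

lemma Lnorm_zero [simp]: "1 \<le> p ==> Lnorm p (\<lambda>x. 0) = 0"
 using Lnorm_cmult_le[of p "\<lambda>_. 0" 0] by simp

lemma Lnorm_eq_0_AE:
 assumes p: "1 \<le> p" and [measurable]: "f \<in> Borel" and 0: "Lnorm p f = 0"
 shows "AE x in lborel. f x = 0"
proof (cases "p = \<infinity>")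
 case True
 then show ?thesis using 0 Lnorm_infinity_le_iff[of f 0] by auto
next
 case False
 then have "(NN x. epow (enn2real p) (f x)) = 0"
  using Lnorm_le_iff[OF False p, of f 0] 0 by simp
 then show ?thesis by (subst (asm) nn_integral_0_iff_AE) auto
qed

lemma Lnorm_finite_AE:
 assumes p: "1 \<le> p" and [measurable]: "f \<in> Borel" and fin: "Lnorm p f < top"
 shows "AE x in lborel. f x < top"
proof (cases "p = \<infinity>")
 case True
 then have "AE x in lborel. f x \<le> Lnorm p f" using Lnorm_infinity_le_iff[of f] by auto
 then show ?thesis using fin by (auto elim!: eventually_mono)
next
 case False
 have "(NN x. epow (enn2real p) (f x)) \<le> epow (enn2real p) (Lnorm p f)"
  using Lnorm_le_iff[OF False p] by blast
 also have "\<dots> < top" using fin by simp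
 finally have "AE x in lborel. epow (enn2real p) (f x) \<noteq> \<infinity>"
  by (intro nn_integral_noteq_infinite) auto
 then show ?thesis by eventually_elim (auto simp: less_top)
qed

text \<open>Minkowski's integral inequality; the countable triangle inequality is the case of a discrete measure.\<close>

lemma (in finite_measure) Lnorm_nn_integral_le:
 fixes f :: "'a => 'b::euclidean_space => ennreal"
 assumes p: "1 \<le> p" and [measurable]: "case_prod f \<in> borel_measurable (M \<Otimes>\<^sub>M borel)"
  and c: "AE s in M. Lnorm p (f s) \<le> c" and cfin: "c < top"
 shows "Lnorm p (\<lambda>x. \<integral>\<^sup>+s. f s x \<partial>M) \<le> emeasure M (space M) * c"
proof -
 interpret L: sigma_finite_measure "lborel :: 'b measure" by (rule sigma_finite_lborel)
 interpret P: pair_sigma_finite M "lborel :: 'b measure" ..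
 have [measurable]: "case_prod f \<in> borel_measurable (M \<Otimes>\<^sub>M lborel)"
  by (subst measurable_cong_sets[OF sets_pair_measure_cong[OF refl sets_lborel] refl]) measurable
 have "{x \<in> space (M \<Otimes>\<^sub>M lborel). case_prod f x \<le> c} \<in> sets (M \<Otimes>\<^sub>M lborel)"
  by (rule borel_measurable_le) measurable
 then have pm: "Measurable.pred (M \<Otimes>\<^sub>M lborel) (\<lambda>x. f (fst x) (snd x) \<le> c)"
  by (simp add: pred_def case_prod_beta)
 show ?thesis
 proof (cases "p = \<infinity>")
  case True
  have "AE s in M. AE x in lborel. f s x \<le> c" using c unfolding True Lnorm_infinity_le_iff .
  then have "AE x in lborel. AE s in M. f s x \<le> c"
   using pm by (subst (asm) P.AE_commute) (auto simp: pred_def)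
  then show ?thesis unfolding True Lnorm_infinity_le_iff
  proof eventually_elim
   case (elim x)
   then have "(\<integral>\<^sup>+s. f s x \<partial>M) \<le> (\<integral>\<^sup>+s. c \<partial>M)" by (intro nn_integral_mono_AE) auto
   then show ?case by (simp add: mult.commute)
  qed
 next
  case False
  define q where "q = enn2real p"
  have q: "1 \<le> q" using enn2real_ge_1[OF False p] by (simp add: q_def)
  define m where "m = measure M (space M)"
  have m: "emeasure M (space M) = ennreal m" "0 \<le> m"
   by (auto simp: m_def emeasure_eq_measure)
  \<comment> \<open>Jensen in \<open>s\<close>, then Tonelli. The factor
    \<open>m powr (q - 1)\<close> of Jensen and the mass \<open>m\<close> from integrating the
    constant \<open>epow q c\<close> combine to the power \<open>q\<close> of the mass.\<close>
  have "(NN x. epow q (\<integral>\<^sup>+s. f s x \<partial>M))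
    \<le> (NN x. ennreal (m powr (q - 1)) * (\<integral>\<^sup>+s. epow q (f s x) \<partial>M))"
   unfolding m_def by (intro nn_integral_mono epow_jensen q) measurable
  also have "\<dots> = ennreal (m powr (q - 1)) * (\<integral>\<^sup>+s. (NN x. epow q (f s x)) \<partial>M)"
   by (subst nn_integral_cmult, measurable, subst P.Fubini', measurable)
  also have "\<dots> \<le> ennreal (m powr (q - 1)) * (\<integral>\<^sup>+s. epow q c \<partial>M)"
  proof (intro mult_left_mono nn_integral_mono_AE)
   show "AE s in M. (NN x. epow q (f s x)) \<le> epow q c"
    using c unfolding Lnorm_le_iff[OF False p] q_def .
  qed auto
  also have "\<dots> = epow q (emeasure M (space M) * c)"
   using q m by (cases "m = 0") (auto simp: epow_mult epow_ennreal powr_diff divide_simps mult.assoc[symmetric] ennreal_mult[symmetric] mult.commute[of "epow q c"])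
  finally show ?thesis unfolding Lnorm_le_iff[OF False p] q_def .
 qed
qed

lemma Lnorm_suminf_le:
 assumes p: "1 \<le> p" and [measurable]: "\<And>k. f k \<in> Borel"
 shows "Lnorm p (\<lambda>x. \<Sum>k. f k x) \<le> (\<Sum>k. Lnorm p (f k))"
proof (rule ennreal_le_epsilon)
 fix e :: real assume e: "0 < e" and fin: "(\<Sum>k. Lnorm p (f k)) < top"
 \<comment> \<open>The weights of the discrete measure; \<open>f k / a k\<close> has norm at most 1.
   The geometric term keeps each weight positive even where the norm vanishes, at a total cost of
   \<open>e\<close>.\<close>
 define a where "a k = Lnorm p (f k) + ennreal (e * (1/2) ^ Suc k)" for k
 have finL: "Lnorm p (f k) < top" for k using fin
  by (meson ennreal_suminf_lessD)
 then have a: "0 < a k" "a k < top" for k using e by (auto simp: a_def add_pos_pos intro: add_nonneg_pos)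
 have "(\<Sum>k. a k) = (\<Sum>k. Lnorm p (f k)) + (\<Sum>k. ennreal (e * (1/2) ^ Suc k))"
  unfolding a_def by (subst suminf_add) auto
 also have "(\<Sum>k. ennreal (e * (1/2) ^ Suc k)) = ennreal e"
  using e sums_mult[OF power_half_series, of e] by (intro suminf_ennreal_eq) auto
 finally have suma: "(\<Sum>k. a k) = (\<Sum>k. Lnorm p (f k)) + ennreal e" .
 let ?M = "density (count_space UNIV) a"
 have M: "emeasure ?M (space ?M) = (\<Sum>k. a k)"
  by (simp add: emeasure_density nn_integral_count_space_nat)
 interpret finite_measure ?M
 proof (rule finite_measureI)
  show "emeasure ?M (space ?M) \<noteq> \<infinity>"
   unfolding M suma using fin by (auto simp: less_top)
 qed
 have "Lnorm p (\<lambda>x. \<integral>\<^sup>+k. f k x / a k \<partial>?M) \<le> emeasure ?M (space ?M) * 1"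
 proof (rule Lnorm_nn_integral_le[OF p])
  show "(\<lambda>(s, x). f s x / a s) \<in> borel_measurable (?M \<Otimes>\<^sub>M borel)"
   by (subst measurable_cong_sets[OF sets_pair_measure_cong[of ?M "count_space UNIV" borel borel] refl])
     (auto intro!: measurable_pair_measure_countable1)
  show "AE s in ?M. Lnorm p (\<lambda>x. f s x / a s) \<le> 1"
  proof (rule AE_I2)
   fix k
   have "Lnorm p (\<lambda>x. f k x / a k) = Lnorm p (\<lambda>x. inverse (a k) * f k x)"
    by (simp add: divide_ennreal_def mult.commute)
   also have "\<dots> \<le> inverse (a k) * Lnorm p (f k)" by (intro Lnorm_cmult_le p) measurable
   also have "\<dots> \<le> inverse (a k) * a k" by (intro mult_left_mono) (auto simp: a_def)
   also have "\<dots> = 1" using a[of k] by (metis divide_ennreal_def ennreal_divide_self less_irrefl mult.commute)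
   finally show "Lnorm p (\<lambda>x. f k x / a k) \<le> 1" .
  qed
 qed auto
 moreover have "(\<integral>\<^sup>+k. f k x / a k \<partial>?M) = (\<Sum>k. f k x)" for x
 proof -
  have "(\<integral>\<^sup>+k. f k x / a k \<partial>?M) = (\<Sum>k. a k * (f k x / a k))"
   by (subst nn_integral_density) (auto simp: nn_integral_count_space_nat)
  also have "(\<lambda>k. a k * (f k x / a k)) = (\<lambda>k. f k x)"
   using a by (intro ext) (metis ennreal_times_divide less_irrefl mult.commute mult_divide_eq_ennreal)
  finally show ?thesis .
 qed
 ultimately show "Lnorm p (\<lambda>x. \<Sum>k. f k x) \<le> (\<Sum>k. Lnorm p (f k)) + ennreal e"
  unfolding M suma by simp
qed

lemma Lnorm_add_le:
 assumes p: "1 \<le> p" and [measurable]: "f \<in> Borel" "g \<in> Borel"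
 shows "Lnorm p (\<lambda>x. f x + g x) \<le> Lnorm p f + Lnorm p g"
proof -
 define h where "h k = (if k = 0 then f else if k = Suc 0 then g else (\<lambda>_. 0))" for k :: nat
 have [measurable]: "h k \<in> Borel" for k by (auto simp: h_def)
 have "Lnorm p (\<lambda>x. \<Sum>k. h k x) \<le> (\<Sum>k. Lnorm p (h k))" by (intro Lnorm_suminf_le p) auto
 moreover have "(\<Sum>k. h k x) = f x + g x" for x
  by (subst suminf_finite[of "{0,1}"]) (auto simp: h_def)
 moreover have "(\<Sum>k. Lnorm p (h k)) = Lnorm p f + Lnorm p g"
  using p by (subst suminf_finite[of "{0,1}"]) (auto simp: h_def)
 ultimately show ?thesis by simp
qed

text \<open>With a cruder constant than Hoelder's inequality: normalise and use \<open>t \<le> 1 + t\<^sup>q\<close>.\<close>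

lemma nn_integral_le_Lnorm:
 assumes p: "1 \<le> p" and [measurable]: "f \<in> Borel" "A \<in> sets borel"
 shows "(NN x. f x * indicator A x) \<le> (emeasure lborel A + 1) * Lnorm p f"
proof (cases "p = \<infinity>")
 case True
 have "AE x in lborel. f x \<le> Lnorm p f" using True Lnorm_infinity_le_iff by blast
 then have "(NN x. f x * indicator A x) \<le> (NN x. Lnorm p f * indicator A x)"
  by (intro nn_integral_mono_AE) (auto elim!: eventually_mono intro: mult_right_mono)
 also have "\<dots> = Lnorm p f * emeasure lborel A" by (subst nn_integral_cmult_indicator) auto
 also have "\<dots> \<le> Lnorm p f * (emeasure lborel A + 1)"
  by (intro mult_left_mono) (auto intro: add_increasing2)
 also have "\<dots> = (emeasure lborel A + 1) * Lnorm p f" by (rule mult.commute)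
 finally show ?thesis .
next
 case False
 define q where "q = enn2real p"
 have q: "1 \<le> q" using enn2real_ge_1[OF False p] by (simp add: q_def)
 show ?thesis
 proof (cases "Lnorm p f")
  case top then show ?thesis by (simp add: ennreal_mult_top)
 next
  case (real c)
  show ?thesis
  proof (cases "c = 0")
   case True
   then have "AE x in lborel. f x = 0" using real by (intro Lnorm_eq_0_AE[OF p]) auto
   then have "(NN x. f x * indicator A x) = 0"
    by (subst nn_integral_0_iff_AE) (auto elim!: eventually_mono)
   then show ?thesis by simp
  next
   case F: False
   with real have c: "0 < c" by simp
   have I: "(NN x. epow q (inverse (ennreal c) * f x)) \<le> 1"
   proof -
    have "Lnorm p (\<lambda>x. inverse (ennreal c) * f x) \<le> inverse (ennreal c) * Lnorm p f"
     by (intro Lnorm_cmult_le p) measurable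
    also have "\<dots> = 1" using c real by (simp add: inverse_ennreal ennreal_mult[symmetric])
    finally show ?thesis unfolding Lnorm_le_iff[OF False p] q_def by simp
   qed
   have "f x = ennreal c * (inverse (ennreal c) * f x)" for x
    using c by (simp add: mult.assoc[symmetric] inverse_ennreal ennreal_mult[symmetric])
   then have "(NN x. f x * indicator A x)
     = (NN x. ennreal c * (inverse (ennreal c) * f x * indicator A x))"
    by (intro nn_integral_cong) (metis mult.assoc)
   also have "\<dots> = ennreal c * (NN x. inverse (ennreal c) * f x * indicator A x)"
    by (intro nn_integral_cmult) measurable
   also have "\<dots> \<le> ennreal c * (NN x. indicator A x + epow q (inverse (ennreal c) * f x))"
    using le_one_plus_epow[OF q]
    by (intro mult_left_mono nn_integral_mono) (auto split: split_indicator)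
   also have "\<dots> = ennreal c * (emeasure lborel A + (NN x. epow q (inverse (ennreal c) * f x)))"
    by (subst nn_integral_add) auto
   also have "\<dots> \<le> ennreal c * (emeasure lborel A + 1)"
    by (intro mult_left_mono add_left_mono I) auto
   finally show ?thesis by (simp add: real mult.commute)
  qed
 qed
qed

section \<open>Behaviour of integrals and norms under affine maps\<close>

lemma nn_integral_lborel_affine:
 fixes f :: "'a::euclidean_space => ennreal"
 assumes [measurable]: "f \<in> Borel" and c: "c \<noteq> 0"
 shows "(NN x. f x) = ennreal (\<bar>c\<bar> ^ DIM('a)) * (NN x. f (t + c *\<^sub>R x))"
 by (subst lborel_affine[OF c, of t])
   (simp add: nn_integral_density nn_integral_distr nn_integral_cmult)

lemma AE_lborel_affine:
 fixes P :: "'a::euclidean_space => bool"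
 assumes c: "c \<noteq> 0" and P: "AE x in lborel. P x"
 shows "AE x in lborel. P (t + c *\<^sub>R x)"
proof -
 obtain N where N: "{x. \<not> P x} \<subseteq> N" "N \<in> sets borel" "emeasure lborel N = 0"
  using P by (auto simp: eventually_ae_filter null_sets_def)
 have "emeasure lborel N = ennreal (\<bar>c\<bar> ^ DIM('a)) * (NN x. indicator N (t + c *\<^sub>R x))"
  using N(2) nn_integral_lborel_affine[of "indicator N" c t] c by simp
 with N c have "(NN x. indicator N (t + c *\<^sub>R x)) = 0" by (simp add: N(3))
 then have "AE x in lborel. indicator N (t + c *\<^sub>R x) = (0::ennreal)"
  using N(2) by (subst (asm) nn_integral_0_iff_AE) auto
 then show ?thesis using N(1) by (auto elim!: eventually_mono split: split_indicator_asm)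
qed

text \<open>One constant for all exponents. For p = \<infinity> it has to be at least 1; for finite
  \<open>p\<close> the Jacobian is absorbed because \<open>K\<close> is at most its own
  \<open>q\<close>-th power.\<close>

lemma Lnorm_affine_le:
 fixes f :: "'a::euclidean_space => ennreal"
 assumes p: "1 \<le> p" and [measurable]: "f \<in> Borel" and c: "0 < c"
  and K: "1 \<le> K" "1 \<le> K * c ^ DIM('a)"
 shows "Lnorm p (\<lambda>x. f (t + c *\<^sub>R x)) \<le> ennreal K * Lnorm p f"
proof (cases "p = \<infinity>")
 case True
 have "AE x in lborel. f x \<le> Lnorm p f" using True Lnorm_infinity_le_iff by blast
 then have "AE x in lborel. f (t + c *\<^sub>R x) \<le> Lnorm p f" using c by (intro AE_lborel_affine) auto
 then show ?thesis unfolding True Lnorm_infinity_le_iff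
 proof eventually_elim
  case (elim x)
  have "1 * Lnorm \<infinity> f \<le> ennreal K * Lnorm \<infinity> f" using K by (intro mult_right_mono) auto
  with elim show ?case using True by (auto intro: order_trans)
 qed
next
 case False
 define q where "q = enn2real p"
 have q: "1 \<le> q" using enn2real_ge_1[OF False p] by (simp add: q_def)
 let ?I = "(NN x. epow q (f (t + c *\<^sub>R x)))"
 have "K \<le> K powr q" using K q powr_mono[of 1 q K] by simp
 then have "1 \<le> K powr q * c ^ DIM('a)"
  using K c by (meson mult_right_mono order_trans zero_le_power less_imp_le)
 then have "1 * ?I \<le> ennreal (K powr q * c ^ DIM('a)) * ?I"
  by (intro mult_right_mono) auto
 also have "\<dots> = ennreal (K powr q) * (ennreal (\<bar>c\<bar> ^ DIM('a)) * ?I)"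
  using c by (simp add: ennreal_mult mult.assoc)
 also have "ennreal (\<bar>c\<bar> ^ DIM('a)) * ?I = (NN x. epow q (f x))"
  using c by (subst nn_integral_lborel_affine[of "\<lambda>x. epow q (f x)" c t]) auto
 also have "\<dots> \<le> epow q (Lnorm p f)" using Lnorm_le_iff[OF False p] by (auto simp: q_def)
 finally have "?I \<le> epow q (ennreal K * Lnorm p f)"
  using K q by (simp add: epow_mult epow_ennreal mult_left_mono)
 then show ?thesis unfolding Lnorm_le_iff[OF False p] q_def .
qed

section \<open>Test functions\<close>

lemma C_diff_SucI:
 assumes "\<And>x. (f has_derivative F x) (at x)" "\<And>i. i \<in> Basis ==> C_diff k (\<lambda>x. F x i)"
 shows "C_diff (Suc k) f"
proof -
 have "frechet_derivative f (at x) = F x" for x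
  using frechet_derivative_at[OF assms(1)] by metis
 moreover have "f differentiable at x" for x
  using assms(1) by (auto simp: differentiable_def)
 ultimately show ?thesis using assms(2) by simp
qed

lemma C_diff_SucD:
 assumes "C_diff (Suc k) f"
 shows "(f has_derivative frechet_derivative f (at x)) (at x)"
  "i \<in> Basis ==> C_diff k (\<lambda>x. pard f i x)"
 using assms by (simp_all add: frechet_derivative_works[symmetric])

lemma C_diff_imp_continuous: "C_diff k f ==> continuous_on A f"
proof (cases k)
 case (Suc j)
 assume "C_diff k f"
 then have "isCont f x" for x
  unfolding Suc by (meson C_diff_SucD(1) has_derivative_continuous)
 then show ?thesis by (simp add: continuous_at_imp_continuous_on)
qed (simp, erule continuous_on_subset, simp)

lemma C_diff_decr: "C_diff (Suc k) f ==> C_diff k f"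
proof (induction k arbitrary: f)
 case 0 then show ?case using C_diff_imp_continuous[of "Suc 0" f UNIV] by simp
next
 case (Suc k)
 show ?case
  by (rule C_diff_SucI[OF C_diff_SucD(1)[OF Suc.prems]])
    (intro Suc.IH C_diff_SucD(2)[OF Suc.prems])
qed

lemma C_diff_const [simp]: "C_diff k (\<lambda>_. c)"
 by (induction k arbitrary: c) (auto intro!: continuous_intros)

lemma C_diff_add: "C_diff k f ==> C_diff k g ==> C_diff k (\<lambda>x. f x + g x)"
proof (induction k arbitrary: f g)
 case 0 then show ?case by (auto intro: continuous_intros)
next
 case (Suc k)
 show ?case
  by (rule C_diff_SucI[OF has_derivative_add[OF C_diff_SucD(1)[OF Suc.prems(1)] C_diff_SucD(1)[OF Suc.prems(2)]]])
    (intro Suc.IH C_diff_SucD(2)[OF Suc.prems(1)] C_diff_SucD(2)[OF Suc.prems(2)])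
qed

lemma C_diff_mult: "C_diff k f ==> C_diff k g ==> C_diff k (\<lambda>x. f x * g x)"
proof (induction k arbitrary: f g)
 case 0 then show ?case by (auto intro: continuous_intros)
next
 case (Suc k)
 show ?case
  by (rule C_diff_SucI[OF has_derivative_mult[OF C_diff_SucD(1)[OF Suc.prems(1)] C_diff_SucD(1)[OF Suc.prems(2)]]])
    (intro C_diff_add Suc.IH C_diff_SucD(2)[OF Suc.prems(1)] C_diff_SucD(2)[OF Suc.prems(2)]
     C_diff_decr[OF Suc.prems(1)] C_diff_decr[OF Suc.prems(2)])
qed

lemma C_diff_cmult: "C_diff k f ==> C_diff k (\<lambda>x. c * f x)"
 by (rule C_diff_mult[OF C_diff_const])

lemma C_diff_sum: "(\<And>i. i \<in> I ==> C_diff k (f i)) ==> C_diff k (\<lambda>x. \<Sum>i\<in>I. f i x)"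
 by (induction I rule: infinite_finite_induct) (auto intro: C_diff_add)

lemma C_diff_inner: "C_diff k (\<lambda>x. x \<bullet> v)"
proof (cases k)
 case (Suc j)
 show ?thesis unfolding Suc
  by (rule C_diff_SucI[where F="\<lambda>_ h. h \<bullet> v"]) (auto intro!: derivative_eq_intros)
qed (auto intro!: continuous_intros)

lemma C_diff_affine_comp:
 fixes f :: "'a::euclidean_space => real"
 shows "C_diff k f ==> C_diff k (\<lambda>x. f (a + c *\<^sub>R x))"
proof (induction k arbitrary: f)
 case 0
 then show ?case by (auto intro!: continuous_on_compose2[of UNIV f] continuous_intros)
next
 case (Suc k)
 show ?case
 proof (rule C_diff_SucI)
  show "((\<lambda>x. f (a + c *\<^sub>R x)) has_derivative (\<lambda>h. frechet_derivative f (at (a + c *\<^sub>R x)) (c *\<^sub>R h))) (at x)" for x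
   by (rule has_derivative_compose[OF _ C_diff_SucD(1)[OF Suc.prems]])
     (auto intro!: derivative_eq_intros)
  fix i :: 'a assume i: "i \<in> Basis"
  have "frechet_derivative f (at y) (c *\<^sub>R i) = c * pard f i y" for y
   using linear_cmul[OF has_derivative_linear[OF C_diff_SucD(1)[OF Suc.prems]]] by simp
  then show "C_diff k (\<lambda>x. frechet_derivative f (at (a + c *\<^sub>R x)) (c *\<^sub>R i))"
   using Suc.IH[OF C_diff_SucD(2)[OF Suc.prems i]] by (simp add: C_diff_cmult)
 qed
qed

text \<open>The class of functions \<open>P(1/t) exp(-1/t)\<close>, extended by zero, is closed under differentiation.\<close>

definition flat_fun :: "real poly => real => real" where
 "flat_fun P t = (if 0 < t then poly P (1/t) * exp (- (1/t)) else 0)"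

lemma poly_exp_tendsto_0: "((\<lambda>y. poly P y * exp (- y)) \<longlongrightarrow> 0) (at_top :: real filter)"
proof -
 have "((\<lambda>y. \<Sum>i\<le>degree P. coeff P i * (y ^ i / exp y)) \<longlongrightarrow> (\<Sum>i\<le>degree P. coeff P i * 0)) (at_top :: real filter)"
  by (intro tendsto_intros tendsto_power_div_exp_0)
 then show ?thesis by (simp add: poly_altdef exp_minus sum_distrib_right sum_divide_distrib divide_inverse mult.assoc)
qed

text \<open>With y = 1/t the derivative of P(y) exp(-y) is y^2 (P(y) - P'(y)) exp(-y), which
  explains the new polynomial. At 0 the right difference quotient is y P(y) exp(-y), which tends to
  0 as y grows; the left one is 0.\<close>

lemma flat_fun_deriv: "(flat_fun P has_real_derivative flat_fun ([:0,0,1:] * (P - pderiv P)) t) (at t)"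
proof -
 consider "t > 0" | "t < 0" | "t = 0" by linarith
 then show ?thesis
 proof cases
  case 1
  have "((\<lambda>t. poly P (1/t) * exp (- (1/t))) has_real_derivative flat_fun ([:0,0,1:] * (P - pderiv P)) t) (at t)"
   using 1 by (auto intro!: derivative_eq_intros poly_DERIV[THEN DERIV_chain2] simp: flat_fun_def field_simps power2_eq_square)
  then show ?thesis
   by (rule has_field_derivative_transform_within_open[where S="{0<..}"]) (use 1 in \<open>auto simp: flat_fun_def\<close>)
 next
  case 2
  have "((\<lambda>t. 0) has_real_derivative flat_fun ([:0,0,1:] * (P - pderiv P)) t) (at t)"
   using 2 by (auto simp: flat_fun_def)
  then show ?thesis
   by (rule has_field_derivative_transform_within_open[where S="{..<0}"]) (use 2 in \<open>auto simp: flat_fun_def\<close>)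
 next
  case 3
  have "((\<lambda>y. flat_fun P y / y) \<longlongrightarrow> 0) (at_left 0)"
   by (rule tendsto_eventually) (auto simp: flat_fun_def eventually_at_filter)
  moreover have "((\<lambda>y. flat_fun P y / y) \<longlongrightarrow> 0) (at_right 0)"
  proof -
   have "((\<lambda>y. poly (pCons 0 P) (inverse y) * exp (- inverse y)) \<longlongrightarrow> 0) (at_right (0::real))"
    by (rule filterlim_compose[OF poly_exp_tendsto_0 filterlim_inverse_at_top_right])
   then show ?thesis
    by (rule Lim_transform_eventually) (auto simp: flat_fun_def eventually_at_filter field_simps)
  qed
  ultimately have "((\<lambda>y. flat_fun P y / y) \<longlongrightarrow> 0) (at 0)"
   by (simp add: filterlim_split_at)
  then show ?thesis using 3 by (simp add: has_field_derivative_iff flat_fun_def)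
 qed
qed

text \<open>Differentiation changes the polynomial, so the induction on the order runs over all
  \<open>P\<close> at once.\<close>

lemma C_diff_flat_fun_comp:
 assumes "\<And>k. C_diff k f" shows "C_diff k (\<lambda>x. flat_fun P (f x))"
proof (induction k arbitrary: P)
 case 0
 have "continuous_on UNIV (flat_fun P)"
  using flat_fun_deriv by (meson DERIV_isCont continuous_at_imp_continuous_on)
 then show ?case using assms[of 0]
  by (auto intro: continuous_on_compose2)
next
 case (Suc k)
 show ?case
 proof (rule C_diff_SucI)
  show "((\<lambda>x. flat_fun P (f x)) has_derivative
   (\<lambda>h. frechet_derivative f (at x) h * flat_fun ([:0,0,1:] * (P - pderiv P)) (f x))) (at x)" for x
   using has_derivative_compose[OF C_diff_SucD(1)[OF assms] flat_fun_deriv[unfolded has_field_derivative_def]]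
   by (simp add: mult.commute)
  show "C_diff k (\<lambda>x. pard f i x * flat_fun ([:0,0,1:] * (P - pderiv P)) (f x))" if "i \<in> Basis" for i
   by (intro C_diff_mult Suc.IH C_diff_SucD(2)[OF assms] that)
 qed
qed

text \<open>The argument is r^2 - |x - c|^2, smooth in \<open>x\<close> and positive exactly on the
  ball. It is written with \<open>(- 1)\<close> as a factor to match the closure rules for sums and
  scalar multiples.\<close>

definition ball_bump :: "'a::euclidean_space => real => 'a => real" where
 "ball_bump c r x = flat_fun 1 (r\<^sup>2 + (- 1) * ((x - c) \<bullet> (x - c)))"

lemma C_diff_ball_bump: "C_diff k (ball_bump c r)"
proof -
 have lin: "C_diff k (\<lambda>x. (x - c) \<bullet> v)" for k and v :: 'a
  using C_diff_add[OF C_diff_inner[of k v] C_diff_const[of k "- (c \<bullet> v)"]] by (simp add: inner_diff_left)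
 have "C_diff k (\<lambda>x. (x - c) \<bullet> (x - c))" for k
 proof (cases k)
  case (Suc j)
  show ?thesis unfolding Suc
  proof (rule C_diff_SucI[where F="\<lambda>x h. 2 * ((x - c) \<bullet> h)"])
   show "((\<lambda>x. (x - c) \<bullet> (x - c)) has_derivative (\<lambda>h. 2 * ((x - c) \<bullet> h))) (at x)" for x
    by (auto intro!: derivative_eq_intros simp: inner_commute)
  qed (intro C_diff_cmult lin)
 qed (auto intro!: continuous_intros)
 then show ?thesis
  unfolding ball_bump_def[abs_def]
  by (intro C_diff_flat_fun_comp C_diff_add C_diff_const C_diff_cmult)
qed

lemma flat_fun_1: "0 \<le> flat_fun 1 t" "flat_fun 1 t \<le> 1" "flat_fun 1 t \<noteq> 0 \<longleftrightarrow> 0 < t" "0 < flat_fun 1 t \<longleftrightarrow> 0 < t"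
 by (auto simp: flat_fun_def)

lemma ball_bump_pos_iff: "0 < r ==> 0 < ball_bump c r x \<longleftrightarrow> x \<in> ball c r"
proof -
 assume r: "0 < r"
 have "0 < ball_bump c r x \<longleftrightarrow> (dist c x)\<^sup>2 < r\<^sup>2"
  by (simp add: ball_bump_def flat_fun_1 dist_norm power2_norm_eq_inner[symmetric] norm_minus_commute)
 also have "\<dots> \<longleftrightarrow> x \<in> ball c r"
  using r by (simp add: power_mono_iff flip: not_le)
 finally show ?thesis .
qed

lemma ball_bump_nonneg: "0 \<le> ball_bump c r x"
 by (simp add: ball_bump_def flat_fun_1)

lemma test_functions_D:
 assumes "\<phi> \<in> test_functions U"
 shows "C_diff k \<phi>" "compact (closure {x. \<phi> x \<noteq> 0})" "closure {x. \<phi> x \<noteq> 0} \<subseteq> U" "\<phi> x \<noteq> 0 ==> x \<in> U"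
 using assms closure_subset[of "{x. \<phi> x \<noteq> 0}"] by (auto simp: test_functions_def)

lemma test_functions_I:
 assumes "\<And>k. C_diff k \<phi>" "compact K" "K \<subseteq> U" "\<And>x. \<phi> x \<noteq> 0 ==> x \<in> K"
 shows "\<phi> \<in> test_functions U"
proof -
 have "closure {x. \<phi> x \<noteq> 0} \<subseteq> K"
  using assms by (intro closure_minimal) (auto simp: compact_imp_closed)
 then show ?thesis using assms compact_closure[of "{x. \<phi> x \<noteq> 0}"] bounded_subset[OF compact_imp_bounded[OF assms(2)]]
  unfolding test_functions_def using closure_subset by (blast intro: order_trans)
qed

text \<open>By Lindelof, \<open>V\<close> is a union of countably many balls whose closures lie in
  \<open>V\<close>. A finite sum of their bumps has compact support in \<open>V\<close>, and at each
  point of \<open>V\<close> it is bounded away from 0 from some index on; outside \<open>V\<close>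
  it vanishes.\<close>

lemma test_functions_approx_open:
 fixes V :: "'a::euclidean_space set"
 assumes "open V"
 obtains \<phi> where "\<And>n. \<phi> n \<in> test_functions V" "\<And>n x. 0 \<le> \<phi> n x" "\<And>n x. \<phi> n x \<le> 1"
  "\<And>x. (\<lambda>n. \<phi> n x) \<longlonglongrightarrow> indicator V x"
proof (cases "V = {}")
 case True
 have 0: "(\<lambda>_. 0) \<in> test_functions V" by (rule test_functions_I[where K="{}"]) auto
 show thesis
 proof (rule that[of "\<lambda>_ _. 0"])
  show "(\<lambda>_. 0) \<in> test_functions V" by (rule 0)
 qed (auto simp: True)
next
 case False
 define F where "F = {ball c r |c r. 0 < r \<and> cball c r \<subseteq> V}"
 have "\<Union>F = V"
 proof (intro equalityI subsetI)
  fix x assume "x \<in> V"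
  then obtain r where "0 < r" "cball x r \<subseteq> V" using assms open_contains_cball by blast
  then show "x \<in> \<Union>F" by (auto simp: F_def intro!: exI[of _ "ball x r"])
 qed (auto simp: F_def)
 moreover obtain F' where F': "F' \<subseteq> F" "countable F'" "\<Union>F' = \<Union>F"
 proof -
  have "open S" if "S \<in> F" for S using that by (auto simp: F_def)
  then show ?thesis using Lindelof[of F] that by metis
 qed
 ultimately have ne: "F' \<noteq> {}" using False by auto
 have "\<forall>n. \<exists>c r. from_nat_into F' n = ball c r \<and> 0 < r \<and> cball c r \<subseteq> V"
  using from_nat_into[OF ne] F'(1) by (auto simp: F_def)
 then obtain c where "\<forall>n. \<exists>r. from_nat_into F' n = ball (c n) r \<and> 0 < r \<and> cball (c n) r \<subseteq> V"
  by (rule choice[THEN exE])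
 then obtain r where "\<forall>n. from_nat_into F' n = ball (c n) (r n) \<and> 0 < r n \<and> cball (c n) (r n) \<subseteq> V"
  by (rule choice[THEN exE])
 then have cr: "\<And>n. from_nat_into F' n = ball (c n) (r n)" "\<And>n. 0 < r n" "\<And>n. cball (c n) (r n) \<subseteq> V"
  by blast+
 have V: "V = (\<Union>n. ball (c n) (r n))"
 proof -
  have "V = \<Union>(range (from_nat_into F'))" using F'(3) \<open>\<Union>F = V\<close> range_from_nat_into[OF ne F'(2)] by simp
  also have "range (from_nat_into F') = range (\<lambda>n. ball (c n) (r n))" by (simp add: cr(1))
  finally show ?thesis by simp
 qed
 define S where "S n x = (\<Sum>i<n. ball_bump (c i) (r i) x)" for n x
 have S0: "0 \<le> S n x" for n x by (auto simp: S_def ball_bump_nonneg intro: sum_nonneg)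
 \<comment> \<open>The factor \<open>n\<close> drives the argument to infinity at every point of
   \<open>V\<close>, however small the bumps are there, and \<open>flat_fun 1\<close> tends to 1 at
   infinity while it stays 0 at 0.\<close>
 define \<phi> where "\<phi> n x = flat_fun 1 (real n * S n x)" for n x
 show thesis
 proof (rule that[of \<phi>])
  fix n
  show "\<phi> n \<in> test_functions V"
  proof (rule test_functions_I)
   show "C_diff k (\<phi> n)" for k
    unfolding \<phi>_def[abs_def] S_def by (intro C_diff_flat_fun_comp C_diff_cmult C_diff_sum C_diff_ball_bump)
   show "compact (\<Union>i<n. cball (c i) (r i))" by (intro compact_UN) auto
   show "(\<Union>i<n. cball (c i) (r i)) \<subseteq> V" using cr(3) by auto
   fix x assume "\<phi> n x \<noteq> 0"
   then have "0 < real n * S n x" unfolding \<phi>_def by (simp only: flat_fun_1)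
   then have "0 < S n x" by (simp add: zero_less_mult_iff)
   then have "\<not> (\<forall>i\<in>{..<n}. ball_bump (c i) (r i) x = 0)"
    unfolding S_def using sum.neutral[of "{..<n}" "\<lambda>i. ball_bump (c i) (r i) x"] by linarith
   then obtain i where "i < n" "ball_bump (c i) (r i) x \<noteq> 0" by auto
   then have "x \<in> ball (c i) (r i)"
    using ball_bump_pos_iff[OF cr(2)[of i], of "c i" x] ball_bump_nonneg[of "c i" "r i" x] by simp
   then show "x \<in> (\<Union>i<n. cball (c i) (r i))" using \<open>i < n\<close> ball_subset_cball by blast
  qed
 next
  fix x
  show "(\<lambda>n. \<phi> n x) \<longlonglongrightarrow> indicator V x"
  proof (cases "x \<in> V")
   case True
   then obtain m where xm: "x \<in> ball (c m) (r m)" unfolding V by auto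
   define d where "d = ball_bump (c m) (r m) x"
   have d: "0 < d" using ball_bump_pos_iff[OF cr(2)[of m], of "c m" x] xm by (simp add: d_def)
   have lim: "filterlim (\<lambda>n. real n * S n x) at_top sequentially"
   proof (rule filterlim_at_top_mono)
    show "filterlim (\<lambda>n. d * real n) at_top sequentially"
     using d by (intro filterlim_tendsto_pos_mult_at_top[OF tendsto_const] filterlim_real_sequentially)
    show "\<forall>\<^sub>F n in sequentially. d * real n \<le> real n * S n x"
     using eventually_gt_at_top[of m]
    proof eventually_elim
     case (elim n)
     then have "d \<le> S n x" unfolding S_def d_def
      by (intro member_le_sum) (auto simp: ball_bump_nonneg)
     then have "real n * d \<le> real n * S n x" by (intro mult_left_mono) auto
     then show ?case by (simp add: mult.commute)
    qed
   qed
   have "((\<lambda>t. exp (- inverse t)) \<longlongrightarrow> exp (- 0)) (at_top :: real filter)"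
    by (intro tendsto_intros tendsto_inverse_0_at_top filterlim_ident)
   then have "((\<lambda>t. exp (- inverse t)) \<longlongrightarrow> 1) (at_top :: real filter)" by simp
   moreover have "\<forall>\<^sub>F t in at_top. exp (- inverse t) = flat_fun 1 t"
    using eventually_gt_at_top[of "0::real"]
    by eventually_elim (simp add: flat_fun_def inverse_eq_divide)
   ultimately have "((\<lambda>t. flat_fun 1 t) \<longlongrightarrow> 1) (at_top :: real filter)"
    by (rule Lim_transform_eventually)
   from filterlim_compose[OF this lim] show ?thesis using True by (simp add: \<phi>_def)
  next
   case False
   then have "ball_bump (c i) (r i) x = 0" for i
   proof -
    have "x \<notin> ball (c i) (r i)" using False cr(3)[of i] ball_subset_cball by blast
    then show ?thesis
     using ball_bump_pos_iff[OF cr(2)[of i], of "c i" x] ball_bump_nonneg[of "c i" "r i" x] by simp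
   qed
   then show ?thesis using False by (simp add: \<phi>_def S_def flat_fun_def)
  qed
 qed (auto simp: \<phi>_def flat_fun_1)
qed

section \<open>Test functions detect signs almost everywhere\<close>

lemma test_functions_mono: "U \<subseteq> V ==> test_functions U \<subseteq> test_functions V"
 by (auto simp: test_functions_def)

lemma test_functions_measurable: "\<phi> \<in> test_functions U ==> \<phi> \<in> Borel"
 by (intro borel_measurable_continuous_onI C_diff_imp_continuous[of 0] test_functions_D)

text \<open>Dominated convergence extends the sign of the integral from test functions to indicators
  of open subsets of \<open>U\<close>, then to countable intersections of these. By outer regularity
  the set where \<open>k < 0\<close> is such an intersection up to a null set, so the integral of
  \<open>k\<close> over it is nonnegative and the set is null.\<close>

lemma AE_nonneg_of_test_functions:
 fixes k :: "'a::euclidean_space => real"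
 assumes U: "open U" and k: "integrable lborel k"
  and *: "\<And>\<phi>. \<phi> \<in> test_functions U ==> (\<And>x. 0 \<le> \<phi> x) ==> 0 \<le> (BB x. k x * \<phi> x)"
 shows "AE x in lborel. x \<in> U --> 0 \<le> k x"
proof -
 have [measurable]: "k \<in> Borel" using borel_measurable_integrable[OF k] by simp
 have 1: "0 \<le> (BB x. k x * indicator V x)" if V: "open V" "V \<subseteq> U" for V
 proof -
  obtain \<phi> where \<phi>: "\<And>n. \<phi> n \<in> test_functions V" "\<And>n x. 0 \<le> \<phi> n x" "\<And>n x. \<phi> n x \<le> 1"
   "\<And>x. (\<lambda>n. \<phi> n x) \<longlonglongrightarrow> indicator V x"
   by (rule test_functions_approx_open[OF V(1)], rule that)
  have [measurable]: "V \<in> sets borel" using V(1) by auto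
  have [measurable]: "\<phi> n \<in> Borel" for n
   using \<phi>(1) by (rule test_functions_measurable)
  have "(\<lambda>n. (BB x. k x * \<phi> n x)) \<longlonglongrightarrow> (BB x. k x * indicator V x)"
  proof (rule integral_dominated_convergence[where w="\<lambda>x. \<bar>k x\<bar>"])
   show "AE x in lborel. (\<lambda>n. k x * \<phi> n x) \<longlonglongrightarrow> k x * indicator V x"
    by (intro AE_I2 tendsto_intros \<phi>(4))
   show "AE x in lborel. norm (k x * \<phi> n x) \<le> \<bar>k x\<bar>" for n
    using \<phi>(2,3) by (intro AE_I2) (auto simp: abs_mult intro: mult_left_le)
  qed (use k in auto)
  moreover have "0 \<le> (BB x. k x * \<phi> n x)" for n
   by (rule *) (use \<phi>(1,2) test_functions_mono[OF V(2)] in auto)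
  ultimately show ?thesis by (intro LIMSEQ_le_const) auto
 qed
 have [measurable]: "U \<in> sets borel" using U by auto
 define A where "A = {x\<in>U. k x < 0}"
 have A [measurable]: "A \<in> sets borel" unfolding A_def by measurable
 have "\<exists>V. open V \<and> A \<subseteq> V \<and> emeasure lborel (V - A) < ennreal ((1/2)^n)" for n
 proof -
  obtain V where "open V" "A \<subseteq> V" "emeasure lborel (V - A) < ennreal ((1/2)^n)"
   by (rule outer_regular_lborel[OF A, of "(1/2)^n"]) auto
  then show ?thesis by blast
 qed
 then obtain V where "\<forall>n. open (V n) \<and> A \<subseteq> V n \<and> emeasure lborel (V n - A) < ennreal ((1/2)^n)"
  by (rule choice[OF allI, THEN exE])
 then have V: "\<And>n. open (V n)" "\<And>n. A \<subseteq> V n" "\<And>n. emeasure lborel (V n - A) < ennreal ((1/2)^n)"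
  by auto
 define G where "G = (\<Inter>n. V n \<inter> U)"
 have [measurable]: "G \<in> sets borel" using V(1) U by (auto simp: G_def)
 have "A \<subseteq> G" using V(2) by (auto simp: G_def A_def)
 have "emeasure lborel (G - A) \<le> ennreal ((1/2)^n)" for n
  using V by (intro order_trans[OF emeasure_mono less_imp_le[OF V(3)[of n]]]) (auto simp: G_def)
 moreover have "(\<lambda>n. ennreal ((1/2)^n)) \<longlonglongrightarrow> ennreal 0"
  by (intro tendsto_ennrealI LIMSEQ_power_zero) auto
 ultimately have "emeasure lborel (G - A) = 0"
  using LIMSEQ_le_const[of "\<lambda>n. ennreal ((1/2)^n)" "ennreal 0" "emeasure lborel (G - A)"] by simp
 then have GA: "AE x in lborel. x \<in> G \<longleftrightarrow> x \<in> A"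
  using \<open>A \<subseteq> G\<close> by (intro AE_I[of _ _ "G - A"]) auto
 \<comment> \<open>The finite intersections are open subsets of \<open>U\<close>, so fact
   \<open>1\<close> applies to each of them, and they decrease to \<open>G\<close>.\<close>
 have "(\<lambda>n. (BB x. k x * indicator (\<Inter>i\<le>n. V i \<inter> U) x)) \<longlonglongrightarrow> (BB x. k x * indicator G x)"
 proof (rule integral_dominated_convergence[where w="\<lambda>x. \<bar>k x\<bar>"])
  have [measurable]: "V i \<in> sets borel" for i using V(1) by auto
  show "(\<lambda>x. k x * indicator (\<Inter>i\<le>n. V i \<inter> U) x) \<in> borel_measurable lborel" for n
   by measurable
  show "AE x in lborel. (\<lambda>n. k x * indicator (\<Inter>i\<le>n. V i \<inter> U) x) \<longlonglongrightarrow> k x * indicator G x"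
  proof (intro AE_I2 tendsto_intros)
   fix x
   show "(\<lambda>n. indicator (\<Inter>i\<le>n. V i \<inter> U) x :: real) \<longlonglongrightarrow> indicator G x"
   proof (cases "x \<in> G")
    case False
    then obtain m where "x \<notin> V m \<inter> U" by (auto simp: G_def)
    then show ?thesis using False
     by (intro tendsto_eventually) (auto simp: eventually_sequentially intro!: exI[of _ m] split: split_indicator)
   qed (auto simp: G_def)
  qed
 qed (use k in \<open>auto split: split_indicator\<close>)
 moreover have "0 \<le> (BB x. k x * indicator (\<Inter>i\<le>n. V i \<inter> U) x)" for n
  using V(1) U by (intro 1) auto
 ultimately have "0 \<le> (BB x. k x * indicator G x)"
  by (intro LIMSEQ_le_const) auto
 also have "\<dots> = (BB x. k x * indicator A x)"
  using GA by (intro integral_cong_AE) (auto split: split_indicator)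
 finally have "(BB x. - (k x * indicator A x)) \<le> 0" by simp
 moreover have "0 \<le> (BB x. - (k x * indicator A x))"
  by (intro integral_nonneg_AE) (auto simp: A_def split: split_indicator)
 ultimately have "(BB x. - (k x * indicator A x)) = 0" by simp
 moreover have "integrable lborel (\<lambda>x. - (k x * indicator A x))"
  using k by (intro integrable_minus integrable_real_mult_indicator) auto
 ultimately have "AE x in lborel. - (k x * indicator A x) = 0"
  by (subst (asm) integral_nonneg_eq_0_iff_AE) (auto simp: A_def split: split_indicator)
 then show ?thesis by eventually_elim (auto simp: A_def split: split_indicator_asm)
qed

lemma AE_eq_0_of_test_functions:
 fixes k :: "'a::euclidean_space => real"
 assumes U: "open U" and k: "integrable lborel k"
  and *: "\<And>\<phi>. \<phi> \<in> test_functions U ==> (BB x. k x * \<phi> x) = 0"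
 shows "AE x in lborel. x \<in> U --> k x = 0"
proof -
 have "AE x in lborel. x \<in> U --> 0 \<le> k x"
  by (rule AE_nonneg_of_test_functions[OF U k]) (simp add: *)
 moreover have "AE x in lborel. x \<in> U --> 0 \<le> - k x"
  by (rule AE_nonneg_of_test_functions[OF U]) (use k in \<open>simp_all add: *\<close>)
 ultimately show ?thesis by eventually_elim auto
qed

section \<open>Weak gradients and segments\<close>

text \<open>The variant of \<open>weak_gradient\<close> with integrals over the whole space. For
  Borel representatives that vanish outside \<open>U\<close> the two agree
  (\<open>weak_gradient_iff_wgrad\<close>), and no restricted or completed measure has to be carried
  along.\<close>

definition wgrad :: "'a::euclidean_space set => ('a => real) => ('a => 'a) => bool" where
 "wgrad U u g \<longleftrightarrow> (\<forall>\<phi>\<in>test_functions U. \<forall>i\<in>Basis.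
   (BB x. u x * pard \<phi> i x) = - (BB x. (g x \<bullet> i) * \<phi> x))"

text \<open>The uniform distribution on the unit interval. Being a probability measure, it lets
  averages along segments go directly through Minkowski's inequality and Fubini.\<close>

definition I01 :: "real measure" where
 "I01 = density lborel (\<lambda>t. ennreal (indicator {0..1} t))"

lemma sets_I01 [measurable_cong, simp]: "sets I01 = sets borel" by (simp add: I01_def)
lemma space_I01 [simp]: "space I01 = UNIV" by (simp add: I01_def)

lemma nn_integral_I01: "f \<in> Borel ==> (\<integral>\<^sup>+t. f t \<partial>I01) = (NN t. f t * indicator {0..1} t)"
 by (simp add: I01_def nn_integral_density ennreal_indicator mult.commute)

lemma integral_I01:
 fixes f :: "real => real"
 shows "f \<in> Borel ==> (\<integral>t. f t \<partial>I01) = (BB t. f t * indicator {0..1} t)"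
 by (simp add: I01_def integral_density mult.commute)

interpretation I01: prob_space I01
proof
 show "emeasure I01 (space I01) = 1"
  unfolding I01_def space_density space_lborel by (subst emeasure_density) (simp_all add: ennreal_indicator)
qed

lemma AE_I01_iff: "(AE t in I01. P t) \<longleftrightarrow> (AE t in lborel. t \<in> {0..1} --> P t)"
 unfolding I01_def by (subst AE_density) (auto split: split_indicator intro!: AE_cong)

lemma AE_I01I: "(\<And>t. 0 \<le> t ==> t \<le> 1 ==> P t) ==> AE t in I01. P t"
 by (auto simp: AE_I01_iff)

lemma measurable_pair_I01_iff:
 "measurable (I01 \<Otimes>\<^sub>M (lborel :: 'a::euclidean_space measure)) N = measurable borel N"
 by (rule measurable_cong_sets) (simp_all add: borel_prod[symmetric] cong: sets_pair_measure_cong)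

interpretation I01_lborel: pair_sigma_finite I01 "lborel :: 'a::euclidean_space measure" ..

lemma Fubini_I01:
 fixes f :: "real \<times> 'a::euclidean_space => real"
 assumes f [measurable]: "f \<in> Borel"
  and C: "\<And>t. 0 \<le> t ==> t \<le> 1 ==> (NN x. ennreal \<bar>f (t, x)\<bar>) \<le> C" and Cfin: "C < top"
 shows "integrable (I01 \<Otimes>\<^sub>M lborel) f"
  and "(BB x. (\<integral>t. f (t, x) \<partial>I01)) = (\<integral>t. (BB x. f (t, x)) \<partial>I01)"
  and "integrable lborel (\<lambda>x. \<integral>t. f (t, x) \<partial>I01)"
proof -
 have m [measurable]: "f \<in> borel_measurable (I01 \<Otimes>\<^sub>M lborel)" using f by (simp add: measurable_pair_I01_iff)
 show i: "integrable (I01 \<Otimes>\<^sub>M lborel) f"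
 proof (rule integrableI_bounded[OF m])
  have "(\<integral>\<^sup>+z. ennreal (norm (f z)) \<partial>(I01 \<Otimes>\<^sub>M lborel)) = (\<integral>\<^sup>+t. (NN x. ennreal \<bar>f (t, x)\<bar>) \<partial>I01)"
   by (subst lborel.nn_integral_fst[symmetric]) auto
  also have "\<dots> \<le> (\<integral>\<^sup>+t. C \<partial>I01)"
   by (intro nn_integral_mono_AE AE_I01I C)
  also have "\<dots> < \<infinity>" using Cfin I01.emeasure_space_1 by simp
  finally show "(\<integral>\<^sup>+z. ennreal (norm (f z)) \<partial>(I01 \<Otimes>\<^sub>M lborel)) < \<infinity>" .
 qed
 then have i': "integrable (I01 \<Otimes>\<^sub>M lborel) (case_prod (\<lambda>t x. f (t, x)))" by simp
 show "(BB x. (\<integral>t. f (t, x) \<partial>I01)) = (\<integral>t. (BB x. f (t, x)) \<partial>I01)"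
  using I01_lborel.Fubini_integral[OF i'] .
 show "integrable lborel (\<lambda>x. \<integral>t. f (t, x) \<partial>I01)"
  using I01_lborel.integrable_snd[OF i'] .
qed

section \<open>Affine substitutions and bounds for test functions\<close>

lemma integral_lborel_affine:
 fixes f :: "'a::euclidean_space => real"
 assumes [measurable]: "f \<in> Borel" and c: "c \<noteq> 0"
 shows "(BB x. f x) = \<bar>c\<bar> ^ DIM('a) * (BB x. f (t + c *\<^sub>R x))"
 by (subst lborel_affine[OF c, of t]) (simp add: integral_density integral_distr)

lemma integrable_lborel_affine:
 fixes f :: "'a::euclidean_space => 'b::euclidean_space"
 assumes f: "integrable lborel f" and c: "c \<noteq> 0"
 shows "integrable lborel (\<lambda>x. f (t + c *\<^sub>R x))"
proof -
 have [measurable]: "f \<in> Borel" using borel_measurable_integrable[OF f] by simp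
 have "ennreal (\<bar>c\<bar> ^ DIM('a)) * (NN x. ennreal (norm (f (t + c *\<^sub>R x)))) < \<infinity>"
  using f c unfolding integrable_iff_bounded
  by (subst nn_integral_lborel_affine[symmetric, where f="\<lambda>x. ennreal (norm (f x))"]) auto
 then show ?thesis using c by (intro integrableI_bounded) (auto simp: ennreal_mult_less_top)
qed

lemma frechet_derivative_test_function_outside:
 assumes "\<phi> \<in> test_functions U" "x \<notin> closure {x. \<phi> x \<noteq> 0}"
 shows "frechet_derivative \<phi> (at x) = (\<lambda>_. 0)"
proof -
 let ?O = "- closure {x. \<phi> x \<noteq> 0}"
 have "((\<lambda>_. 0) has_derivative (\<lambda>_. 0)) (at x)" by simp
 then have "(\<phi> has_derivative (\<lambda>_. 0)) (at x)"
  by (rule has_derivative_transform_within_open[where s="?O"])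
    (use assms(2) closure_subset[of "{x. \<phi> x \<noteq> 0}"] in auto)
 then show ?thesis by (metis frechet_derivative_at)
qed

lemma frechet_derivative_basis:
 assumes "C_diff (Suc k) \<phi>"
 shows "frechet_derivative \<phi> (at x) v = (\<Sum>i\<in>Basis. (v \<bullet> i) * pard \<phi> i x)"
proof -
 interpret linear "frechet_derivative \<phi> (at x)"
  using has_derivative_linear[OF C_diff_SucD(1)[OF assms]] .
 have "frechet_derivative \<phi> (at x) (\<Sum>i\<in>Basis. (v \<bullet> i) *\<^sub>R i) = (\<Sum>i\<in>Basis. (v \<bullet> i) * pard \<phi> i x)"
  by (simp add: sum scale)
 then show ?thesis by (simp add: euclidean_representation)
qed

lemma test_function_partial_measurable:
 assumes "\<phi> \<in> test_functions U" "i \<in> Basis"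
 shows "(\<lambda>x. pard \<phi> i x) \<in> Borel"
 by (intro borel_measurable_continuous_onI C_diff_imp_continuous[of 0] C_diff_SucD(2)[OF test_functions_D(1)[OF assms(1), of "Suc 0"]] assms)

lemma test_function_bounded:
 assumes \<phi>: "\<phi> \<in> test_functions U"
 obtains B where "0 < B" "\<And>x. \<bar>\<phi> x\<bar> \<le> B" "\<And>x v. \<bar>frechet_derivative \<phi> (at x) v\<bar> \<le> B * norm v"
  "\<And>x y. \<bar>\<phi> x - \<phi> y\<bar> \<le> B * norm (x - y)"
proof -
 let ?K = "closure {x. \<phi> x \<noteq> 0}"
 have K: "compact ?K" using test_functions_D(2)[OF \<phi>] .
 have bnd: "\<exists>B>0. \<forall>x. \<bar>f x\<bar> \<le> B" if "continuous_on UNIV f" "\<And>x. x \<notin> ?K ==> f x = 0" for f :: "'a => real"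
 proof -
  have "compact (f ` ?K)" using that(1) K by (intro compact_continuous_image) (auto intro: continuous_on_subset)
  then obtain B where B: "0 < B" "\<forall>y\<in>f ` ?K. norm y \<le> B" using compact_imp_bounded bounded_pos by blast
  have "\<bar>f x\<bar> \<le> B" for x
  proof (cases "x \<in> ?K")
   case True
   then show ?thesis using B(2) by auto
  qed (use that(2) B(1) in auto)
  with B(1) show ?thesis by blast
 qed
 obtain B0 where B0: "0 < B0" "\<forall>x. \<bar>\<phi> x\<bar> \<le> B0"
  using bnd[of \<phi>] C_diff_imp_continuous[OF test_functions_D(1)[OF \<phi>, of 0]] closure_subset[of "{x. \<phi> x \<noteq> 0}"] by blast
 have "\<forall>i\<in>Basis. \<exists>B>0. \<forall>x. \<bar>pard \<phi> i x\<bar> \<le> B"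
 proof
  fix i :: 'a assume i: "i \<in> Basis"
  show "\<exists>B>0. \<forall>x. \<bar>pard \<phi> i x\<bar> \<le> B"
  proof (rule bnd)
   show "continuous_on UNIV (\<lambda>x. pard \<phi> i x)"
    by (intro C_diff_imp_continuous[of 0] C_diff_SucD(2)[OF test_functions_D(1)[OF \<phi>, of "Suc 0"]] i)
  qed (simp add: frechet_derivative_test_function_outside[OF \<phi>])
 qed
 then obtain Bi where Bi: "\<And>i. i \<in> Basis ==> 0 < Bi i" "\<And>i x. i \<in> Basis ==> \<bar>pard \<phi> i x\<bar> \<le> Bi i"
  by metis
 define B1 where "B1 = (\<Sum>i\<in>Basis. Bi i)"
 have B1: "\<bar>frechet_derivative \<phi> (at x) v\<bar> \<le> B1 * norm v" for x v
 proof -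
  have "\<bar>frechet_derivative \<phi> (at x) v\<bar> \<le> (\<Sum>i\<in>Basis. \<bar>(v \<bullet> i) * pard \<phi> i x\<bar>)"
   unfolding frechet_derivative_basis[OF test_functions_D(1)[OF \<phi>, of "Suc 0"], of x v] by (rule sum_abs)
  also have "\<dots> \<le> (\<Sum>i\<in>Basis. norm v * Bi i)"
   using Bi Basis_le_norm by (intro sum_mono) (auto simp: abs_mult intro!: mult_mono)
  finally show ?thesis by (simp add: B1_def sum_distrib_left mult.commute)
 qed
 have B1': "\<bar>\<phi> x - \<phi> y\<bar> \<le> B1 * norm (x - y)" for x y
 proof -
  have "norm (\<phi> x - \<phi> y) \<le> B1 * norm (x - y)"
  proof (rule differentiable_bound[of UNIV \<phi> "\<lambda>x. frechet_derivative \<phi> (at x)"])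
   show "(\<phi> has_derivative frechet_derivative \<phi> (at z)) (at z)" for z
    by (rule C_diff_SucD(1)[OF test_functions_D(1)[OF \<phi>, of "Suc 0"]])
   show "onorm (frechet_derivative \<phi> (at z)) \<le> B1" for z
    using B1[of z] by (intro onorm_le) auto
  qed auto
  then show ?thesis by simp
 qed
 have "B0 * 1 \<le> B0 + B1 * 1" "0 \<le> B1" using Bi(1) by (auto simp: B1_def intro: sum_nonneg less_imp_le)
 show thesis
 proof (rule that[of "B0 + B1"])
  show "\<bar>\<phi> x\<bar> \<le> B0 + B1" for x using B0(2) \<open>0 \<le> B1\<close> by (metis add_increasing2)
  show "\<bar>frechet_derivative \<phi> (at x) v\<bar> \<le> (B0 + B1) * norm v" for x v
   using B1[of x v] B0(1) by (simp add: distrib_right add_increasing)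
  show "\<bar>\<phi> x - \<phi> y\<bar> \<le> (B0 + B1) * norm (x - y)" for x y
   using B1'[of x y] B0(1) by (simp add: distrib_right add_increasing)
 qed (use B0 \<open>0 \<le> B1\<close> in auto)
qed

lemma test_function_support_nbhd:
 assumes "\<phi> \<in> test_functions U" "open U"
 obtains d where "0 < d" "\<And>x y. \<phi> x \<noteq> 0 ==> norm (y - x) < d ==> y \<in> U"
proof -
 obtain e where e: "e > 0" "(\<Union>x\<in>closure {x. \<phi> x \<noteq> 0}. ball x e) \<subseteq> U"
  using compact_subset_open_imp_ball_epsilon_subset[OF test_functions_D(2)[OF assms(1)] assms(2) test_functions_D(3)[OF assms(1)]] by blast
 show thesis
 proof (rule that[OF e(1)])
  fix x y assume "\<phi> x \<noteq> 0" "norm (y - x) < e"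
  then have "x \<in> closure {x. \<phi> x \<noteq> 0}" "y \<in> ball x e"
   using closure_subset by (force, simp add: dist_norm norm_minus_commute)
  with e(2) show "y \<in> U" by blast
 qed
qed

lemma integrable_mult_test:
 fixes u :: "'a::euclidean_space => real"
 assumes u: "integrable lborel u" and [measurable]: "f \<in> Borel" and B: "\<And>x. \<bar>f x\<bar> \<le> B"
 shows "integrable lborel (\<lambda>x. u x * f x)"
proof (rule Bochner_Integration.integrable_bound[where f="\<lambda>x. B * u x"])
 have [measurable]: "u \<in> Borel" using borel_measurable_integrable[OF u] by simp
 show "(\<lambda>x. u x * f x) \<in> borel_measurable lborel" by measurable
 have "0 \<le> B" using B[of 0] by simp
 then show "AE x in lborel. norm (u x * f x) \<le> norm (B * u x)"
  using B by (intro AE_I2) (simp add: abs_mult mult.commute mult_right_mono)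
qed (use u in auto)

text \<open>Discrete integration by parts: translation invariance moves the quotient from
  \<open>u\<close> to \<phi>, where it is bounded by the Lipschitz constant and converges pointwise.
  The sign comes from the reversed shift.\<close>

lemma difference_quotient_tendsto:
 fixes u :: "'a::euclidean_space => real"
 assumes u: "integrable lborel u" and \<phi>: "\<phi> \<in> test_functions U" and i: "i \<in> Basis"
  and h: "h \<longlonglongrightarrow> 0" "\<And>k. h k \<noteq> 0"
 shows "(\<lambda>k. (BB x. (u (x + h k *\<^sub>R i) - u x) / h k * \<phi> x)) \<longlonglongrightarrow> - (BB x. u x * pard \<phi> i x)"
proof -
 have um [measurable]: "u \<in> Borel" using borel_measurable_integrable[OF u] by simp
 have \<phi>m [measurable]: "\<phi> \<in> Borel" using \<phi> by (rule test_functions_measurable)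
 have [measurable]: "(\<lambda>x. pard \<phi> i x) \<in> Borel" by (rule test_function_partial_measurable[OF \<phi> i])
 obtain B where B: "0 < B" "\<And>x. \<bar>\<phi> x\<bar> \<le> B" "\<And>x y. \<bar>\<phi> x - \<phi> y\<bar> \<le> B * norm (x - y)"
  using test_function_bounded[OF \<phi>] by metis
 have eq: "(BB x. (u (x + c *\<^sub>R i) - u x) / c * \<phi> x) = (BB x. u x * ((\<phi> (x - c *\<^sub>R i) - \<phi> x) / c))" (is "?l = ?r")
  if c: "c \<noteq> 0" for c
 proof -
  have i1: "integrable lborel (\<lambda>x. u x * \<phi> (x - c *\<^sub>R i))" by (rule integrable_mult_test[OF u]) (use B(2) in auto)
  have i2: "integrable lborel (\<lambda>x. u x * \<phi> x)" by (rule integrable_mult_test[OF u]) (use B(2) in auto)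
  have i3: "integrable lborel (\<lambda>x. u (x + c *\<^sub>R i) * \<phi> x)"
   using integrable_lborel_affine[OF i1, of 1 "c *\<^sub>R i"] by (simp add: add.commute)
  have "(BB x. u x * \<phi> (x - c *\<^sub>R i)) = (BB x. u (x + c *\<^sub>R i) * \<phi> x)"
   using integral_lborel_affine[of "\<lambda>x. u x * \<phi> (x - c *\<^sub>R i)" 1 "c *\<^sub>R i"] by (simp add: add.commute)
  moreover have "?l = ((BB x. u (x + c *\<^sub>R i) * \<phi> x) - (BB x. u x * \<phi> x)) / c"
   using i2 i3 by (simp add: left_diff_distrib diff_divide_distrib)
  moreover have "?r = ((BB x. u x * \<phi> (x - c *\<^sub>R i)) - (BB x. u x * \<phi> x)) / c"
   using i1 i2 by (simp add: right_diff_distrib diff_divide_distrib)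
  ultimately show ?thesis by (simp only:)
 qed
 have "(\<lambda>k. (BB x. u x * ((\<phi> (x - h k *\<^sub>R i) - \<phi> x) / h k))) \<longlonglongrightarrow> (BB x. u x * (- pard \<phi> i x))"
 proof (rule integral_dominated_convergence[where w="\<lambda>x. \<bar>u x\<bar> * B"])
  show "AE x in lborel. (\<lambda>k. u x * ((\<phi> (x - h k *\<^sub>R i) - \<phi> x) / h k)) \<longlonglongrightarrow> u x * (- pard \<phi> i x)"
  proof (intro AE_I2 tendsto_intros)
   fix x
   have D: "(\<phi> has_derivative frechet_derivative \<phi> (at x)) (at x)"
    by (rule C_diff_SucD(1)[OF test_functions_D(1)[OF \<phi>, of "Suc 0"]])
   have "((\<lambda>t. \<phi> (x + t *\<^sub>R (- i))) has_derivative (\<lambda>t. frechet_derivative \<phi> (at x) (t *\<^sub>R (- i)))) (at 0)"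
    using D by (intro has_derivative_compose[where f="\<lambda>t. x + t *\<^sub>R (- i)" and g=\<phi>]) (auto intro!: derivative_eq_intros)
   moreover have "frechet_derivative \<phi> (at x) (t *\<^sub>R (- i)) = - pard \<phi> i x * t" for t
    using linear_cmul[OF has_derivative_linear[OF D], of t "- i"] linear_neg[OF has_derivative_linear[OF D], of i] by simp
   moreover have "(\<lambda>t. - pard \<phi> i x * t) = (*) (- pard \<phi> i x)"
    by (rule ext) simp
   ultimately have "((\<lambda>t. \<phi> (x + t *\<^sub>R (- i))) has_real_derivative - pard \<phi> i x) (at 0)"
    unfolding has_field_derivative_def by (simp only:)
   then have "((\<lambda>t. (\<phi> (x - t *\<^sub>R i) - \<phi> x) / t) \<longlongrightarrow> - pard \<phi> i x) (at 0)"
    by (simp add: has_field_derivative_iff)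
   moreover have "filterlim h (at 0) sequentially" using h by (simp add: filterlim_at)
   ultimately show "(\<lambda>k. (\<phi> (x - h k *\<^sub>R i) - \<phi> x) / h k) \<longlonglongrightarrow> - pard \<phi> i x"
    by (rule filterlim_compose)
  qed
  show "AE x in lborel. norm (u x * ((\<phi> (x - h k *\<^sub>R i) - \<phi> x) / h k)) \<le> \<bar>u x\<bar> * B" for k
  proof (rule AE_I2)
   fix x
   have "\<bar>\<phi> (x - h k *\<^sub>R i) - \<phi> x\<bar> \<le> B * \<bar>h k\<bar>"
    using B(3)[of "x - h k *\<^sub>R i" x] i by simp
   then have "\<bar>(\<phi> (x - h k *\<^sub>R i) - \<phi> x) / h k\<bar> \<le> B" using h(2)[of k] by (simp add: abs_divide divide_le_eq)
   then show "norm (u x * ((\<phi> (x - h k *\<^sub>R i) - \<phi> x) / h k)) \<le> \<bar>u x\<bar> * B" by (simp only: real_norm_def abs_mult mult_left_mono abs_ge_zero)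
  qed
 qed (use u in \<open>auto intro!: integrable_mult_left\<close>)
 then show ?thesis unfolding eq[OF h(2)] by simp
qed

text \<open>Tested against \<phi>, the difference quotient of \<open>u\<close> becomes an average of
  integrals of \<open>g\<close> against translates of \<phi>, and the translates converge as the
  step shrinks. Only the steps \<open>1 / real (Suc k)\<close> in coordinate directions are
  required: these are countably many conditions, so they can be inherited by almost every
  slice.\<close>

lemma wgradI_segments:
 fixes u :: "'a::euclidean_space => real"
 assumes U: "open U" and u: "integrable lborel u" and g: "integrable lborel g"
  and seg: "\<And>k i. i \<in> Basis ==> AE x in lborel.
   (\<forall>t\<in>{0..1}. x + (t / real (Suc k)) *\<^sub>R i \<in> U) -->
   u (x + (1 / real (Suc k)) *\<^sub>R i) - u x = (\<integral>t. g (x + (t / real (Suc k)) *\<^sub>R i) \<bullet> i \<partial>I01) / real (Suc k)"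
 shows "wgrad U u g"
 unfolding wgrad_def
proof (intro ballI)
 fix \<phi> and i :: 'a assume \<phi>: "\<phi> \<in> test_functions U" and i: "i \<in> Basis"
 have [measurable]: "u \<in> Borel" using borel_measurable_integrable[OF u] by simp
 have [measurable]: "g \<in> Borel" using borel_measurable_integrable[OF g] by simp
 have [measurable]: "\<phi> \<in> Borel" using \<phi> by (rule test_functions_measurable)
 obtain B where B: "0 < B" "\<And>x. \<bar>\<phi> x\<bar> \<le> B" "\<And>x y. \<bar>\<phi> x - \<phi> y\<bar> \<le> B * norm (x - y)"
  using test_function_bounded[OF \<phi>] by metis
 \<comment> \<open>For steps below \<open>d\<close> the whole segment from a point with \<phi>
   nonzero stays in \<open>U\<close>, which is where \<open>seg\<close> may be used.\<close>
 obtain d where d: "0 < d" "\<And>x y. \<phi> x \<noteq> 0 ==> norm (y - x) < d ==> y \<in> U"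
  using test_function_support_nbhd[OF \<phi> U] by blast
 have gi: "integrable lborel (\<lambda>x. g x \<bullet> i)" using g by simp
 define h where "h k = 1 / real (Suc k)" for k
 have h: "h \<longlonglongrightarrow> 0" "\<And>k. h k \<noteq> 0" "\<And>k. 0 < h k" unfolding h_def[abs_def] using LIMSEQ_Suc[OF lim_1_over_n] by auto
 define Q where "Q k = (BB x. (u (x + h k *\<^sub>R i) - u x) / h k * \<phi> x)" for k
 have Q: "Q \<longlonglongrightarrow> - (BB x. u x * pard \<phi> i x)"
  unfolding Q_def by (rule difference_quotient_tendsto[OF u \<phi> i h(1,2)])
 define A where "A = (BB x. \<bar>g x \<bullet> i\<bar>)"
 \<comment> \<open>After Fubini and a translation, \<phi> is replaced by translates over distances
   \<open>t * h k\<close>. Each differs from \<phi> by at most \<open>B * h k\<close>, so the error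
   is of the order of the step.\<close>
 have est: "\<bar>Q k - (BB x. (g x \<bullet> i) * \<phi> x)\<bar> \<le> B * h k * A" if hk: "h k < d" for k
 proof -
  let ?f = "\<lambda>z. (g (snd z + (fst z * h k) *\<^sub>R i) \<bullet> i) * \<phi> (snd z)"
  have int_t: "integrable lborel (\<lambda>x. (g x \<bullet> i) * \<phi> (x - (t * h k) *\<^sub>R i))" for t
   by (rule integrable_mult_test[OF gi]) (use B(2) in auto)
  have eq_t: "(BB x. (g (x + (t * h k) *\<^sub>R i) \<bullet> i) * \<phi> x) = (BB x. (g x \<bullet> i) * \<phi> (x - (t * h k) *\<^sub>R i))" for t
   using integral_lborel_affine[of "\<lambda>x. (g x \<bullet> i) * \<phi> (x - (t * h k) *\<^sub>R i)" 1 "(t * h k) *\<^sub>R i"] by (simp add: add.commute)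
  have "(BB x. (\<integral>t. ?f (t, x) \<partial>I01)) = (\<integral>t. (BB x. ?f (t, x)) \<partial>I01)"
  proof (rule Fubini_I01(2))
   show "?f \<in> Borel" by (simp add: borel_prod[symmetric])
   fix t :: real
   have "(NN x. ennreal \<bar>?f (t, x)\<bar>) = (NN x. ennreal \<bar>(g x \<bullet> i) * \<phi> (x - (t * h k) *\<^sub>R i)\<bar>)"
    using nn_integral_lborel_affine[of "\<lambda>x. ennreal \<bar>(g x \<bullet> i) * \<phi> (x - (t * h k) *\<^sub>R i)\<bar>" 1 "(t * h k) *\<^sub>R i"] by (simp add: add.commute)
   also have "\<dots> \<le> (NN x. ennreal (\<bar>g x \<bullet> i\<bar> * B))"
    using B(2) by (intro nn_integral_mono ennreal_leI) (auto simp: abs_mult intro: mult_left_mono)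
   also have "\<dots> = ennreal (A * B)"
    unfolding A_def using gi B(1) by (subst nn_integral_eq_integral) auto
   finally show "(NN x. ennreal \<bar>?f (t, x)\<bar>) \<le> ennreal (A * B)" .
  qed simp
  moreover have "Q k = (BB x. (\<integral>t. ?f (t, x) \<partial>I01))"
   unfolding Q_def
  proof (rule integral_cong_AE)
   show "AE x in lborel. (u (x + h k *\<^sub>R i) - u x) / h k * \<phi> x = (\<integral>t. ?f (t, x) \<partial>I01)"
    using seg[OF i, of k]
   proof eventually_elim
    case (elim x)
    show ?case
    proof (cases "\<phi> x = 0")
     case False
     have "x + (t / real (Suc k)) *\<^sub>R i \<in> U" if "t \<in> {0..1}" for t
     proof (rule d(2)[OF False])
      have "norm (x + (t / real (Suc k)) *\<^sub>R i - x) = t * h k" using i that by (simp add: h_def)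
      also have "\<dots> \<le> 1 * h k" using that h(3)[of k] by (intro mult_right_mono) auto
      finally show "norm (x + (t / real (Suc k)) *\<^sub>R i - x) < d" using hk by simp
     qed
     with elim have "(u (x + h k *\<^sub>R i) - u x) / h k = (\<integral>t. g (x + (t * h k) *\<^sub>R i) \<bullet> i \<partial>I01)"
      by (simp add: h_def)
     then show ?thesis by simp
    qed simp
   qed
   have "(\<lambda>(x, t). ?f (t, x)) \<in> borel_measurable (lborel \<Otimes>\<^sub>M I01)" by measurable
   then show "(\<lambda>x. \<integral>t. ?f (t, x) \<partial>I01) \<in> borel_measurable lborel"
    by (intro I01.borel_measurable_lebesgue_integral) simp
  qed measurable
  ultimately have Qk: "Q k = (\<integral>t. (BB x. (g x \<bullet> i) * \<phi> (x - (t * h k) *\<^sub>R i)) \<partial>I01)"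
   by (simp add: eq_t)
  define F where "F t = (BB x. (g x \<bullet> i) * \<phi> (x - (t * h k) *\<^sub>R i))" for t
  define c where "c = (BB x. (g x \<bullet> i) * \<phi> x)"
  have Fc: "\<bar>F t - c\<bar> \<le> B * h k * A" if "0 \<le> t" "t \<le> 1" for t
  proof -
   have "F t - c = (BB x. (g x \<bullet> i) * \<phi> (x - (t * h k) *\<^sub>R i) - (g x \<bullet> i) * \<phi> x)"
    unfolding F_def c_def using int_t[of t] int_t[of 0] by (subst Bochner_Integration.integral_diff) auto
   also have "\<bar>\<dots>\<bar> \<le> (BB x. B * h k * \<bar>g x \<bullet> i\<bar>)"
   proof (rule order_trans[OF integral_abs_bound integral_mono])
    show "integrable lborel (\<lambda>x. \<bar>(g x \<bullet> i) * \<phi> (x - (t * h k) *\<^sub>R i) - (g x \<bullet> i) * \<phi> x\<bar>)"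
     using int_t[of t] int_t[of 0] by (intro integrable_abs Bochner_Integration.integrable_diff) auto
    fix x
    have "\<bar>\<phi> (x - (t * h k) *\<^sub>R i) - \<phi> x\<bar> \<le> B * (t * h k)"
     using B(3)[of "x - (t * h k) *\<^sub>R i" x] i that h(3)[of k] by simp
    also have "\<dots> \<le> B * h k" using that B(1) h(3)[of k] by (intro mult_left_mono mult_left_le_one_le) auto
    finally have "\<bar>g x \<bullet> i\<bar> * \<bar>\<phi> (x - (t * h k) *\<^sub>R i) - \<phi> x\<bar> \<le> \<bar>g x \<bullet> i\<bar> * (B * h k)"
     by (intro mult_left_mono) auto
    then show "\<bar>(g x \<bullet> i) * \<phi> (x - (t * h k) *\<^sub>R i) - (g x \<bullet> i) * \<phi> x\<bar> \<le> B * h k * \<bar>g x \<bullet> i\<bar>"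
     by (simp only: right_diff_distrib[symmetric] abs_mult) (simp only: mult_ac)
   qed (use gi in auto)
   also have "\<dots> = B * h k * A" by (simp add: A_def)
   finally show ?thesis .
  qed
  have Fm: "F \<in> borel_measurable I01"
   unfolding F_def[abs_def]
   by (rule lborel.borel_measurable_lebesgue_integral) measurable
  have Fi: "integrable I01 F"
  proof (rule I01.integrable_const_bound[where B="\<bar>c\<bar> + B * h k * A"])
   show "AE t in I01. norm (F t) \<le> \<bar>c\<bar> + B * h k * A"
    by (rule AE_I01I) (use Fc in fastforce)
  qed (rule Fm)
  have "Q k - c = (\<integral>t. F t - c \<partial>I01)"
   using Fi I01.prob_space unfolding Qk F_def[symmetric] by (subst Bochner_Integration.integral_diff) (auto simp: I01.prob_space[simplified])
  also have "\<bar>\<dots>\<bar> \<le> (\<integral>t. B * h k * A \<partial>I01)"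
  proof (rule order_trans[OF integral_abs_bound integral_mono_AE])
   show "AE t in I01. \<bar>F t - c\<bar> \<le> B * h k * A" by (rule AE_I01I) (use Fc in auto)
  qed (use Fi in \<open>auto intro!: integrable_abs Bochner_Integration.integrable_diff\<close>)
  also have "\<dots> = B * h k * A" using I01.prob_space by simp
  finally show ?thesis by (simp add: c_def)
 qed
 have "(\<lambda>k. Q k - (BB x. (g x \<bullet> i) * \<phi> x)) \<longlonglongrightarrow> 0"
 proof (rule Lim_null_comparison)
  show "\<forall>\<^sub>F k in sequentially. norm (Q k - (BB x. (g x \<bullet> i) * \<phi> x)) \<le> B * h k * A"
   using order_tendstoD(2)[OF h(1) d(1)] by eventually_elim (use est in auto)
  show "(\<lambda>k. B * h k * A) \<longlonglongrightarrow> 0"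
   using tendsto_mult_left[OF tendsto_mult_right[OF h(1), of A], of B] by (simp add: mult.assoc)
 qed
 then have "Q \<longlonglongrightarrow> (BB x. (g x \<bullet> i) * \<phi> x)" by (simp add: LIM_zero_iff)
 with Q have "- (BB x. u x * pard \<phi> i x) = (BB x. (g x \<bullet> i) * \<phi> x)"
  by (rule LIMSEQ_unique)
 then show "(BB x. u x * pard \<phi> i x) = - (BB x. (g x \<bullet> i) * \<phi> x)" by simp
qed

lemma continuous_compact_support_bounded:
 fixes f :: "'a::euclidean_space => real"
 assumes "continuous_on UNIV f" "compact K" "\<And>x. x \<notin> K ==> f x = 0"
 obtains B where "0 < B" "\<And>x. \<bar>f x\<bar> \<le> B"
proof -
 have "compact (f ` K)" using assms by (intro compact_continuous_image) (auto intro: continuous_on_subset)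
 then obtain B where B: "0 < B" "\<forall>y\<in>f ` K. norm y \<le> B" using compact_imp_bounded bounded_pos by blast
 have "\<bar>f x\<bar> \<le> B" for x
  using assms(3)[of x] B by (cases "x \<in> K") auto
 with that B(1) show thesis by blast
qed

text \<open>\<open>X t\<close> inverts the map x + t (b x + h), and the power in front of \<phi> is
  the Jacobian of \<open>X t\<close>: a density is transported along these maps. The derivative is
  minus the transported divergence of \<phi> times the velocity b x + h, as in the continuity
  equation; the dimension times \<open>b\<close> is the divergence of the velocity.\<close>

lemma test_function_divergence_derivative:
 fixes \<phi> :: "'a::euclidean_space => real" and h :: 'a
 assumes \<phi>: "\<And>k. C_diff k \<phi>" and s: "0 < 1 + b * s"
 defines "X \<equiv> \<lambda>t z. inverse (1 + b * t) *\<^sub>R (z - t *\<^sub>R h)"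
 shows "((\<lambda>t. inverse (1 + b * t) ^ DIM('a) * \<phi> (X t z)) has_real_derivative
  - (inverse (1 + b * s) ^ Suc DIM('a) * (real DIM('a) * b * \<phi> (X s z) +
    frechet_derivative \<phi> (at (X s z)) (b *\<^sub>R X s z + h)))) (at s)"
proof -
 define c where "c = inverse (1 + b * s)"
 define x where "x = X s z"
 have D: "(\<phi> has_derivative frechet_derivative \<phi> (at x)) (at x)"
  by (rule C_diff_SucD(1)[OF \<phi>[of "Suc 0"]])
 interpret linear "frechet_derivative \<phi> (at x)" using has_derivative_linear[OF D] .
 have dc: "((\<lambda>t. inverse (1 + b * t)) has_real_derivative - (c * b * c)) (at s)"
  using s by (auto intro!: derivative_eq_intros simp: c_def)
 have dX: "((\<lambda>t. X t z) has_vector_derivative (c *\<^sub>R (- h) + (- (c * b * c)) *\<^sub>R (z - s *\<^sub>R h))) (at s)"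
  unfolding X_def c_def
  by (rule has_vector_derivative_scaleR[OF dc[unfolded c_def]]) (auto intro!: derivative_eq_intros)
 have eqX: "c *\<^sub>R (- h) + (- (c * b * c)) *\<^sub>R (z - s *\<^sub>R h) = (- c) *\<^sub>R (b *\<^sub>R x + h)"
  by (simp add: x_def X_def c_def[symmetric] algebra_simps)
 have "((\<phi> \<circ> (\<lambda>t. X t z)) has_vector_derivative frechet_derivative \<phi> (at x) ((- c) *\<^sub>R (b *\<^sub>R x + h))) (at s)"
  using vector_derivative_diff_chain_within[OF dX[unfolded eqX] has_derivative_at_withinI[OF D[unfolded x_def]]]
  by (simp add: x_def)
 then have d\<phi>: "((\<lambda>t. \<phi> (X t z)) has_real_derivative (- c * frechet_derivative \<phi> (at x) (b *\<^sub>R x + h))) (at s)"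
  unfolding scale has_real_derivative_iff_has_vector_derivative by (simp add: o_def)
 have "((\<lambda>t. inverse (1 + b * t) ^ DIM('a) * \<phi> (X t z)) has_real_derivative
   (of_nat DIM('a) * (- (c * b * c) * c ^ (DIM('a) - Suc 0))) * \<phi> x +
   (- c * frechet_derivative \<phi> (at x) (b *\<^sub>R x + h)) * c ^ DIM('a)) (at s)"
  using DERIV_mult[OF DERIV_power[OF dc, of "DIM('a)"] d\<phi>] by (simp add: c_def x_def)
 moreover have "c * c ^ (DIM('a) - Suc 0) = c ^ DIM('a)"
  by (metis DIM_positive Suc_pred One_nat_def power_Suc)
 then have "(of_nat DIM('a) * (- (c * b * c) * c ^ (DIM('a) - Suc 0))) * \<phi> x +
   (- c * frechet_derivative \<phi> (at x) (b *\<^sub>R x + h)) * c ^ DIM('a) =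
   - (c ^ Suc DIM('a) * (real DIM('a) * b * \<phi> x + frechet_derivative \<phi> (at x) (b *\<^sub>R x + h)))"
  by (simp add: distrib_left mult_ac)
 ultimately show ?thesis by (simp add: c_def x_def)
qed

text \<open>The line through the affine maps \<open>x \<mapsto> x + t(bx + h)\<close>, which covers translations
 and dilations, is tested against \<open>\<phi>\<close> and differentiated in \<open>t\<close>.\<close>

lemma wgrad_path:
 fixes u :: "'a::euclidean_space => real"
 assumes U: "open U" "bounded U" and u: "integrable lborel u" and g: "integrable lborel g"
  and w: "wgrad U u g" and b: "- 1 < b"
 shows "AE x in lborel. (\<forall>t\<in>{0..1}. x + t *\<^sub>R (b *\<^sub>R x + h) \<in> U) -->
  u (x + (b *\<^sub>R x + h)) - u x = (\<integral>t. g (x + t *\<^sub>R (b *\<^sub>R x + h)) \<bullet> (b *\<^sub>R x + h) \<partial>I01)"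
proof -
 have um [measurable]: "u \<in> Borel" using borel_measurable_integrable[OF u] by simp
 have gm [measurable]: "g \<in> Borel" using borel_measurable_integrable[OF g] by simp
 define n where "n = DIM('a)"
 define vel where "vel x = b *\<^sub>R x + h" for x
 have velm [measurable]: "vel \<in> Borel" unfolding vel_def by measurable
 \<comment> \<open>The starting points whose whole path stays in \<open>U\<close>. Paths are compact
   and depend continuously on the start, so \<open>V\<close> is open and has its own test
   functions.\<close>
 define V where "V = {x. \<forall>t\<in>{0..1}. x + t *\<^sub>R vel x \<in> U}"
 \<comment> \<open>A lower bound for the dilation factor \<open>1 + b * t\<close> on the unit
   interval, positive because of \<open>- 1 < b\<close>. It bounds all Jacobians of the inverse
   maps.\<close>
 define m where "m = min 1 (1 + b)"
 have m: "0 < m" using b by (auto simp: m_def)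
 have km: "m \<le> 1 + b * t" if "0 \<le> t" "t \<le> 1" for t
 proof (cases "0 \<le> b")
  case False
  then have "b * 1 \<le> b * t" using that by (intro mult_left_mono_neg) auto
  then show ?thesis by (auto simp: m_def)
 qed (use that in \<open>auto simp: m_def\<close>)
 have path: "x + t *\<^sub>R vel x = t *\<^sub>R h + (1 + b * t) *\<^sub>R x" for t x
  by (simp add: vel_def algebra_simps)
 have "V \<subseteq> U" by (auto simp: V_def dest: bspec[of _ _ 0])
 have oV: "open V"
  unfolding open_dist
 proof
  fix x assume x: "x \<in> V"
  have "compact ((\<lambda>t. x + t *\<^sub>R vel x) ` {0..1})"
   by (intro compact_continuous_image continuous_intros) auto
  moreover have "(\<lambda>t. x + t *\<^sub>R vel x) ` {0..1} \<subseteq> U" using x by (auto simp: V_def)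
  ultimately obtain e where e: "0 < e" "(\<Union>y\<in>(\<lambda>t. x + t *\<^sub>R vel x) ` {0..1}. ball y e) \<subseteq> U"
   using compact_subset_open_imp_ball_epsilon_subset[OF _ U(1)] by blast
  show "\<exists>e>0. \<forall>y. dist y x < e --> y \<in> V"
  proof (intro exI conjI allI impI)
   show "0 < e / (1 + \<bar>b\<bar>)" using e(1) by auto
   fix y assume y: "dist y x < e / (1 + \<bar>b\<bar>)"
   show "y \<in> V" unfolding V_def
   proof safe
    fix t :: real assume t: "t \<in> {0..1}"
    have "\<bar>1 + b * t\<bar> \<le> 1 + \<bar>b\<bar>"
     using t by (intro order_trans[OF abs_triangle_ineq]) (auto simp: abs_mult mult_left_le)
    then have "norm ((1 + b * t) *\<^sub>R (y - x)) \<le> (1 + \<bar>b\<bar>) * norm (y - x)"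
     by (simp add: mult_right_mono)
    also have "\<dots> < e" proof -
     have "0 < 1 + \<bar>b\<bar>" by auto
     with y show ?thesis by (simp add: dist_norm pos_less_divide_eq mult.commute)
    qed
    finally have "y + t *\<^sub>R vel y \<in> ball (x + t *\<^sub>R vel x) e"
     by (simp add: path dist_norm norm_minus_commute scaleR_diff_right)
    then show "y + t *\<^sub>R vel y \<in> U" using e(2) t by blast
   qed
  qed
 qed
 have [measurable]: "V \<in> sets borel" using oV by auto
 obtain R where R: "0 < R" "\<And>x. x \<in> U ==> norm x \<le> R" using U(2) bounded_pos by blast
 define Cv where "Cv = \<bar>b\<bar> * R + norm h"
 have Cv: "norm (vel x) \<le> Cv" if "x \<in> V" for x
 proof -
  have "norm x \<le> R" using that \<open>V \<subseteq> U\<close> R(2) by blast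
  then have "\<bar>b\<bar> * norm x \<le> \<bar>b\<bar> * R" by (intro mult_left_mono) auto
  then show ?thesis using norm_triangle_ineq[of "b *\<^sub>R x" h] by (simp add: vel_def Cv_def)
 qed
 have Cv0: "0 \<le> Cv" using R by (simp add: Cv_def)
 define Ig where "Ig = (NN x. ennreal (norm (g x)))"
 have Ig: "Ig < top" using g by (simp add: Ig_def integrable_iff_bounded)
 have g_path: "(NN x. ennreal (norm (g (x + t *\<^sub>R vel x)))) \<le> ennreal (inverse m ^ n) * Ig"
  if t: "0 \<le> t" "t \<le> 1" for t
 proof -
  let ?J = "(NN x. ennreal (norm (g (x + t *\<^sub>R vel x))))"
  have "Ig = ennreal (\<bar>1 + b * t\<bar> ^ n) * ?J"
   unfolding Ig_def path n_def using km[OF t] m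
   by (intro nn_integral_lborel_affine) auto
  moreover have "ennreal (m ^ n) * ?J \<le> ennreal (\<bar>1 + b * t\<bar> ^ n) * ?J"
   using km[OF t] m by (intro mult_right_mono ennreal_leI power_mono) auto
  ultimately have "ennreal (inverse m ^ n) * (ennreal (m ^ n) * ?J) \<le> ennreal (inverse m ^ n) * Ig"
   by (intro mult_left_mono) auto
  then show ?thesis using m by (simp add: mult.assoc[symmetric] ennreal_mult[symmetric] power_mult_distrib[symmetric])
 qed
 \<comment> \<open>The defect of the asserted identity on \<open>V\<close>. It is integrable, so it
   vanishes almost everywhere on \<open>V\<close> once all its integrals against test functions of
   \<open>V\<close> vanish.\<close>
 define k where "k x = indicator V x * (u (x + vel x) - u x - (\<integral>t. g (x + t *\<^sub>R vel x) \<bullet> vel x \<partial>I01))" for x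
 have i1: "integrable lborel (\<lambda>x. u (x + vel x))"
  using integrable_lborel_affine[OF u, of "1 + b" h] b by (simp add: path[of _ 1, simplified])
 have f3: "integrable lborel (\<lambda>x. \<integral>t. indicator V x * (g (x + t *\<^sub>R vel x) \<bullet> vel x) \<partial>I01)"
 proof -
  let ?f = "\<lambda>z. indicator V (snd z) * (g (snd z + fst z *\<^sub>R vel (snd z)) \<bullet> vel (snd z)) :: real"
  have "integrable lborel (\<lambda>x. \<integral>t. ?f (t, x) \<partial>I01)"
  proof (rule Fubini_I01(3))
  show "?f \<in> Borel"
   by (simp add: borel_prod[symmetric])
  fix t :: real assume t: "0 \<le> t" "t \<le> 1"
  have "(NN x. ennreal \<bar>indicator V x * (g (x + t *\<^sub>R vel x) \<bullet> vel x)\<bar>)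
   \<le> (NN x. ennreal Cv * ennreal (norm (g (x + t *\<^sub>R vel x))))"
  proof (intro nn_integral_mono)
   fix x
   have "\<bar>indicator V x * (g (x + t *\<^sub>R vel x) \<bullet> vel x)\<bar> \<le> Cv * norm (g (x + t *\<^sub>R vel x))"
   proof (cases "x \<in> V")
    case True
    have "\<bar>g (x + t *\<^sub>R vel x) \<bullet> vel x\<bar> \<le> norm (g (x + t *\<^sub>R vel x)) * norm (vel x)"
     by (rule Cauchy_Schwarz_ineq2)
    also have "\<dots> \<le> norm (g (x + t *\<^sub>R vel x)) * Cv" using Cv[OF True] by (intro mult_left_mono) auto
    finally show ?thesis using True by (simp add: mult.commute)
   qed (use Cv0 in auto)
   then show "ennreal \<bar>indicator V x * (g (x + t *\<^sub>R vel x) \<bullet> vel x)\<bar> \<le> ennreal Cv * ennreal (norm (g (x + t *\<^sub>R vel x)))"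
    using Cv0 by (simp add: ennreal_mult[symmetric] ennreal_leI)
  qed
  also have "\<dots> \<le> ennreal Cv * (ennreal (inverse m ^ n) * Ig)"
   using g_path[OF t] by (subst nn_integral_cmult) (auto intro: mult_left_mono)
  finally show "(NN x. ennreal \<bar>?f (t, x)\<bar>) \<le> ennreal Cv * (ennreal (inverse m ^ n) * Ig)"
   by simp
  next
  show "ennreal Cv * (ennreal (inverse m ^ n) * Ig) < \<top>" using Ig by (simp add: ennreal_mult_less_top)
  qed
  then show ?thesis by simp
 qed
 have iV: "integrable lborel (\<lambda>x. indicator V x * f x)" if "integrable lborel f" for f :: "'a => real"
  using integrable_mult_indicator[OF _ that, of V] by simp
 have ik: "integrable lborel k"
  using f3 iV[OF i1] iV[OF u] unfolding k_def right_diff_distrib by simp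
 have "AE x in lborel. x \<in> V --> k x = 0"
 proof (rule AE_eq_0_of_test_functions[OF oV ik])
  fix \<phi> assume \<phi>: "\<phi> \<in> test_functions V"
  note sm = test_functions_D(1)[OF \<phi>]
  define K where "K = closure {x. \<phi> x \<noteq> 0}"
  have K: "compact K" "K \<subseteq> V" "\<And>x. x \<notin> K ==> \<phi> x = 0"
   using test_functions_D(2,3)[OF \<phi>] closure_subset[of "{x. \<phi> x \<noteq> 0}"] by (auto simp: K_def)
  have \<phi>m [measurable]: "\<phi> \<in> Borel" using \<phi> by (rule test_functions_measurable)
  obtain B where B: "0 < B" "\<And>x. \<bar>\<phi> x\<bar> \<le> B" using test_function_bounded[OF \<phi>] by metis
  define pd where "pd i x = pard \<phi> i x" for i x
  have pd_cont: "continuous_on UNIV (pd i)" if "i \<in> Basis" for i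
   unfolding pd_def by (intro C_diff_imp_continuous[of 0] C_diff_SucD(2)[OF sm[of "Suc 0"]] that)
  define dv where "dv x = real n * b * \<phi> x + (\<Sum>i\<in>Basis. (vel x \<bullet> i) * pd i x)" for x
  have dv_cont: "continuous_on UNIV dv"
   unfolding dv_def vel_def by (intro continuous_intros pd_cont C_diff_imp_continuous[OF sm])
  then have [measurable]: "dv \<in> Borel" by (rule borel_measurable_continuous_onI)
  obtain Cd where Cd: "0 < Cd" "\<And>x. \<bar>dv x\<bar> \<le> Cd"
  proof (rule continuous_compact_support_bounded[OF dv_cont K(1)])
   show "dv x = 0" if "x \<notin> K" for x
    using frechet_derivative_test_function_outside[OF \<phi>, of x] that K(3)[OF that] by (simp add: dv_def pd_def K_def)
  qed (rule that)
  define X where "X t z = inverse (1 + b * t) *\<^sub>R (z - t *\<^sub>R h)" for t z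
  have X_path: "X t (t *\<^sub>R h + (1 + b * t) *\<^sub>R x) = x" if "1 + b * t \<noteq> 0" for t x
   using that by (simp add: X_def)
  \<comment> \<open>The transported density. Integrating \<open>u\<close> against \<open>W 1\<close>
    gives the integral of \<open>u (x + vel x)\<close> against \<phi>, and \<open>W 0\<close> is
    \<phi>; their difference is the time integral of \<open>W'\<close>.\<close>
  define W where "W t z = inverse (1 + b * t) ^ n * \<phi> (X t z)" for t z
  define W' where "W' t z = - (inverse (1 + b * t) ^ Suc n * dv (X t z))" for t z
  have W'm [measurable]: "(\<lambda>z. W' (fst z) (snd z)) \<in> Borel2"
   unfolding W'_def X_def by measurable
  have W'_bound: "\<bar>W' t z\<bar> \<le> inverse m ^ Suc n * Cd" if t: "0 \<le> t" "t \<le> 1" for t z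
  proof -
   have "\<bar>W' t z\<bar> = inverse (1 + b * t) ^ Suc n * \<bar>dv (X t z)\<bar>"
    using km[OF t] m by (simp add: W'_def abs_mult power_abs)
   also have "\<dots> \<le> inverse m ^ Suc n * Cd"
    using km[OF t] m Cd(2)[of "X t z"] by (intro mult_mono power_mono le_imp_inverse_le) auto
   finally show ?thesis .
  qed
  have ftc: "(\<integral>t. W' t z \<partial>I01) = W 1 z - W 0 z" for z
  proof -
   have "(\<lambda>t. W' t z) \<in> Borel" unfolding W'_def X_def by measurable
   then have "(\<integral>t. W' t z \<partial>I01) = (BB t. W' t z * indicator {0..1} t)"
    by (rule integral_I01)
   also have "\<dots> = W 1 z - W 0 z"
   proof (rule integral_FTC_Icc_real)
    fix t :: real assume t: "0 \<le> t" "t \<le> 1"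
    have pos: "0 < 1 + b * t" using km[OF t] m by linarith
    have fr: "frechet_derivative \<phi> (at x) (b *\<^sub>R x + h) = (\<Sum>i\<in>Basis. ((b *\<^sub>R x + h) \<bullet> i) * pd i x)" for x
     unfolding pd_def by (rule frechet_derivative_basis[OF sm[of "Suc 0"]])
    show "((\<lambda>t. W t z) has_real_derivative W' t z) (at t)"
     using test_function_divergence_derivative[OF sm pos, of z h]
     by (simp only: W_def W'_def X_def n_def dv_def vel_def fr)
    have "isCont (\<lambda>t. X t z) t" unfolding X_def using pos by (intro continuous_intros) auto
    moreover have "isCont dv (X t z)" using dv_cont by (simp add: continuous_on_eq_continuous_at)
    ultimately have "isCont (\<lambda>t. dv (X t z)) t" by (rule isCont_o2)
    then show "isCont (\<lambda>t. W' t z) t" unfolding W'_def using pos by (intro continuous_intros) auto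
   qed simp
   finally show ?thesis .
  qed
  define J where "J t = (BB x. (g (x + t *\<^sub>R vel x) \<bullet> vel x) * \<phi> x)" for t
  \<comment> \<open>\<open>W' t\<close> is minus the divergence of the field with components
    \<open>\<Psi> i\<close>. The weak gradient turns the integral of \<open>u\<close> against this
    divergence into one of \<open>g\<close> against the field, and the change of variables back to
    the starting point gives \<open>J t\<close>.\<close>
  have inner: "(BB z. u z * W' t z) = J t" if t: "0 \<le> t" "t \<le> 1" for t
  proof -
   define c where "c = inverse (1 + b * t)"
   have pos: "0 < 1 + b * t" "0 < c" using km[OF t] m by (auto simp: c_def)
   define ch where "ch i x = (vel x \<bullet> i) * \<phi> x" for i x
   have smch: "C_diff j (ch i)" for i j
    unfolding ch_def vel_def inner_add_left inner_scaleR_left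
    by (intro C_diff_mult C_diff_add C_diff_cmult C_diff_inner C_diff_const sm)
   \<comment> \<open>The field \<phi> times velocity, transported to time \<open>t\<close>. Its
     support lies in the image of the support of \<phi> under the map at time \<open>t\<close>,
     which is in \<open>U\<close> by the definition of \<open>V\<close>; hence each component is a
     test function of \<open>U\<close>.\<close>
   define \<Psi> where "\<Psi> i z = c ^ n * ch i (X t z)" for i z
   have X_aff: "X t z = (- ((c * t) *\<^sub>R h)) + c *\<^sub>R z" for z by (simp add: X_def c_def algebra_simps)
   have \<Psi>: "\<Psi> i \<in> test_functions U" for i
   proof (rule test_functions_I)
    show "C_diff j (\<Psi> i)" for j
     unfolding \<Psi>_def X_aff by (intro C_diff_cmult C_diff_affine_comp smch)
    show "compact ((\<lambda>x. x + t *\<^sub>R vel x) ` K)"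
     unfolding vel_def using K(1) by (intro compact_continuous_image continuous_intros)
    show "(\<lambda>x. x + t *\<^sub>R vel x) ` K \<subseteq> U" using K(2) t by (auto simp: V_def)
    fix z assume "\<Psi> i z \<noteq> 0"
    then have "X t z \<in> K" using K(3)[of "X t z"] by (auto simp: \<Psi>_def ch_def)
    moreover have "z = X t z + t *\<^sub>R vel (X t z)" using pos by (simp add: path) (simp add: X_def)
    ultimately show "z \<in> (\<lambda>x. x + t *\<^sub>R vel x) ` K" by blast
   qed
   have d\<Psi>: "frechet_derivative (\<Psi> i) (at z) i = c ^ Suc n * (b * \<phi> (X t z) + (vel (X t z) \<bullet> i) * pd i (X t z))"
    if i: "i \<in> Basis" for i z
   proof -
    let ?x = "X t z"
    have D: "(\<phi> has_derivative frechet_derivative \<phi> (at ?x)) (at ?x)" by (rule C_diff_SucD(1)[OF sm[of "Suc 0"]])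
    have "(ch i has_derivative (\<lambda>v. (vel ?x \<bullet> i) * frechet_derivative \<phi> (at ?x) v + (b *\<^sub>R v \<bullet> i) * \<phi> ?x)) (at ?x)"
     unfolding ch_def vel_def by (intro has_derivative_mult D) (auto intro!: derivative_eq_intros)
    moreover have "(X t has_derivative (\<lambda>v. c *\<^sub>R v)) (at z)"
     unfolding X_aff[abs_def] by (auto intro!: derivative_eq_intros)
    ultimately have "((\<lambda>z. ch i (X t z)) has_derivative
      (\<lambda>v. (vel ?x \<bullet> i) * frechet_derivative \<phi> (at ?x) (c *\<^sub>R v) + (b *\<^sub>R (c *\<^sub>R v) \<bullet> i) * \<phi> ?x)) (at z)"
     by (rule has_derivative_compose[rotated])
    then have "(\<Psi> i has_derivative
      (\<lambda>v. c ^ n * ((vel ?x \<bullet> i) * frechet_derivative \<phi> (at ?x) (c *\<^sub>R v) + (b *\<^sub>R (c *\<^sub>R v) \<bullet> i) * \<phi> ?x))) (at z)"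
     unfolding \<Psi>_def by (rule has_derivative_mult_right)
    then have "frechet_derivative (\<Psi> i) (at z) =
      (\<lambda>v. c ^ n * ((vel ?x \<bullet> i) * frechet_derivative \<phi> (at ?x) (c *\<^sub>R v) + (b *\<^sub>R (c *\<^sub>R v) \<bullet> i) * \<phi> ?x))"
     by (rule frechet_derivative_at[symmetric])
    moreover have "frechet_derivative \<phi> (at ?x) (c *\<^sub>R i) = c * pd i ?x"
     unfolding pd_def using linear_cmul[OF has_derivative_linear[OF D]] by simp
    ultimately show ?thesis using i by (simp add: distrib_left mult_ac)
   qed
   have sum_d\<Psi>: "(\<Sum>i\<in>Basis. frechet_derivative (\<Psi> i) (at z) i) = - W' t z" for z
    by (simp add: d\<Psi> W'_def dv_def sum_distrib_left[symmetric] sum.distrib n_def c_def del: power_Suc)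
   have int1: "integrable lborel (\<lambda>z. u z * frechet_derivative (\<Psi> i) (at z) i)" if i: "i \<in> Basis" for i
   proof -
    obtain B' where "\<And>x v. \<bar>frechet_derivative (\<Psi> i) (at x) v\<bar> \<le> B' * norm v"
     using test_function_bounded[OF \<Psi>[of i]] by metis
    from this[of _ i] have "\<And>x. \<bar>frechet_derivative (\<Psi> i) (at x) i\<bar> \<le> B'" using i by simp
    then show ?thesis
     by (intro integrable_mult_test[OF u] test_function_partial_measurable[OF \<Psi> i])
   qed
   have int2: "integrable lborel (\<lambda>z. (g z \<bullet> i) * \<Psi> i z)" if i: "i \<in> Basis" for i
   proof -
    obtain B' where "\<And>x. \<bar>\<Psi> i x\<bar> \<le> B'"
     using test_function_bounded[OF \<Psi>[of i]] by metis
    then show ?thesis using g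
     by (intro integrable_mult_test test_functions_measurable[OF \<Psi>]) auto
   qed
   have "(BB z. u z * W' t z) = - (BB z. (\<Sum>i\<in>Basis. u z * frechet_derivative (\<Psi> i) (at z) i))"
    by (simp add: sum_distrib_left[symmetric] sum_d\<Psi>)
   also have "\<dots> = - (\<Sum>i\<in>Basis. (BB z. u z * frechet_derivative (\<Psi> i) (at z) i))"
    using int1 by (subst Bochner_Integration.integral_sum) auto
   also have "\<dots> = (\<Sum>i\<in>Basis. (BB z. (g z \<bullet> i) * \<Psi> i z))"
    using w \<Psi> unfolding wgrad_def by (simp add: sum_negf)
   also have "\<dots> = (BB z. (\<Sum>i\<in>Basis. (g z \<bullet> i) * \<Psi> i z))"
    using int2 by (subst Bochner_Integration.integral_sum) auto
   also have "\<dots> = (BB z. c ^ n * ((g z \<bullet> vel (X t z)) * \<phi> (X t z)))"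
   proof -
    have "(\<Sum>i\<in>Basis. (g z \<bullet> i) * \<Psi> i z) = c ^ n * ((g z \<bullet> vel (X t z)) * \<phi> (X t z))" for z
     by (subst euclidean_inner) (simp add: \<Psi>_def ch_def sum_distrib_left sum_distrib_right mult_ac)
    then show ?thesis by simp
   qed
   also have "\<dots> = \<bar>1 + b * t\<bar> ^ n * (BB x. c ^ n * ((g (t *\<^sub>R h + (1 + b * t) *\<^sub>R x) \<bullet> vel x) * \<phi> x))"
   proof -
    have [measurable]: "X t \<in> Borel" unfolding X_aff[abs_def] by measurable
    show ?thesis
     unfolding n_def using pos
     by (subst integral_lborel_affine[where c="1 + b * t" and t="t *\<^sub>R h"]) (simp_all add: X_path)
   qed
   also have "\<dots> = J t"
    using pos by (simp add: J_def path c_def abs_of_pos power_inverse)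
   finally show ?thesis .
  qed
  have F1: "(BB z. (\<integral>t. u z * W' t z \<partial>I01)) = (\<integral>t. (BB z. u z * W' t z) \<partial>I01)"
  proof -
   let ?f = "\<lambda>p. u (snd p) * W' (fst p) (snd p)"
   have "(BB z. (\<integral>t. ?f (t, z) \<partial>I01)) = (\<integral>t. (BB z. ?f (t, z)) \<partial>I01)"
   proof (rule Fubini_I01(2))
   show "?f \<in> Borel" unfolding borel_prod[symmetric] by measurable
   fix t :: real assume t: "0 \<le> t" "t \<le> 1"
   have "\<bar>u x * W' t x\<bar> \<le> \<bar>u x * (inverse m ^ Suc n * Cd)\<bar>" for x
    unfolding abs_mult[of "u x"] using W'_bound[OF t, of x] by (intro mult_left_mono) auto
   then show "(NN x. ennreal \<bar>?f (t, x)\<bar>) \<le> (NN x. ennreal \<bar>u x * (inverse m ^ Suc n * Cd)\<bar>)"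
    by (intro nn_integral_mono ennreal_leI) simp
   next
   have "integrable lborel (\<lambda>x. u x * (inverse m ^ Suc n * Cd))" using u by (intro integrable_mult_left)
   then show "(NN x. ennreal \<bar>u x * (inverse m ^ Suc n * Cd)\<bar>) < \<top>"
    by (simp only: integrable_iff_bounded real_norm_def infinity_ennreal_def)
   qed
   then show ?thesis by simp
  qed
  obtain Cf where Cf: "0 < Cf" "\<And>x. \<bar>norm (vel x) * \<phi> x\<bar> \<le> Cf"
  proof (rule continuous_compact_support_bounded[OF _ K(1), of "\<lambda>x. norm (vel x) * \<phi> x"])
   show "continuous_on UNIV (\<lambda>x. norm (vel x) * \<phi> x)"
    unfolding vel_def by (intro continuous_intros C_diff_imp_continuous[OF sm])
  qed (use K(3) that in auto)
  have F2: "(BB x. (\<integral>t. (g (x + t *\<^sub>R vel x) \<bullet> vel x) * \<phi> x \<partial>I01)) = (\<integral>t. J t \<partial>I01)"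
  proof -
   let ?f = "\<lambda>p. (g (snd p + fst p *\<^sub>R vel (snd p)) \<bullet> vel (snd p)) * \<phi> (snd p)"
   have "(BB x. (\<integral>t. ?f (t, x) \<partial>I01)) = (\<integral>t. (BB x. ?f (t, x)) \<partial>I01)"
   proof (rule Fubini_I01(2))
   show "?f \<in> Borel"
    by (simp add: borel_prod[symmetric])
   fix t :: real assume t: "0 \<le> t" "t \<le> 1"
   have "(NN x. ennreal \<bar>(g (x + t *\<^sub>R vel x) \<bullet> vel x) * \<phi> x\<bar>)
    \<le> (NN x. ennreal Cf * ennreal (norm (g (x + t *\<^sub>R vel x))))"
   proof (intro nn_integral_mono)
    fix x
    have "\<bar>(g (x + t *\<^sub>R vel x) \<bullet> vel x) * \<phi> x\<bar> \<le> (norm (g (x + t *\<^sub>R vel x)) * norm (vel x)) * \<bar>\<phi> x\<bar>"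
     unfolding abs_mult by (intro mult_right_mono Cauchy_Schwarz_ineq2) auto
    also have "\<dots> = norm (g (x + t *\<^sub>R vel x)) * \<bar>norm (vel x) * \<phi> x\<bar>" by (simp add: abs_mult)
    also have "\<dots> \<le> norm (g (x + t *\<^sub>R vel x)) * Cf" by (intro mult_left_mono Cf(2)) auto
    finally show "ennreal \<bar>(g (x + t *\<^sub>R vel x) \<bullet> vel x) * \<phi> x\<bar> \<le> ennreal Cf * ennreal (norm (g (x + t *\<^sub>R vel x)))"
     using Cf(1) by (simp add: ennreal_mult[symmetric] ennreal_leI mult.commute)
   qed
   also have "\<dots> \<le> ennreal Cf * (ennreal (inverse m ^ n) * Ig)"
    using g_path[OF t] by (subst nn_integral_cmult) (auto intro: mult_left_mono)
   finally show "(NN x. ennreal \<bar>?f (t, x)\<bar>) \<le> ennreal Cf * (ennreal (inverse m ^ n) * Ig)" by simp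
   next
   show "ennreal Cf * (ennreal (inverse m ^ n) * Ig) < \<top>" using Ig by (simp add: ennreal_mult_less_top)
   qed
   then show ?thesis by (simp add: J_def[abs_def])
  qed
  have "(\<integral>t. (BB z. u z * W' t z) \<partial>I01) = (\<integral>t. J t \<partial>I01)"
  proof (rule integral_cong_AE)
   show "AE t in I01. (BB z. u z * W' t z) = J t" by (rule AE_I01I) (rule inner)
   have "(\<lambda>(t, z). u z * W' t z) \<in> Borel2"
    unfolding case_prod_beta by measurable
   then show "(\<lambda>t. (BB z. u z * W' t z)) \<in> borel_measurable I01"
    by (intro lborel.borel_measurable_lebesgue_integral) simp
   show "J \<in> borel_measurable I01"
    unfolding J_def[abs_def] by (intro lborel.borel_measurable_lebesgue_integral) simp
  qed
  then have "(BB x. (\<integral>t. (g (x + t *\<^sub>R vel x) \<bullet> vel x) * \<phi> x \<partial>I01)) = (BB z. u z * (W 1 z - W 0 z))"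
   using F1 F2 by (simp add: ftc)
  also have "\<dots> = (BB z. u z * W 1 z) - (BB z. u z * W 0 z)"
  proof -
   have [measurable]: "X 1 \<in> Borel" unfolding X_def by measurable
   have "integrable lborel (\<lambda>z. u z * W 1 z)"
   proof (rule integrable_mult_test[OF u])
    show "\<bar>W 1 x\<bar> \<le> inverse (1 + b) ^ n * B" for x
     unfolding W_def abs_mult using b B(2) by (intro mult_mono) auto
   qed (simp add: W_def)
   moreover have "integrable lborel (\<lambda>z. u z * W 0 z)"
    by (rule integrable_mult_test[OF u, of _ B]) (use B(2) in \<open>auto simp: W_def X_def\<close>)
   ultimately show ?thesis by (simp add: right_diff_distrib)
  qed
  also have "(BB z. u z * W 1 z) = (BB x. u (x + vel x) * \<phi> x)"
  proof -
   have [measurable]: "X 1 \<in> Borel" unfolding X_def by measurable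
   have WX: "W 1 (h + (1 + b) *\<^sub>R x) = inverse (1 + b) ^ n * \<phi> x" for x
    using X_path[of 1 x] b by (simp add: W_def)
   have "(BB z. u z * W 1 z) = \<bar>1 + b\<bar> ^ n * (BB x. u (h + (1 + b) *\<^sub>R x) * W 1 (h + (1 + b) *\<^sub>R x))"
    unfolding n_def using b by (intro integral_lborel_affine) (auto simp: W_def)
   also have "\<dots> = (\<bar>1 + b\<bar> ^ n * inverse (1 + b) ^ n) * (BB x. u (h + (1 + b) *\<^sub>R x) * \<phi> x)"
   proof -
    have "(\<lambda>x. u (h + (1 + b) *\<^sub>R x) * (inverse (1 + b) ^ n * \<phi> x)) = (\<lambda>x. inverse (1 + b) ^ n * (u (h + (1 + b) *\<^sub>R x) * \<phi> x))"
     by (rule ext) (simp only: mult_ac)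
    then show ?thesis unfolding WX by (simp only: integral_mult_right_zero mult.assoc)
   qed
   also have "\<bar>1 + b\<bar> ^ n * inverse (1 + b) ^ n = 1" using b by (simp add: power_inverse)
   finally show ?thesis using path[of _ 1] by simp
  qed
  also have "(BB z. u z * W 0 z) = (BB x. u x * \<phi> x)" by (simp add: W_def X_def)
  finally have eq: "(BB x. (\<integral>t. (g (x + t *\<^sub>R vel x) \<bullet> vel x) * \<phi> x \<partial>I01))
   = (BB x. u (x + vel x) * \<phi> x) - (BB x. u x * \<phi> x)" .
  have ki: "integrable lborel (\<lambda>x. u (x + vel x) * \<phi> x)" "integrable lborel (\<lambda>x. u x * \<phi> x)"
   using i1 u B(2) by (auto intro!: integrable_mult_test[of _ \<phi> B])
  have "integrable lborel (\<lambda>x. (\<integral>t. indicator V x * (g (x + t *\<^sub>R vel x) \<bullet> vel x) \<partial>I01) * \<phi> x)"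
   using f3 B(2) by (rule integrable_mult_test[OF _ \<phi>m])
  moreover have "(\<integral>t. indicator V x * (g (x + t *\<^sub>R vel x) \<bullet> vel x) \<partial>I01) * \<phi> x = (\<integral>t. (g (x + t *\<^sub>R vel x) \<bullet> vel x) * \<phi> x \<partial>I01)" for x
   using test_functions_D(4)[OF \<phi>, of x] by (cases "\<phi> x = 0") auto
  ultimately have ki3: "integrable lborel (\<lambda>x. \<integral>t. (g (x + t *\<^sub>R vel x) \<bullet> vel x) * \<phi> x \<partial>I01)" by (simp only:)
  have "k x * \<phi> x = u (x + vel x) * \<phi> x - u x * \<phi> x - (\<integral>t. (g (x + t *\<^sub>R vel x) \<bullet> vel x) * \<phi> x \<partial>I01)" for x
   using test_functions_D(4)[OF \<phi>, of x] by (cases "\<phi> x = 0") (auto simp: k_def algebra_simps)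
  then have "(BB x. k x * \<phi> x) = (BB x. u (x + vel x) * \<phi> x) - (BB x. u x * \<phi> x)
    - (BB x. (\<integral>t. (g (x + t *\<^sub>R vel x) \<bullet> vel x) * \<phi> x \<partial>I01))"
   by (simp only: Bochner_Integration.integral_diff Bochner_Integration.integrable_diff ki ki3)
  then show "(BB x. k x * \<phi> x) = 0" using eq by simp
 qed
 then show ?thesis
  by eventually_elim (auto simp: k_def V_def vel_def)
qed

section \<open>Hajlasz gradients\<close>

text \<open>Riesz representation by minimising \<open>\<integral>\<phi>\<^sup>2 - 2 L \<phi>\<close>: a minimising sequence is Cauchy by the parallelogram law.\<close>

lemma (in finite_measure) functional_representation:
 fixes L :: "('a => real) => real"
 assumes T: "\<And>\<phi>. \<phi> \<in> T ==> \<phi> \<in> borel_measurable M" "\<And>\<phi>. \<phi> \<in> T ==> \<exists>B. \<forall>x. \<bar>\<phi> x\<bar> \<le> B"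
  and T0: "T \<noteq> {}"
  and Tlin: "\<And>\<phi> \<psi> c. \<phi> \<in> T ==> \<psi> \<in> T ==> (\<lambda>x. \<phi> x + c * \<psi> x) \<in> T"
  and Llin: "\<And>\<phi> \<psi> c. \<phi> \<in> T ==> \<psi> \<in> T ==> L (\<lambda>x. \<phi> x + c * \<psi> x) = L \<phi> + c * L \<psi>"
  and Lbound: "\<And>\<phi>. \<phi> \<in> T ==> \<bar>L \<phi>\<bar> \<le> C * (\<integral>x. \<bar>\<phi> x\<bar> \<partial>M)"
 obtains f where "integrable M f" "\<And>\<phi>. \<phi> \<in> T ==> (\<integral>x. f x * \<phi> x \<partial>M) = L \<phi>"
proof -
 have intg: "integrable M (\<lambda>x. f x * \<phi> x)" if fi: "integrable M f" and \<phi>T: "\<phi> \<in> T" for f \<phi>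
 proof -
  obtain B where B: "\<forall>x. \<bar>\<phi> x\<bar> \<le> B" using T(2)[OF \<phi>T] by blast
  have [measurable]: "\<phi> \<in> borel_measurable M" "f \<in> borel_measurable M" using T(1)[OF \<phi>T] fi by auto
  show ?thesis
  proof (rule Bochner_Integration.integrable_bound[where f="\<lambda>x. B * f x"])
   show "AE x in M. norm (f x * \<phi> x) \<le> norm (B * f x)"
   proof (rule AE_I2)
    fix x
    have "\<bar>\<phi> x\<bar> \<le> \<bar>B\<bar>" using B by (meson abs_ge_self order_trans)
    then show "norm (f x * \<phi> x) \<le> norm (B * f x)" by (simp add: abs_mult mult.commute mult_right_mono)
   qed
  qed (use fi in auto)
 qed
 have int1: "integrable M \<phi>" if \<phi>: "\<phi> \<in> T" for \<phi>
  using intg[OF integrable_const[of 1] \<phi>] by simp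
 have int2: "integrable M (\<lambda>x. \<phi> x * \<psi> x)" if "\<phi> \<in> T" "\<psi> \<in> T" for \<phi> \<psi>
  using intg[OF int1] that by simp
 define q where "q \<phi> \<psi> = (\<integral>x. \<phi> x * \<psi> x \<partial>M)" for \<phi> \<psi> :: "'a => real"
 define J where "J \<phi> = q \<phi> \<phi> - 2 * L \<phi>" for \<phi>
 define mM where "mM = measure M (space M)"
 have J_line: "J (\<lambda>x. \<phi> x + c * \<psi> x) = J \<phi> + 2 * c * (q \<phi> \<psi> - L \<psi>) + c\<^sup>2 * q \<psi> \<psi>"
  if "\<phi> \<in> T" "\<psi> \<in> T" for \<phi> \<psi> c
 proof -
  have "q (\<lambda>x. \<phi> x + c * \<psi> x) (\<lambda>x. \<phi> x + c * \<psi> x) = (\<integral>x. \<phi> x * \<phi> x + (2 * c) * (\<phi> x * \<psi> x) + c\<^sup>2 * (\<psi> x * \<psi> x) \<partial>M)"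
   unfolding q_def by (intro Bochner_Integration.integral_cong refl) (simp add: algebra_simps power2_eq_square)
  also have "\<dots> = q \<phi> \<phi> + 2 * c * q \<phi> \<psi> + c\<^sup>2 * q \<psi> \<psi>"
   unfolding q_def using int2 that
   by (simp only: Bochner_Integration.integral_add Bochner_Integration.integrable_add integrable_mult_right integral_mult_right_zero)
  finally show ?thesis unfolding J_def Llin[OF that] by (simp add: algebra_simps)
 qed
 have J_lower: "- (C\<^sup>2 * mM) \<le> J \<phi>" if \<phi>: "\<phi> \<in> T" for \<phi>
 proof -
  have "2 * (C * (\<integral>x. \<bar>\<phi> x\<bar> \<partial>M)) = (\<integral>x. 2 * C * \<bar>\<phi> x\<bar> \<partial>M)" by simp
  also have "\<dots> \<le> (\<integral>x. \<phi> x * \<phi> x + C\<^sup>2 \<partial>M)"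
  proof (rule integral_mono)
   fix x
   have "0 \<le> (\<bar>\<phi> x\<bar> - C)\<^sup>2" by simp
   then show "2 * C * \<bar>\<phi> x\<bar> \<le> \<phi> x * \<phi> x + C\<^sup>2" by (simp add: power2_diff power2_eq_square[of "\<phi> x"] mult_ac)
  qed (use int1[OF \<phi>] int2[OF \<phi> \<phi>] in auto)
  also have "\<dots> = q \<phi> \<phi> + C\<^sup>2 * mM" using int2[OF \<phi> \<phi>] by (simp add: q_def mM_def)
  finally show ?thesis using Lbound[OF \<phi>] by (simp add: J_def)
 qed
 define m where "m = Inf (J ` T)"
 have bdd: "bdd_below (J ` T)" using J_lower by (intro bdd_belowI) auto
 have m_le: "m \<le> J \<phi>" if "\<phi> \<in> T" for \<phi> unfolding m_def using bdd that by (auto intro: cInf_lower)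
 \<comment> \<open>The rate 1/4 is chosen so that squared distances of consecutive members are of
   order 4^(-k) and their first-power distances of order 2^(-k), hence summable.\<close>
 have "\<exists>\<phi>\<in>T. J \<phi> < m + (1/4)^k" for k
  using cInf_lessD[of "J ` T" "m + (1/4)^k"] T0 by (auto simp: m_def)
 then have "\<forall>k. \<exists>\<phi>. \<phi> \<in> T \<and> J \<phi> < m + (1/4)^k" by blast
 from choice[OF this] obtain \<Phi> where \<Phi>: "\<And>k. \<Phi> k \<in> T" "\<And>k. J (\<Phi> k) < m + (1/4)^k" by blast
 define d where "d k x = \<Phi> (Suc k) x - \<Phi> k x" for k x
 have dT: "d k \<in> T" for k using Tlin[OF \<Phi>(1)[of "Suc k"] \<Phi>(1)[of k], of "-1"] by (simp add: d_def[abs_def])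
 have d2: "q (d k) (d k) \<le> 4 * (1/4)^k" for k
 proof -
  have "m \<le> J (\<lambda>x. \<Phi> k x + (1/2) * d k x)" by (intro m_le Tlin \<Phi> dT)
  also have "\<dots> = J (\<Phi> k) + (q (\<Phi> k) (d k) - L (d k)) + q (d k) (d k) / 4"
   by (subst J_line[OF \<Phi>(1) dT]) (simp add: power2_eq_square)
  finally have 1: "m \<le> J (\<Phi> k) + (q (\<Phi> k) (d k) - L (d k)) + q (d k) (d k) / 4" .
  have "J (\<Phi> (Suc k)) = J (\<lambda>x. \<Phi> k x + 1 * d k x)" by (simp add: d_def[abs_def])
  also have "\<dots> = J (\<Phi> k) + 2 * (q (\<Phi> k) (d k) - L (d k)) + q (d k) (d k)"
   by (subst J_line[OF \<Phi>(1) dT]) simp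
  finally have 2: "J (\<Phi> (Suc k)) = J (\<Phi> k) + 2 * (q (\<Phi> k) (d k) - L (d k)) + q (d k) (d k)" .
  have "(1/4::real)^Suc k \<le> (1/4)^k" by simp
  have aux: "y \<le> 4 * e" if "m \<le> a + x + y / 4" "b = a + 2 * x + y" "a < m + e" "b < m + e'" "e' \<le> e"
   for a b x y e e' :: real using that by linarith
  show ?thesis by (rule aux[OF 1 2 \<Phi>(2) \<Phi>(2)]) simp
 qed
 \<comment> \<open>Instead of the Cauchy-Schwarz inequality: |d| is at most 2^k d^2 + 2^(-k),
   according to whether |d| exceeds 2^(-k) or not. The measure is finite, so the constant
   integrates.\<close>
 have d1: "(\<integral>x. \<bar>d k x\<bar> \<partial>M) \<le> (4 + mM) * (1/2)^k" for k
 proof -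
  have "(\<integral>x. \<bar>d k x\<bar> \<partial>M) \<le> (\<integral>x. 2^k * (d k x * d k x) + (1/2)^k \<partial>M)"
  proof (rule integral_mono)
   fix x
   have "\<bar>d k x\<bar> * 1 \<le> 2^k * (d k x * d k x) + (1/2)^k"
   proof (cases "\<bar>d k x\<bar> \<le> (1/2)^k")
    case False
    then have "(1/2)^k * \<bar>d k x\<bar> \<le> \<bar>d k x\<bar> * \<bar>d k x\<bar>" by (intro mult_right_mono) auto
    then have "2^k * ((1/2)^k * \<bar>d k x\<bar>) \<le> 2^k * (d k x * d k x)" by (intro mult_left_mono) (auto simp: abs_mult_self_eq)
    moreover have "(2::real)^k * (1/2)^k = 1" by (simp add: power_mult_distrib[symmetric])
    ultimately have "\<bar>d k x\<bar> \<le> 2^k * (d k x * d k x)" by (simp only: mult.assoc[symmetric] mult_1)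
    then show ?thesis by (simp add: add_increasing2)
   next
    case True
    have "0 \<le> 2^k * (d k x * d k x)" by simp
    with True show ?thesis by linarith
   qed
   then show "\<bar>d k x\<bar> \<le> 2^k * (d k x * d k x) + (1/2)^k" by simp
  qed (use int1[OF dT] int2[OF dT dT] in auto)
  also have "\<dots> = 2^k * q (d k) (d k) + (1/2)^k * mM" using int2[OF dT[of k] dT[of k]] by (simp add: q_def mM_def)
  also have "\<dots> \<le> 2^k * (4 * (1/4)^k) + (1/2)^k * mM" by (intro add_right_mono mult_left_mono d2) auto
  also have "2^k * (4 * (1/4)^k) = 4 * ((2::real) * (1/4))^k" unfolding power_mult_distrib by simp
  finally show ?thesis by (simp add: algebra_simps)
 qed
 have sum_d1: "summable (\<lambda>k. \<integral>x. \<bar>d k x\<bar> \<partial>M)"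
 proof (rule summable_comparison_test[where g="\<lambda>k. (4 + mM) * (1/2)^k"])
  show "\<exists>N. \<forall>n\<ge>N. norm (\<integral>x. \<bar>d n x\<bar> \<partial>M) \<le> (4 + mM) * (1 / 2) ^ n"
   using d1 by simp
 qed (intro summable_mult summable_geometric, simp)
 have dm [measurable]: "d k \<in> borel_measurable M" for k using T(1)[OF dT] .
 have ae: "AE x in M. summable (\<lambda>k. \<bar>d k x\<bar>)"
 proof -
  have "(\<integral>\<^sup>+x. (\<Sum>k. ennreal \<bar>d k x\<bar>) \<partial>M) = (\<Sum>k. \<integral>\<^sup>+x. ennreal \<bar>d k x\<bar> \<partial>M)"
   by (intro nn_integral_suminf) measurable
  also have "\<dots> = (\<Sum>k. ennreal (\<integral>x. \<bar>d k x\<bar> \<partial>M))"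
   using int1[OF dT] by (intro suminf_cong nn_integral_eq_integral) auto
  also have "\<dots> \<noteq> \<infinity>" using sum_d1 by (simp add: ennreal_suminf_neq_top)
  finally have "AE x in M. (\<Sum>k. ennreal \<bar>d k x\<bar>) \<noteq> \<infinity>" by (intro nn_integral_noteq_infinite) auto
  then show ?thesis by eventually_elim (auto intro: summable_suminf_not_top)
 qed
 define f where "f x = \<Phi> 0 x + (\<Sum>k. d k x)" for x
 have fs: "integrable M (\<lambda>x. \<Sum>k. d k x)"
  using int1[OF dT] ae sum_d1 by (intro integrable_suminf) auto
 have fint: "integrable M f" unfolding f_def[abs_def] using fs int1[OF \<Phi>(1)] by simp
 show thesis
 proof (rule that[OF fint])
  fix \<psi> assume \<psi>: "\<psi> \<in> T"
  obtain B where B: "\<And>x. \<bar>\<psi> x\<bar> \<le> B" using T(2)[OF \<psi>] by blast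
  have [measurable]: "\<psi> \<in> borel_measurable M" using T(1)[OF \<psi>] .
  have dpsi: "(\<integral>x. \<bar>d k x * \<psi> x\<bar> \<partial>M) \<le> B * (\<integral>x. \<bar>d k x\<bar> \<partial>M)" for k
  proof -
   have "(\<integral>x. \<bar>d k x * \<psi> x\<bar> \<partial>M) \<le> (\<integral>x. B * \<bar>d k x\<bar> \<partial>M)"
   proof (rule integral_mono)
    show "integrable M (\<lambda>x. \<bar>d k x * \<psi> x\<bar>)" by (rule integrable_abs[OF int2[OF dT \<psi>]])
    show "integrable M (\<lambda>x. B * \<bar>d k x\<bar>)" using int1[OF dT, of k] by simp
    show "\<bar>d k x * \<psi> x\<bar> \<le> B * \<bar>d k x\<bar>" for x
     using mult_right_mono[OF B[of x], of "\<bar>d k x\<bar>"] by (simp only: abs_mult mult.commute[of "\<bar>d k x\<bar>"])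
   qed
   then show ?thesis by simp
  qed
  have "(\<lambda>k. \<integral>x. d k x * \<psi> x \<partial>M) sums (\<integral>x. (\<Sum>k. d k x * \<psi> x) \<partial>M)"
  proof (rule sums_integral)
   show "AE x in M. summable (\<lambda>k. norm (d k x * \<psi> x))"
    using ae by eventually_elim (simp add: abs_mult summable_mult2)
   show "summable (\<lambda>k. \<integral>x. norm (d k x * \<psi> x) \<partial>M)"
    by (rule summable_comparison_test[OF _ summable_mult[OF sum_d1, of B]]) (use dpsi in simp)
  qed (use int2[OF dT \<psi>] in auto)
  moreover have "(\<integral>x. (\<Sum>k. d k x * \<psi> x) \<partial>M) = (\<integral>x. (\<Sum>k. d k x) * \<psi> x \<partial>M)"
  proof (rule integral_cong_AE)
   show "AE x in M. (\<Sum>k. d k x * \<psi> x) = (\<Sum>k. d k x) * \<psi> x"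
    using ae by eventually_elim (simp only: suminf_mult2[OF summable_rabs_cancel])
  qed measurable
  ultimately have s: "(\<lambda>k. q (d k) \<psi>) sums (\<integral>x. (\<Sum>k. d k x) * \<psi> x \<partial>M)" by (simp add: q_def)
  have part: "q (\<Phi> n) \<psi> = q (\<Phi> 0) \<psi> + (\<Sum>k<n. q (d k) \<psi>)" for n
  proof (induction n)
   case (Suc n)
   have "q (d n) \<psi> = (\<integral>x. \<Phi> (Suc n) x * \<psi> x - \<Phi> n x * \<psi> x \<partial>M)" by (simp add: q_def d_def left_diff_distrib)
   also have "\<dots> = q (\<Phi> (Suc n)) \<psi> - q (\<Phi> n) \<psi>"
    unfolding q_def using int2[OF \<Phi>(1) \<psi>] by simp
   finally show ?case using Suc by simp
  qed simp
  have "(\<lambda>n. q (\<Phi> 0) \<psi> + (\<Sum>k<n. q (d k) \<psi>)) \<longlonglongrightarrow> q (\<Phi> 0) \<psi> + (\<integral>x. (\<Sum>k. d k x) * \<psi> x \<partial>M)"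
   using s by (intro tendsto_intros) (simp add: sums_def)
  then have "(\<lambda>n. q (\<Phi> n) \<psi>) \<longlonglongrightarrow> q (\<Phi> 0) \<psi> + (\<integral>x. (\<Sum>k. d k x) * \<psi> x \<partial>M)"
   unfolding part[symmetric] .
  also have "q (\<Phi> 0) \<psi> + (\<integral>x. (\<Sum>k. d k x) * \<psi> x \<partial>M) = (\<integral>x. f x * \<psi> x \<partial>M)"
   unfolding q_def f_def distrib_right
   by (rule Bochner_Integration.integral_add[symmetric, OF int2[OF \<Phi>(1) \<psi>] intg[OF fs \<psi>]])
  finally have lim: "(\<lambda>n. q (\<Phi> n) \<psi> - L \<psi>) \<longlonglongrightarrow> (\<integral>x. f x * \<psi> x \<partial>M) - L \<psi>" by (intro tendsto_intros)
  have "(\<lambda>n. q (\<Phi> n) \<psi> - L \<psi>) \<longlonglongrightarrow> 0"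
  proof (rule Lim_null_comparison)
   show "\<forall>\<^sub>F n in sequentially. norm (q (\<Phi> n) \<psi> - L \<psi>) \<le> (1/2)^n * (1 + q \<psi> \<psi>)"
   proof (rule always_eventually, rule allI)
    fix n
    define s :: real where "s = (1/2)^n"
    have s: "0 < s" "s\<^sup>2 = (1/4)^n" by (auto simp: s_def power2_eq_square power_mult_distrib[symmetric])
    \<comment> \<open>Adding \<open>c\<close> times \<psi> cannot push \<open>J\<close> below its
      infimum, and \<open>\<Phi> n\<close> is within 4^(-n) of it. The choices \<open>c = s\<close>
      and \<open>c = - s\<close> bound the linear term, which is the defect of the
      representation.\<close>
    have ev: "0 \<le> 2 * c * (q (\<Phi> n) \<psi> - L \<psi>) + c\<^sup>2 * q \<psi> \<psi> + s\<^sup>2" for c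
     using m_le[OF Tlin[OF \<Phi>(1) \<psi>, of n c]] \<Phi>(2)[of n] unfolding J_line[OF \<Phi>(1) \<psi>] s(2) by linarith
    have "2 * s * \<bar>q (\<Phi> n) \<psi> - L \<psi>\<bar> \<le> s\<^sup>2 * q \<psi> \<psi> + s\<^sup>2"
    proof (cases "0 \<le> q (\<Phi> n) \<psi> - L \<psi>")
     case True
     then show ?thesis using ev[of "- s"] by simp
    next
     case False
     then have "\<bar>q (\<Phi> n) \<psi> - L \<psi>\<bar> = - (q (\<Phi> n) \<psi> - L \<psi>)" by simp
     then show ?thesis using ev[of s] by (simp only:)
    qed
    also have "\<dots> \<le> 2 * s * (s * (1 + q \<psi> \<psi>))"
    proof -
     have "0 \<le> q \<psi> \<psi>" unfolding q_def by (intro integral_nonneg_AE) auto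
     then have "0 \<le> s * (s * (1 + q \<psi> \<psi>))" using s(1) by simp
     then show ?thesis by (simp add: power2_eq_square algebra_simps)
    qed
    finally show "norm (q (\<Phi> n) \<psi> - L \<psi>) \<le> (1/2)^n * (1 + q \<psi> \<psi>)"
     using s(1) by (simp add: s_def[symmetric])
   qed
   show "(\<lambda>n. (1/2)^n * (1 + q \<psi> \<psi>)) \<longlonglongrightarrow> 0"
    by (intro tendsto_mult_left_zero LIMSEQ_power_zero) simp
  qed
  from LIMSEQ_unique[OF lim this] show "(\<integral>x. f x * \<psi> x \<partial>M) = L \<psi>" by simp
 qed
qed

definition hajlasz :: "'a::euclidean_space set => ('a => real) => ('a => real) => bool" where
 "hajlasz U u g \<longleftrightarrow> (\<exists>E\<in>null_sets lborel. \<forall>x\<in>U - E. \<forall>y\<in>U - E. \<bar>u x - u y\<bar> \<le> norm (x - y) * (g x + g y))"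

text \<open>On the support of \<phi> the difference quotient of \<open>u\<close> is at most g(x + h)
  + g(x). As the step tends to 0, each of the two terms contributes one integral of \<open>g\<close>
  against |\<phi>|; hence the factor 2.\<close>

lemma hajlasz_functional_bound:
 fixes u g :: "'a::euclidean_space => real"
 assumes U: "open U" and u: "integrable lborel u" and g: "integrable lborel g" "\<And>x. 0 \<le> g x"
  and H: "hajlasz U u g" and \<phi>: "\<phi> \<in> test_functions U" and i: "i \<in> Basis"
 shows "\<bar>(BB x. u x * pard \<phi> i x)\<bar> \<le> 2 * (BB x. g x * \<bar>\<phi> x\<bar>)"
proof -
 have [measurable]: "u \<in> Borel" using borel_measurable_integrable[OF u] by simp
 have [measurable]: "g \<in> Borel" using borel_measurable_integrable[OF g(1)] by simp
 have [measurable]: "\<phi> \<in> Borel" using \<phi> by (rule test_functions_measurable)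
 obtain B where B: "0 < B" "\<And>x. \<bar>\<phi> x\<bar> \<le> B" "\<And>x y. \<bar>\<phi> x - \<phi> y\<bar> \<le> B * norm (x - y)"
  using test_function_bounded[OF \<phi>] by metis
 obtain d where d: "0 < d" "\<And>x y. \<phi> x \<noteq> 0 ==> norm (y - x) < d ==> y \<in> U"
  using test_function_support_nbhd[OF \<phi> U] by blast
 obtain E where E: "E \<in> null_sets lborel" "\<And>x y. x \<in> U - E ==> y \<in> U - E ==> \<bar>u x - u y\<bar> \<le> norm (x - y) * (g x + g y)"
  using H by (auto simp: hajlasz_def)
 define h where "h k = 1 / real (Suc k)" for k
 have h: "h \<longlonglongrightarrow> 0" "\<And>k. h k \<noteq> 0" "\<And>k. 0 < h k" unfolding h_def[abs_def] using LIMSEQ_Suc[OF lim_1_over_n] by auto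
 define Q where "Q k = (BB x. (u (x + h k *\<^sub>R i) - u x) / h k * \<phi> x)" for k
 have Q: "Q \<longlonglongrightarrow> - (BB x. u x * pard \<phi> i x)"
  unfolding Q_def by (rule difference_quotient_tendsto[OF u \<phi> i h(1,2)])
 define G where "G = (BB x. g x)"
 define P where "P = (BB x. g x * \<bar>\<phi> x\<bar>)"
 have iP: "integrable lborel (\<lambda>x. g x * \<bar>\<phi> x\<bar>)" by (rule integrable_mult_test[OF g(1)]) (use B(2) in auto)
 have est: "\<bar>Q k\<bar> \<le> 2 * P + B * h k * G" if hk: "h k < d" for k
 proof -
  have i1: "integrable lborel (\<lambda>x. g x * \<bar>\<phi> (x - h k *\<^sub>R i)\<bar>)" by (rule integrable_mult_test[OF g(1)]) (use B(2) in auto)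
  have i2: "integrable lborel (\<lambda>x. g (x + h k *\<^sub>R i) * \<bar>\<phi> x\<bar>)"
   using integrable_lborel_affine[OF i1, of 1 "h k *\<^sub>R i"] by (simp add: add.commute)
  have e2: "(BB x. g (x + h k *\<^sub>R i) * \<bar>\<phi> x\<bar>) = (BB x. g x * \<bar>\<phi> (x - h k *\<^sub>R i)\<bar>)"
   using integral_lborel_affine[of "\<lambda>x. g x * \<bar>\<phi> (x - h k *\<^sub>R i)\<bar>" 1 "h k *\<^sub>R i"] by (simp add: add.commute)
  have "AE x in lborel. x \<notin> E" using E(1) by (rule AE_not_in)
  moreover have "AE x in lborel. x + h k *\<^sub>R i \<notin> E"
   using AE_lborel_affine[OF _ AE_not_in[OF E(1)], of 1 "h k *\<^sub>R i"] by (simp add: add.commute)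
  ultimately have "AE x in lborel. norm ((u (x + h k *\<^sub>R i) - u x) / h k * \<phi> x) \<le> g (x + h k *\<^sub>R i) * \<bar>\<phi> x\<bar> + g x * \<bar>\<phi> x\<bar>"
  proof eventually_elim
   case (elim x)
   show ?case
   proof (cases "\<phi> x = 0")
    case False
    have "x \<in> U" "x + h k *\<^sub>R i \<in> U" using d(2)[OF False, of x] d(2)[OF False, of "x + h k *\<^sub>R i"] hk h(3)[of k] d(1) i by auto
    with elim have "\<bar>u (x + h k *\<^sub>R i) - u x\<bar> \<le> h k * (g (x + h k *\<^sub>R i) + g x)"
     using E(2)[of "x + h k *\<^sub>R i" x] i h(3)[of k] by simp
    then have "\<bar>u (x + h k *\<^sub>R i) - u x\<bar> / h k \<le> g (x + h k *\<^sub>R i) + g x"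
     using h(3)[of k] by (simp add: divide_le_eq mult.commute)
    then have "\<bar>u (x + h k *\<^sub>R i) - u x\<bar> / h k * \<bar>\<phi> x\<bar> \<le> (g (x + h k *\<^sub>R i) + g x) * \<bar>\<phi> x\<bar>"
     by (rule mult_right_mono) simp
    then show ?thesis using h(3)[of k] by (simp add: abs_mult distrib_right)
   qed simp
  qed
  then have ae: "AE x in lborel. \<bar>(u (x + h k *\<^sub>R i) - u x) / h k * \<phi> x\<bar> \<le> g (x + h k *\<^sub>R i) * \<bar>\<phi> x\<bar> + g x * \<bar>\<phi> x\<bar>"
   by (simp only: real_norm_def)
  have Gi: "integrable lborel (\<lambda>x. g (x + h k *\<^sub>R i) * \<bar>\<phi> x\<bar> + g x * \<bar>\<phi> x\<bar>)" using i2 iP by simp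
  have Di: "integrable lborel (\<lambda>x. \<bar>(u (x + h k *\<^sub>R i) - u x) / h k * \<phi> x\<bar>)"
  proof (rule Bochner_Integration.integrable_bound[OF Gi])
   show "AE x in lborel. norm \<bar>(u (x + h k *\<^sub>R i) - u x) / h k * \<phi> x\<bar> \<le> norm (g (x + h k *\<^sub>R i) * \<bar>\<phi> x\<bar> + g x * \<bar>\<phi> x\<bar>)"
   proof -
    have aux: "norm \<bar>a\<bar> \<le> norm b" if "\<bar>a\<bar> \<le> b" for a b :: real using that by simp
    show ?thesis using ae by eventually_elim (rule aux)
   qed
  qed measurable
  have "\<bar>Q k\<bar> \<le> (BB x. g (x + h k *\<^sub>R i) * \<bar>\<phi> x\<bar> + g x * \<bar>\<phi> x\<bar>)"
   unfolding Q_def by (rule order_trans[OF integral_abs_bound integral_mono_AE[OF Di Gi ae]])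
  also have "\<dots> = (BB x. g x * \<bar>\<phi> (x - h k *\<^sub>R i)\<bar>) + P"
   using i2 iP by (simp add: e2 P_def)
  also have "(BB x. g x * \<bar>\<phi> (x - h k *\<^sub>R i)\<bar>) \<le> (BB x. g x * \<bar>\<phi> x\<bar> + B * h k * g x)"
  proof (rule integral_mono)
   fix x
   have "\<bar>\<phi> (x - h k *\<^sub>R i)\<bar> \<le> \<bar>\<phi> x\<bar> + B * h k"
    using B(3)[of "x - h k *\<^sub>R i" x] i h(3)[of k] by simp
   then have "g x * \<bar>\<phi> (x - h k *\<^sub>R i)\<bar> \<le> g x * (\<bar>\<phi> x\<bar> + B * h k)" using g(2)[of x] by (rule mult_left_mono)
   then show "g x * \<bar>\<phi> (x - h k *\<^sub>R i)\<bar> \<le> g x * \<bar>\<phi> x\<bar> + B * h k * g x" by (simp add: algebra_simps)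
  qed (use i1 iP g(1) in auto)
  also have "\<dots> = P + B * h k * G" using iP g(1) by (simp add: P_def G_def)
  finally show ?thesis by simp
 qed
 have "(\<lambda>k. 2 * P + B * h k * G) \<longlonglongrightarrow> 2 * P + B * 0 * G" by (intro tendsto_intros h(1))
 moreover have "(\<lambda>k. \<bar>Q k\<bar>) \<longlonglongrightarrow> \<bar>- (BB x. u x * pard \<phi> i x)\<bar>" by (intro tendsto_intros Q)
 moreover have "\<forall>\<^sub>F k in sequentially. \<bar>Q k\<bar> \<le> 2 * P + B * h k * G"
  using order_tendstoD(2)[OF h(1) d(1)] by eventually_elim (use est in auto)
 ultimately have "\<bar>- (BB x. u x * pard \<phi> i x)\<bar> \<le> 2 * P + B * 0 * G"
  by (intro tendsto_le[OF sequentially_bot])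
 then show ?thesis by (simp add: P_def)
qed

lemma test_functions_add_cmult:
 assumes "\<phi> \<in> test_functions U" "\<psi> \<in> test_functions U"
 shows "(\<lambda>x. \<phi> x + c * \<psi> x) \<in> test_functions U"
proof (rule test_functions_I)
 show "C_diff k (\<lambda>x. \<phi> x + c * \<psi> x)" for k
  by (intro C_diff_add C_diff_cmult test_functions_D(1)[OF assms(1)] test_functions_D(1)[OF assms(2)])
 show "compact (closure {x. \<phi> x \<noteq> 0} \<union> closure {x. \<psi> x \<noteq> 0})"
  using assms by (auto simp: test_functions_def)
 show "closure {x. \<phi> x \<noteq> 0} \<union> closure {x. \<psi> x \<noteq> 0} \<subseteq> U"
  using assms by (auto simp: test_functions_def)
 show "x \<in> closure {x. \<phi> x \<noteq> 0} \<union> closure {x. \<psi> x \<noteq> 0}" if "\<phi> x + c * \<psi> x \<noteq> 0" for x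
  using that closure_subset[of "{x. \<phi> x \<noteq> 0}"] closure_subset[of "{x. \<psi> x \<noteq> 0}"] by (cases "\<phi> x = 0") auto
qed

text \<open>The distributional derivative is bounded by the L^1 norm with weight \<open>g\<close>,
  so it has a density \<open>f\<close> with respect to \<open>g\<close> times Lebesgue measure, and
  \<open>w = g * f\<close>. Testing 2 g - w and 2 g + w with nonnegative functions gives a pointwise
  bound, which transfers every L^p norm of \<open>g\<close> at once, p = \<infinity>
  included.\<close>

lemma hajlasz_partial:
 fixes u g :: "'a::euclidean_space => real"
 assumes U: "open U" and u: "integrable lborel u" and g: "integrable lborel g" "\<And>x. 0 \<le> g x"
  and H: "hajlasz U u g" and i: "i \<in> Basis"
 shows "\<exists>w. integrable lborel w \<and> (AE x in lborel. x \<in> U --> \<bar>w x\<bar> \<le> 2 * g x) \<and>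
  (\<forall>\<phi>\<in>test_functions U. (BB x. u x * pard \<phi> i x) = - (BB x. w x * \<phi> x))"
proof -
 have [measurable]: "g \<in> Borel" using borel_measurable_integrable[OF g(1)] by simp
 \<comment> \<open>With the weight built into the measure, the bound of the functional is exactly
   the L^1 bound that \<open>functional_representation\<close> asks for.\<close>
 let ?M = "density lborel (\<lambda>x. ennreal (g x))"
 interpret M: finite_measure ?M
  using g by (intro finite_measureI) (simp add: emeasure_density nn_integral_eq_integral)
 define L where "L \<phi> = - (BB x. u x * pard \<phi> i x)" for \<phi>
 have intM: "(\<integral>x. f x \<partial>?M) = (BB x. g x * f x)" if "f \<in> Borel" for f :: "'a => real"
  using that g(2) by (subst integral_density) auto
 obtain f where f: "integrable ?M f" "\<And>\<phi>. \<phi> \<in> test_functions U ==> (\<integral>x. f x * \<phi> x \<partial>?M) = L \<phi>"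
 proof (rule M.functional_representation[of "test_functions U" L 2])
  show "\<phi> \<in> borel_measurable ?M" if "\<phi> \<in> test_functions U" for \<phi>
   using test_functions_measurable[OF that] by simp
  show "\<exists>B. \<forall>x. \<bar>\<phi> x\<bar> \<le> B" if "\<phi> \<in> test_functions U" for \<phi> :: "'a => real"
   using test_function_bounded[OF that] by metis
  have "(\<lambda>_. 0) \<in> test_functions U" by (rule test_functions_I[where K="{}"]) auto
  then show "test_functions U \<noteq> {}" by blast
  show "\<bar>L \<phi>\<bar> \<le> 2 * (\<integral>x. \<bar>\<phi> x\<bar> \<partial>?M)" if "\<phi> \<in> test_functions U" for \<phi>
   using hajlasz_functional_bound[OF U u g H that i] test_functions_measurable[OF that] by (simp add: L_def intM)
  fix \<phi> \<psi> c assume *: "\<phi> \<in> test_functions U" "\<psi> \<in> test_functions U"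
  then show "(\<lambda>x. \<phi> x + c * \<psi> x) \<in> test_functions U" by (rule test_functions_add_cmult)
  have D: "(\<phi> has_derivative frechet_derivative \<phi> (at x)) (at x)" "(\<psi> has_derivative frechet_derivative \<psi> (at x)) (at x)" for x
   using * by (auto intro!: C_diff_SucD(1)[OF test_functions_D(1)[of _ U "Suc 0"]])
  have "frechet_derivative (\<lambda>x. \<phi> x + c * \<psi> x) (at x) = (\<lambda>v. frechet_derivative \<phi> (at x) v + c * frechet_derivative \<psi> (at x) v)" for x
   by (rule frechet_derivative_at[symmetric]) (intro has_derivative_add has_derivative_mult_right D)
  then have e: "u x * frechet_derivative (\<lambda>x. \<phi> x + c * \<psi> x) (at x) i = u x * pard \<phi> i x + c * (u x * pard \<psi> i x)" for x
   by (simp add: algebra_simps)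
  have ii: "integrable lborel (\<lambda>x. u x * pard \<phi> i x)" if ph: "\<phi> \<in> test_functions U" for \<phi>
  proof -
   obtain B where "\<And>x v. \<bar>frechet_derivative \<phi> (at x) v\<bar> \<le> B * norm v"
    using test_function_bounded[OF ph] by metis
   from this[of _ i] have "\<And>x. \<bar>pard \<phi> i x\<bar> \<le> B" using i by simp
   then show ?thesis by (intro integrable_mult_test[OF u] test_function_partial_measurable[OF ph i])
  qed
  show "L (\<lambda>x. \<phi> x + c * \<psi> x) = L \<phi> + c * L \<psi>"
   unfolding L_def e using ii[OF *(1)] ii[OF *(2)] by simp
 qed (rule that)
 have fm [measurable]: "f \<in> Borel" using f(1) by (auto simp: integrable_iff_bounded)
 define w where "w x = g x * f x" for x
 have w: "integrable lborel w"
  using f(1) g(2) unfolding w_def by (subst (asm) integrable_density) auto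
 have wL: "(BB x. w x * \<phi> x) = L \<phi>" if "\<phi> \<in> test_functions U" for \<phi>
  using f(2)[OF that] test_functions_measurable[OF that] by (simp add: intM w_def mult.assoc)
 have wb: "AE x in lborel. x \<in> U --> 0 \<le> 2 * g x - s * w x" if s: "\<bar>s\<bar> = 1" for s
 proof (rule AE_nonneg_of_test_functions[OF U])
  show "integrable lborel (\<lambda>x. 2 * g x - s * w x)" using g w by simp
  fix \<phi> :: "'a => real" assume \<phi>: "\<phi> \<in> test_functions U" "\<And>x. 0 \<le> \<phi> x"
  obtain B where B: "\<And>x. \<bar>\<phi> x\<bar> \<le> B" using test_function_bounded[OF \<phi>(1)] by metis
  have ii: "integrable lborel (\<lambda>x. g x * \<phi> x)" "integrable lborel (\<lambda>x. w x * \<phi> x)"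
   using integrable_mult_test[OF g(1) test_functions_measurable[OF \<phi>(1)] B] integrable_mult_test[OF w test_functions_measurable[OF \<phi>(1)] B] by auto
  have "(BB x. (2 * g x - s * w x) * \<phi> x) = (BB x. 2 * (g x * \<phi> x) - s * (w x * \<phi> x))"
   by (simp add: algebra_simps)
  also have "\<dots> = 2 * (BB x. g x * \<bar>\<phi> x\<bar>) - s * L \<phi>" using ii \<phi>(2) by (simp add: wL[OF \<phi>(1)])
  also have "\<dots> \<ge> 0"
  proof -
   have "s * L \<phi> \<le> \<bar>s * L \<phi>\<bar>" by simp
   also have "\<dots> = \<bar>L \<phi>\<bar>" using s by (simp add: abs_mult)
   also have "\<dots> \<le> 2 * (BB x. g x * \<bar>\<phi> x\<bar>)"
    using hajlasz_functional_bound[OF U u g H \<phi>(1) i] by (simp add: L_def)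
   finally show ?thesis by simp
  qed
  finally show "0 \<le> (BB x. (2 * g x - s * w x) * \<phi> x)" .
 qed
 have "AE x in lborel. x \<in> U --> \<bar>w x\<bar> \<le> 2 * g x"
  using wb[of 1, simplified] wb[of "-1", simplified] by eventually_elim auto
 then show ?thesis using w wL by (intro exI[of _ w]) (auto simp: L_def)
qed

lemma hajlasz_imp_wgrad:
 fixes u g :: "'a::euclidean_space => real"
 assumes U: "open U" and u: "integrable lborel u" and g: "integrable lborel g" "\<And>x. 0 \<le> g x"
  and H: "hajlasz U u g"
 obtains w :: "'a => 'a" where "integrable lborel w" "wgrad U u w"
  "AE x in lborel. x \<in> U --> norm (w x) \<le> 2 * real DIM('a) * g x"
proof -
 have "\<forall>i\<in>Basis. \<exists>w. integrable lborel w \<and> (AE x in lborel. x \<in> U --> \<bar>w x\<bar> \<le> 2 * g x) \<and>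
  (\<forall>\<phi>\<in>test_functions U. (BB x. u x * pard \<phi> i x) = - (BB x. w x * \<phi> x))"
  using hajlasz_partial[OF U u g H] by blast
 from bchoice[OF this] obtain w where w: "\<And>i. i \<in> Basis ==> integrable lborel (w i)"
  "\<And>i. i \<in> Basis ==> AE x in lborel. x \<in> U --> \<bar>w i x\<bar> \<le> 2 * g x"
  "\<And>i \<phi>. i \<in> Basis ==> \<phi> \<in> test_functions U ==> (BB x. u x * pard \<phi> i x) = - (BB x. w i x * \<phi> x)"
  by blast
 define W where "W x = (\<Sum>i\<in>Basis. w i x *\<^sub>R i)" for x
 have Wi: "W x \<bullet> i = w i x" if "i \<in> Basis" for x i using that by (simp add: W_def)
 show thesis
 proof (rule that[of W])
  show "integrable lborel W" unfolding W_def by (intro Bochner_Integration.integrable_sum integrable_scaleR_left w)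
  show "wgrad U u W" using w(3) by (auto simp: wgrad_def Wi)
  have "AE x in lborel. \<forall>i\<in>Basis. x \<in> U --> \<bar>w i x\<bar> \<le> 2 * g x"
   using w(2) by (intro AE_finite_allI) auto
  then show "AE x in lborel. x \<in> U --> norm (W x) \<le> 2 * real DIM('a) * g x"
  proof eventually_elim
   case (elim x)
   show ?case
   proof
    assume "x \<in> U"
    have "norm (W x) \<le> (\<Sum>i\<in>Basis. \<bar>W x \<bullet> i\<bar>)" by (rule norm_le_l1)
    also have "\<dots> \<le> (\<Sum>i\<in>(Basis::'a set). 2 * g x)" using elim \<open>x \<in> U\<close> by (intro sum_mono) (auto simp: Wi)
    finally show "norm (W x) \<le> 2 * real DIM('a) * g x" by simp
   qed
  qed
 qed
qed

section \<open>Poincare inequality\<close>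

abbreviation nrm :: "ennreal => ('a::euclidean_space => 'b::real_normed_vector) => ennreal" where
 "nrm p f \<equiv> Lnorm p (\<lambda>x. ennreal (norm (f x)))"

text \<open>A Sobolev function together with one chosen weak gradient, both as Borel functions
  extended by zero. Such pairs can be combined linearly and passed to norm limits without new
  choices of representatives.\<close>

definition sob :: "ennreal => 'a::euclidean_space set => ('a => real) => ('a => 'a) => bool" where
 "sob p U u g \<longleftrightarrow> u \<in> Borel \<and> g \<in> Borel \<and>
   (\<forall>x. x \<notin> U --> u x = 0 \<and> g x = 0) \<and> nrm p u < top \<and> nrm p g < top \<and> wgrad U u g"

lemma finite_nrm_integrable:
 fixes f :: "'a::euclidean_space => 'b::euclidean_space"
 assumes p: "1 \<le> p" and U: "U \<in> sets borel" "bounded U" and f [measurable]: "f \<in> Borel"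
  and 0: "\<And>x. x \<notin> U ==> f x = 0" and fin: "nrm p f < top"
 shows "integrable lborel f"
proof (rule integrableI_bounded)
 have "(NN x. ennreal (norm (f x))) = (NN x. ennreal (norm (f x)) * indicator U x)"
  using 0 by (intro nn_integral_cong) (auto split: split_indicator)
 also have "\<dots> \<le> (emeasure lborel U + 1) * nrm p f"
  by (intro nn_integral_le_Lnorm p U) measurable
 also have "\<dots> < \<infinity>"
  using emeasure_bounded_finite[OF U(2)] fin by (auto simp: ennreal_mult_less_top)
 finally show "(NN x. ennreal (norm (f x))) < \<infinity>" .
qed measurable

lemma sob_integrable:
 assumes "1 \<le> p" "open U" "bounded U" "sob p U u g"
 shows "integrable lborel u" "integrable lborel g"
 using assms by (auto simp: sob_def intro!: finite_nrm_integrable[of p U])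

lemma ennreal_abs_integral_le:
 fixes f :: "'a => real"
 shows "ennreal \<bar>\<integral>x. f x \<partial>M\<bar> \<le> (\<integral>\<^sup>+x. ennreal \<bar>f x\<bar> \<partial>M)"
 using integral_norm_bound_ennreal[of M f] by (cases "integrable M f") (auto simp: not_integrable_integral_eq)

lemma wgrad_path_bound:
 fixes u :: "'a::euclidean_space => real"
 assumes U: "open U" "bounded U" and u: "integrable lborel u" and g: "integrable lborel g"
  and w: "wgrad U u g" and b: "- 1 < b"
 shows "AE x in lborel. (\<forall>t\<in>{0..1}. x + t *\<^sub>R (b *\<^sub>R x + h) \<in> U) -->
  ennreal \<bar>u (x + (b *\<^sub>R x + h)) - u x\<bar>
   \<le> ennreal (norm (b *\<^sub>R x + h)) * (\<integral>\<^sup>+t. ennreal (norm (g (x + t *\<^sub>R (b *\<^sub>R x + h)))) \<partial>I01)"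
 using wgrad_path[OF U u g w b, of h]
proof eventually_elim
 case (elim x)
 have gm [measurable]: "g \<in> Borel" using borel_measurable_integrable[OF g] by simp
 let ?v = "b *\<^sub>R x + h"
 show ?case
 proof
  assume "\<forall>t\<in>{0..1}. x + t *\<^sub>R ?v \<in> U"
  with elim have "ennreal \<bar>u (x + ?v) - u x\<bar> = ennreal \<bar>\<integral>t. g (x + t *\<^sub>R ?v) \<bullet> ?v \<partial>I01\<bar>" by simp
  also have "\<dots> \<le> (\<integral>\<^sup>+t. ennreal \<bar>g (x + t *\<^sub>R ?v) \<bullet> ?v\<bar> \<partial>I01)" by (rule ennreal_abs_integral_le)
  also have "\<dots> \<le> (\<integral>\<^sup>+t. ennreal (norm ?v) * ennreal (norm (g (x + t *\<^sub>R ?v))) \<partial>I01)"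
  proof (intro nn_integral_mono)
   fix t
   have "\<bar>g (x + t *\<^sub>R ?v) \<bullet> ?v\<bar> \<le> norm ?v * norm (g (x + t *\<^sub>R ?v))"
    using Cauchy_Schwarz_ineq2[of "g (x + t *\<^sub>R ?v)" ?v] by (simp only: mult.commute)
   then show "ennreal \<bar>g (x + t *\<^sub>R ?v) \<bullet> ?v\<bar> \<le> ennreal (norm ?v) * ennreal (norm (g (x + t *\<^sub>R ?v)))"
    by (simp add: ennreal_mult[symmetric] ennreal_leI)
  qed
  also have "\<dots> = ennreal (norm ?v) * (\<integral>\<^sup>+t. ennreal (norm (g (x + t *\<^sub>R ?v))) \<partial>I01)"
   by (rule nn_integral_cmult) measurable
  finally show "ennreal \<bar>u (x + ?v) - u x\<bar> \<le> ennreal (norm ?v) * (\<integral>\<^sup>+t. ennreal (norm (g (x + t *\<^sub>R ?v))) \<partial>I01)" .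
 qed
qed

text \<open>Minkowski over \<open>t\<close>: each map x + t (b x + h) has dilation factor at least
  \<open>l\<close>, so one constant from \<open>Lnorm_affine_le\<close> serves all
  \<open>t\<close>.\<close>

lemma Lnorm_path_average_le:
 fixes g :: "'a::euclidean_space => 'b::euclidean_space"
 assumes p: "1 \<le> p" and [measurable]: "g \<in> Borel" and fin: "nrm p g < top"
  and b: "0 < l" "l \<le> 1" "l \<le> 1 + b" and K: "1 \<le> K * l ^ DIM('a)"
 shows "Lnorm p (\<lambda>x. \<integral>\<^sup>+t. ennreal (norm (g (x + t *\<^sub>R (b *\<^sub>R x + h)))) \<partial>I01) \<le> ennreal K * nrm p g"
proof -
 have K1: "1 \<le> K"
 proof -
  have "0 < K" using K b(1) by (metis less_le_trans zero_less_one zero_less_mult_pos2 zero_less_power)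
  then have "K * l ^ DIM('a) \<le> K * 1" using b by (intro mult_left_mono power_le_one) auto
  then show ?thesis using K by simp
 qed
 have "Lnorm p (\<lambda>x. \<integral>\<^sup>+t. ennreal (norm (g (x + t *\<^sub>R (b *\<^sub>R x + h)))) \<partial>I01) \<le> emeasure I01 (space I01) * (ennreal K * nrm p g)"
 proof (rule I01.Lnorm_nn_integral_le[OF p])
  show "(\<lambda>(t, x). ennreal (norm (g (x + t *\<^sub>R (b *\<^sub>R x + h))))) \<in> borel_measurable (I01 \<Otimes>\<^sub>M borel)"
   by measurable
  show "ennreal K * nrm p g < top" using fin by (simp add: ennreal_mult_less_top)
  show "AE t in I01. Lnorm p (\<lambda>x. ennreal (norm (g (x + t *\<^sub>R (b *\<^sub>R x + h))))) \<le> ennreal K * nrm p g"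
  proof (rule AE_I01I)
   fix t :: real assume t: "0 \<le> t" "t \<le> 1"
   have lt: "l \<le> 1 + t * b"
   proof (cases "0 \<le> b")
    case True then show ?thesis using b(2) t by (simp add: add_increasing2)
   next
    case False
    then have "1 * b \<le> t * b" using t by (intro mult_right_mono_neg) auto
    then show ?thesis using b(3) by simp
   qed
   have "1 \<le> K * (1 + t * b) ^ DIM('a)"
    using K lt b(1) K1 by (meson mult_left_mono order_trans power_mono less_imp_le zero_less_one)
   then have "Lnorm p (\<lambda>x. ennreal (norm (g (t *\<^sub>R h + (1 + t * b) *\<^sub>R x)))) \<le> ennreal K * nrm p g"
    using lt b(1) K1 by (intro Lnorm_affine_le[OF p, where f="\<lambda>x. ennreal (norm (g x))"]) auto
   then show "Lnorm p (\<lambda>x. ennreal (norm (g (x + t *\<^sub>R (b *\<^sub>R x + h))))) \<le> ennreal K * nrm p g"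
    by (simp add: algebra_simps)
  qed
 qed
 then show ?thesis using I01.emeasure_space_1 by simp
qed

lemma average_deviation_le:
 fixes u :: "'a::euclidean_space => real"
 assumes u: "integrable lborel u" and B: "B \<in> sets borel" "emeasure lborel B < top" "0 < measure lborel B"
 defines "c \<equiv> (BB y. u y * indicator B y) / measure lborel B"
 shows "ennreal \<bar>a - c\<bar> \<le> ennreal (1 / measure lborel B) * (NN y. ennreal \<bar>a - u y\<bar> * indicator B y)"
proof -
 let ?m = "measure lborel B"
 have i1: "integrable lborel (\<lambda>y. u y * indicator B y)" using integrable_mult_indicator[OF _ u, of B] B by (simp add: mult.commute)
 have i2: "integrable lborel (\<lambda>y. a * indicator B y :: real)" using B by (intro integrable_mult_right integrable_real_indicator) auto
 have "(BB y. (a - u y) * indicator B y) = (BB y. a * indicator B y - u y * indicator B y)"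
  by (simp add: left_diff_distrib)
 also have "\<dots> = a * ?m - (BB y. u y * indicator B y)"
  using i1 i2 B(1) by (subst Bochner_Integration.integral_diff) (auto simp: measure_def)
 also have "\<dots> = (a - c) * ?m" using B(3) by (simp add: c_def field_simps)
 finally have "a - c = (1 / ?m) * (BB y. (a - u y) * indicator B y)" using B(3) by simp
 then have "ennreal \<bar>a - c\<bar> = ennreal (1 / ?m) * ennreal \<bar>(BB y. (a - u y) * indicator B y)\<bar>"
  using B(3) by (simp add: abs_mult ennreal_mult[symmetric])
 also have "\<dots> \<le> ennreal (1 / ?m) * (NN y. ennreal \<bar>(a - u y) * indicator B y\<bar>)"
  by (intro mult_left_mono ennreal_abs_integral_le) simp
 also have "(NN y. ennreal \<bar>(a - u y) * indicator B y\<bar>) = (NN y. ennreal \<bar>a - u y\<bar> * indicator B y)"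
  by (intro nn_integral_cong) (auto split: split_indicator)
 finally show ?thesis .
qed

lemma emeasure_density_indicator_UNIV:
 fixes A :: "'a::euclidean_space set"
 assumes "A \<in> sets borel"
 shows "emeasure (density lborel (indicator A)) UNIV = emeasure lborel A"
proof -
 have "emeasure (density lborel (indicator A)) UNIV = (NN x. indicator A x * indicator UNIV x)"
  using assms by (intro emeasure_density) auto
 then show ?thesis using assms by simp
qed

definition ball_mean :: "'a::euclidean_space => real => ('a => real) => real" where
 "ball_mean c r u = (BB y. u y * indicator (ball c r) y) / measure lborel (ball c r)"

lemma measure_ball_pos: "0 < r ==> 0 < measure lborel (ball c r :: 'a::euclidean_space set)"
 by (metis bounded_ball content_ball_pos)

text \<open>The deviation of u(x) from the mean is an average of u(x) - u(x + h) over the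
  \<open>h\<close> with x + h in the ball. For fixed \<open>h\<close> the segment stays in the
  convex ball and the path bound gives norm at most 2 r times that of the gradient; Minkowski over
  the ball of radius 2 r finishes.\<close>

lemma poincare_ball:
 fixes u :: "'a::euclidean_space => real"
 assumes p: "1 \<le> p" and U: "open U" "bounded U" and S: "sob p U u g" and r: "0 < r" "ball c r \<subseteq> U"
 shows "Lnorm p (\<lambda>x. ennreal \<bar>u x - ball_mean c r u\<bar> * indicator (ball c r) x)
  \<le> ennreal (1 / measure lborel (ball c r)) * (emeasure lborel (ball (0::'a) (2 * r)) * (ennreal (2 * r) * nrm p g))"
proof -
 note int = sob_integrable[OF p U S]
 have [measurable]: "u \<in> Borel" and gm [measurable]: "g \<in> Borel"
  and gfin: "nrm p g < top" and w: "wgrad U u g" using S by (auto simp: sob_def)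
 let ?B = "ball c r"
 let ?H = "density lborel (indicator (ball (0::'a) (2 * r)))"
 define F where "F h x = ennreal \<bar>u (x + h) - u x\<bar> * indicator ?B x * indicator ?B (x + h)" for h x
 have Bm [measurable]: "?B \<in> sets borel" by simp
 have Fm [measurable]: "case_prod F \<in> Borel2" unfolding F_def by measurable
 have bfin: "emeasure lborel (ball (0::'a) s) < top" for s
  using emeasure_bounded_finite[of "ball (0::'a) s"] by (simp add: bounded_ball)
 interpret H: finite_measure ?H
  by (intro finite_measureI) (use bfin[of "2 * r"] in \<open>simp add: emeasure_density_indicator_UNIV\<close>)
 have sH: "sets ?H = sets borel" by simp
 have LF: "Lnorm p (F h) \<le> ennreal (2 * r) * nrm p g" if h: "h \<in> ball 0 (2 * r)" for h
 proof -
  have "Lnorm p (F h) \<le> Lnorm p (\<lambda>x. ennreal (2 * r) * (\<integral>\<^sup>+t. ennreal (norm (g (x + t *\<^sub>R (0 *\<^sub>R x + h)))) \<partial>I01))"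
  proof (rule Lnorm_mono_AE[OF p])
   show "AE x in lborel. F h x \<le> ennreal (2 * r) * (\<integral>\<^sup>+t. ennreal (norm (g (x + t *\<^sub>R (0 *\<^sub>R x + h)))) \<partial>I01)"
    using wgrad_path_bound[OF U int w, of 0 h, simplified]
   proof eventually_elim
    case (elim x)
    show ?case
    proof (cases "x \<in> ?B \<and> x + h \<in> ?B")
     case True
     have "x + t *\<^sub>R h \<in> U" if "t \<in> {0..1}" for t
     proof -
      have "(1 - t) *\<^sub>R x + t *\<^sub>R (x + h) \<in> ?B"
       using True that convex_ball[of c r] by (intro convexD_alt) auto
      then have "x + t *\<^sub>R h \<in> ?B" by (simp add: algebra_simps)
      with r(2) show ?thesis by blast
     qed
     with elim have "F h x \<le> ennreal (norm h) * (\<integral>\<^sup>+t. ennreal (norm (g (x + t *\<^sub>R h))) \<partial>I01)"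
      using True by (simp add: F_def)
     also have "\<dots> \<le> ennreal (2 * r) * (\<integral>\<^sup>+t. ennreal (norm (g (x + t *\<^sub>R h))) \<partial>I01)"
      using h by (intro mult_right_mono ennreal_leI) (auto simp: dist_norm)
     finally show ?thesis by simp
    qed (auto simp: F_def)
   qed
  qed
  also have "\<dots> \<le> ennreal (2 * r) * Lnorm p (\<lambda>x. \<integral>\<^sup>+t. ennreal (norm (g (x + t *\<^sub>R (0 *\<^sub>R x + h)))) \<partial>I01)"
   by (intro Lnorm_cmult_le p I01.borel_measurable_nn_integral) measurable
  also have "\<dots> \<le> ennreal (2 * r) * (ennreal 1 * nrm p g)"
   by (intro mult_left_mono Lnorm_path_average_le[where l=1] p gm gfin) auto
  finally show ?thesis by simp
 qed
 have "Lnorm p (\<lambda>x. \<integral>\<^sup>+h. F h x \<partial>?H) \<le> emeasure ?H (space ?H) * (ennreal (2 * r) * nrm p g)"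
 proof (rule H.Lnorm_nn_integral_le[OF p])
  show "case_prod F \<in> borel_measurable (?H \<Otimes>\<^sub>M borel)"
   using Fm by (subst measurable_cong_sets[OF sets_pair_measure_cong[OF sH refl] refl])
  show "AE s in ?H. Lnorm p (F s) \<le> ennreal (2 * r) * nrm p g"
  proof -
   have "indicator (ball (0::'a) (2 * r)) \<in> borel_measurable lborel" by (rule borel_measurable_indicator) simp
   then show ?thesis using LF by (subst AE_density) (auto split: split_indicator)
  qed
  show "ennreal (2 * r) * nrm p g < top" using gfin by (simp add: ennreal_mult_less_top)
 qed
 also have "emeasure ?H (space ?H) = emeasure lborel (ball (0::'a) (2 * r))" by (simp add: emeasure_density_indicator_UNIV)
 finally have LH: "Lnorm p (\<lambda>x. \<integral>\<^sup>+h. F h x \<partial>?H) \<le> emeasure lborel (ball (0::'a) (2 * r)) * (ennreal (2 * r) * nrm p g)" .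
 have Hm: "(\<lambda>x. \<integral>\<^sup>+h. F h x \<partial>?H) \<in> Borel"
  using Fm by (intro H.borel_measurable_nn_integral) (simp add: measurable_cong_sets[OF sets_pair_measure_cong[OF refl sH] refl] split_def)
 have pt: "ennreal \<bar>u x - ball_mean c r u\<bar> * indicator ?B x \<le> ennreal (1 / measure lborel ?B) * (\<integral>\<^sup>+h. F h x \<partial>?H)" for x
 proof (cases "x \<in> ?B")
  case True
  have Bb: "emeasure lborel ?B < top" using emeasure_bounded_finite[OF bounded_ball, of c r] by simp
  have "ennreal \<bar>u x - ball_mean c r u\<bar> \<le> ennreal (1 / measure lborel ?B) * (NN y. ennreal \<bar>u x - u y\<bar> * indicator ?B y)"
   unfolding ball_mean_def by (rule average_deviation_le[OF int(1) _ Bb measure_ball_pos[OF r(1)]]) simp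
  also have "(NN y. ennreal \<bar>u x - u y\<bar> * indicator ?B y) = (NN h. ennreal \<bar>u x - u (x + h)\<bar> * indicator ?B (x + h))"
   using nn_integral_lborel_affine[of "\<lambda>y. ennreal \<bar>u x - u y\<bar> * indicator ?B y" 1 x] by simp
  also have "\<dots> = (NN h. indicator (ball 0 (2 * r)) h * F h x)"
  proof (intro nn_integral_cong)
   fix h
   have "h \<in> ball 0 (2 * r)" if "x + h \<in> ?B"
    using norm_triangle_ineq[of "c - x" "x + h - c"] that True
    using norm_triangle_ineq4[of "x + h - c" "x - c"] by (auto simp: dist_norm norm_minus_commute)
   then show "ennreal \<bar>u x - u (x + h)\<bar> * indicator ?B (x + h) = indicator (ball 0 (2 * r)) h * F h x"
    using True by (auto simp: F_def abs_minus_commute split: split_indicator)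
  qed
  also have "\<dots> = (\<integral>\<^sup>+h. F h x \<partial>?H)"
  proof (rule nn_integral_density[symmetric])
   show "indicator (ball (0::'a) (2 * r)) \<in> borel_measurable lborel" by (rule borel_measurable_indicator) simp
   show "(\<lambda>h. F h x) \<in> borel_measurable lborel" unfolding F_def by measurable
  qed
  finally show ?thesis using True by simp
 qed simp
 have "Lnorm p (\<lambda>x. ennreal \<bar>u x - ball_mean c r u\<bar> * indicator ?B x)
   \<le> Lnorm p (\<lambda>x. ennreal (1 / measure lborel ?B) * (\<integral>\<^sup>+h. F h x \<partial>?H))"
  by (intro Lnorm_mono p pt)
 also have "\<dots> \<le> ennreal (1 / measure lborel ?B) * Lnorm p (\<lambda>x. \<integral>\<^sup>+h. F h x \<partial>?H)"
  by (intro Lnorm_cmult_le p Hm)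
 also have "\<dots> \<le> ennreal (1 / measure lborel ?B) * (emeasure lborel (ball (0::'a) (2 * r)) * (ennreal (2 * r) * nrm p g))"
  by (intro mult_left_mono LH) simp
 finally show ?thesis .
qed

text \<open>Contract \<open>\<Omega>\<close> towards the star center into a ball and use the inequality on that ball.\<close>

lemma poincare_star:
 fixes \<Omega> :: "'a::euclidean_space set"
 assumes p: "1 \<le> p" and O: "open \<Omega>" "bounded \<Omega>" and star: "star_center \<Omega> x0" and r: "0 < r" "ball x0 r \<subseteq> \<Omega>"
 shows "\<exists>C\<ge>0. \<forall>u g. sob p \<Omega> u g -->
  Lnorm p (\<lambda>x. ennreal \<bar>u x - ball_mean x0 r u\<bar> * indicator \<Omega> x) \<le> ennreal C * nrm p g"
proof -
 obtain D where D: "0 < D" "\<And>x. x \<in> \<Omega> ==> norm (x - x0) \<le> D"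
 proof -
  obtain a where "0 < a" "\<And>x. x \<in> \<Omega> ==> norm x \<le> a" using O(2) bounded_pos by blast
  then have "norm (x - x0) \<le> a + norm x0" if "x \<in> \<Omega>" for x
   using norm_triangle_ineq4[of x x0] that by (meson add_right_mono order_trans)
  with \<open>0 < a\<close> show thesis by (intro that[of "a + norm x0"]) (auto intro: add_pos_nonneg)
 qed
 \<comment> \<open>The bound by \<open>r / (2 * D)\<close> makes the contraction with factor
   \<open>l\<close> about \<open>x0\<close> send \<Omega> into the ball; 1/2 keeps \<open>l\<close>
   below 1.\<close>
 define l where "l = min (1/2) (r / (2 * D))"
 have l: "0 < l" "l \<le> 1" "l * D < r"
 proof -
  have "l * D \<le> r / (2 * D) * D" using D(1) by (intro mult_right_mono) (auto simp: l_def)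
  then show "l * D < r" using D(1) r(1) by simp
 qed (use D(1) r(1) in \<open>auto simp: l_def\<close>)
 define K where "K = (1 / l) ^ DIM('a)"
 have K: "1 \<le> K * l ^ DIM('a)" "1 \<le> K" "0 \<le> K"
  using l by (auto simp: K_def power_mult_distrib[symmetric] one_le_power)
 define Bc where "Bc = 1 / measure lborel (ball x0 r) * (measure lborel (ball (0::'a) (2 * r)) * (2 * r))"
 have Bc0: "0 \<le> Bc" using r by (simp add: Bc_def)
 \<comment> \<open>With this \<open>b\<close> and \<open>h\<close> the path of
   \<open>wgrad_path\<close> runs straight from \<open>x\<close> to its contracted image, hence
   inside the segment to the star center.\<close>
 define b where "b = l - 1"
 define h where "h = - b *\<^sub>R x0"
 have b1: "- 1 < b" using l(1) by (simp add: b_def)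
 have bh: "b *\<^sub>R x + h = b *\<^sub>R (x - x0)" for x by (simp add: h_def algebra_simps)
 have path1: "x + (b *\<^sub>R x + h) = h + l *\<^sub>R x" for x by (simp add: b_def algebra_simps)
 show ?thesis
 \<comment> \<open>\<open>D * K\<close> pays for the path to the contracted point, whose length is
   at most \<open>D\<close>; \<open>K * Bc\<close> is the inequality on the ball pulled back along
   the contraction.\<close>
 proof (intro exI[of _ "D * K + K * Bc"] conjI allI impI)
  show "0 \<le> D * K + K * Bc" using D K Bc0 by simp
  fix u g assume S: "sob p \<Omega> u g"
  note int = sob_integrable[OF p O S]
  have [measurable]: "u \<in> Borel" and gm [measurable]: "g \<in> Borel"
   and gfin: "nrm p g < top" and w: "wgrad \<Omega> u g" using S by (auto simp: sob_def)
  have [measurable]: "\<Omega> \<in> sets borel" using O by auto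
  define c where "c = ball_mean x0 r u"
  define v where "v z = ennreal \<bar>u z - c\<bar> * indicator (ball x0 r) z" for z
  have [measurable]: "ball x0 r \<in> sets borel" by simp
  have [measurable]: "v \<in> Borel" unfolding v_def by measurable
  define P where "P x = (\<integral>\<^sup>+t. ennreal (norm (g (x + t *\<^sub>R (b *\<^sub>R x + h)))) \<partial>I01)" for x
  have Pm [measurable]: "P \<in> Borel" unfolding P_def by (intro I01.borel_measurable_nn_integral) measurable
  have "AE x in lborel. ennreal \<bar>u x - c\<bar> * indicator \<Omega> x \<le> ennreal D * P x + v (h + l *\<^sub>R x)"
   using wgrad_path_bound[OF O int w b1, of h]
  proof eventually_elim
   case (elim x)
   show ?case
   proof (cases "x \<in> \<Omega>")
    case True
    have "x + t *\<^sub>R (b *\<^sub>R x + h) \<in> \<Omega>" if "t \<in> {0..1}" for t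
    proof -
     have "x + t *\<^sub>R (b *\<^sub>R x + h) = (1 - t * (1 - l)) *\<^sub>R x + (t * (1 - l)) *\<^sub>R x0"
      unfolding bh by (simp add: b_def algebra_simps)
     moreover have "t * (1 - l) \<le> 1" using that l by (intro mult_le_one) auto
     ultimately have "x + t *\<^sub>R (b *\<^sub>R x + h) \<in> closed_segment x x0"
      using that l by (auto simp: closed_segment_def intro!: exI[of _ "t * (1 - l)"])
     then show ?thesis using star True by (auto simp: star_center_def)
    qed
    with elim have "ennreal \<bar>u (x + (b *\<^sub>R x + h)) - u x\<bar> \<le> ennreal (norm (b *\<^sub>R x + h)) * P x"
     by (simp add: P_def)
    also have "\<dots> \<le> ennreal D * P x"
    proof (intro mult_right_mono ennreal_leI)
     have "norm (b *\<^sub>R (x - x0)) \<le> 1 * norm (x - x0)"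
      unfolding norm_scaleR using l by (intro mult_right_mono) (auto simp: b_def)
     then show "norm (b *\<^sub>R x + h) \<le> D" using D(2)[OF True] by (simp add: bh)
    qed simp
    finally have 1: "ennreal \<bar>u (h + l *\<^sub>R x) - u x\<bar> \<le> ennreal D * P x" by (simp add: path1)
    have "h + l *\<^sub>R x = x0 + l *\<^sub>R (x - x0)" by (simp add: h_def b_def algebra_simps)
    moreover have "norm (l *\<^sub>R (x - x0)) < r"
    proof -
     have "l * norm (x - x0) \<le> l * D" using D(2)[OF True] l by (intro mult_left_mono) auto
     then have "l * norm (x - x0) < r" using l(3) by linarith
     then show ?thesis using l(1) by simp
    qed
    ultimately have "h + l *\<^sub>R x \<in> ball x0 r" by (simp add: dist_norm)
    then have "ennreal \<bar>u x - c\<bar> \<le> ennreal \<bar>u (h + l *\<^sub>R x) - u x\<bar> + v (h + l *\<^sub>R x)"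
     by (simp add: v_def flip: ennreal_plus)
    also have "\<dots> \<le> ennreal D * P x + v (h + l *\<^sub>R x)" by (intro add_right_mono 1)
    finally show ?thesis using True by simp
   qed simp
  qed
  then have "Lnorm p (\<lambda>x. ennreal \<bar>u x - c\<bar> * indicator \<Omega> x) \<le> Lnorm p (\<lambda>x. ennreal D * P x + v (h + l *\<^sub>R x))"
   by (rule Lnorm_mono_AE[OF p])
  also have "\<dots> \<le> Lnorm p (\<lambda>x. ennreal D * P x) + Lnorm p (\<lambda>x. v (h + l *\<^sub>R x))"
   by (intro Lnorm_add_le p) measurable
  also have "\<dots> \<le> ennreal D * (ennreal K * nrm p g) + ennreal K * (ennreal Bc * nrm p g)"
  proof (rule add_mono)
   have "Lnorm p (\<lambda>x. ennreal D * P x) \<le> ennreal D * Lnorm p P" by (intro Lnorm_cmult_le p) measurable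
   also have "\<dots> \<le> ennreal D * (ennreal K * nrm p g)"
    unfolding P_def using l by (intro mult_left_mono Lnorm_path_average_le[where l=l] p gfin K) (auto simp: b_def)
   finally show "Lnorm p (\<lambda>x. ennreal D * P x) \<le> ennreal D * (ennreal K * nrm p g)" .
   have "Lnorm p (\<lambda>x. v (h + l *\<^sub>R x)) \<le> ennreal K * Lnorm p v"
    using l K by (intro Lnorm_affine_le p) auto
   also have "\<dots> \<le> ennreal K * (ennreal Bc * nrm p g)"
   proof (intro mult_left_mono)
    have "Lnorm p v \<le> ennreal (1 / measure lborel (ball x0 r)) * (emeasure lborel (ball (0::'a) (2 * r)) * (ennreal (2 * r) * nrm p g))"
     unfolding v_def c_def by (rule poincare_ball[OF p O S r])
    also have "emeasure lborel (ball (0::'a) (2 * r)) = ennreal (measure lborel (ball (0::'a) (2 * r)))"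
     using emeasure_bounded_finite[OF bounded_ball, of "0::'a" "2 * r"] by (intro emeasure_eq_ennreal_measure) auto
    also have "ennreal (1 / measure lborel (ball x0 r)) * (ennreal (measure lborel (ball (0::'a) (2 * r))) * (ennreal (2 * r) * nrm p g)) = ennreal Bc * nrm p g"
    proof -
     have "0 \<le> 1 / measure lborel (ball x0 r)" "0 \<le> measure lborel (ball (0::'a) (2 * r)) * (2 * r)"
      "0 \<le> measure lborel (ball (0::'a) (2 * r))" "0 \<le> 2 * r" using r(1) by auto
     then show ?thesis unfolding Bc_def by (simp only: ennreal_mult mult.assoc)
    qed
    finally show "Lnorm p v \<le> ennreal Bc * nrm p g" .
   qed simp
   finally show "Lnorm p (\<lambda>x. v (h + l *\<^sub>R x)) \<le> ennreal K * (ennreal Bc * nrm p g)" .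
  qed
  also have "\<dots> = ennreal (D * K + K * Bc) * nrm p g"
   using D(1) K Bc0 by (simp add: ennreal_mult distrib_right mult.assoc)
  finally show "Lnorm p (\<lambda>x. ennreal \<bar>u x - ball_mean x0 r u\<bar> * indicator \<Omega> x) \<le> ennreal (D * K + K * Bc) * nrm p g"
   by (simp add: c_def)
 qed
qed

section \<open>Completeness and uniform approximation\<close>

text \<open>Baire's theorem for a distance on representatives, with completeness expressed by tail
  sums. If no \<open>A N\<close> were dense in a ball, one could choose points \<open>s n\<close>
  with shrinking radii such that \<open>s (Suc n)\<close> keeps a distance from \<open>A n\<close>
  larger than the tail of the remaining steps. Their limit would lie in no
  \<open>A N\<close>.\<close>

lemma baire_dense_ball:
 fixes d :: "'w => 'w => ennreal" and A :: "nat => 'w set"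
 assumes w0: "w0 \<in> W"
  and complete: "\<And>s. (\<And>k. s k \<in> W) ==> (\<Sum>k. d (s k) (s (Suc k))) < top ==>
   \<exists>x\<in>W. \<forall>n. d (s n) x \<le> (\<Sum>k. d (s (k + n)) (s (Suc (k + n))))"
  and cover: "W \<subseteq> (\<Union>N. A N)"
 shows "\<exists>N v r. v \<in> W \<and> 0 < (r::real) \<and> (\<forall>w\<in>W. d v w < ennreal r --> (\<forall>e::real>0. \<exists>a\<in>A N. d w a < ennreal e))"
proof (rule ccontr)
 assume neg: "\<not> ?thesis"
 have step: "\<exists>w\<in>W. d v w < ennreal r \<and> (\<exists>e::real>0. \<forall>a\<in>A N. ennreal e \<le> d w a)" if "v \<in> W" "0 < r" for N v r
 proof (rule ccontr)
  assume n: "\<not> ?thesis"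
  have "\<exists>a\<in>A N. d w a < ennreal e" if "w \<in> W" "d v w < ennreal r" "0 < e" for w and e :: real
   using n that by (meson not_le)
  with neg \<open>v \<in> W\<close> \<open>0 < r\<close> show False by blast
 qed
 define P where "P n z \<longleftrightarrow> fst z \<in> W \<and> 0 < snd z \<and> snd z \<le> (1/4)^n" for n and z :: "'w \<times> real"
 \<comment> \<open>Radii shrink by the factor 4, so the steps after \<open>s n\<close> add up to at
   most 4/3 times its radius. This is below the margin of twice the radius kept from
   \<open>A n\<close>, measured at the next point.\<close>
 define Q where "Q n z z' \<longleftrightarrow> d (fst z) (fst z') < ennreal (snd z) \<and> snd z' \<le> snd z / 4 \<and> (\<forall>a\<in>A n. ennreal (2 * snd z') < d (fst z') a)"
  for n :: nat and z z' :: "'w \<times> real"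
 have "\<exists>f. \<forall>n. P n (f n) \<and> Q n (f n) (f (Suc n))"
 proof (rule dependent_nat_choice)
  show "\<exists>z. P 0 z" using w0 by (intro exI[of _ "(w0, 1)"]) (simp add: P_def)
  fix z n assume z: "P n z"
  then obtain w e where w: "w \<in> W" "d (fst z) w < ennreal (snd z)" "0 < (e::real)" "\<forall>a\<in>A n. ennreal e \<le> d w a"
   using step[of "fst z" "snd z" n] by (auto simp: P_def)
  define r' where "r' = min (e / 4) (snd z / 4)"
  have r': "0 < r'" "2 * r' < e" "r' \<le> snd z / 4" using w(3) z by (auto simp: r'_def P_def)
  have "ennreal (2 * r') < ennreal e" using r' by (intro ennreal_lessI) (use w(3) in auto)
  then have "Q n z (w, r')" using w r' by (auto simp: Q_def intro: less_le_trans)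
  moreover have "P (Suc n) (w, r')" using w(1) r' z by (auto simp: P_def)
  ultimately show "\<exists>z'. P (Suc n) z' \<and> Q n z z'" by blast
 qed
 then obtain f where f: "\<And>n. P n (f n)" "\<And>n. Q n (f n) (f (Suc n))" by blast
 define s where "s n = fst (f n)" for n
 define r where "r n = snd (f n)" for n
 have sW: "s n \<in> W" and r0: "0 < r n" "r n \<le> (1/4)^n" for n using f(1)[of n] by (auto simp: P_def s_def r_def)
 have ds: "d (s n) (s (Suc n)) \<le> ennreal (r n)" and rs: "r (Suc n) \<le> r n / 4"
  and As: "\<And>a. a \<in> A n ==> ennreal (2 * r (Suc n)) < d (s (Suc n)) a" for n
  using f(2)[of n] by (auto simp: Q_def s_def r_def)
 have rk: "r (k + n) \<le> r n * (1/4)^k" for k n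
 proof (induction k)
  case (Suc k)
  then show ?case using rs[of "k + n"] by simp
 qed simp
 have sums: "(\<Sum>k. d (s (k + n)) (s (Suc (k + n)))) \<le> ennreal (2 * r n)" for n
 proof -
  have "(\<Sum>k. d (s (k + n)) (s (Suc (k + n)))) \<le> (\<Sum>k. ennreal (r n * (1/4)^k))"
   by (intro suminf_le order_trans[OF ds ennreal_leI[OF rk]]) auto
  also have "\<dots> = ennreal (r n * (1 / (1 - 1/4)))"
   using r0(1)[of n] sums_mult[OF geometric_sums[of "1/4::real"], of "r n"] by (intro suminf_ennreal_eq) auto
  also have "\<dots> \<le> ennreal (2 * r n)" using r0(1)[of n] by (intro ennreal_leI) simp
  finally show ?thesis .
 qed
 have "(\<Sum>k. d (s k) (s (Suc k))) < top"
  using sums[of 0] by (auto intro: le_less_trans)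
 with complete[of s] sW obtain x where x: "x \<in> W" "\<And>n. d (s n) x \<le> (\<Sum>k. d (s (k + n)) (s (Suc (k + n))))" by blast
 from x(1) cover obtain N where "x \<in> A N" by blast
 from As[OF this] x(2)[of "Suc N"] sums[of "Suc N"] show False by (meson leD order_trans)
qed

text \<open>Riesz-Fischer with a rate: the series of norms bounds the norm of the pointwise sum of
  absolute values, which is therefore finite almost everywhere. The tail estimate has the form
  required by the completeness hypothesis of \<open>baire_dense_ball\<close>.\<close>

lemma Lnorm_fast_Cauchy:
 fixes D :: "nat => 'a::euclidean_space => 'b::euclidean_space"
 assumes p: "1 \<le> p" and [measurable]: "\<And>k. D k \<in> Borel"
  and fin: "(\<Sum>k. nrm p (D k)) < top"
 shows "AE x in lborel. summable (\<lambda>k. norm (D k x))"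
  and "nrm p (\<lambda>x. (\<Sum>k. D k x) - (\<Sum>k<n. D k x)) \<le> (\<Sum>k. nrm p (D (k + n)))"
proof -
 have "Lnorm p (\<lambda>x. \<Sum>k. ennreal (norm (D k x))) \<le> (\<Sum>k. nrm p (D k))"
  by (intro Lnorm_suminf_le p) measurable
 then have "Lnorm p (\<lambda>x. \<Sum>k. ennreal (norm (D k x))) < top" using fin by simp
 then have "AE x in lborel. (\<Sum>k. ennreal (norm (D k x))) < top"
  by (intro Lnorm_finite_AE[OF p]) measurable
 then show ae: "AE x in lborel. summable (\<lambda>k. norm (D k x))"
  by eventually_elim (auto intro: summable_suminf_not_top)
 have "nrm p (\<lambda>x. (\<Sum>k. D k x) - (\<Sum>k<n. D k x)) \<le> Lnorm p (\<lambda>x. \<Sum>k. ennreal (norm (D (k + n) x)))"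
 proof (rule Lnorm_mono_AE[OF p])
  show "AE x in lborel. ennreal (norm ((\<Sum>k. D k x) - (\<Sum>k<n. D k x))) \<le> (\<Sum>k. ennreal (norm (D (k + n) x)))"
   using ae
  proof eventually_elim
   case (elim x)
   have s: "summable (\<lambda>k. norm (D (k + n) x))" using summable_ignore_initial_segment[OF elim, of n] .
   have "(\<Sum>k. D k x) - (\<Sum>k<n. D k x) = (\<Sum>k. D (k + n) x)"
    using suminf_split_initial_segment[OF summable_norm_cancel[OF elim], of n] by simp
   then have "norm ((\<Sum>k. D k x) - (\<Sum>k<n. D k x)) \<le> (\<Sum>k. norm (D (k + n) x))"
    using summable_norm[OF s] by simp
   then have "ennreal (norm ((\<Sum>k. D k x) - (\<Sum>k<n. D k x))) \<le> ennreal (\<Sum>k. norm (D (k + n) x))" by (rule ennreal_leI)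
   also have "\<dots> = (\<Sum>k. ennreal (norm (D (k + n) x)))" using s by (intro suminf_ennreal2[symmetric]) auto
   finally show ?case .
  qed
 qed
 also have "\<dots> \<le> (\<Sum>k. nrm p (D (k + n)))" by (intro Lnorm_suminf_le p) measurable
 finally show "nrm p (\<lambda>x. (\<Sum>k. D k x) - (\<Sum>k<n. D k x)) \<le> (\<Sum>k. nrm p (D (k + n)))" .
qed

section \<open>Linear combinations and limits in the Sobolev class\<close>

lemma nrm_lincomb_le:
 fixes f g :: "'a::euclidean_space => 'b::euclidean_space"
 assumes p: "1 \<le> p" and [measurable]: "f \<in> Borel" "g \<in> Borel"
 shows "nrm p (\<lambda>x. a *\<^sub>R f x + b *\<^sub>R g x) \<le> ennreal \<bar>a\<bar> * nrm p f + ennreal \<bar>b\<bar> * nrm p g"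
proof -
 have "nrm p (\<lambda>x. a *\<^sub>R f x + b *\<^sub>R g x) \<le> Lnorm p (\<lambda>x. ennreal \<bar>a\<bar> * ennreal (norm (f x)) + ennreal \<bar>b\<bar> * ennreal (norm (g x)))"
 proof (intro Lnorm_mono p)
  fix x
  have "norm (a *\<^sub>R f x + b *\<^sub>R g x) \<le> \<bar>a\<bar> * norm (f x) + \<bar>b\<bar> * norm (g x)"
   using norm_triangle_ineq[of "a *\<^sub>R f x" "b *\<^sub>R g x"] by simp
  then show "ennreal (norm (a *\<^sub>R f x + b *\<^sub>R g x)) \<le> ennreal \<bar>a\<bar> * ennreal (norm (f x)) + ennreal \<bar>b\<bar> * ennreal (norm (g x))"
   by (simp add: ennreal_mult[symmetric] ennreal_plus[symmetric] ennreal_leI del: ennreal_plus)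
 qed
 also have "\<dots> \<le> Lnorm p (\<lambda>x. ennreal \<bar>a\<bar> * ennreal (norm (f x))) + Lnorm p (\<lambda>x. ennreal \<bar>b\<bar> * ennreal (norm (g x)))"
  by (intro Lnorm_add_le p) measurable
 also have "\<dots> \<le> ennreal \<bar>a\<bar> * nrm p f + ennreal \<bar>b\<bar> * nrm p g"
  by (intro add_mono Lnorm_cmult_le p) measurable
 finally show ?thesis .
qed

lemma nrm_diff_triangle:
 fixes f g h :: "'a::euclidean_space => 'b::euclidean_space"
 assumes p: "1 \<le> p" and [measurable]: "f \<in> Borel" "g \<in> Borel" "h \<in> Borel"
 shows "nrm p (\<lambda>x. f x - h x) \<le> nrm p (\<lambda>x. f x - g x) + nrm p (\<lambda>x. g x - h x)"
 using nrm_lincomb_le[OF p, of "\<lambda>x. f x - g x" "\<lambda>x. g x - h x" 1 1] by simp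

lemma wgrad_lincomb:
 fixes u v :: "'a::euclidean_space => real"
 assumes "integrable lborel u" "integrable lborel v" "integrable lborel g" "integrable lborel k" "wgrad U u g" "wgrad U v k"
 shows "wgrad U (\<lambda>x. a * u x + b * v x) (\<lambda>x. a *\<^sub>R g x + b *\<^sub>R k x)"
 unfolding wgrad_def
proof (intro ballI)
 fix \<phi> and i :: 'a assume \<phi>: "\<phi> \<in> test_functions U" and i: "i \<in> Basis"
 obtain B where B: "\<And>x. \<bar>\<phi> x\<bar> \<le> B" "\<And>x v. \<bar>frechet_derivative \<phi> (at x) v\<bar> \<le> B * norm v"
  using test_function_bounded[OF \<phi>] by metis
 have Bi: "\<And>x. \<bar>pard \<phi> i x\<bar> \<le> B" using B(2)[of _ i] i by simp
 note I = integrable_mult_test[OF _ test_function_partial_measurable[OF \<phi> i] Bi] integrable_mult_test[OF _ test_functions_measurable[OF \<phi>] B(1)]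
 have "(BB x. (a * u x + b * v x) * pard \<phi> i x)
   = (BB x. a * (u x * pard \<phi> i x) + b * (v x * pard \<phi> i x))"
  by (simp add: algebra_simps)
 also have "\<dots> = a * (BB x. u x * pard \<phi> i x) + b * (BB x. v x * pard \<phi> i x)"
  using I(1)[OF assms(1)] I(1)[OF assms(2)] by simp
 also have "\<dots> = - (a * (BB x. (g x \<bullet> i) * \<phi> x) + b * (BB x. (k x \<bullet> i) * \<phi> x))"
  using assms(5,6) \<phi> i by (simp add: wgrad_def)
 also have "a * (BB x. (g x \<bullet> i) * \<phi> x) + b * (BB x. (k x \<bullet> i) * \<phi> x)
   = (BB x. a * ((g x \<bullet> i) * \<phi> x) + b * ((k x \<bullet> i) * \<phi> x))"
  using I(2)[of "\<lambda>x. g x \<bullet> i"] I(2)[of "\<lambda>x. k x \<bullet> i"] assms(3,4) by simp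
 also have "\<dots> = (BB x. ((a *\<^sub>R g x + b *\<^sub>R k x) \<bullet> i) * \<phi> x)"
  by (simp add: algebra_simps inner_add_left)
 finally show "(BB x. (a * u x + b * v x) * pard \<phi> i x) = - (BB x. ((a *\<^sub>R g x + b *\<^sub>R k x) \<bullet> i) * \<phi> x)" .
qed

lemma sob_lincomb:
 fixes u v :: "'a::euclidean_space => real"
 assumes p: "1 \<le> p" and U: "open U" "bounded U" and S: "sob p U u g" "sob p U v k"
 shows "sob p U (\<lambda>x. a * u x + b * v x) (\<lambda>x. a *\<^sub>R g x + b *\<^sub>R k x)"
proof -
 have [measurable]: "u \<in> Borel" "v \<in> Borel" "g \<in> Borel" "k \<in> Borel"
  using S by (auto simp: sob_def)
 have "nrm p (\<lambda>x. a * u x + b * v x) < top"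
  using nrm_lincomb_le[OF p, of u v a b] S by (auto simp: sob_def ennreal_mult_less_top intro: le_less_trans)
 moreover have "nrm p (\<lambda>x. a *\<^sub>R g x + b *\<^sub>R k x) < top"
  using nrm_lincomb_le[OF p, of g k a b] S by (auto simp: sob_def ennreal_mult_less_top intro: le_less_trans)
 moreover have "wgrad U (\<lambda>x. a * u x + b * v x) (\<lambda>x. a *\<^sub>R g x + b *\<^sub>R k x)"
  using S by (intro wgrad_lincomb sob_integrable[OF p U S(1)] sob_integrable[OF p U S(2)]) (simp_all add: sob_def)
 moreover have "\<forall>x. x \<notin> U --> a * u x + b * v x = 0 \<and> a *\<^sub>R g x + b *\<^sub>R k x = 0"
  using S by (auto simp: sob_def)
 moreover have "(\<lambda>x. a * u x + b * v x) \<in> Borel" "(\<lambda>x. a *\<^sub>R g x + b *\<^sub>R k x) \<in> Borel"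
  by measurable
 ultimately show ?thesis unfolding sob_def by blast
qed

lemma ball_mean_lincomb:
 assumes "integrable lborel u" "integrable lborel v"
 shows "ball_mean c r (\<lambda>x. a * u x + b * v x) = a * ball_mean c r u + b * ball_mean c r v"
proof -
 have 1: "integrable lborel (\<lambda>y. u y * indicator (ball c r) y)" "integrable lborel (\<lambda>y. v y * indicator (ball c r) y)"
  using integrable_mult_indicator[OF _ assms(1), of "ball c r"] integrable_mult_indicator[OF _ assms(2), of "ball c r"]
  by (simp_all add: mult.commute)
 have "(BB y. (a * u y + b * v y) * indicator (ball c r) y) = (BB y. a * (u y * indicator (ball c r) y) + b * (v y * indicator (ball c r) y))"
  by (simp add: algebra_simps)
 also have "\<dots> = a * (BB y. u y * indicator (ball c r) y) + b * (BB y. v y * indicator (ball c r) y)"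
  using 1 by simp
 finally show ?thesis by (simp add: ball_mean_def add_divide_distrib)
qed

lemma hajlasz_lincomb:
 assumes "hajlasz U u g" "hajlasz U v h"
 shows "hajlasz U (\<lambda>x. a * u x + b * v x) (\<lambda>x. \<bar>a\<bar> * g x + \<bar>b\<bar> * h x)"
proof -
 obtain E F where E: "E \<in> null_sets lborel" "\<And>x y. x \<in> U - E ==> y \<in> U - E ==> \<bar>u x - u y\<bar> \<le> norm (x - y) * (g x + g y)"
  and F: "F \<in> null_sets lborel" "\<And>x y. x \<in> U - F ==> y \<in> U - F ==> \<bar>v x - v y\<bar> \<le> norm (x - y) * (h x + h y)"
  using assms by (auto simp: hajlasz_def)
 show ?thesis unfolding hajlasz_def
 proof (intro bexI ballI)
  show "E \<union> F \<in> null_sets lborel" using E(1) F(1) by (rule null_sets.Un)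
  fix x y assume "x \<in> U - (E \<union> F)" "y \<in> U - (E \<union> F)"
  then have "\<bar>u x - u y\<bar> \<le> norm (x - y) * (g x + g y)" "\<bar>v x - v y\<bar> \<le> norm (x - y) * (h x + h y)"
   using E(2) F(2) by auto
  then have *: "\<bar>a\<bar> * \<bar>u x - u y\<bar> \<le> \<bar>a\<bar> * (norm (x - y) * (g x + g y))" "\<bar>b\<bar> * \<bar>v x - v y\<bar> \<le> \<bar>b\<bar> * (norm (x - y) * (h x + h y))"
   by (auto intro: mult_left_mono)
  have "\<bar>a * u x + b * v x - (a * u y + b * v y)\<bar> = \<bar>a * (u x - u y) + b * (v x - v y)\<bar>" by (simp add: algebra_simps)
  also have "\<dots> \<le> \<bar>a\<bar> * \<bar>u x - u y\<bar> + \<bar>b\<bar> * \<bar>v x - v y\<bar>" by (simp add: abs_mult[symmetric])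
  also have "\<dots> \<le> \<bar>a\<bar> * (norm (x - y) * (g x + g y)) + \<bar>b\<bar> * (norm (x - y) * (h x + h y))" using * by (rule add_mono)
  also have "\<dots> = norm (x - y) * (\<bar>a\<bar> * g x + \<bar>b\<bar> * h x + (\<bar>a\<bar> * g y + \<bar>b\<bar> * h y))" by (simp add: algebra_simps)
  finally show "\<bar>a * u x + b * v x - (a * u y + b * v y)\<bar> \<le> norm (x - y) * (\<bar>a\<bar> * g x + \<bar>b\<bar> * h x + (\<bar>a\<bar> * g y + \<bar>b\<bar> * h y))" .
 qed
qed

text \<open>On a bounded set convergence in norm implies L^1 convergence. The vector
  \<open>e\<close> lets the same statement serve the functions (\<open>e = 1\<close> in the reals)
  and the components of the gradients.\<close>

lemma integral_tendsto_of_nrm: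
 fixes u :: "'a::euclidean_space => 'b::euclidean_space"
 assumes p: "1 \<le> p" and U: "U \<in> sets borel" "bounded U"
  and un [measurable]: "\<And>n. un n \<in> Borel" and um [measurable]: "u \<in> Borel"
  and out: "\<And>n x. x \<notin> U ==> un n x = 0" "\<And>x. x \<notin> U ==> u x = 0"
  and fin: "\<And>n. nrm p (un n) < top" "nrm p u < top"
  and lim: "(\<lambda>n. nrm p (\<lambda>x. un n x - u x)) \<longlonglongrightarrow> 0"
  and f [measurable]: "f \<in> Borel" and B: "\<And>x. \<bar>f x\<bar> \<le> B"
 shows "(\<lambda>n. (BB x. (un n x \<bullet> e) * f x)) \<longlonglongrightarrow> (BB x. (u x \<bullet> e) * f x)"
proof (rule tendsto_L1_int)
 have iu: "integrable lborel u" "integrable lborel (un n)" for n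
  using finite_nrm_integrable[OF p U um out(2) fin(2)] finite_nrm_integrable[OF p U un out(1) fin(1)] by auto
 show "integrable lborel (\<lambda>x. (u x \<bullet> e) * f x)" "integrable lborel (\<lambda>x. (un n x \<bullet> e) * f x)" for n
  using iu by (auto intro!: integrable_mult_test[OF _ f B])
 have B0: "0 \<le> B" using B[of 0] by simp
 define c where "c = ennreal (norm e * B) * (emeasure lborel U + 1)"
 have c: "c < top" using emeasure_bounded_finite[OF U(2)] by (simp add: c_def ennreal_mult_less_top)
 have bnd: "(NN x. ennreal (norm ((un n x \<bullet> e) * f x - (u x \<bullet> e) * f x))) \<le> c * nrm p (\<lambda>x. un n x - u x)" for n
 proof -
  have "(NN x. ennreal (norm ((un n x \<bullet> e) * f x - (u x \<bullet> e) * f x)))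
   \<le> (NN x. ennreal (norm e * B) * (ennreal (norm (un n x - u x)) * indicator U x))"
  proof (intro nn_integral_mono)
   fix x
   have "\<bar>(un n x \<bullet> e) * f x - (u x \<bullet> e) * f x\<bar> = \<bar>(un n x - u x) \<bullet> e\<bar> * \<bar>f x\<bar>"
    by (simp add: left_diff_distrib[symmetric] abs_mult inner_diff_left)
   also have "\<dots> \<le> (norm (un n x - u x) * norm e) * B"
    by (intro mult_mono Cauchy_Schwarz_ineq2 B) auto
   finally show "ennreal (norm ((un n x \<bullet> e) * f x - (u x \<bullet> e) * f x)) \<le> ennreal (norm e * B) * (ennreal (norm (un n x - u x)) * indicator U x)"
    using out[of x] B0 by (auto simp: ennreal_mult[symmetric] ennreal_leI mult_ac split: split_indicator)
  qed
  also have "\<dots> = ennreal (norm e * B) * (NN x. ennreal (norm (un n x - u x)) * indicator U x)"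
  proof (rule nn_integral_cmult)
   have [measurable]: "U \<in> sets borel" by fact
   show "(\<lambda>x. ennreal (norm (un n x - u x)) * indicator U x) \<in> borel_measurable lborel" by measurable
  qed
  also have "\<dots> \<le> ennreal (norm e * B) * ((emeasure lborel U + 1) * nrm p (\<lambda>x. un n x - u x))"
   by (intro mult_left_mono nn_integral_le_Lnorm p U) auto
  finally show ?thesis by (simp add: c_def mult.assoc)
 qed
 show "(\<lambda>n. (NN x. ennreal (norm ((un n x \<bullet> e) * f x - (u x \<bullet> e) * f x)))) \<longlonglongrightarrow> 0"
 proof (rule tendsto_sandwich[OF _ _ tendsto_const])
  show "(\<lambda>n. c * nrm p (\<lambda>x. un n x - u x)) \<longlonglongrightarrow> 0"
   using ennreal_tendsto_cmult[OF c lim] by simp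
 qed (use bnd in auto)
qed

lemma sob_limit:
 fixes u :: "'a::euclidean_space => real"
 assumes p: "1 \<le> p" and U: "open U" "bounded U" and S: "\<And>n. sob p U (un n) (gn n)"
  and um: "u \<in> Borel" "g \<in> Borel"
  and out: "\<And>x. x \<notin> U ==> u x = 0 \<and> g x = 0" and fin: "nrm p u < top" "nrm p g < top"
  and lim: "(\<lambda>n. nrm p (\<lambda>x. un n x - u x)) \<longlonglongrightarrow> 0" "(\<lambda>n. nrm p (\<lambda>x. gn n x - g x)) \<longlonglongrightarrow> 0"
 shows "sob p U u g" and "(\<lambda>n. ball_mean c r (un n)) \<longlonglongrightarrow> ball_mean c r u"
proof -
 have Ub: "U \<in> sets borel" using U by auto
 note tu = integral_tendsto_of_nrm[OF p Ub U(2) _ um(1) _ _ _ fin(1) lim(1), where e=1, unfolded inner_real_def mult_1_right]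
 note tg = integral_tendsto_of_nrm[OF p Ub U(2) _ um(2) _ _ _ fin(2) lim(2)]
 have "wgrad U u g" unfolding wgrad_def
 proof (intro ballI)
  fix \<phi> and i :: 'a assume \<phi>: "\<phi> \<in> test_functions U" and i: "i \<in> Basis"
  obtain B where B: "\<And>x. \<bar>\<phi> x\<bar> \<le> B" "\<And>x v. \<bar>frechet_derivative \<phi> (at x) v\<bar> \<le> B * norm v"
   using test_function_bounded[OF \<phi>] by metis
  have Bi: "\<And>x. \<bar>pard \<phi> i x\<bar> \<le> B" using B(2)[of _ i] i by simp
  have "(\<lambda>n. (BB x. un n x * pard \<phi> i x)) \<longlonglongrightarrow> (BB x. u x * pard \<phi> i x)"
   by (rule tu[OF _ _ _ _ test_function_partial_measurable[OF \<phi> i] Bi]) (use S out in \<open>auto simp: sob_def\<close>)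
  moreover have "(\<lambda>n. (BB x. (gn n x \<bullet> i) * \<phi> x)) \<longlonglongrightarrow> (BB x. (g x \<bullet> i) * \<phi> x)"
   by (rule tg[OF _ _ _ _ test_functions_measurable[OF \<phi>] B(1)]) (use S out in \<open>auto simp: sob_def\<close>)
  then have "(\<lambda>n. - (BB x. (gn n x \<bullet> i) * \<phi> x)) \<longlonglongrightarrow> - (BB x. (g x \<bullet> i) * \<phi> x)" by (rule tendsto_minus)
  moreover have "(BB x. un n x * pard \<phi> i x) = - (BB x. (gn n x \<bullet> i) * \<phi> x)" for n
   using S[of n] \<phi> i by (simp add: sob_def wgrad_def)
  ultimately show "(BB x. u x * pard \<phi> i x) = - (BB x. (g x \<bullet> i) * \<phi> x)"
   using LIMSEQ_unique by (simp only:)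
 qed
 then show "sob p U u g" using um out fin by (auto simp: sob_def)
 have "(\<lambda>n. (BB x. un n x * indicator (ball c r) x)) \<longlonglongrightarrow> (BB x. u x * indicator (ball c r) x)"
 proof -
  have 1: "indicator (ball c r) \<in> Borel" by (rule borel_measurable_indicator) simp
  have 2: "\<bar>indicator (ball c r) x :: real\<bar> \<le> 1" for x by (simp split: split_indicator)
  show ?thesis by (rule tu[OF _ _ _ _ 1 2]) (use S out in \<open>auto simp: sob_def\<close>)
 qed
 then show "(\<lambda>n. ball_mean c r (un n)) \<longlonglongrightarrow> ball_mean c r u"
  unfolding ball_mean_def divide_inverse by (intro tendsto_intros)
qed

text \<open>Vanishing mean over the ball removes constants, so that the Poincare inequality bounds
  \<open>u\<close> by \<open>g\<close> and the distance of gradients alone can serve as the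
  metric.\<close>

definition normalized_sob :: "ennreal => 'a::euclidean_space set => 'a => real => ('a => real) => ('a => 'a) => bool" where
 "normalized_sob p U c r u g \<longleftrightarrow> sob p U u g \<and> ball_mean c r u = 0"

text \<open>The bound \<open>N\<close> is a parameter because the countable cover in the Baire
  argument is indexed by it. \<open>h\<close> is nonnegative everywhere, and only its whole-space
  norm is controlled.\<close>

definition admissible :: "ennreal => 'a::euclidean_space set => ennreal => ('a => real) => ('a => real) => bool" where
 "admissible p U N u h \<longleftrightarrow> h \<in> Borel \<and> (\<forall>x. 0 \<le> h x) \<and> nrm p h \<le> N \<and> hajlasz U u h"

lemma normalized_sob_lincomb:
 assumes p: "1 \<le> p" and U: "open U" "bounded U" and S: "normalized_sob p U c r u g" "normalized_sob p U c r v k"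
 shows "normalized_sob p U c r (\<lambda>x. a * u x + b * v x) (\<lambda>x. a *\<^sub>R g x + b *\<^sub>R k x)"
proof -
 have S': "sob p U u g" "sob p U v k" using S by (auto simp: normalized_sob_def)
 show ?thesis
  using S sob_lincomb[OF p U S'] ball_mean_lincomb[OF sob_integrable(1)[OF p U S'(1)] sob_integrable(1)[OF p U S'(2)]]
  by (simp add: normalized_sob_def)
qed

lemma normalized_sob_zero:
 assumes p: "1 \<le> p" shows "normalized_sob p U c r (\<lambda>_. 0) (\<lambda>_. 0)"
 by (simp add: normalized_sob_def sob_def wgrad_def ball_mean_def Lnorm_zero[OF p])

lemma admissible_lincomb:
 assumes p: "1 \<le> p" and A: "admissible p U M u g" "admissible p U N v h"
 shows "admissible p U (ennreal \<bar>a\<bar> * M + ennreal \<bar>b\<bar> * N) (\<lambda>x. a * u x + b * v x) (\<lambda>x. \<bar>a\<bar> * g x + \<bar>b\<bar> * h x)"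
proof -
 have [measurable]: "g \<in> Borel" "h \<in> Borel" using A by (auto simp: admissible_def)
 have "nrm p (\<lambda>x. \<bar>a\<bar> * g x + \<bar>b\<bar> * h x) \<le> ennreal \<bar>a\<bar> * nrm p g + ennreal \<bar>b\<bar> * nrm p h"
  using nrm_lincomb_le[OF p, of g h "\<bar>a\<bar>" "\<bar>b\<bar>"] by simp
 also have "\<dots> \<le> ennreal \<bar>a\<bar> * M + ennreal \<bar>b\<bar> * N"
  using A by (intro add_mono mult_left_mono) (auto simp: admissible_def)
 finally have 1: "nrm p (\<lambda>x. \<bar>a\<bar> * g x + \<bar>b\<bar> * h x) \<le> ennreal \<bar>a\<bar> * M + ennreal \<bar>b\<bar> * N" .
 have 2: "(\<lambda>x. \<bar>a\<bar> * g x + \<bar>b\<bar> * h x) \<in> Borel" by measurable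
 have 3: "hajlasz U (\<lambda>x. a * u x + b * v x) (\<lambda>x. \<bar>a\<bar> * g x + \<bar>b\<bar> * h x)"
  using A by (intro hajlasz_lincomb) (auto simp: admissible_def)
 have 4: "0 \<le> \<bar>a\<bar> * g x + \<bar>b\<bar> * h x" for x using A by (simp add: admissible_def)
 from 1 2 3 4 show ?thesis unfolding admissible_def by blast
qed

lemma ennreal_suminf_tail_tendsto_0:
 fixes f :: "nat => ennreal"
 assumes "(\<Sum>k. f k) < top" shows "(\<lambda>n. \<Sum>k. f (k + n)) \<longlonglongrightarrow> 0"
proof -
 define a where "a k = enn2real (f k)" for k
 have f: "f k = ennreal (a k)" "0 \<le> a k" for k
  using ennreal_suminf_lessD[OF assms, of k] by (auto simp: a_def)
 have s: "summable a" using assms f by (intro summable_suminf_not_top) auto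
 have "(\<lambda>n. suminf a - (\<Sum>k<n. a k)) \<longlonglongrightarrow> suminf a - suminf a"
  by (intro tendsto_intros summable_LIMSEQ s)
 moreover have "suminf a - (\<Sum>k<n. a k) = (\<Sum>k. a (k + n))" for n
  using suminf_split_initial_segment[OF s, of n] by simp
 ultimately have "(\<lambda>n. \<Sum>k. a (k + n)) \<longlonglongrightarrow> 0" by (simp only: diff_self)
 then have "(\<lambda>n. ennreal (\<Sum>k. a (k + n))) \<longlonglongrightarrow> ennreal 0" by (rule tendsto_ennrealI)
 moreover have "(\<Sum>k. f (k + n)) = ennreal (\<Sum>k. a (k + n))" for n
  unfolding f(1) using summable_ignore_initial_segment[OF s, of n] f(2) by (intro suminf_ennreal2) auto
 ultimately show ?thesis by simp
qed

text \<open>The Poincare inequality applied to consecutive differences makes the functions converge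
  as fast as the gradients; \<open>sob_limit\<close> preserves both the weak gradient and the
  vanishing mean.\<close>

lemma normalized_sob_complete:
 fixes U :: "'a::euclidean_space set"
 assumes p: "1 \<le> p" and U: "open U" "bounded U"
  and P: "\<And>u g. normalized_sob p U c r u g ==> nrm p u \<le> ennreal C * nrm p g"
  and S: "\<And>k. normalized_sob p U c r (un k) (gn k)" and fin: "(\<Sum>k. nrm p (\<lambda>x. gn k x - gn (Suc k) x)) < top"
 shows "\<exists>u g. normalized_sob p U c r u g \<and> (\<forall>n. nrm p (\<lambda>x. gn n x - g x) \<le> (\<Sum>k. nrm p (\<lambda>x. gn (k + n) x - gn (Suc (k + n)) x)))"
proof -
 define D where "D k x = gn (Suc k) x - gn k x" for k x
 define E where "E k x = un (Suc k) x - un k x" for k x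
 have Sk: "sob p U (un k) (gn k)" for k using S[of k] by (simp add: normalized_sob_def)
 have ED: "normalized_sob p U c r (E k) (D k)" for k
  using normalized_sob_lincomb[OF p U S[of "Suc k"] S[of k], of 1 "-1"] by (simp add: E_def[abs_def] D_def[abs_def])
 have m [measurable]: "un k \<in> Borel" "gn k \<in> Borel" for k using Sk[of k] by (auto simp: sob_def)
 have mD [measurable]: "D k \<in> Borel" "E k \<in> Borel" for k
  unfolding D_def[abs_def] E_def[abs_def] by measurable
 have DD: "nrm p (D k) = nrm p (\<lambda>x. gn k x - gn (Suc k) x)" for k
  by (simp add: D_def norm_minus_commute)
 have finD: "(\<Sum>k. nrm p (D k)) < top" using fin by (simp add: DD)
 have "(\<Sum>k. nrm p (E k)) \<le> (\<Sum>k. ennreal C * nrm p (D k))" by (intro suminf_le P ED) auto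
 also have "\<dots> < top" using finD by (simp add: ennreal_mult_less_top)
 finally have finE: "(\<Sum>k. nrm p (E k)) < top" .
 define g where "g x = gn 0 x + (\<Sum>k. D k x)" for x
 define u where "u x = un 0 x + (\<Sum>k. E k x)" for x
 have gm [measurable]: "g \<in> Borel" "u \<in> Borel"
  unfolding g_def[abs_def] u_def[abs_def] by measurable
 have teleD: "gn n x - gn 0 x = (\<Sum>k<n. D k x)" "un n x - un 0 x = (\<Sum>k<n. E k x)" for n x
  unfolding D_def E_def
  by (rule sum_lessThan_telescope[of "\<lambda>n. gn n x" n, symmetric], rule sum_lessThan_telescope[of "\<lambda>n. un n x" n, symmetric])
 have "norm (gn n x - g x) = norm ((\<Sum>k. D k x) - (\<Sum>k<n. D k x))" for n x
  unfolding teleD(1)[symmetric] g_def by (simp add: norm_minus_commute algebra_simps)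
 then have gl: "nrm p (\<lambda>x. gn n x - g x) \<le> (\<Sum>k. nrm p (D (k + n)))" for n
  using Lnorm_fast_Cauchy(2)[OF p mD(1) finD, of n] by simp
 have "norm (un n x - u x) = norm ((\<Sum>k. E k x) - (\<Sum>k<n. E k x))" for n x
  unfolding teleD(2)[symmetric] u_def by (simp add: norm_minus_commute algebra_simps)
 then have ul: "nrm p (\<lambda>x. un n x - u x) \<le> (\<Sum>k. nrm p (E (k + n)))" for n
  using Lnorm_fast_Cauchy(2)[OF p mD(2) finE, of n] by simp
 have gt: "(\<lambda>n. nrm p (\<lambda>x. gn n x - g x)) \<longlonglongrightarrow> 0"
  by (rule tendsto_sandwich[OF _ _ tendsto_const ennreal_suminf_tail_tendsto_0[OF finD]]) (use gl in auto)
 have ut: "(\<lambda>n. nrm p (\<lambda>x. un n x - u x)) \<longlonglongrightarrow> 0"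
  by (rule tendsto_sandwich[OF _ _ tendsto_const ennreal_suminf_tail_tendsto_0[OF finE]]) (use ul in auto)
 have out: "u x = 0 \<and> g x = 0" if "x \<notin> U" for x
  using that Sk by (simp add: u_def g_def D_def E_def sob_def)
 have "nrm p g < top"
 proof -
  have "nrm p g \<le> nrm p (gn 0) + nrm p (\<lambda>x. gn 0 x - g x)"
   using nrm_lincomb_le[OF p m(2)[of 0], of "\<lambda>x. gn 0 x - g x" 1 "-1"] by simp
  also have "\<dots> < top" using Sk[of 0] gl[of 0] finD by (auto simp: sob_def intro: le_less_trans)
  finally show ?thesis .
 qed
 moreover have "nrm p u < top"
 proof -
  have "nrm p u \<le> nrm p (un 0) + nrm p (\<lambda>x. un 0 x - u x)"
   using nrm_lincomb_le[OF p m(1)[of 0], of "\<lambda>x. un 0 x - u x" 1 "-1"] by simp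
  also have "\<dots> < top" using Sk[of 0] ul[of 0] finE by (auto simp: sob_def intro: le_less_trans)
  finally show ?thesis .
 qed
 ultimately have "sob p U u g" and bm: "(\<lambda>n. ball_mean c r (un n)) \<longlonglongrightarrow> ball_mean c r u"
  using sob_limit[OF p U Sk gm(2) gm(1) out _ _ ut gt] by auto
 moreover have "ball_mean c r u = 0"
  using bm S LIMSEQ_unique[OF bm, of 0] by (simp add: normalized_sob_def)
 ultimately show ?thesis using gl unfolding DD by (intro exI[of _ u] exI[of _ g]) (simp add: normalized_sob_def)
qed

text \<open>Baire yields one \<open>N\<close> such that the pairs with a Hajlasz gradient of norm at
  most \<open>N\<close> are dense in a ball around some \<open>v\<close>. Approximate both
  \<open>v\<close> and \<open>v\<close> plus a small multiple of the given pair, subtract and divide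
  by the multiple. Only approximants are obtained; \<open>slice_hajlasz_finite\<close> and
  \<open>normalized_sob_infinity_lipschitz\<close> remove the error.\<close>

lemma admissible_dense:
 fixes U :: "'a::euclidean_space set"
 assumes p: "1 \<le> p" and U: "open U" "bounded U"
  and P: "\<And>u g. normalized_sob p U c r u g ==> nrm p u \<le> ennreal C * nrm p g"
  and H: "\<And>u g. sob p U u g ==> \<exists>h. \<exists>N<top. admissible p U N u h"
 shows "\<exists>K\<ge>0. \<forall>u g b e. normalized_sob p U c r u g --> nrm p g \<le> ennreal b --> 0 < b --> 0 < e -->
  (\<exists>a k h. normalized_sob p U c r a k \<and> nrm p (\<lambda>x. g x - k x) \<le> ennreal e \<and> admissible p U (ennreal (K * b)) a h)"
proof -
 define W where "W = {z. normalized_sob p U c r (fst z) (snd z)}"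
 define A where "A N = {z\<in>W. \<exists>h. admissible p U (of_nat N) (fst z) h}" for N :: nat
 define d where "d z z' = nrm p (\<lambda>x. snd z x - snd z' x)" for z z' :: "('a => real) \<times> ('a => 'a)"
 have cover: "W \<subseteq> (\<Union>N. A N)"
 proof
  fix z assume z: "z \<in> W"
  then have "sob p U (fst z) (snd z)" by (simp add: W_def normalized_sob_def)
  from H[OF this] obtain h N where h: "admissible p U N (fst z) h" "N < top" by blast
  from ennreal_Ex_less_of_nat[OF h(2)] obtain n where "N < of_nat n" by blast
  then have "admissible p U (of_nat n) (fst z) h" using h(1) by (auto simp: admissible_def)
  then show "z \<in> (\<Union>N. A N)" using z by (auto simp: A_def)
 qed
 have complete: "\<exists>x\<in>W. \<forall>n. d (s n) x \<le> (\<Sum>k. d (s (k + n)) (s (Suc (k + n))))"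
  if s: "\<And>k. s k \<in> W" and fin: "(\<Sum>k. d (s k) (s (Suc k))) < top" for s
 proof -
  obtain u g where "normalized_sob p U c r u g"
   "\<forall>n. nrm p (\<lambda>x. snd (s n) x - g x) \<le> (\<Sum>k. nrm p (\<lambda>x. snd (s (k + n)) x - snd (s (Suc (k + n))) x))"
  proof -
   have sk: "\<And>k. normalized_sob p U c r (fst (s k)) (snd (s k))" using s by (simp add: W_def)
   have f2: "(\<Sum>k. nrm p (\<lambda>x. snd (s k) x - snd (s (Suc k)) x)) < top" using fin by (simp add: d_def)
   from normalized_sob_complete[OF p U P sk f2] show thesis using that by blast
  qed
  then show ?thesis by (intro bexI[of _ "(u, g)"]) (auto simp: W_def d_def)
 qed
 have "((\<lambda>_. 0), (\<lambda>_. 0)) \<in> W" using normalized_sob_zero[OF p] by (simp add: W_def)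
 from baire_dense_ball[of _ W d A, OF this complete cover]
 obtain N v r' where v: "v \<in> W" "0 < (r'::real)" and dense: "\<And>w e. w \<in> W ==> d v w < ennreal r' ==> 0 < (e::real) ==> \<exists>a\<in>A N. d w a < ennreal e"
  by blast
 have Wm: "snd z \<in> Borel" if "z \<in> W" for z using that by (auto simp: W_def normalized_sob_def sob_def)
 show ?thesis
 \<comment> \<open>Two approximants cost \<open>N\<close> each, and dividing by
   \<open>s = r' / (2 * b)\<close> turns 2 N into 4 N b / r'.\<close>
 proof (intro exI[of _ "4 * real N / r'"] conjI allI impI)
  show "0 \<le> 4 * real N / r'" using v by simp
  fix u g b e assume S: "normalized_sob p U c r u g" and g: "nrm p g \<le> ennreal b" and b: "0 < b" and e: "0 < (e::real)"
  \<comment> \<open>The scaled gradient then has norm at most \<open>r' / 2\<close>, safely inside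
    the ball around \<open>v\<close>.\<close>
  define s where "s = r' / (2 * b)"
  have s: "0 < s" using v b by (simp add: s_def)
  define w where "w = ((\<lambda>x. 1 * fst v x + s * u x), (\<lambda>x. 1 *\<^sub>R snd v x + s *\<^sub>R g x))"
  have gm [measurable]: "g \<in> Borel" using S by (auto simp: normalized_sob_def sob_def)
  have vm [measurable]: "snd v \<in> Borel" using Wm[OF v(1)] .
  have w: "w \<in> W" unfolding w_def W_def using normalized_sob_lincomb[OF p U _ S, of "fst v" "snd v" 1 s] v(1) by (simp add: W_def)
  have "d v w = nrm p (\<lambda>x. s *\<^sub>R g x + 0 *\<^sub>R g x)" by (simp add: d_def w_def)
  also have "\<dots> \<le> ennreal s * nrm p g" using nrm_lincomb_le[OF p gm gm, of s 0] s by simp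
  also have "\<dots> \<le> ennreal s * ennreal b" by (intro mult_left_mono g) simp
  also have "\<dots> = ennreal (r' / 2)" using s b by (simp add: ennreal_mult[symmetric]) (simp add: s_def)
  also have "\<dots> < ennreal r'" using v(2) by (intro ennreal_lessI) auto
  finally have vw: "d v w < ennreal r'" .
  obtain a1 where a1: "a1 \<in> A N" "d w a1 < ennreal (s * e / 2)" using dense[OF w vw, of "s * e / 2"] s e by auto
  have "d v v < ennreal r'" using v(2) by (simp add: d_def Lnorm_zero[OF p])
  then obtain a2 where a2: "a2 \<in> A N" "d v a2 < ennreal (s * e / 2)" using dense[OF v(1), of "s * e / 2"] s e by auto
  obtain h1 where h1: "admissible p U (of_nat N) (fst a1) h1" using a1(1) by (auto simp: A_def)
  obtain h2 where h2: "admissible p U (of_nat N) (fst a2) h2" using a2(1) by (auto simp: A_def)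
  have aW: "a1 \<in> W" "a2 \<in> W" using a1 a2 by (auto simp: A_def)
  note [measurable] = Wm[OF aW(1)] Wm[OF aW(2)] Wm[OF w]
  let ?a = "\<lambda>x. (1/s) * fst a1 x + (- (1/s)) * fst a2 x" and ?k = "\<lambda>x. (1/s) *\<^sub>R snd a1 x + (- (1/s)) *\<^sub>R snd a2 x"
  have "normalized_sob p U c r ?a ?k"
   using aW by (intro normalized_sob_lincomb p U) (auto simp: W_def)
  moreover have "nrm p (\<lambda>x. g x - ?k x) \<le> ennreal e"
  proof -
   have "g x - ?k x = (1/s) *\<^sub>R (snd w x - snd a1 x) + (- (1/s)) *\<^sub>R (snd v x - snd a2 x)" for x
    using s by (simp add: w_def algebra_simps)
   then have "nrm p (\<lambda>x. g x - ?k x) = nrm p (\<lambda>x. (1/s) *\<^sub>R (snd w x - snd a1 x) + (- (1/s)) *\<^sub>R (snd v x - snd a2 x))"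
    by (simp only:)
   also have "\<dots> \<le> ennreal \<bar>1/s\<bar> * d w a1 + ennreal \<bar>- (1/s)\<bar> * d v a2"
    unfolding d_def by (intro nrm_lincomb_le p) measurable
   also have "\<dots> \<le> ennreal (1/s) * ennreal (s * e / 2) + ennreal (1/s) * ennreal (s * e / 2)"
    using a1(2) a2(2) s by (intro add_mono mult_mono) auto
   also have "\<dots> = ennreal e" using s e by (simp add: ennreal_mult[symmetric] ennreal_plus[symmetric] del: ennreal_plus)
   finally show ?thesis .
  qed
  moreover have "admissible p U (ennreal (4 * real N / r' * b)) ?a (\<lambda>x. \<bar>1/s\<bar> * h1 x + \<bar>- (1/s)\<bar> * h2 x)"
  proof -
   have "ennreal \<bar>1/s\<bar> * of_nat N + ennreal \<bar>- (1/s)\<bar> * of_nat N = ennreal (4 * real N / r' * b)"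
    using s v(2) b by (simp add: ennreal_of_nat_eq_real_of_nat ennreal_mult[symmetric] ennreal_plus[symmetric] del: ennreal_plus) (simp add: s_def field_simps)
   then show ?thesis using admissible_lincomb[OF p h1 h2, of "1/s" "- (1/s)"] by simp
  qed
  ultimately show "\<exists>a k h. normalized_sob p U c r a k \<and> nrm p (\<lambda>x. g x - k x) \<le> ennreal e \<and> admissible p U (ennreal (4 * real N / r' * b)) a h"
   by blast
 qed
qed

text \<open>A step function is coded by a list so that countability is that of lists over a
  countable set. The sets may overlap, and sums become concatenations.\<close>

definition rat_step :: "(rat \<times> 'a set) list => 'a => real" where
 "rat_step l x = (\<Sum>(c, V)\<leftarrow>l. of_rat c * indicator V x)"

lemma rat_step_append: "rat_step (l @ m) x = rat_step l x + rat_step m x"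
 by (simp add: rat_step_def)

lemma rat_step_scale: "rat_step (map (\<lambda>(c, V). (a * c, V)) l) x = of_rat a * rat_step l x"
 by (induction l) (auto simp: rat_step_def of_rat_mult algebra_simps)

lemma rat_step_measurable: "set l \<subseteq> UNIV \<times> sets borel ==> rat_step l \<in> Borel"
 by (induction l) (auto simp: rat_step_def[abs_def] split: prod.split)

section \<open>Density of rational step functions\<close>

lemma nrm_indicator_diff:
 assumes p: "1 \<le> p" "p \<noteq> \<infinity>" and [measurable]: "A \<in> sets borel" "B \<in> sets borel"
 shows "nrm p (\<lambda>x. indicator A x - indicator B x :: real) = epow (1 / enn2real p) (emeasure lborel (A - B \<union> (B - A)))"
proof -
 have "(NN x. epow (enn2real p) (ennreal (norm (indicator A x - indicator B x :: real)))) = (NN x. indicator (A - B \<union> (B - A)) x)"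
  by (intro nn_integral_cong) (auto split: split_indicator)
 also have "\<dots> = emeasure lborel (A - B \<union> (B - A))" by (intro nn_integral_indicator) simp
 finally show ?thesis using p by (simp add: Lnorm_def)
qed

text \<open>Half of the error goes to an open superset of \<open>A\<close>, half to exhausting that
  open set by finitely many basis sets, which works because its measure is finite.\<close>

lemma finite_union_approx:
 fixes A :: "'a::euclidean_space set"
 assumes \<B>: "countable \<B>" "topological_basis \<B>" and A: "A \<in> sets borel" "emeasure lborel A < top" and e: "0 < e"
 shows "\<exists>F. finite F \<and> F \<subseteq> \<B> \<and> emeasure lborel (A - \<Union>F \<union> (\<Union>F - A)) < ennreal e"
proof -
 obtain V where V: "open V" "A \<subseteq> V" "emeasure lborel (V - A) < ennreal (e/2)"
  by (rule outer_regular_lborel[OF A(1), of "e/2"]) (use e in auto)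
 obtain \<B>' where B': "\<B>' \<subseteq> \<B>" "\<Union>\<B>' = V" using \<B>(2) V(1) unfolding topological_basis_def by blast
 have [measurable]: "V \<in> sets borel" "A \<in> sets borel" using V(1) A(1) by auto
 have Vfin: "emeasure lborel V < top"
 proof -
  have "emeasure lborel V = emeasure lborel (A \<union> (V - A))" using V(2) by (simp add: Un_absorb1)
  also have "\<dots> \<le> emeasure lborel A + emeasure lborel (V - A)" by (intro emeasure_subadditive) auto
  also have "\<dots> < top" using A(2) V(3) by (auto intro: less_trans)
  finally show ?thesis .
 qed
 show ?thesis
 proof (cases "\<B>' = {}")
  case True
  then have "A = {}" using B' V(2) by auto
  then show ?thesis using e by (intro exI[of _ "{}"]) auto
 next
  case False
  have cB': "countable \<B>'" using B'(1) \<B>(1) by (rule countable_subset)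
  define W where "W n = (\<Union>i\<le>n. from_nat_into \<B>' i)" for n
  have fb: "from_nat_into \<B>' i \<in> \<B>'" for i by (rule from_nat_into[OF False])
  have Wb [measurable]: "W n \<in> sets borel" for n
   unfolding W_def using fb B'(1) \<B>(2) by (intro sets.finite_UN) (auto intro!: borel_open dest: topological_basis_open)
  have "(\<Union>n. W n) = V"
  proof -
   have "(\<Union>n. W n) = \<Union>(range (from_nat_into \<B>'))" by (auto simp: W_def)
   then show ?thesis using range_from_nat_into[OF False cB'] B'(2) by simp
  qed
  moreover have "incseq W" unfolding W_def by (auto simp: incseq_def intro: order_trans)
  ultimately have "(\<lambda>n. emeasure lborel (W n)) \<longlonglongrightarrow> emeasure lborel V"
  proof -
   assume W: "(\<Union>n. W n) = V" "incseq W"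
   have "range W \<subseteq> sets lborel" using Wb by auto
   from Lim_emeasure_incseq[OF this W(2)] show ?thesis by (simp only: W(1))
  qed
  then have "(\<lambda>n. emeasure lborel V - emeasure lborel (W n)) \<longlonglongrightarrow> emeasure lborel V - emeasure lborel V"
   using Vfin by (intro tendsto_diff_ennreal) auto
  then have "(\<lambda>n. emeasure lborel V - emeasure lborel (W n)) \<longlonglongrightarrow> 0" using Vfin by simp
  then have "\<forall>\<^sub>F n in sequentially. emeasure lborel V - emeasure lborel (W n) < ennreal (e/2)"
   by (rule order_tendstoD) (use e in simp)
  then obtain n where n: "emeasure lborel V - emeasure lborel (W n) < ennreal (e/2)" by (auto simp: eventually_sequentially)
  have WV: "W n \<subseteq> V" using \<open>(\<Union>n. W n) = V\<close> by blast
  have "emeasure lborel (V - W n) = emeasure lborel V - emeasure lborel (W n)"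
  proof (rule emeasure_Diff)
   have "emeasure lborel (W n) \<le> emeasure lborel V" using WV by (intro emeasure_mono) auto
   then show "emeasure lborel (W n) \<noteq> \<infinity>" using Vfin by auto
  qed (use WV in auto)
  with n have n': "emeasure lborel (V - W n) < ennreal (e/2)" by simp
  have "emeasure lborel (A - W n \<union> (W n - A)) \<le> emeasure lborel ((V - W n) \<union> (V - A))"
   using WV V(2) by (intro emeasure_mono) auto
  also have "\<dots> \<le> emeasure lborel (V - W n) + emeasure lborel (V - A)" by (intro emeasure_subadditive) auto
  also have "\<dots> < ennreal (e/2) + ennreal (e/2)" using n' V(3) by (rule add_strict_mono)
  also have "\<dots> = ennreal e" using e by (simp add: ennreal_plus[symmetric] del: ennreal_plus)
  finally have "emeasure lborel (A - W n \<union> (W n - A)) < ennreal e" .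
  then show ?thesis using fb B'(1) by (intro exI[of _ "from_nat_into \<B>' ` {..n}"]) (auto simp: W_def)
 qed
qed

section \<open>Separability and measurable selection\<close>

lemma nrm_tendsto_0:
 fixes f :: "'a::euclidean_space => real"
 assumes p: "1 \<le> p" "p \<noteq> \<infinity>" and [measurable]: "f \<in> Borel" "\<And>i. F i \<in> Borel"
  and fin: "nrm p f < top" and F: "\<And>i x. 0 \<le> F i x" "\<And>i x. F i x \<le> f x" and lim: "\<And>x. (\<lambda>i. F i x) \<longlonglongrightarrow> f x"
  and e: "0 < e"
 shows "\<exists>i::nat. nrm p (\<lambda>x. f x - F i x) \<le> ennreal e"
proof -
 define q where "q = enn2real p"
 have q: "1 \<le> q" using enn2real_ge_1[OF p(2,1)] by (simp add: q_def)
 let ?I = "\<lambda>i. (NN x. epow q (ennreal (norm (f x - F i x))))"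
 have "?I \<longlonglongrightarrow> (\<integral>\<^sup>+(x::'a). 0 \<partial>lborel)"
 proof (rule nn_integral_dominated_convergence[where w="\<lambda>x. epow q (ennreal (norm (f x)))"])
  show "(NN x. epow q (ennreal (norm (f x)))) < \<infinity>"
  proof -
   have "(NN x. epow q (ennreal (norm (f x)))) \<le> epow q (nrm p f)"
    using Lnorm_le_iff[OF p(2,1), of "\<lambda>x. ennreal (norm (f x))" "nrm p f"] unfolding q_def by simp
   also have "\<dots> < \<infinity>" using fin by simp
   finally show ?thesis .
  qed
  show "AE x in lborel. epow q (ennreal (norm (f x - F i x))) \<le> epow q (ennreal (norm (f x)))" for i
  proof (rule AE_I2)
   fix x
   have "norm (f x - F i x) \<le> norm (f x)" using F[of i x] by simp
   then show "epow q (ennreal (norm (f x - F i x))) \<le> epow q (ennreal (norm (f x)))" using q by (intro epow_mono ennreal_leI) auto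
  qed
  show "AE x in lborel. (\<lambda>i. epow q (ennreal (norm (f x - F i x)))) \<longlonglongrightarrow> 0"
  proof (rule AE_I2)
   fix x
   have "(\<lambda>i. norm (f x - F i x)) \<longlonglongrightarrow> norm (f x - f x)" by (intro tendsto_intros lim)
   then have "(\<lambda>i. norm (f x - F i x) powr q) \<longlonglongrightarrow> norm (f x - f x) powr q"
    using q by (intro tendsto_powr2) auto
   then have "(\<lambda>i. ennreal (norm (f x - F i x) powr q)) \<longlonglongrightarrow> ennreal (norm (f x - f x) powr q)" by (rule tendsto_ennrealI)
   then show "(\<lambda>i. epow q (ennreal (norm (f x - F i x)))) \<longlonglongrightarrow> 0" using q by (simp add: epow_ennreal)
  qed
 qed measurable
 then have "?I \<longlonglongrightarrow> 0" by simp
 then have "\<forall>\<^sub>F i in sequentially. ?I i < epow q (ennreal e)"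
  by (rule order_tendstoD) (use e in \<open>simp add: epow_ennreal\<close>)
 then obtain i where "?I i < epow q (ennreal e)" by (auto simp: eventually_sequentially)
 then have "nrm p (\<lambda>x. f x - F i x) \<le> ennreal e" unfolding Lnorm_le_iff[OF p(2,1)] q_def by simp
 then show ?thesis ..
qed

lemma nrm_mono_abs: "1 \<le> p ==> (\<And>x. norm (f x) \<le> norm (g x)) ==> nrm p f \<le> nrm p g"
 by (intro Lnorm_mono ennreal_leI) auto

text \<open>Induction over nonnegative Borel functions. The finiteness of the norm stands inside the
  induction formula: by nonnegativity it descends from a sum to the summands and from a monotone
  limit to its members.\<close>

lemma rat_step_dense_nonneg:
 fixes f :: "'a::euclidean_space => real"
 assumes p: "1 \<le> p" "p \<noteq> \<infinity>" and \<B>: "countable \<B>" "topological_basis \<B>"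
  and f: "f \<in> Borel" "\<And>x. 0 \<le> f x"
 defines "T \<equiv> {l :: (rat \<times> 'a set) list. set l \<subseteq> UNIV \<times> (Union ` {F. finite F \<and> F \<subseteq> \<B>})}"
 shows "nrm p f < top --> (\<forall>e>0. \<exists>l\<in>T. nrm p (\<lambda>x. f x - rat_step l x) \<le> ennreal e)"
proof -
 define q where "q = enn2real p"
 have q: "1 \<le> q" using enn2real_ge_1[OF p(2,1)] by (simp add: q_def)
 have Tb: "rat_step l \<in> Borel" if "l \<in> T" for l
 proof (rule rat_step_measurable)
  have "\<Union>F \<in> sets borel" if "finite F" "F \<subseteq> \<B>" for F
   using that \<B>(2) by (intro sets.finite_Union) (auto intro!: borel_open dest: topological_basis_open)
  then show "set l \<subseteq> UNIV \<times> sets borel" using that by (auto simp: T_def)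
 qed
 from f show ?thesis
 proof (induction f rule: borel_measurable_induct_real)
  case (set A)
  have A: "A \<in> sets borel" using set by simp
  show ?case
  proof (intro impI allI)
   fix e :: real assume fin: "nrm p (indicator A :: 'a => real) < top" and e: "0 < e"
   have "nrm p (indicator A :: 'a => real) = epow (1/q) (emeasure lborel A)"
    using nrm_indicator_diff[OF p A, of "{}"] by (simp add: q_def)
   then have "emeasure lborel A < top" using fin by simp
   from finite_union_approx[OF \<B> A this, of "e powr q"] e
   obtain F where F: "finite F" "F \<subseteq> \<B>" "emeasure lborel (A - \<Union>F \<union> (\<Union>F - A)) < ennreal (e powr q)" by auto
   have Fb: "\<Union>F \<in> sets borel"
    using F \<B>(2) by (intro sets.finite_Union) (auto intro!: borel_open dest: topological_basis_open)
   have "nrm p (\<lambda>x. indicator A x - rat_step [(1, \<Union>F)] x) = epow (1/q) (emeasure lborel (A - \<Union>F \<union> (\<Union>F - A)))"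
    using nrm_indicator_diff[OF p A Fb] by (simp add: rat_step_def q_def)
   also have "\<dots> \<le> epow (1/q) (epow q (ennreal e))" using F(3) e q by (intro epow_mono) (auto simp: epow_ennreal)
   also have "\<dots> = ennreal e" using q by (simp add: epow_epow)
   finally show "\<exists>l\<in>T. nrm p (\<lambda>x. indicator A x - rat_step l x) \<le> ennreal e"
    using F by (intro bexI[of _ "[(1, \<Union>F)]"]) (auto simp: T_def)
  qed
 next
  case (mult u c)
  have um [measurable]: "u \<in> Borel" using mult by simp
  show ?case
  proof (intro impI allI)
   fix e :: real assume fin: "nrm p (\<lambda>x. c * u x) < top" and e: "0 < e"
   show "\<exists>l\<in>T. nrm p (\<lambda>x. c * u x - rat_step l x) \<le> ennreal e"
   proof (cases "c = 0")
    case True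
    then show ?thesis by (intro bexI[of _ "[]"]) (auto simp: T_def rat_step_def Lnorm_zero[OF p(1)])
   next
    case False
    have "nrm p u \<le> ennreal \<bar>1/c\<bar> * nrm p (\<lambda>x. c * u x) + ennreal \<bar>0\<bar> * nrm p u"
     using nrm_lincomb_le[OF p(1), of "\<lambda>x. c * u x" u "1/c" 0] False by simp
    also have "\<dots> < top" using fin by (simp add: ennreal_mult_less_top)
    finally have ufin: "nrm p u < top" .
    then obtain M where M: "nrm p u = ennreal M" "0 \<le> M" by (cases "nrm p u") auto
    \<comment> \<open>The tolerance for replacing \<open>c\<close> by a rational:
      \<open>\<delta> * M\<close> is at most \<open>e / 2\<close>, and \<delta> at most 1 keeps the
      rational below \<open>c + 1\<close>.\<close>
    define \<delta> where "\<delta> = min 1 (e / (2 * (M + 1)))"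
    have \<delta>: "0 < \<delta>" "\<delta> \<le> 1" "\<delta> * M \<le> e / 2"
    proof -
     have "\<delta> * M \<le> e / (2 * (M + 1)) * M" using M by (intro mult_right_mono) (auto simp: \<delta>_def)
     also have "\<dots> \<le> e / 2" using M e by (simp add: field_simps)
     finally show "\<delta> * M \<le> e / 2" .
    qed (use e M in \<open>auto simp: \<delta>_def\<close>)
    obtain c' where c': "c - \<delta> < real_of_rat c'" "real_of_rat c' < c + \<delta>"
     using of_rat_dense[of "c - \<delta>" "c + \<delta>"] \<delta>(1) by auto
    have c'b: "\<bar>c - of_rat c'\<bar> \<le> \<delta>" "\<bar>real_of_rat c'\<bar> \<le> c + 1"
     unfolding abs_le_iff using c' \<delta>(1,2) mult(1) by (intro conjI; linarith)+
    obtain l where l: "l \<in> T" "nrm p (\<lambda>x. u x - rat_step l x) \<le> ennreal (e / (2 * (c + 1)))"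
     using mult.IH[rule_format, OF ufin, of "e / (2 * (c + 1))"] mult(1) e by auto
    note [measurable] = Tb[OF l(1)]
    have "nrm p (\<lambda>x. c * u x - rat_step (map (\<lambda>(c, V). (c' * c, V)) l) x)
      = nrm p (\<lambda>x. (c - of_rat c') *\<^sub>R u x + of_rat c' *\<^sub>R (u x - rat_step l x))"
    proof -
     have "c * u x - rat_step (map (\<lambda>(c, V). (c' * c, V)) l) x = (c - of_rat c') *\<^sub>R u x + of_rat c' *\<^sub>R (u x - rat_step l x)" for x
      unfolding rat_step_scale by (simp add: algebra_simps)
     then show ?thesis by (simp only:)
    qed
    also have "\<dots> \<le> ennreal \<bar>c - of_rat c'\<bar> * nrm p u + ennreal \<bar>of_rat c'\<bar> * nrm p (\<lambda>x. u x - rat_step l x)"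
     by (intro nrm_lincomb_le p) measurable
    also have "\<dots> \<le> ennreal \<delta> * ennreal M + ennreal (c + 1) * ennreal (e / (2 * (c + 1)))"
     using c'b l(2) M by (intro add_mono mult_mono ennreal_leI) auto
    also have "\<dots> = ennreal (\<delta> * M + e / 2)"
    proof -
     have "K * (e / (2 * K)) = e / 2" if "0 < K" for K :: real using that by (simp add: field_simps)
     from this[of "c + 1"] have "(c + 1) * (e / (2 * (c + 1))) = e / 2" using mult(1) by simp
     then have "ennreal (c + 1) * ennreal (e / (2 * (c + 1))) = ennreal (e / 2)"
      using mult(1) e by (subst ennreal_mult[symmetric]) auto
     then show ?thesis using \<delta> M e by (simp add: ennreal_mult[symmetric] ennreal_plus[symmetric] del: ennreal_plus)
    qed
    also have "\<dots> \<le> ennreal e" using \<delta>(3) by (intro ennreal_leI) auto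
    finally show ?thesis using l(1) by (intro bexI[of _ "map (\<lambda>(c, V). (c' * c, V)) l"]) (auto simp: T_def)
   qed
  qed
 next
  case (add u v)
  have m [measurable]: "u \<in> Borel" "v \<in> Borel" using add by auto
  have pos: "0 \<le> u x" "0 \<le> v x" for x using add by auto
  show ?case
  proof (intro impI allI)
   fix e :: real assume fin: "nrm p (\<lambda>x. v x + u x) < top" and e: "0 < e"
   have n1: "norm (u x) \<le> norm (v x + u x)" and n2: "norm (v x) \<le> norm (v x + u x)" for x using pos[of x] by auto
   have "nrm p u \<le> nrm p (\<lambda>x. v x + u x)" by (rule nrm_mono_abs[OF p(1) n1])
   moreover have "nrm p v \<le> nrm p (\<lambda>x. v x + u x)" by (rule nrm_mono_abs[OF p(1) n2])
   ultimately
   have uv: "nrm p u < top" "nrm p v < top" using fin by auto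
   obtain l where l: "l \<in> T" "nrm p (\<lambda>x. u x - rat_step l x) \<le> ennreal (e / 2)"
    using add.IH(1)[rule_format, OF uv(1), of "e / 2"] e by auto
   obtain k where k: "k \<in> T" "nrm p (\<lambda>x. v x - rat_step k x) \<le> ennreal (e / 2)"
    using add.IH(2)[rule_format, OF uv(2), of "e / 2"] e by auto
   note [measurable] = Tb[OF l(1)] Tb[OF k(1)]
   have "nrm p (\<lambda>x. (v x + u x) - rat_step (k @ l) x) = nrm p (\<lambda>x. 1 *\<^sub>R (v x - rat_step k x) + 1 *\<^sub>R (u x - rat_step l x))"
    by (simp add: rat_step_append algebra_simps)
   also have "\<dots> \<le> ennreal \<bar>1\<bar> * nrm p (\<lambda>x. v x - rat_step k x) + ennreal \<bar>1\<bar> * nrm p (\<lambda>x. u x - rat_step l x)"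
    by (intro nrm_lincomb_le p) measurable
   also have "\<dots> \<le> ennreal (e/2) + ennreal (e/2)" using l k by (auto intro: add_mono)
   also have "\<dots> = ennreal e" using e by (simp add: ennreal_plus[symmetric] del: ennreal_plus)
   finally show "\<exists>l\<in>T. nrm p (\<lambda>x. (v x + u x) - rat_step l x) \<le> ennreal e"
    using l k by (intro bexI[of _ "k @ l"]) (auto simp: T_def)
  qed
 next
  case (seq F)
  have m [measurable]: "\<And>i. F i \<in> Borel" using seq by auto
  have lim: "\<And>x. (\<lambda>i. F i x) \<longlonglongrightarrow> f x" using seq by auto
  have Ff: "F i x \<le> f x" for i x
   using incseq_le[OF _ lim[of x], of i] \<open>incseq F\<close> by (auto simp: incseq_def le_fun_def)
  have fm [measurable]: "f \<in> Borel" by (rule borel_measurable_LIMSEQ_real[OF lim m])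
  have F0: "\<And>i x. 0 \<le> F i x" using seq by auto
  show ?case
  proof (intro impI allI)
   fix e :: real assume fin: "nrm p f < top" and e: "0 < e"
   obtain i where i: "nrm p (\<lambda>x. f x - F i x) \<le> ennreal (e/2)"
    using nrm_tendsto_0[OF p fm m fin F0 Ff lim, of "e/2"] e by auto
   have "nrm p (F i) \<le> nrm p f" proof (rule nrm_mono_abs[OF p(1)])
    show "norm (F i x) \<le> norm (f x)" for x using F0[of i x] Ff[of i x] by simp
   qed
   then have "nrm p (F i) < top" using fin by simp
   then obtain l where l: "l \<in> T" "nrm p (\<lambda>x. F i x - rat_step l x) \<le> ennreal (e / 2)"
    using seq.IH[of i, rule_format, of "e / 2"] e by auto
   note [measurable] = Tb[OF l(1)]
   have "nrm p (\<lambda>x. f x - rat_step l x) \<le> nrm p (\<lambda>x. f x - F i x) + nrm p (\<lambda>x. F i x - rat_step l x)"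
    by (intro nrm_diff_triangle p) measurable
   also have "\<dots> \<le> ennreal (e/2) + ennreal (e/2)" using i l by (intro add_mono)
   also have "\<dots> = ennreal e" using e by (simp add: ennreal_plus[symmetric] del: ennreal_plus)
   finally show "\<exists>l\<in>T. nrm p (\<lambda>x. f x - rat_step l x) \<le> ennreal e" using l by blast
  qed
 qed
qed

lemma nrm_sum_le:
 fixes f :: "'i => 'a::euclidean_space => 'b::euclidean_space"
 assumes p: "1 \<le> p" and "finite I" and "\<And>i. i \<in> I ==> f i \<in> Borel"
 shows "nrm p (\<lambda>x. \<Sum>i\<in>I. f i x) \<le> (\<Sum>i\<in>I. nrm p (f i))"
 using assms(2,3)
proof (induction I rule: finite_induct)
 case (insert i I)
 have [measurable]: "f i \<in> Borel" "(\<lambda>x. \<Sum>i\<in>I. f i x) \<in> Borel"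
  using insert by auto
 have "nrm p (\<lambda>x. \<Sum>i\<in>insert i I. f i x) = nrm p (\<lambda>x. 1 *\<^sub>R f i x + 1 *\<^sub>R (\<Sum>i\<in>I. f i x))" using insert by simp
 also have "\<dots> \<le> ennreal \<bar>1\<bar> * nrm p (f i) + ennreal \<bar>1\<bar> * nrm p (\<lambda>x. \<Sum>i\<in>I. f i x)"
  by (intro nrm_lincomb_le p) measurable
 also have "\<dots> \<le> nrm p (f i) + (\<Sum>i\<in>I. nrm p (f i))" using insert by (simp add: add_left_mono)
 finally show ?case using insert by simp
qed (simp add: Lnorm_zero[OF p])

lemma nrm_dense_countable:
 assumes p: "1 \<le> p" "p \<noteq> \<infinity>"
 obtains Q :: "('a::euclidean_space => 'b::euclidean_space) set" where "countable Q" "Q \<noteq> {}" "Q \<subseteq> borel_measurable borel"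
  "\<And>f e. f \<in> Borel ==> nrm p f < top ==> 0 < e ==> \<exists>q\<in>Q. nrm p (\<lambda>x. f x - q x) \<le> ennreal e"
proof -
 obtain \<B> :: "'a set set" where \<B>: "countable \<B>" "topological_basis \<B>" using ex_countable_basis by blast
 define \<F> where "\<F> = Union ` {F. finite F \<and> F \<subseteq> \<B>}"
 have "countable \<F>" unfolding \<F>_def using \<B>(1) by (intro countable_image countable_Collect_finite_subset)
 define T where "T = {l :: (rat \<times> 'a set) list. set l \<subseteq> UNIV \<times> \<F>}"
 have "T = lists (UNIV \<times> \<F>)" by (auto simp: T_def lists_eq_set)
 then have cT: "countable T" using \<open>countable \<F>\<close> by (simp add: countable_lists)
 have Tb: "rat_step l \<in> Borel" if "l \<in> T" for l
 proof (rule rat_step_measurable)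
  have "\<Union>F \<in> sets borel" if "finite F" "F \<subseteq> \<B>" for F
   using that \<B>(2) by (intro sets.finite_Union) (auto intro!: borel_open dest: topological_basis_open)
  then show "set l \<subseteq> UNIV \<times> sets borel" using that by (auto simp: T_def \<F>_def)
 qed
 define ev where "ev L x = (\<Sum>i\<in>Basis. (rat_step (fst (L i)) x - rat_step (snd (L i)) x) *\<^sub>R i)"
  for L :: "'b => (rat \<times> 'a set) list \<times> (rat \<times> 'a set) list" and x
 define Q where "Q = ev ` (Basis \<rightarrow>\<^sub>E T \<times> T)"
 show thesis
 proof (rule that[of Q])
  show "countable Q" unfolding Q_def using cT by (intro countable_image countable_PiE) auto
  have "[] \<in> T" by (simp add: T_def)
  then have "(\<lambda>i\<in>Basis. ([], [])) \<in> (Basis :: 'b set) \<rightarrow>\<^sub>E T \<times> T" by auto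
  then show "Q \<noteq> {}" unfolding Q_def by blast
  show "Q \<subseteq> borel_measurable borel"
  proof
   fix f assume "f \<in> Q"
   then obtain L where L: "L \<in> Basis \<rightarrow>\<^sub>E T \<times> T" "f = ev L" by (auto simp: Q_def)
   then have "rat_step (fst (L i)) \<in> Borel" "rat_step (snd (L i)) \<in> Borel" if "i \<in> Basis" for i
    using PiE_mem[OF L(1) that] Tb by auto
   then show "f \<in> Borel" unfolding L(2) ev_def[abs_def]
    by (intro borel_measurable_sum borel_measurable_scaleR borel_measurable_diff) auto
  qed
  fix f :: "'a => 'b" and e :: real assume f [measurable]: "f \<in> Borel" and fin: "nrm p f < top" and e: "0 < e"
  define e' where "e' = e / (2 * real DIM('b))"
  have e': "0 < e'" using e by (simp add: e'_def)
  have ex: "\<exists>lk. lk \<in> T \<times> T \<and> nrm p (\<lambda>x. (f x \<bullet> i) - (rat_step (fst lk) x - rat_step (snd lk) x)) \<le> ennreal (2 * e')" if i: "i \<in> Basis" for i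
  proof -
   define fp where "fp x = max 0 (f x \<bullet> i)" for x
   define fn where "fn x = max 0 (- (f x \<bullet> i))" for x
   have m [measurable]: "fp \<in> Borel" "fn \<in> Borel" unfolding fp_def fn_def by measurable
   have le: "norm (fp x) \<le> norm (f x)" "norm (fn x) \<le> norm (f x)" for x
    using Basis_le_norm[OF i, of "f x"] by (auto simp: fp_def fn_def)
   have fin': "nrm p fp < top" "nrm p fn < top"
    using nrm_mono_abs[OF p(1), of fp f] nrm_mono_abs[OF p(1), of fn f] le fin by auto
   have pos: "\<And>x. 0 \<le> fp x" "\<And>x. 0 \<le> fn x" by (auto simp: fp_def fn_def)
   obtain l where l: "l \<in> T" "nrm p (\<lambda>x. fp x - rat_step l x) \<le> ennreal e'"
    using rat_step_dense_nonneg[OF p \<B> m(1) pos(1), rule_format, OF fin'(1) e'] by (auto simp: T_def \<F>_def)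
   obtain k where k: "k \<in> T" "nrm p (\<lambda>x. fn x - rat_step k x) \<le> ennreal e'"
    using rat_step_dense_nonneg[OF p \<B> m(2) pos(2), rule_format, OF fin'(2) e'] by (auto simp: T_def \<F>_def)
   note [measurable] = Tb[OF l(1)] Tb[OF k(1)]
   have "f x \<bullet> i = fp x - fn x" for x by (simp add: fp_def fn_def)
   then have "(f x \<bullet> i) - (rat_step l x - rat_step k x) = 1 *\<^sub>R (fp x - rat_step l x) + (-1) *\<^sub>R (fn x - rat_step k x)" for x
    by simp
   then have "nrm p (\<lambda>x. (f x \<bullet> i) - (rat_step l x - rat_step k x)) = nrm p (\<lambda>x. 1 *\<^sub>R (fp x - rat_step l x) + (-1) *\<^sub>R (fn x - rat_step k x))"
    by (simp only:)
   also have "\<dots> \<le> ennreal \<bar>1\<bar> * nrm p (\<lambda>x. fp x - rat_step l x) + ennreal \<bar>-1\<bar> * nrm p (\<lambda>x. fn x - rat_step k x)"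
    by (intro nrm_lincomb_le p) measurable
   also have "\<dots> \<le> ennreal e' + ennreal e'" using l k by (auto intro: add_mono)
   also have "\<dots> = ennreal (2 * e')" using e' by (simp add: ennreal_plus[symmetric] del: ennreal_plus)
   finally show ?thesis using l k by (intro exI[of _ "(l, k)"]) auto
  qed
  then obtain L where L: "\<And>i. i \<in> Basis ==> L i \<in> T \<times> T"
   "\<And>i. i \<in> Basis ==> nrm p (\<lambda>x. (f x \<bullet> i) - (rat_step (fst (L i)) x - rat_step (snd (L i)) x)) \<le> ennreal (2 * e')"
   using bchoice[of Basis "\<lambda>i lk. lk \<in> T \<times> T \<and> nrm p (\<lambda>x. (f x \<bullet> i) - (rat_step (fst lk) x - rat_step (snd lk) x)) \<le> ennreal (2 * e')"] by auto
  have Lm: "rat_step (fst (L i)) \<in> Borel" "rat_step (snd (L i)) \<in> Borel" if "i \<in> Basis" for i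
   using L(1)[OF that] Tb by auto
  have "f x - ev (restrict L Basis) x = (\<Sum>i\<in>Basis. ((f x \<bullet> i) - (rat_step (fst (L i)) x - rat_step (snd (L i)) x)) *\<^sub>R i)" for x
   by (simp add: ev_def euclidean_representation scaleR_diff_left sum_subtractf)
  then have "nrm p (\<lambda>x. f x - ev (restrict L Basis) x) = nrm p (\<lambda>x. \<Sum>i\<in>Basis. ((f x \<bullet> i) - (rat_step (fst (L i)) x - rat_step (snd (L i)) x)) *\<^sub>R i)"
   by (simp only:)
  also have "\<dots> \<le> (\<Sum>i\<in>Basis. nrm p (\<lambda>x. ((f x \<bullet> i) - (rat_step (fst (L i)) x - rat_step (snd (L i)) x)) *\<^sub>R i))"
   using Lm by (intro nrm_sum_le p finite_Basis borel_measurable_scaleR borel_measurable_diff borel_measurable_inner f borel_measurable_const) auto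
  also have "\<dots> \<le> (\<Sum>i\<in>(Basis::'b set). ennreal (2 * e'))"
   using L(2) by (intro sum_mono) auto
  also have "\<dots> = ennreal e" using e by (simp add: e'_def ennreal_of_nat_eq_real_of_nat ennreal_mult[symmetric])
  finally show "\<exists>q\<in>Q. nrm p (\<lambda>x. f x - q x) \<le> ennreal e"
   unfolding Q_def using L(1) by (intro bexI[of _ "ev (restrict L Basis)"]) auto
 qed
qed

text \<open>Separability passes to the family indexed by \<open>D\<close>: for each member of a
  countable dense set and each tolerance, one index is picked whose function is that close. The
  chosen indices lie in \<open>D\<close> itself and so carry the data attached to its
  elements.\<close>

lemma nrm_separable:
 fixes F :: "'z => 'a::euclidean_space => 'b::euclidean_space"
 assumes p: "1 \<le> p" "p \<noteq> \<infinity>" and D: "\<And>z. z \<in> D ==> F z \<in> Borel" "\<And>z. z \<in> D ==> nrm p (F z) < top"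
  and z0: "z0 \<in> D"
 obtains s :: "nat => 'z" where "\<And>j. s j \<in> D" "\<And>z e. z \<in> D ==> 0 < e ==> \<exists>j. nrm p (\<lambda>x. F z x - F (s j) x) \<le> ennreal e"
proof -
 obtain Q :: "('a => 'b) set" where Q: "countable Q" "Q \<noteq> {}" "Q \<subseteq> borel_measurable borel"
  "\<And>f e. f \<in> Borel ==> nrm p f < top ==> 0 < e ==> \<exists>q\<in>Q. nrm p (\<lambda>x. f x - q x) \<le> ennreal e"
  by (rule nrm_dense_countable[OF p, where 'a='a and 'b='b], rule that)
 define close where "close q m z \<longleftrightarrow> z \<in> D \<and> nrm p (\<lambda>x. F z x - q x) \<le> ennreal (1 / real (Suc m))" for q m z
 \<comment> \<open>\<open>z0\<close> is only the default for the case in which nothing in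
   \<open>D\<close> is close enough.\<close>
 define pick where "pick qm = (if \<exists>z. close (fst qm) (snd qm) z then SOME z. close (fst qm) (snd qm) z else z0)" for qm
 define s where "s j = pick (from_nat_into (Q \<times> (UNIV :: nat set)) j)" for j
 have pick: "close q m (pick (q, m))" if "close q m z" for q m z
 proof -
  have ex: "\<exists>z. close (fst (q, m)) (snd (q, m)) z" using that by auto
  from someI_ex[OF ex] show ?thesis using ex by (simp add: pick_def)
 qed
 have pickD: "pick qm \<in> D" for qm
 proof (cases "\<exists>z. close (fst qm) (snd qm) z")
  case True
  from someI_ex[OF True] have "close (fst qm) (snd qm) (pick qm)" using True by (simp add: pick_def)
  then show ?thesis by (simp add: close_def)
 qed (use z0 in \<open>simp add: pick_def\<close>)
 show thesis
 proof (rule that[of s])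
  show "s j \<in> D" for j
   unfolding s_def by (rule pickD)
  fix z e assume z: "z \<in> D" and e: "0 < (e::real)"
  obtain m where m: "2 / real (Suc m) < e"
   using reals_Archimedean[of "e/2"] e by (auto simp: field_simps)
  obtain q where q: "q \<in> Q" "nrm p (\<lambda>x. F z x - q x) \<le> ennreal (1 / real (Suc m))"
   using Q(4)[OF D(1)[OF z] D(2)[OF z], of "1 / real (Suc m)"] by auto
  then have c: "close q m (pick (q, m))" using z by (intro pick[of _ _ z]) (simp add: close_def)
  obtain j where j: "from_nat_into (Q \<times> (UNIV :: nat set)) j = (q, m)"
   using from_nat_into_surj[of "Q \<times> (UNIV :: nat set)" "(q, m)"] Q(1) q(1) by auto
  have [measurable]: "q \<in> Borel" "F z \<in> Borel" "F (s j) \<in> Borel"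
   using Q(3) q(1) D(1) z c by (auto simp: s_def j close_def)
  have "nrm p (\<lambda>x. F z x - F (s j) x) \<le> nrm p (\<lambda>x. F z x - q x) + nrm p (\<lambda>x. q x - F (s j) x)"
   by (intro nrm_diff_triangle p) measurable
  also have "\<dots> \<le> ennreal (1 / real (Suc m)) + ennreal (1 / real (Suc m))"
   using q(2) c by (intro add_mono) (auto simp: close_def s_def j norm_minus_commute)
  also have "\<dots> = ennreal (2 / real (Suc m))" by (simp add: ennreal_plus[symmetric] del: ennreal_plus)
  also have "\<dots> \<le> ennreal e" using m by (intro ennreal_leI) simp
  finally show "\<exists>j. nrm p (\<lambda>x. F z x - F (s j) x) \<le> ennreal e" by blast
 qed
qed

section \<open>Measurability along slices\<close>

lemma measurable_slice_Lnorm: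
 fixes F :: "real \<times> 'a::euclidean_space => ennreal"
 assumes p: "p \<noteq> \<infinity>" and [measurable]: "F \<in> Borel2"
 shows "(\<lambda>t. Lnorm p (\<lambda>x. F (t, x))) \<in> Borel"
proof -
 have [measurable]: "F \<in> borel_measurable (borel \<Otimes>\<^sub>M lborel)"
  using assms(2) by (simp cong: measurable_cong_sets sets_pair_measure_cong)
 have "(\<lambda>t. (NN x. epow (enn2real p) (F (t, x)))) \<in> Borel" by measurable
 then have "(\<lambda>t. epow (1 / enn2real p) (NN x. epow (enn2real p) (F (t, x)))) \<in> Borel" by measurable
 then show ?thesis using p by (simp add: Lnorm_def)
qed

lemma slice_measurable:
 fixes f :: "real \<times> 'a::euclidean_space => 'b::topological_space"
 shows "f \<in> Borel2 ==> (\<lambda>x. f (t, x)) \<in> Borel"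
 by (rule measurable_compose[of "\<lambda>x. (t, x)" borel "borel \<Otimes>\<^sub>M borel"]) measurable

lemma null_sets_of_slices:
 fixes N :: "(real \<times> 'a::euclidean_space) set"
 assumes N: "N \<in> sets (borel \<Otimes>\<^sub>M borel)" and 0: "AE t in lborel. AE x in lborel. (t, x) \<notin> N"
 shows "N \<in> null_sets lborel"
proof -
 have N': "N \<in> sets (lborel \<Otimes>\<^sub>M lborel)" using N by (simp cong: sets_pair_measure_cong)
 have "AE t in lborel. emeasure lborel (Pair t -` N) = 0"
  using 0
 proof eventually_elim
  case (elim t)
  have "Pair t -` N \<in> sets lborel" using sets_Pair1[OF N'] by simp
  then show ?case using elim by (subst (asm) AE_iff_measurable[of "Pair t -` N"]) auto
 qed
 then have "(NN t. emeasure lborel (Pair t -` N)) = 0"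
  using lborel.measurable_emeasure_Pair[OF N'] by (subst nn_integral_0_iff_AE) auto
 then have "emeasure (lborel \<Otimes>\<^sub>M lborel) N = 0" by (simp add: lborel.emeasure_pair_measure_alt[OF N'])
 moreover have "N \<in> sets borel" using N unfolding borel_prod .
 ultimately show ?thesis by (simp add: lborel_prod null_sets_def)
qed

text \<open>The selected family must be jointly measurable in \<open>(t, x)\<close>. At each stage the first member of a fixed
 sequence that reduces the remaining gradient norm by a fixed factor is subtracted.\<close>

definition greedy_index :: "ennreal => (nat => 'a::euclidean_space => 'a) => (real \<times> 'a => 'a) => real => nat" where
 "greedy_index p k f t = (LEAST j. nrm p (\<lambda>x. f (t, x) - k j x) \<le> ennreal (3/4) * nrm p (\<lambda>x. f (t, x)))"

primrec greedy :: "ennreal => (nat => 'a::euclidean_space => 'a) => (real \<times> 'a => 'a) => nat => real \<times> 'a => 'a" where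
 "greedy p k f 0 = f"
| "greedy p k f (Suc n) = (\<lambda>z. greedy p k f n z - k (greedy_index p k (greedy p k f n) (fst z)) (snd z))"

lemma greedy_index_measurable:
 fixes f :: "real \<times> 'a::euclidean_space => 'a"
 assumes p: "p \<noteq> \<infinity>" and k [measurable]: "\<And>j. k j \<in> Borel" and f [measurable]: "f \<in> Borel2"
 shows "greedy_index p k f \<in> measurable borel (count_space UNIV)"
proof -
 have [measurable]: "(\<lambda>t. nrm p (\<lambda>x. f (t, x) - k j x)) \<in> Borel" for j
  using measurable_slice_Lnorm[OF p, of "\<lambda>z. ennreal (norm (f z - k j (snd z)))"] by simp
 have [measurable]: "(\<lambda>t. nrm p (\<lambda>x. f (t, x))) \<in> Borel"
  using measurable_slice_Lnorm[OF p, of "\<lambda>z. ennreal (norm (f z))"] by simp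
 show ?thesis unfolding greedy_index_def[abs_def] by measurable
qed

lemma index_family_measurable:
 fixes k :: "nat => 'a::euclidean_space => 'b::euclidean_space"
 assumes k [measurable]: "\<And>j. k j \<in> Borel" and J [measurable]: "J \<in> measurable borel (count_space UNIV)"
 shows "(\<lambda>z. k (J (fst z)) (snd z)) \<in> Borel2"
 by (rule measurable_compose_countable[where f="\<lambda>j z. k j (snd z)" and g="\<lambda>z. J (fst z)"]) measurable

lemma greedy_measurable:
 fixes f :: "real \<times> 'a::euclidean_space => 'a"
 assumes p: "p \<noteq> \<infinity>" and k: "\<And>j. k j \<in> Borel" and f: "f \<in> Borel2"
 shows "greedy p k f n \<in> Borel2"
proof (induction n)
 case (Suc n)
 show ?case
  using borel_measurable_diff[OF Suc index_family_measurable[OF k greedy_index_measurable[OF p k Suc]]] by simp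
qed (use f in simp)

text \<open>The iteration of the open mapping theorem, carried out for all \<open>t\<close> at once.
  Every subtraction multiplies the remaining gradient norm by at most 3/4, so the subtracted Hajlasz
  gradients have summable norms and their sum is \<open>G\<close>. The remainders are summable by
  the Poincare inequality, hence tend to 0 almost everywhere, and the increments of \<open>v\<close>
  are controlled by \<open>G\<close>.\<close>

lemma slice_hajlasz_finite:
 fixes U :: "'a::euclidean_space set" and v :: "real \<times> 'a => real" and f :: "real \<times> 'a => 'a"
 assumes p: "1 \<le> p" "p \<noteq> \<infinity>" and U: "open U" "bounded U" and C0: "0 \<le> C" and K0: "0 \<le> K"
  and P: "\<And>u g. normalized_sob p U c r u g ==> nrm p u \<le> ennreal C * nrm p g"
  and dense: "\<And>u g b e. normalized_sob p U c r u g ==> nrm p g \<le> ennreal b ==> 0 < b ==> 0 < e ==>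
   \<exists>a k h. normalized_sob p U c r a k \<and> nrm p (\<lambda>x. g x - k x) \<le> ennreal e \<and> admissible p U (ennreal (K * b)) a h"
  and m [measurable]: "v \<in> Borel2" "f \<in> Borel2"
  and S: "\<And>t. normalized_sob p U c r (\<lambda>x. v (t, x)) (\<lambda>x. f (t, x))"
 shows "\<exists>G N. G \<in> Borel2 \<and> N \<in> sets (borel \<Otimes>\<^sub>M borel) \<and> N \<in> null_sets lborel \<and>
  (\<forall>t. Lnorm p (\<lambda>x. G (t, x)) \<le> ennreal (16 * K) * nrm p (\<lambda>x. f (t, x))) \<and>
  (\<forall>t. \<forall>x\<in>U. \<forall>y\<in>U. (t, x) \<notin> N --> (t, y) \<notin> N -->
   ennreal \<bar>v (t, x) - v (t, y)\<bar> \<le> ennreal (norm (x - y)) * (G (t, x) + G (t, y)))"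
proof -
 \<comment> \<open>Triples of function, gradient and Hajlasz gradient. The factor
   \<open>2 * K\<close> arises because an approximant within \<open>b / 2\<close> of a gradient of
   norm \<open>b\<close> has norm at least \<open>b / 2\<close>, so that \<open>K * b\<close> is at
   most \<open>2 * K\<close> times its norm.\<close>
 define D where "D = {z :: ('a => real) \<times> ('a => 'a) \<times> ('a => real).
  normalized_sob p U c r (fst z) (fst (snd z)) \<and> admissible p U (ennreal (2 * K) * nrm p (fst (snd z))) (fst z) (snd (snd z))}"
 define z0 :: "('a => real) \<times> ('a => 'a) \<times> ('a => real)" where "z0 = (\<lambda>_. 0, \<lambda>_. 0, \<lambda>_. 0)"
 have z0: "z0 \<in> D" unfolding D_def z0_def using normalized_sob_zero[OF p(1)]
  by (auto simp: admissible_def hajlasz_def Lnorm_zero[OF p(1)] intro: exI[of _ "{}"])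
 have Dm: "fst (snd z) \<in> Borel" "nrm p (fst (snd z)) < top" if "z \<in> D" for z
  using that by (auto simp: D_def normalized_sob_def sob_def)
 obtain s' :: "nat => ('a => real) \<times> ('a => 'a) \<times> ('a => real)" where s': "\<And>j. s' j \<in> D"
  "\<And>z e. z \<in> D ==> 0 < e ==> \<exists>j. nrm p (\<lambda>x. fst (snd z) x - fst (snd (s' j)) x) \<le> ennreal e"
 proof (rule nrm_separable[OF p, where F="\<lambda>z. fst (snd z)" and D=D and ?z0.0=z0])
  show "fst (snd z) \<in> Borel" "nrm p (fst (snd z)) < top" if "z \<in> D" for z using Dm[OF that] by auto
 qed (use z0 that in auto)
 \<comment> \<open>The zero triple is put in front to handle a gradient that already vanishes;
   otherwise errors \<open>b / 2\<close> and \<open>b / 4\<close> add up to the factor 3/4.\<close>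
 define s where "s j = (case j of 0 => z0 | Suc i => s' i)" for j
 have sD: "s j \<in> D" for j using z0 s'(1) by (auto simp: s_def split: nat.split)
 define a where "a j = fst (s j)" for j
 define k where "k j = fst (snd (s j))" for j
 define h where "h j = snd (snd (s j))" for j
 have ak: "normalized_sob p U c r (a j) (k j)" and adm: "admissible p U (ennreal (2 * K) * nrm p (k j)) (a j) (h j)" for j
  using sD[of j] by (auto simp: D_def a_def k_def h_def)
 have am [measurable]: "a j \<in> Borel" "k j \<in> Borel" for j
  using ak[of j] by (auto simp: normalized_sob_def sob_def)
 have hm [measurable]: "h j \<in> Borel" and h0: "0 \<le> h j x" and hn: "nrm p (h j) \<le> ennreal (2 * K) * nrm p (k j)"
  and hh: "hajlasz U (a j) (h j)" for j x
  using adm[of j] by (auto simp: admissible_def)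
 have red: "\<exists>j. nrm p (\<lambda>x. g x - k j x) \<le> ennreal (3/4) * nrm p g" if ug: "normalized_sob p U c r u g" for u g
 proof (cases "nrm p g = 0")
  case True
  then show ?thesis by (intro exI[of _ 0]) (simp add: k_def s_def z0_def)
 next
  case False
  have gm [measurable]: "g \<in> Borel" and "nrm p g < top" using ug by (auto simp: normalized_sob_def sob_def)
  then obtain b where b: "nrm p g = ennreal b" "0 < b" using False by (cases "nrm p g") (auto simp: less_le)
  obtain a' k' h' where *: "normalized_sob p U c r a' k'" "nrm p (\<lambda>x. g x - k' x) \<le> ennreal (b/2)" "admissible p U (ennreal (K * b)) a' h'"
   using dense[OF ug, of b "b/2"] b by auto
  have k'm [measurable]: "k' \<in> Borel" using *(1) by (auto simp: normalized_sob_def sob_def)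
  have "ennreal b \<le> nrm p k' + nrm p (\<lambda>x. g x - k' x)"
   unfolding b(1)[symmetric] using nrm_lincomb_le[OF p(1), of k' "\<lambda>x. g x - k' x" 1 1] by simp
  also have "\<dots> \<le> nrm p k' + ennreal (b/2)" by (intro add_left_mono *(2))
  finally have bk: "ennreal b \<le> 2 * nrm p k'"
  proof (cases "nrm p k'")
   case (real y)
   assume "ennreal b \<le> nrm p k' + ennreal (b/2)"
   then have "b \<le> y + b / 2" using real b by (simp add: ennreal_plus[symmetric] del: ennreal_plus)
   then have "ennreal b \<le> ennreal (2 * y)" by (intro ennreal_leI) simp
   then show ?thesis using real by (simp add: ennreal_mult)
  qed simp
  have "ennreal (K * b) \<le> ennreal (2 * K) * nrm p k'"
   using mult_left_mono[OF bk, of "ennreal K"] K0 b(2) by (simp add: ennreal_mult mult_ac)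
  then have "(a', k', h') \<in> D" using *(1,3) by (auto simp: D_def admissible_def)
  from s'(2)[OF this, of "b/4"] b(2) obtain j where j: "nrm p (\<lambda>x. k' x - k (Suc j) x) \<le> ennreal (b/4)"
   by (auto simp: k_def s_def)
  have "nrm p (\<lambda>x. g x - k (Suc j) x) \<le> nrm p (\<lambda>x. g x - k' x) + nrm p (\<lambda>x. k' x - k (Suc j) x)"
   by (intro nrm_diff_triangle p) measurable
  also have "\<dots> \<le> ennreal (b/2) + ennreal (b/4)" using *(2) j by (intro add_mono)
  also have "\<dots> = ennreal (3/4) * nrm p g"
   using b by (simp add: ennreal_mult[symmetric] ennreal_plus[symmetric] del: ennreal_plus)
  finally show ?thesis by blast
 qed
 define F where "F n = greedy p k f n" for n
 define J where "J n t = greedy_index p k (F n) t" for n t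
 have Fm [measurable]: "F n \<in> Borel2" for n
  unfolding F_def by (rule greedy_measurable[OF p(2) am(2) m(2)])
 have Jm [measurable]: "J n \<in> measurable borel (count_space UNIV)" for n
  unfolding J_def[abs_def] by (rule greedy_index_measurable[OF p(2) am(2) Fm])
 have F0: "F 0 = f" and FSuc: "F (Suc n) (t, x) = F n (t, x) - k (J n t) x" for n t x
  by (simp_all add: F_def J_def)
 \<comment> \<open>The remainder after \<open>n\<close> subtractions. It has vanishing mean and
   gradient \<open>F n\<close>, so its norm decays like (3/4)^n.\<close>
 define V where "V n z = v z - (\<Sum>i<n. a (J i (fst z)) (snd z))" for n z
 have aJm [measurable]: "(\<lambda>z. a (J i (fst z)) (snd z)) \<in> Borel2" for i
  by (rule index_family_measurable[OF am(1) Jm])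
 have hJm [measurable]: "(\<lambda>z. h (J i (fst z)) (snd z)) \<in> Borel2" for i
  by (rule index_family_measurable[OF hm Jm])
 have Vm [measurable]: "V n \<in> Borel2" for n unfolding V_def[abs_def] by measurable
 have VF: "normalized_sob p U c r (\<lambda>x. V n (t, x)) (\<lambda>x. F n (t, x))" for n t
 proof (induction n)
  case 0 then show ?case using S[of t] by (simp add: V_def F0)
 next
  case (Suc n)
  have "normalized_sob p U c r (\<lambda>x. 1 * V n (t, x) + (-1) * a (J n t) x) (\<lambda>x. 1 *\<^sub>R F n (t, x) + (-1) *\<^sub>R k (J n t) x)"
   by (intro normalized_sob_lincomb p U Suc ak)
  then show ?case by (simp add: V_def FSuc algebra_simps)
 qed
 define b where "b t = nrm p (\<lambda>x. f (t, x))" for t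
 have bfin: "b t < top" for t using S[of t] by (auto simp: b_def normalized_sob_def sob_def)
 have Fdec: "nrm p (\<lambda>x. F n (t, x)) \<le> ennreal ((3/4)^n) * b t" for n t
 proof (induction n)
  case 0 then show ?case by (simp add: F0 b_def)
 next
  case (Suc n)
  have "nrm p (\<lambda>x. F n (t, x) - k (J n t) x) \<le> ennreal (3/4) * nrm p (\<lambda>x. F n (t, x))"
   unfolding J_def greedy_index_def by (rule LeastI_ex[OF red[OF VF]])
  also have "\<dots> \<le> ennreal (3/4) * (ennreal ((3/4)^n) * b t)" by (intro mult_left_mono Suc) simp
  also have "\<dots> = ennreal ((3/4)^Suc n) * b t" by (simp add: ennreal_mult[symmetric] mult.assoc[symmetric])
  finally show ?case by (simp add: FSuc)
 qed
 have geo: "(\<Sum>n. ennreal ((3/4)^n) * B) = 4 * B" for B :: ennreal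
 proof -
  have "(\<Sum>n. ennreal ((3/4)^n)) = ennreal (1 / (1 - 3/4))"
   by (intro suminf_ennreal_eq geometric_sums) auto
  then show ?thesis by simp
 qed
 define G where "G z = (\<Sum>n. ennreal (h (J n (fst z)) (snd z)))" for z
 have Gm: "G \<in> Borel2" unfolding G_def[abs_def] by measurable
 have GL: "Lnorm p (\<lambda>x. G (t, x)) \<le> ennreal (16 * K) * b t" for t
 proof -
  have kn: "nrm p (k (J n t)) \<le> 2 * (ennreal ((3/4)^n) * b t)" for n
  proof -
   note [measurable] = slice_measurable[OF Fm]
   have "nrm p (k (J n t)) = nrm p (\<lambda>x. 1 *\<^sub>R F n (t, x) + (-1) *\<^sub>R F (Suc n) (t, x))" by (simp add: FSuc)
   also have "\<dots> \<le> ennreal \<bar>1\<bar> * nrm p (\<lambda>x. F n (t, x)) + ennreal \<bar>-1\<bar> * nrm p (\<lambda>x. F (Suc n) (t, x))"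
    by (intro nrm_lincomb_le p) measurable
   also have "\<dots> \<le> ennreal ((3/4)^n) * b t + ennreal ((3/4)^n) * b t"
   proof -
    have "nrm p (\<lambda>x. F (Suc n) (t, x)) \<le> ennreal ((3/4)^Suc n) * b t" by (rule Fdec)
    also have "\<dots> \<le> ennreal ((3/4)^n) * b t" by (intro mult_right_mono ennreal_leI) auto
    finally show ?thesis using Fdec[of n t] by (auto intro: add_mono)
   qed
   finally show ?thesis by (simp add: mult_2)
  qed
  have "Lnorm p (\<lambda>x. G (t, x)) \<le> (\<Sum>n. Lnorm p (\<lambda>x. ennreal (h (J n t) x)))"
   unfolding G_def fst_conv snd_conv by (intro Lnorm_suminf_le p) measurable
  also have "\<dots> \<le> (\<Sum>n. ennreal (2 * K) * (2 * (ennreal ((3/4)^n) * b t)))"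
  proof (intro suminf_le)
   fix n
   have "Lnorm p (\<lambda>x. ennreal (h (J n t) x)) = nrm p (h (J n t))" using h0 by simp
   also have "\<dots> \<le> ennreal (2 * K) * nrm p (k (J n t))" by (rule hn)
   also have "\<dots> \<le> ennreal (2 * K) * (2 * (ennreal ((3/4)^n) * b t))" by (intro mult_left_mono kn) simp
   finally show "Lnorm p (\<lambda>x. ennreal (h (J n t) x)) \<le> ennreal (2 * K) * (2 * (ennreal ((3/4)^n) * b t))" .
  qed auto
  \<comment> \<open>The 4 is the sum of (3/4)^n, and the 2 comes from writing a subtracted gradient
    as the difference of two consecutive remainders; together they give
    \<open>16 * K\<close>.\<close>
  also have "\<dots> = ennreal (2 * K) * (2 * (4 * b t))" by (simp only: ennreal_suminf_cmult geo)
  also have "\<dots> = ennreal (16 * K) * b t"     proof -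
   have "ennreal (16 * K) = ennreal ((2 * K) * 8)" by simp
   also have "\<dots> = ennreal (2 * K) * ennreal 8" using K0 by (intro ennreal_mult) auto
   also have "ennreal 8 = 2 * 4" by simp
   finally have "ennreal (16 * K) = ennreal (2 * K) * (2 * 4)" .
   then show ?thesis by (simp only: mult.assoc)
  qed
  finally show ?thesis .
 qed
 obtain E where E: "\<And>j. E j \<in> null_sets lborel"
  "\<And>j x y. x \<in> U - E j ==> y \<in> U - E j ==> \<bar>a j x - a j y\<bar> \<le> norm (x - y) * (h j x + h j y)"
 proof -
  have "\<forall>j. \<exists>E. E \<in> null_sets lborel \<and> (\<forall>x\<in>U - E. \<forall>y\<in>U - E. \<bar>a j x - a j y\<bar> \<le> norm (x - y) * (h j x + h j y))"
   using hh unfolding hajlasz_def by blast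
  from choice[OF this] that show thesis by blast
 qed
 \<comment> \<open>Off the first set the remainders tend to 0. The second uses that all slices draw
   on the same countable family, whose exceptional sets do not depend on \<open>t\<close>.\<close>
 define N where "N = {z. (\<Sum>n. ennreal \<bar>V n z\<bar>) = top} \<union> UNIV \<times> (\<Union>j. E j)"
 have Nm: "N \<in> sets (borel \<Otimes>\<^sub>M borel)"
 proof -
  have [measurable]: "(\<Union>j. E j) \<in> sets borel" using E(1) by (auto simp: null_sets_def)
  have "{z \<in> space (borel \<Otimes>\<^sub>M borel). (\<Sum>n. ennreal \<bar>V n z\<bar>) = top} \<in> sets (borel \<Otimes>\<^sub>M (borel :: 'a measure))" by measurable
  then show ?thesis unfolding N_def by (intro sets.Un pair_measureI) (auto simp: space_pair_measure)
 qed
 have Nn: "N \<in> null_sets lborel"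
 proof (rule null_sets_of_slices[OF Nm], rule AE_I2)
  fix t
  have m1: "(\<lambda>x. ennreal \<bar>V n (t, x)\<bar>) \<in> Borel" for n
  proof -
   have [measurable]: "(\<lambda>x. V n (t, x)) \<in> Borel" by (rule slice_measurable[OF Vm])
   show ?thesis by measurable
  qed
  have Vb: "Lnorm p (\<lambda>x. ennreal \<bar>V n (t, x)\<bar>) \<le> ennreal C * (ennreal ((3/4)^n) * b t)" for n
  proof -
   have "nrm p (\<lambda>x. V n (t, x)) \<le> ennreal C * nrm p (\<lambda>x. F n (t, x))" by (rule P[OF VF])
   also have "\<dots> \<le> ennreal C * (ennreal ((3/4)^n) * b t)" by (rule mult_left_mono[OF Fdec]) simp
   finally show ?thesis by (simp only: real_norm_def)
  qed
  have "Lnorm p (\<lambda>x. \<Sum>n. ennreal \<bar>V n (t, x)\<bar>) \<le> (\<Sum>n. Lnorm p (\<lambda>x. ennreal \<bar>V n (t, x)\<bar>))"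
   by (rule Lnorm_suminf_le[OF p(1) m1])
  also have "\<dots> \<le> (\<Sum>n. ennreal C * (ennreal ((3/4)^n) * b t))"
   by (rule suminf_le[OF Vb]) (rule summableI)+
  also have "\<dots> = ennreal C * (4 * b t)" by (simp only: ennreal_suminf_cmult geo)
  also have "\<dots> < top" using bfin[of t] by (simp add: ennreal_mult_less_top)
  finally have fin: "Lnorm p (\<lambda>x. \<Sum>n. ennreal \<bar>V n (t, x)\<bar>) < top" .
  have "AE x in lborel. (\<Sum>n. ennreal \<bar>V n (t, x)\<bar>) < top"
   by (rule Lnorm_finite_AE[OF p(1) borel_measurable_suminf_order[OF m1] fin])
  moreover have "AE x in lborel. x \<notin> (\<Union>j. E j)" using E(1) by (intro AE_not_in null_sets_UN) auto
  ultimately show "AE x in lborel. (t, x) \<notin> N" by eventually_elim (auto simp: N_def)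
 qed
 have est: "ennreal \<bar>v (t, x) - v (t, y)\<bar> \<le> ennreal (norm (x - y)) * (G (t, x) + G (t, y))"
  if xy: "x \<in> U" "y \<in> U" "(t, x) \<notin> N" "(t, y) \<notin> N" for t x y
 proof -
  have V0: "(\<lambda>n. \<bar>V n (t, z)\<bar>) \<longlonglongrightarrow> 0" if "(t, z) \<notin> N" for z
   using that by (intro summable_LIMSEQ_zero summable_suminf_not_top) (auto simp: N_def)
  have step: "ennreal \<bar>v (t, x) - v (t, y)\<bar> \<le> ennreal (\<bar>V n (t, x)\<bar> + \<bar>V n (t, y)\<bar>) + ennreal (norm (x - y)) * (G (t, x) + G (t, y))" for n
  proof -
   have aj: "\<bar>a j x - a j y\<bar> \<le> norm (x - y) * (h j x + h j y)" for j
    using xy by (intro E(2)) (auto simp: N_def)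
   have "v (t, x) - v (t, y) = V n (t, x) - V n (t, y) + (\<Sum>i<n. a (J i t) x - a (J i t) y)"
    by (simp add: V_def sum_subtractf)
   then have "\<bar>v (t, x) - v (t, y)\<bar> \<le> \<bar>V n (t, x)\<bar> + \<bar>V n (t, y)\<bar> + \<bar>\<Sum>i<n. a (J i t) x - a (J i t) y\<bar>" by linarith
   also have "\<bar>\<Sum>i<n. a (J i t) x - a (J i t) y\<bar> \<le> (\<Sum>i<n. norm (x - y) * (h (J i t) x + h (J i t) y))"
    by (rule order_trans[OF sum_abs sum_mono[OF aj]])
   finally have "ennreal \<bar>v (t, x) - v (t, y)\<bar> \<le> ennreal (\<bar>V n (t, x)\<bar> + \<bar>V n (t, y)\<bar> + (\<Sum>i<n. norm (x - y) * (h (J i t) x + h (J i t) y)))"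
    by (intro ennreal_leI) simp
   also have "\<dots> = ennreal (\<bar>V n (t, x)\<bar> + \<bar>V n (t, y)\<bar>) + ennreal (norm (x - y)) * ((\<Sum>i<n. ennreal (h (J i t) x)) + (\<Sum>i<n. ennreal (h (J i t) y)))"
   proof -
    define SX where "SX = (\<Sum>i<n. h (J i t) x)"
    define SY where "SY = (\<Sum>i<n. h (J i t) y)"
    have pos: "0 \<le> SX" "0 \<le> SY" using h0 by (auto simp: SX_def SY_def intro: sum_nonneg)
    have 1: "(\<Sum>i<n. norm (x - y) * (h (J i t) x + h (J i t) y)) = norm (x - y) * (SX + SY)"
     unfolding SX_def SY_def sum.distrib[symmetric] by (rule sum_distrib_left[symmetric])
    have 2: "(\<Sum>i<n. ennreal (h (J i t) x)) = ennreal SX" "(\<Sum>i<n. ennreal (h (J i t) y)) = ennreal SY"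
     unfolding SX_def SY_def using h0 by (auto intro: sum_ennreal)
    have 3: "ennreal (A + B * (SX + SY)) = ennreal A + ennreal B * (ennreal SX + ennreal SY)" if "0 \<le> A" "0 \<le> B" for A B
     using that pos by (simp only: ennreal_plus ennreal_mult add_nonneg_nonneg mult_nonneg_nonneg)
    show ?thesis unfolding 1 2 by (rule 3) auto
   qed
   also have "\<dots> \<le> ennreal (\<bar>V n (t, x)\<bar> + \<bar>V n (t, y)\<bar>) + ennreal (norm (x - y)) * (G (t, x) + G (t, y))"
    unfolding G_def fst_conv snd_conv by (intro add_left_mono mult_left_mono add_mono sum_le_suminf) auto
   finally show ?thesis .
  qed
  have "(\<lambda>n. ennreal (\<bar>V n (t, x)\<bar> + \<bar>V n (t, y)\<bar>)) \<longlonglongrightarrow> ennreal (0 + 0)"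
   using xy by (intro tendsto_ennrealI tendsto_add V0)
  then have "(\<lambda>n. ennreal (\<bar>V n (t, x)\<bar> + \<bar>V n (t, y)\<bar>) + ennreal (norm (x - y)) * (G (t, x) + G (t, y))) \<longlonglongrightarrow> ennreal (0 + 0) + ennreal (norm (x - y)) * (G (t, x) + G (t, y))"
   by (intro tendsto_add tendsto_const)
  then have lim: "(\<lambda>n. ennreal (\<bar>V n (t, x)\<bar> + \<bar>V n (t, y)\<bar>) + ennreal (norm (x - y)) * (G (t, x) + G (t, y))) \<longlonglongrightarrow> ennreal (norm (x - y)) * (G (t, x) + G (t, y))"
   by (simp only: add_0_left ennreal_0)
  show ?thesis by (rule LIMSEQ_le_const[OF lim]) (intro exI allI impI step)
 qed
 show ?thesis
 proof (intro exI[of _ G] exI[of _ N] conjI allI ballI impI)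
  show "Lnorm p (\<lambda>x. G (t, x)) \<le> ennreal (16 * K) * nrm p (\<lambda>x. f (t, x))" for t using GL[of t] by (simp add: b_def)
  show "ennreal \<bar>v (t, x) - v (t, y)\<bar> \<le> ennreal (norm (x - y)) * (G (t, x) + G (t, y))"
   if "x \<in> U" "y \<in> U" "(t, x) \<notin> N" "(t, y) \<notin> N" for t x y
   using that by (rule est)
 qed (fact Gm Nm Nn)+
qed

section \<open>One-dimensional maximal functions\<close>

text \<open>\<open>s\<close> is the direction, 1 or -1 in the applications. The interval is
  half-open so that adjacent pieces add up without overlap.\<close>

definition line_int :: "real => real => (real \<times> 'a::euclidean_space => ennreal) => real \<times> 'a => ennreal" where
 "line_int s r f z = (NN \<tau>. f (fst z + s * \<tau>, snd z) * indicator {0..<r} \<tau>)"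

text \<open>Only dyadic rational lengths occur: the supremum is then countable, hence measurable,
  and every length is a whole number of steps 2^(-j), as a discrete maximal inequality
  requires.\<close>

definition line_max :: "real => (real \<times> 'a::euclidean_space => ennreal) => real \<times> 'a => ennreal" where
 "line_max s f z = (SUP (j, k)\<in>UNIV. line_int s (real (Suc k) / 2 ^ j) f z / ennreal (real (Suc k) / 2 ^ j))"

lemma line_measurable:
 fixes f :: "real \<times> 'a::euclidean_space => ennreal"
 assumes f [measurable]: "f \<in> Borel2"
 shows line_int_measurable: "line_int s r f \<in> Borel2"
  and line_max_measurable: "line_max s f \<in> Borel2"
proof -
 have "(\<lambda>(z, \<tau>). f (fst z + s * \<tau>, snd z) * indicator {0..<r} \<tau>) \<in> borel_measurable ((borel \<Otimes>\<^sub>M borel) \<Otimes>\<^sub>M lborel)" for r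
  by measurable
 from lborel.borel_measurable_nn_integral[OF this]
 show *: "line_int s r f \<in> Borel2" for r
  unfolding line_int_def[abs_def] by simp
 show "line_max s f \<in> Borel2"
  unfolding line_max_def[abs_def] case_prod_beta
  by (intro borel_measurable_SUP borel_measurable_divide_ennreal * borel_measurable_const) auto
qed

lemma line_int_add:
 fixes f :: "real \<times> 'a::euclidean_space => ennreal"
 assumes f [measurable]: "f \<in> Borel2" and "0 \<le> h" "0 \<le> r"
 shows "line_int s (h + r) f z = line_int s h f z + line_int s r f (fst z + s * h, snd z)"
proof -
 have "line_int s (h + r) f z = (NN \<tau>. f (fst z + s * \<tau>, snd z) * indicator {0..<h} \<tau> + f (fst z + s * \<tau>, snd z) * indicator {h..<h + r} \<tau>)"
  unfolding line_int_def using assms by (intro nn_integral_cong) (auto split: split_indicator)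
 also have "\<dots> = line_int s h f z + (NN \<tau>. f (fst z + s * \<tau>, snd z) * indicator {h..<h + r} \<tau>)"
  unfolding line_int_def by (rule nn_integral_add) measurable
 also have "(NN \<tau>. f (fst z + s * \<tau>, snd z) * indicator {h..<h + r} \<tau>) = (NN \<tau>. f (fst z + s * (h + 1 * \<tau>), snd z) * indicator {h..<h + r} (h + 1 * \<tau>))"
  by (subst nn_integral_real_affine[where c=1 and t=h]) auto
 also have "\<dots> = line_int s r f (fst z + s * h, snd z)"
  unfolding line_int_def by (intro nn_integral_cong) (auto simp: algebra_simps split: split_indicator)
 finally show ?thesis .
qed

lemma nn_integral_translate_fst:
 fixes f :: "real \<times> 'a::euclidean_space => ennreal"
 assumes [measurable]: "f \<in> Borel"
 shows "(NN z. f (fst z + c, snd z)) = (NN z. f z)"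
proof -
 have "(NN z. f z) = (NN z. f ((c, 0) + 1 *\<^sub>R z))"
  by (subst nn_integral_lborel_affine[of f 1 "(c, 0)"]) auto
 also have "\<dots> = (NN z. f (fst z + c, snd z))"
  by (intro nn_integral_cong) (auto simp: plus_prod_def add.commute)
 finally show ?thesis ..
qed

lemma nn_integral_line_int:
 fixes f :: "real \<times> 'a::euclidean_space => ennreal"
 assumes f [measurable]: "f \<in> Borel" and r: "0 \<le> r"
 shows "(NN z. line_int s r f z) = ennreal r * (NN z. f z)"
proof -
 have fm [measurable]: "f \<in> Borel2" unfolding borel_prod by (rule f)
 have "(\<lambda>(\<tau>, z). f (fst z + s * \<tau>, snd z) * indicator {0..<r} \<tau>) \<in> borel_measurable (borel \<Otimes>\<^sub>M (borel \<Otimes>\<^sub>M borel))"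
  by measurable
 then have m: "(\<lambda>(\<tau>, z). f (fst z + s * \<tau>, snd z) * indicator {0..<r} \<tau>) \<in> borel_measurable (lborel \<Otimes>\<^sub>M (lborel :: (real \<times> 'a) measure))"
  by (subst measurable_cong_sets[OF sets_pair_measure_cong[OF sets_lborel sets_lborel] refl]) (simp add: borel_prod)
 have "(NN z. line_int s r f z) = (NN \<tau>. (NN z. f (fst z + s * \<tau>, snd z) * indicator {0..<r} \<tau>))"
  unfolding line_int_def using lborel_pair.Fubini'[OF m] by simp
 also have "\<dots> = (NN \<tau>. (NN z. f z) * indicator {0..<r} \<tau>)"
 proof (intro nn_integral_cong)
  fix \<tau> :: real
  have [measurable]: "(\<lambda>z. f (fst z + s * \<tau>, snd z)) \<in> Borel"
   unfolding borel_prod[symmetric] by measurable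
  have "(NN z. f (fst z + s * \<tau>, snd z) * indicator {0..<r} \<tau>) = (NN z. f (fst z + s * \<tau>, snd z)) * indicator {0..<r} \<tau>"
   by (intro nn_integral_multc) simp
  then show "(NN z. f (fst z + s * \<tau>, snd z) * indicator {0..<r} \<tau>) = (NN z. f z) * indicator {0..<r} \<tau>"
   by (simp add: nn_integral_translate_fst)
 qed
 also have "\<dots> = ennreal r * (NN z. f z)"
  using r by (simp add: nn_integral_cmult_indicator mult.commute)
 finally show ?thesis .
qed

text \<open>Garsia's argument for the maximal ergodic theorem, applied to the translation by \<open>h\<close>: the truncated
 subtraction of \<^typ>\<open>ennreal\<close> computes the positive part in the recursion.\<close>

primrec garsia :: "real => real => ennreal => (real \<times> 'a::euclidean_space => ennreal) => nat => real \<times> 'a => ennreal" where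
 "garsia s h c a 0 = (\<lambda>z. 0)"
| "garsia s h c a (Suc n) = (\<lambda>z. a z + garsia s h c a n (fst z + s * h, snd z) - c)"

lemma garsia_measurable:
 fixes a :: "real \<times> 'a::euclidean_space => ennreal"
 assumes [measurable]: "a \<in> Borel2"
 shows "garsia s h c a n \<in> Borel2"
proof (induction n)
 case (Suc n)
 note [measurable] = Suc
 have "(\<lambda>z. garsia s h c a n (fst z + s * h, snd z)) \<in> Borel2"
  by (rule measurable_compose[OF _ Suc]) measurable
 then show ?case by simp
qed simp

lemma garsia_incr: "garsia s h c a n z \<le> garsia s h c a (Suc n) z"
proof (induction n arbitrary: z)
 case (Suc n)
 show ?case by (simp only: garsia.simps(2)) (intro ennreal_minus_mono add_left_mono Suc[unfolded garsia.simps(2)] order_refl)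
qed simp

text \<open>Where the \<open>n\<close>-th function P is positive, nothing was truncated and P + c
  equals \<open>a\<close> plus the previous function at the translated point, which is at most P
  there; elsewhere there is nothing to show. Integrate: by translation invariance the integrals of P
  cancel, being finite.\<close>

lemma garsia_weak:
 fixes a :: "real \<times> 'a::euclidean_space => ennreal"
 assumes [measurable]: "a \<in> Borel2" and fin: "(NN z. a z) < top" and c: "c < top"
 shows "c * emeasure lborel {z. 0 < garsia s h c a n z} \<le> (NN z. a z)"
proof -
 let ?P = "garsia s h c a"
 have am [measurable]: "a \<in> Borel" using assms(1) by (simp add: borel_prod)
 have Pm [measurable]: "?P n \<in> Borel" for n
  using garsia_measurable[OF assms(1)] by (simp add: borel_prod)
 have Tm [measurable]: "(\<lambda>z. ?P n (fst z + s * h, snd z)) \<in> Borel" for n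
 proof -
  have "(\<lambda>z. ?P n (fst z + s * h, snd z)) \<in> Borel2"
   by (rule measurable_compose[OF _ garsia_measurable[OF assms(1)]]) measurable
  then show ?thesis unfolding borel_prod .
 qed
 have Pfin: "(NN z. ?P n z) < top" for n
 proof (induction n)
  case (Suc n)
  have "(NN z. ?P (Suc n) z) \<le> (NN z. a z + ?P n (fst z + s * h, snd z))"
   by (intro nn_integral_mono) (simp add: diff_le_self_ennreal)
  also have "\<dots> = (NN z. a z) + (NN z. ?P n z)"
   by (subst nn_integral_add) (simp_all add: nn_integral_translate_fst)
  finally show ?case using Suc fin by (auto intro: le_less_trans)
 qed simp
 show ?thesis
 proof (cases n)
  case (Suc m)
  let ?E = "{z. 0 < ?P n z}"
  have Em [measurable]: "?E \<in> sets borel" by measurable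
  have "(NN z. ?P n z) + c * emeasure lborel ?E = (NN z. ?P n z + c * indicator ?E z)"
   by (subst nn_integral_add) (auto simp: nn_integral_cmult_indicator)
  also have "\<dots> \<le> (NN z. a z + ?P n (fst z + s * h, snd z))"
  proof (intro nn_integral_mono)
   fix z
   show "?P n z + c * indicator ?E z \<le> a z + ?P n (fst z + s * h, snd z)"
   proof (cases "z \<in> ?E")
    case True
    then have "0 < (a z + ?P m (fst z + s * h, snd z)) - c" by (simp add: Suc)
    then have "c \<le> a z + ?P m (fst z + s * h, snd z)"
    proof (rule contrapos_pp)
     assume "\<not> c \<le> a z + ?P m (fst z + s * h, snd z)"
     then have "a z + ?P m (fst z + s * h, snd z) < c" by (simp only: not_le)
     then have "(a z + ?P m (fst z + s * h, snd z)) - c = 0"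
      using less_trans[OF _ c] by (intro diff_eq_0_ennreal less_imp_le)
     then show "\<not> 0 < (a z + ?P m (fst z + s * h, snd z)) - c" by (simp only: less_irrefl not_False_eq_True)
    qed
    then have "?P n z + c = a z + ?P m (fst z + s * h, snd z)" by (simp add: Suc diff_add_cancel_ennreal)
    also have "\<dots> \<le> a z + ?P n (fst z + s * h, snd z)" unfolding Suc by (intro add_left_mono garsia_incr)
    finally show ?thesis using True by simp
   qed simp
  qed
  also have "\<dots> = (NN z. ?P n z) + (NN z. a z)"
   by (subst nn_integral_add) (simp_all add: nn_integral_translate_fst add.commute)
  finally show ?thesis using Pfin[of n] by (auto simp: ennreal_add_left_cancel_le)
 qed simp
qed

text \<open>Every step of length \<open>h\<close> costs at most \<open>c\<close> beyond the positive
  part. Hence an integral over \<open>k\<close> steps that exceeds \<open>k\<close> times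
  \<open>c\<close> forces the Garsia function to be positive.\<close>

lemma garsia_lower:
 fixes f :: "real \<times> 'a::euclidean_space => ennreal"
 assumes f: "f \<in> Borel2" and h: "0 \<le> h"
 shows "line_int s (real k * h) f z \<le> of_nat k * c + garsia s h c (line_int s h f) k z"
proof (induction k arbitrary: z)
 case 0 then show ?case by (simp add: line_int_def)
next
 case (Suc k)
 let ?z = "(fst z + s * h, snd z)"
 let ?P = "garsia s h c (line_int s h f)"
 have "line_int s (real (Suc k) * h) f z = line_int s (h + real k * h) f z" by (simp add: algebra_simps)
 also have "\<dots> = line_int s h f z + line_int s (real k * h) f ?z" using h by (intro line_int_add f) auto
 also have "\<dots> \<le> line_int s h f z + (of_nat k * c + ?P k ?z)" by (intro add_left_mono Suc)
 also have "\<dots> = of_nat k * c + (line_int s h f z + ?P k ?z)" by (simp add: add_ac)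
 also have "\<dots> \<le> of_nat k * c + (c + (line_int s h f z + ?P k ?z - c))"
  by (intro add_left_mono) (metis add.commute ennreal_minus_le_iff order_refl)
 also have "\<dots> = of_nat (Suc k) * c + ?P (Suc k) z" by (simp add: algebra_simps)
 finally show ?case .
qed

text \<open>For a fixed dyadic scale the superlevel set is covered by positivity sets of Garsia
  functions, which increase with the number of steps. The resulting sets also increase as the scale
  is refined, so both suprema pass through the measure and the constant stays 1.\<close>

lemma line_max_weak:
 fixes f :: "real \<times> 'a::euclidean_space => ennreal"
 assumes f: "f \<in> Borel2" and l: "0 < l"
 shows "ennreal l * emeasure lborel {z. ennreal l < line_max s f z} \<le> (NN z. f z)"
proof (cases "(NN z. f z) = top")
 case False
 have fb: "f \<in> Borel" using f by (simp add: borel_prod)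
 \<comment> \<open>The threshold per step of length 2^(-j): an average above \<open>l\<close> over
   \<open>Suc k\<close> steps is an integral above \<open>Suc k\<close> times
   \<open>c j\<close>.\<close>
 define c where "c j = ennreal (l / 2 ^ j)" for j :: nat
 define a where "a j = line_int s (1 / 2 ^ j) f" for j :: nat
 have am: "a j \<in> Borel2" for j unfolding a_def by (rule line_int_measurable[OF f])
 define E where "E j n = {z. 0 < garsia s (1 / 2 ^ j) (c j) (a j) n z}" for j n
 have Em [measurable]: "E j n \<in> sets borel" for j n
  unfolding E_def using garsia_measurable[OF am, of s "1/2^j" "c j" j n] by (simp add: borel_prod)
 have Ew: "ennreal l * emeasure lborel (E j n) \<le> (NN z. f z)" for j n
 proof -
  have I: "(NN z. a j z) = ennreal (1 / 2 ^ j) * (NN z. f z)"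
   unfolding a_def by (rule nn_integral_line_int[OF fb]) simp
  then have "(NN z. a j z) < top" using False by (simp add: ennreal_mult_less_top less_top)
  from garsia_weak[OF am this, of "c j" s "1/2^j" n]
  have "c j * emeasure lborel (E j n) \<le> ennreal (1 / 2 ^ j) * (NN z. f z)"
   by (simp add: I E_def c_def)
  then have "ennreal (2^j) * (c j * emeasure lborel (E j n)) \<le> ennreal (2^j) * (ennreal (1 / 2 ^ j) * (NN z. f z))"
   by (rule mult_left_mono) simp
  then show ?thesis using l by (simp add: mult.assoc[symmetric] c_def ennreal_mult[symmetric])
 qed
 define D where "D j k = {z. ennreal (l * (real (Suc k) / 2^j)) < line_int s (real (Suc k) / 2^j) f z}" for j k
 have DE: "D j k \<subseteq> E j (Suc k)" for j k
 proof
  fix z assume "z \<in> D j k"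
  then have 1: "ennreal (l * (real (Suc k) / 2^j)) < line_int s (real (Suc k) * (1/2^j)) f z" by (simp add: D_def)
  also have "\<dots> \<le> of_nat (Suc k) * c j + garsia s (1/2^j) (c j) (a j) (Suc k) z"
   unfolding a_def by (rule garsia_lower[OF f]) simp
  finally have "0 < garsia s (1/2^j) (c j) (a j) (Suc k) z"
  proof (rule contrapos_pp)
   assume "\<not> 0 < garsia s (1/2^j) (c j) (a j) (Suc k) z"
   then have "garsia s (1/2^j) (c j) (a j) (Suc k) z = 0" by (simp only: zero_less_iff_neq_zero not_not)
   then have "of_nat (Suc k) * c j + garsia s (1/2^j) (c j) (a j) (Suc k) z = ennreal (l * (real (Suc k) / 2^j))"
    using l by (simp only: c_def ennreal_of_nat_eq_real_of_nat add_0_right) (subst ennreal_mult[symmetric], simp_all add: mult.commute)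
   then show "\<not> ennreal (l * (real (Suc k) / 2^j)) < of_nat (Suc k) * c j + garsia s (1/2^j) (c j) (a j) (Suc k) z" by simp
  qed
  then show "z \<in> E j (Suc k)" by (simp add: E_def)
 qed
 have Einc: "incseq (E j)" for j
 proof (intro incseq_SucI subsetI)
  fix n z assume "z \<in> E j n"
  then have "0 < garsia s (1 / 2 ^ j) (c j) (a j) n z" by (simp only: E_def mem_Collect_eq)
  then have "0 < garsia s (1 / 2 ^ j) (c j) (a j) (Suc n) z" by (rule less_le_trans[OF _ garsia_incr])
  then show "z \<in> E j (Suc n)" by (simp only: E_def mem_Collect_eq)
 qed
 define B where "B j = (\<Union>k. D j k)" for j
 have Dm [measurable]: "D j k \<in> sets borel" for j k
  unfolding D_def using line_int_measurable[OF f, of s "real (Suc k) / 2^j"] by (simp add: borel_prod)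
 have Bm [measurable]: "B j \<in> sets borel" for j unfolding B_def by measurable
 have Bw: "ennreal l * emeasure lborel (B j) \<le> (NN z. f z)" for j
 proof -
  have "B j \<subseteq> (\<Union>n. E j n)" using DE by (auto simp: B_def)
  then have "emeasure lborel (B j) \<le> emeasure lborel (\<Union>n. E j n)" by (intro emeasure_mono) auto
  also have "\<dots> = (SUP n. emeasure lborel (E j n))"
   using Einc[of j] by (intro SUP_emeasure_incseq[symmetric]) auto
  finally have "ennreal l * emeasure lborel (B j) \<le> ennreal l * (SUP n. emeasure lborel (E j n))"
   by (intro mult_left_mono) auto
  also have "\<dots> = (SUP n. ennreal l * emeasure lborel (E j n))" by (simp add: SUP_mult_left_ennreal)
  also have "\<dots> \<le> (NN z. f z)" by (intro SUP_least Ew)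
  finally show ?thesis .
 qed
 have Binc: "incseq B"
 proof (intro incseq_SucI)
  fix j
  \<comment> \<open>The same length at the next scale: k + 1 steps become 2 k + 2, which is the
    successor of 2 k + 1.\<close>
  have "D j k \<subseteq> D (Suc j) (2 * k + 1)" for k
  proof -
   have "real (Suc (2 * k + 1)) / 2 ^ Suc j = real (Suc k) / 2 ^ j" by (simp add: field_simps)
   then show ?thesis unfolding D_def by simp
  qed
  then show "B j \<subseteq> B (Suc j)" by (auto simp: B_def)
 qed
 have "{z. ennreal l < line_max s f z} \<subseteq> (\<Union>j. B j)"
 proof
  fix z assume "z \<in> {z. ennreal l < line_max s f z}"
  then obtain j k where jk: "ennreal l < line_int s (real (Suc k) / 2 ^ j) f z / ennreal (real (Suc k) / 2 ^ j)"
   by (auto simp: line_max_def less_SUP_iff)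
  define r where "r = real (Suc k) / 2 ^ j"
  have r: "0 < r" by (simp add: r_def)
  have "ennreal l * ennreal r < line_int s r f z / ennreal r * ennreal r"
   using jk r unfolding r_def[symmetric] by (intro ennreal_mult_strict_right_mono) auto
  also have "\<dots> = line_int s r f z" using r by (subst ennreal_divide_times) auto
  finally have "ennreal (l * r) < line_int s r f z" using l r by (simp add: ennreal_mult)
  then have "z \<in> D j k" by (simp add: D_def r_def)
  then show "z \<in> (\<Union>j. B j)" by (auto simp: B_def)
 qed
 then have "emeasure lborel {z. ennreal l < line_max s f z} \<le> emeasure lborel (\<Union>j. B j)" by (intro emeasure_mono) auto
 also have "\<dots> = (SUP j. emeasure lborel (B j))" using Binc by (intro SUP_emeasure_incseq[symmetric]) auto
 finally have "ennreal l * emeasure lborel {z. ennreal l < line_max s f z} \<le> ennreal l * (SUP j. emeasure lborel (B j))"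
  by (intro mult_left_mono) auto
 also have "\<dots> = (SUP j. ennreal l * emeasure lborel (B j))" by (simp add: SUP_mult_left_ennreal)
 also have "\<dots> \<le> (NN z. f z)" by (intro SUP_least Bw)
 finally show ?thesis .
qed simp

text \<open>The layer cake formula in the variable \<open>\<sigma> = - ln \<lambda>\<close>, which removes the singularity at \<open>\<lambda> = 0\<close>.\<close>

lemma layer_cake:
 assumes q: "0 < q"
 shows "(NN \<sigma>. ennreal (q * exp (- (q * \<sigma>))) * indicator {\<sigma>. ennreal (exp (- \<sigma>)) \<le> y} \<sigma>) = epow q y"
proof -
 have fin: "(NN \<sigma>. ennreal (q * exp (- (q * \<sigma>))) * indicator {\<sigma>. ennreal (exp (- \<sigma>)) \<le> ennreal r} \<sigma>) = ennreal (r powr q)"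
  if r: "0 < r" for r
 proof -
  have "(ennreal (exp (- \<sigma>)) \<le> ennreal r) \<longleftrightarrow> \<sigma> \<in> {- ln r..}" for \<sigma>
  proof -
   have "exp (- \<sigma>) \<le> r \<longleftrightarrow> - \<sigma> \<le> ln r" using exp_le_cancel_iff[of "- \<sigma>" "ln r"] r by simp
   then show ?thesis using r by auto
  qed
  then have "(NN \<sigma>. ennreal (q * exp (- (q * \<sigma>))) * indicator {\<sigma>. ennreal (exp (- \<sigma>)) \<le> ennreal r} \<sigma>)
   = (NN \<sigma>. ennreal (q * exp (- (q * \<sigma>))) * indicator {- ln r..} \<sigma>)"
   by (intro nn_integral_cong) (auto split: split_indicator)
  also have "\<dots> = ennreal (0 - (- exp (- (q * (- ln r)))))"
  proof (rule nn_integral_FTC_atLeast)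
   show "DERIV (\<lambda>\<sigma>. - exp (- (q * \<sigma>))) x :> q * exp (- (q * x))" for x
    by (auto intro!: derivative_eq_intros)
   have "filterlim (\<lambda>\<sigma>. q * \<sigma>) at_top at_top"
    using q by (intro filterlim_tendsto_pos_mult_at_top[OF tendsto_const] filterlim_ident)
   then have "filterlim (\<lambda>\<sigma>. - (q * \<sigma>)) at_bot at_top" by (simp add: filterlim_uminus_at_top)
   then have "((\<lambda>\<sigma>. exp (- (q * \<sigma>))) \<longlongrightarrow> 0) at_top" by (rule filterlim_compose[OF exp_at_bot])
   from tendsto_minus[OF this] show "((\<lambda>\<sigma>. - exp (- (q * \<sigma>))) \<longlongrightarrow> 0) at_top" by simp
  qed (use q in auto)
  also have "\<dots> = ennreal (r powr q)" using r by (simp add: powr_def)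
  finally show ?thesis .
 qed
 show ?thesis
 proof (cases y)
  case (real r)
  show ?thesis
  proof (cases "r = 0")
   case True
   have "\<not> ennreal (exp (- \<sigma>)) \<le> 0" for \<sigma> :: real by (simp add: ennreal_eq_0_iff not_le)
   then show ?thesis using real True by simp
  next
   case False
   then show ?thesis using fin[of r] real by (simp add: epow_ennreal)
  qed
 next
  case top
  have "ennreal (real n) \<le> (NN \<sigma>. ennreal (q * exp (- (q * \<sigma>))) * indicator {\<sigma>. ennreal (exp (- \<sigma>)) \<le> y} \<sigma>)" for n
  proof -
   have r: "0 < (real (Suc n)) powr (1/q)" by simp
   have "ennreal (real n) \<le> ennreal (((real (Suc n)) powr (1/q)) powr q)" using q by (intro ennreal_leI) (simp add: powr_powr)
   also have "\<dots> \<le> (NN \<sigma>. ennreal (q * exp (- (q * \<sigma>))) * indicator {\<sigma>. ennreal (exp (- \<sigma>)) \<le> y} \<sigma>)"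
    unfolding fin[OF r, symmetric] top by (intro nn_integral_mono) (auto split: split_indicator)
   finally show ?thesis .
  qed
  then have "(SUP n. of_nat n) \<le> (NN \<sigma>. ennreal (q * exp (- (q * \<sigma>))) * indicator {\<sigma>. ennreal (exp (- \<sigma>)) \<le> y} \<sigma>)"
   by (intro SUP_least) (simp only: ennreal_of_nat_eq_real_of_nat)
  then have "(NN \<sigma>. ennreal (q * exp (- (q * \<sigma>))) * indicator {\<sigma>. ennreal (exp (- \<sigma>)) \<le> y} \<sigma>) = top"
   by (simp only: ennreal_SUP_of_nat_eq_top top_unique)
  then show ?thesis using top by simp
 qed
qed

text \<open>A dyadic length between \<open>r\<close> and \<open>2 * r\<close> exists: take a scale
  finer than \<open>r\<close> and round up. This passes from the dyadic supremum to arbitrary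
  lengths.\<close>

lemma line_int_cmult_le_max:
 fixes f :: "real \<times> 'a::euclidean_space => ennreal"
 assumes r: "0 < r"
 shows "line_int s r f z \<le> ennreal (2 * r) * line_max s f z"
proof -
 obtain j where j: "(1/2)^j < r" using real_arch_pow_inv[of r "1/2"] r by auto
 define k where "k = nat \<lfloor>r * 2 ^ j\<rfloor>"
 have kr: "real k \<le> r * 2^j" "r * 2^j < real k + 1" using r by (auto simp: k_def)
 define R where "R = real (Suc k) / 2 ^ j"
 have "1 \<le> r * 2 ^ j" using j by (simp add: power_one_over field_simps)
 then have R: "0 < R" "r \<le> R" "R \<le> 2 * r"
  using kr by (auto simp: R_def field_simps)
 have "line_int s r f z \<le> line_int s R f z"
  unfolding line_int_def using R by (intro nn_integral_mono) (auto split: split_indicator)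
 also have "\<dots> = ennreal R * (line_int s R f z / ennreal R)"
  using R(1) by (subst ennreal_times_divide, subst mult.commute, subst mult_divide_eq_ennreal) auto
 also have "\<dots> \<le> ennreal (2 * r) * line_max s f z"
  using R unfolding line_max_def R_def by (intro mult_mono ennreal_leI SUP_upper2[of "(j, k)"]) auto
 finally show ?thesis .
qed

lemma line_max_split:
 fixes f g :: "real \<times> 'a::euclidean_space => ennreal"
 assumes g [measurable]: "g \<in> Borel2" and le: "\<And>z. f z \<le> g z + c"
 shows "line_max s f z \<le> line_max s g z + c"
proof -
 have "line_int s r f z / ennreal r \<le> line_max s g z + c" if r: "r = real (Suc k) / 2 ^ j" for r j k
 proof -
  have r0: "0 < r" by (simp add: r)
  have "line_int s r f z \<le> (NN \<tau>. g (fst z + s * \<tau>, snd z) * indicator {0..<r} \<tau> + c * indicator {0..<r} \<tau>)"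
   unfolding line_int_def using le by (intro nn_integral_mono) (auto split: split_indicator)
  also have "\<dots> = line_int s r g z + c * ennreal r"
   unfolding line_int_def using r0 by (subst nn_integral_add) (auto simp: nn_integral_cmult_indicator)
  finally have "line_int s r f z / ennreal r \<le> (line_int s r g z + c * ennreal r) / ennreal r"
   by (rule divide_right_mono_ennreal)
  also have "\<dots> = line_int s r g z / ennreal r + c"
   using r0 by (simp add: add_divide_distrib_ennreal mult_divide_eq_ennreal)
  also have "\<dots> \<le> line_max s g z + c"
   unfolding line_max_def r by (intro add_right_mono SUP_upper2[of "(j, k)"]) auto
  finally show ?thesis .
 qed
 then show ?thesis unfolding line_max_def[of s f] by (intro SUP_least) auto
qed

lemma epow_split: "1 < q ==> epow q y = y * epow (q - 1) y"
proof (cases y)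
 case (real r)
 assume q: "1 < q"
 have "r powr q = r * r powr (q - 1)" using real q by (cases "r = 0") (auto simp: powr_mult_base)
 then show ?thesis using real by (simp add: epow_ennreal ennreal_mult)
qed simp

text \<open>Marcinkiewicz truncation: the part of \<open>f\<close> below \<open>l / 4\<close> adds
  at most \<open>l / 4\<close> to the maximal function, so where this is at least \<open>l\<close>
  the large part alone exceeds \<open>l / 2\<close>. The weak bound is applied to the large
  part.\<close>

lemma line_max_level:
 fixes f :: "real \<times> 'a::euclidean_space => ennreal"
 assumes f [measurable]: "f \<in> Borel2" and l: "0 < l"
 shows "emeasure lborel {z. ennreal l \<le> line_max s f z} \<le> ennreal (2 / l) * (NN z. f z * indicator {y. ennreal l \<le> 4 * y} (f z))"
proof -
 define g where "g z = f z * indicator {y. ennreal l \<le> 4 * y} (f z)" for z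
 have [measurable]: "{y::ennreal. ennreal l \<le> 4 * y} \<in> sets borel" by measurable
 have g [measurable]: "g \<in> Borel2" unfolding g_def[abs_def] by measurable
 have "f z \<le> g z + ennreal (l / 4)" for z
 proof (cases "ennreal l \<le> 4 * f z")
  case False
  then obtain r where r: "f z = ennreal r" "0 \<le> r" by (cases "f z") (auto simp: ennreal_mult_top)
  have "4 * r < l" using False r l by (simp add: not_le numeral_mult_ennreal ennreal_less_iff)
  then show ?thesis using r False by (simp add: g_def ennreal_leI)
 qed (simp add: g_def add_increasing2)
 then have sp: "line_max s f z \<le> line_max s g z + ennreal (l / 4)" for z by (rule line_max_split[OF g])
 have sub: "{z. ennreal l \<le> line_max s f z} \<subseteq> {z. ennreal (l / 2) < line_max s g z}"
 proof
  fix z assume "z \<in> {z. ennreal l \<le> line_max s f z}"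
  then have 1: "ennreal l \<le> line_max s g z + ennreal (l / 4)" using sp[of z] by (auto intro: order_trans)
  have "\<not> line_max s g z \<le> ennreal (l / 2)"
  proof
   assume "line_max s g z \<le> ennreal (l / 2)"
   then have "ennreal l \<le> ennreal (l / 2) + ennreal (l / 4)" using 1 by (meson add_right_mono order_trans)
   then show False using l by (simp add: ennreal_plus[symmetric] del: ennreal_plus)
  qed
  then show "z \<in> {z. ennreal (l / 2) < line_max s g z}" by simp
 qed
 have [measurable]: "line_max s g \<in> Borel" using line_max_measurable[OF g] by (simp add: borel_prod)
 have "emeasure lborel {z. ennreal l \<le> line_max s f z} \<le> emeasure lborel {z. ennreal (l / 2) < line_max s g z}"
  using sub by (intro emeasure_mono) auto
 also have "\<dots> = ennreal (2 / l) * (ennreal (l / 2) * emeasure lborel {z. ennreal (l / 2) < line_max s g z})"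
  using l by (simp add: mult.assoc[symmetric] ennreal_mult[symmetric])
 also have "\<dots> \<le> ennreal (2 / l) * (NN z. g z)"
  using line_max_weak[OF g, of "l / 2"] l by (intro mult_left_mono) auto
 finally show ?thesis by (simp add: g_def)
qed

text \<open>For finite \<open>p\<close>: layer cake, the level estimate at exp(-\<sigma>), Tonelli,
  and the layer cake again with exponent \<open>q - 1\<close> applied to \<open>4 * f\<close>. The
  weight integrates only because \<open>q > 1\<close>.\<close>

lemma line_max_strong:
 assumes p: "1 < p"
 shows "\<exists>C\<ge>0. \<forall>s. \<forall>f :: real \<times> 'a::euclidean_space => ennreal. f \<in> Borel2 -->
  Lnorm p (line_max s f) \<le> ennreal C * Lnorm p f"
proof (cases "p = \<infinity>")
 case True
 have "Lnorm p (line_max s f) \<le> Lnorm p f" if f [measurable]: "f \<in> Borel2"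
  for s and f :: "real \<times> 'a => ennreal"
 proof (rule ennreal_le_epsilon)
  fix e :: real assume e: "0 < e" and fin: "Lnorm p f < top"
  define c where "c = Lnorm p f"
  \<comment> \<open>The part of \<open>f\<close> above its essential bound is zero almost
    everywhere; the weak estimate shows that its maximal function is then at most \<open>e\<close>
    almost everywhere.\<close>
  define g where "g z = f z * indicator {y. c < y} (f z)" for z
  have g [measurable]: "g \<in> Borel2" unfolding g_def[abs_def] by measurable
  have gb [measurable]: "g \<in> Borel" using g by (simp add: borel_prod)
  have "f z \<le> g z + c" for z by (auto simp: g_def add_increasing2 split: split_indicator)
  then have sp: "line_max s f z \<le> line_max s g z + c" for z by (rule line_max_split[OF g])
  have "AE z in lborel. f z \<le> c" using Lnorm_infinity_le_iff[of f c] True by (simp add: c_def)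
  then have "AE z in lborel. g z = 0" by eventually_elim (auto simp: g_def)
  then have "(NN z. g z) = 0" by (subst nn_integral_0_iff_AE) auto
  then have "ennreal e * emeasure lborel {z. ennreal e < line_max s g z} = 0"
   using line_max_weak[OF g e, of s] by simp
  then have 0: "emeasure lborel {z. ennreal e < line_max s g z} = 0" using e by simp
  have [measurable]: "line_max s g \<in> Borel" using line_max_measurable[OF g] by (simp add: borel_prod)
  have "AE z in lborel. line_max s g z \<le> ennreal e"
   using 0 by (intro AE_I[of _ _ "{z. ennreal e < line_max s g z}"]) (auto simp: not_le)
  then have "AE z in lborel. line_max s f z \<le> c + ennreal e"
   by eventually_elim (use sp in \<open>metis add.commute add_left_mono order_trans\<close>)
  then show "Lnorm p (line_max s f) \<le> Lnorm p f + ennreal e"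
   using Lnorm_infinity_le_iff[of "line_max s f" "c + ennreal e"] True by (simp add: c_def)
 qed
 then show ?thesis by (intro exI[of _ 1]) simp
next
 case False
 define q where "q = enn2real p"
 have p1: "1 \<le> p" using p by simp
 have q: "1 < q"
 proof -
  have "ennreal q = p" using False by (simp add: q_def less_top)
  then show ?thesis using p by (metis one_less_ennreal)
 qed
 \<comment> \<open>The factor \<open>2 * q / (q - 1)\<close> collects the 2 of the level estimate
   and the change of weight from \<open>q\<close> to \<open>q - 1\<close>; the power of 4 is that of
   the truncation level.\<close>
 define c where "c = 2 * q / (q - 1) * 4 powr (q - 1)"
 have c: "0 \<le> c" using q by (simp add: c_def)
 show ?thesis
 proof (intro exI[of _ "c powr (1/q)"] conjI allI impI)
  fix s and f :: "real \<times> 'a => ennreal" assume f [measurable]: "f \<in> Borel2"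
  have fb [measurable]: "f \<in> Borel" using f by (simp add: borel_prod)
  have Mb [measurable]: "line_max s f \<in> Borel" using line_max_measurable[OF f] by (simp add: borel_prod)
  have [measurable]: "(\<lambda>x::real \<times> (real \<times> 'a). line_max s f (snd x)) \<in> borel_measurable (lborel \<Otimes>\<^sub>M lborel)"
   by (rule measurable_compose[OF measurable_snd]) simp
  have [measurable]: "(\<lambda>x::real \<times> (real \<times> 'a). f (snd x)) \<in> borel_measurable (lborel \<Otimes>\<^sub>M lborel)"
   by (rule measurable_compose[OF measurable_snd]) simp
  let ?w = "\<lambda>\<sigma>. ennreal (q * exp (- (q * \<sigma>)))"
  have "(NN z. epow q (line_max s f z)) = (NN z. (NN \<sigma>. ?w \<sigma> * indicator {\<sigma>. ennreal (exp (- \<sigma>)) \<le> line_max s f z} \<sigma>))"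
   using q by (simp add: layer_cake)
  also have "\<dots> = (NN \<sigma>. (NN z. ?w \<sigma> * indicator {\<sigma>. ennreal (exp (- \<sigma>)) \<le> line_max s f z} \<sigma>))"
   by (rule lborel_pair.Fubini') (simp add: case_prod_beta indicator_def)
  also have "\<dots> \<le> (NN \<sigma>. (NN z. ennreal (2 * q / (q - 1)) * f z * (ennreal ((q - 1) * exp (- ((q - 1) * \<sigma>))) * indicator {\<sigma>. ennreal (exp (- \<sigma>)) \<le> 4 * f z} \<sigma>)))"
  proof (rule nn_integral_mono)
   fix \<sigma> :: real
   let ?l = "exp (- \<sigma>)"
   have "(NN z. ?w \<sigma> * indicator {\<sigma>. ennreal (exp (- \<sigma>)) \<le> line_max s f z} \<sigma>) = (NN z. ?w \<sigma> * indicator {z. ennreal ?l \<le> line_max s f z} z)"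
    by (intro nn_integral_cong) (auto split: split_indicator)
   also have "\<dots> = ?w \<sigma> * emeasure lborel {z. ennreal ?l \<le> line_max s f z}"
    by (intro nn_integral_cmult_indicator) measurable
   also have "\<dots> \<le> ?w \<sigma> * (ennreal (2 / ?l) * (NN z. f z * indicator {y. ennreal ?l \<le> 4 * y} (f z)))"
    by (intro mult_left_mono line_max_level f) auto
   also have "\<dots> = ennreal (2 * q / (q - 1) * ((q - 1) * exp (- ((q - 1) * \<sigma>)))) * (NN z. f z * indicator {y. ennreal ?l \<le> 4 * y} (f z))"
   proof -
    have "q * exp (- (q * \<sigma>)) * (2 / ?l) = 2 * q / (q - 1) * ((q - 1) * exp (- ((q - 1) * \<sigma>)))"
     using q by (simp add: exp_minus field_simps flip: exp_add)
    then show ?thesis using q by (simp add: mult.assoc[symmetric] ennreal_mult[symmetric])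
   qed
   also have "\<dots> = (NN z. ennreal (2 * q / (q - 1) * ((q - 1) * exp (- ((q - 1) * \<sigma>)))) * (f z * indicator {y. ennreal ?l \<le> 4 * y} (f z)))"
   proof (rule nn_integral_cmult[symmetric])
    have [measurable]: "{y::ennreal. ennreal ?l \<le> 4 * y} \<in> sets borel" by measurable
    show "(\<lambda>z. f z * indicator {y. ennreal ?l \<le> 4 * y} (f z)) \<in> borel_measurable lborel" by measurable
   qed
   also have "\<dots> = (NN z. ennreal (2 * q / (q - 1)) * f z * (ennreal ((q - 1) * exp (- ((q - 1) * \<sigma>))) * indicator {\<sigma>. ennreal (exp (- \<sigma>)) \<le> 4 * f z} \<sigma>))"
   proof (intro nn_integral_cong)
    fix z
    have "ennreal (2 * q / (q - 1) * ((q - 1) * exp (- ((q - 1) * \<sigma>)))) = ennreal (2 * q / (q - 1)) * ennreal ((q - 1) * exp (- ((q - 1) * \<sigma>)))"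
     using q by (intro ennreal_mult) auto
    then show "ennreal (2 * q / (q - 1) * ((q - 1) * exp (- ((q - 1) * \<sigma>)))) * (f z * indicator {y. ennreal ?l \<le> 4 * y} (f z)) = ennreal (2 * q / (q - 1)) * f z * (ennreal ((q - 1) * exp (- ((q - 1) * \<sigma>))) * indicator {\<sigma>. ennreal (exp (- \<sigma>)) \<le> 4 * f z} \<sigma>)"
     by (simp only:) (simp add: mult_ac indicator_def)
   qed
   finally show "(NN z. ?w \<sigma> * indicator {\<sigma>. ennreal (exp (- \<sigma>)) \<le> line_max s f z} \<sigma>) \<le> (NN z. ennreal (2 * q / (q - 1)) * f z * (ennreal ((q - 1) * exp (- ((q - 1) * \<sigma>))) * indicator {\<sigma>. ennreal (exp (- \<sigma>)) \<le> 4 * f z} \<sigma>))" .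
  qed
  also have "\<dots> = (NN z. (NN \<sigma>. ennreal (2 * q / (q - 1)) * f z * (ennreal ((q - 1) * exp (- ((q - 1) * \<sigma>))) * indicator {\<sigma>. ennreal (exp (- \<sigma>)) \<le> 4 * f z} \<sigma>)))"
   by (rule lborel_pair.Fubini'[symmetric]) (simp add: case_prod_beta indicator_def)
  also have "\<dots> = (NN z. ennreal c * epow q (f z))"
  proof (intro nn_integral_cong)
   fix z
   have "(NN \<sigma>. ennreal (2 * q / (q - 1)) * f z * (ennreal ((q - 1) * exp (- ((q - 1) * \<sigma>))) * indicator {\<sigma>. ennreal (exp (- \<sigma>)) \<le> 4 * f z} \<sigma>))
    = ennreal (2 * q / (q - 1)) * f z * (NN \<sigma>. ennreal ((q - 1) * exp (- ((q - 1) * \<sigma>))) * indicator {\<sigma>. ennreal (exp (- \<sigma>)) \<le> 4 * f z} \<sigma>)"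
    by (rule nn_integral_cmult) (simp add: indicator_def)
   also have "\<dots> = ennreal (2 * q / (q - 1)) * f z * (ennreal (4 powr (q - 1)) * epow (q - 1) (f z))"
    using q layer_cake[of "q - 1" "4 * f z"] epow_ennreal[of 4 "q - 1"] by (simp add: epow_mult)
   also have "\<dots> = ennreal (2 * q / (q - 1)) * ennreal (4 powr (q - 1)) * (f z * epow (q - 1) (f z))" by (simp only: mult_ac)
   also have "\<dots> = ennreal c * epow q (f z)"
   proof -
    have "ennreal (2 * q / (q - 1)) * ennreal (4 powr (q - 1)) = ennreal c"
     using q by (subst ennreal_mult[symmetric]) (auto simp: c_def)
    then show ?thesis by (simp only: epow_split[OF q, of "f z"])
   qed
   finally show "(NN \<sigma>. ennreal (2 * q / (q - 1)) * f z * (ennreal ((q - 1) * exp (- ((q - 1) * \<sigma>))) * indicator {\<sigma>. ennreal (exp (- \<sigma>)) \<le> 4 * f z} \<sigma>)) = ennreal c * epow q (f z)" .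
  qed
  also have "\<dots> = ennreal c * (NN z. epow q (f z))" by (rule nn_integral_cmult) measurable
  also have "\<dots> \<le> ennreal c * epow q (Lnorm p f)"
   using Lnorm_le_iff[OF False p1, of f "Lnorm p f"] by (intro mult_left_mono) (simp_all add: q_def)
  also have "\<dots> = epow q (ennreal (c powr (1/q)) * Lnorm p f)"
   using q c by (simp add: epow_mult epow_ennreal powr_powr)
  finally show "Lnorm p (line_max s f) \<le> ennreal (c powr (1/q)) * Lnorm p f"
   unfolding Lnorm_le_iff[OF False p1] q_def .
 qed simp
qed

section \<open>From maximal functions to increments\<close>

lemma window_le_line_int:
 fixes f :: "real \<times> 'a::euclidean_space => ennreal"
 assumes f [measurable]: "f \<in> Borel2" and A: "A \<subseteq> {s - r<..<s + r}"
 shows "(NN \<tau>. f (\<tau>, y) * indicator A \<tau>) \<le> line_int 1 r f (s, y) + line_int (- 1) r f (s, y)"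
proof -
 have "(NN \<tau>. f (\<tau>, y) * indicator A \<tau>) \<le> (NN \<tau>. f (\<tau>, y) * indicator {s..<s + r} \<tau> + f (\<tau>, y) * indicator {s - r<..s} \<tau>)"
 proof (intro nn_integral_mono)
  fix \<tau>
  show "f (\<tau>, y) * indicator A \<tau> \<le> f (\<tau>, y) * indicator {s..<s + r} \<tau> + f (\<tau>, y) * indicator {s - r<..s} \<tau>"
   using A by (cases "\<tau> \<in> A"; cases "s \<le> \<tau>") (auto simp: indicator_def intro: add_increasing add_increasing2)
 qed
 also have "\<dots> = (NN \<tau>. f (\<tau>, y) * indicator {s..<s + r} \<tau>) + (NN \<tau>. f (\<tau>, y) * indicator {s - r<..s} \<tau>)"
  by (rule nn_integral_add) measurable
 also have "(NN \<tau>. f (\<tau>, y) * indicator {s..<s + r} \<tau>) = line_int 1 r f (s, y)"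
  unfolding line_int_def by (subst nn_integral_real_affine[where c=1 and t=s]) (auto intro!: nn_integral_cong split: split_indicator)
 also have "(NN \<tau>. f (\<tau>, y) * indicator {s - r<..s} \<tau>) = line_int (- 1) r f (s, y)"
  unfolding line_int_def by (subst nn_integral_real_affine[where c="-1" and t=s]) (auto intro!: nn_integral_cong split: split_indicator)
 finally show ?thesis .
qed

definition both_max :: "(real \<times> 'a::euclidean_space => ennreal) => real \<times> 'a => ennreal" where
 "both_max f z = line_max 1 f z + line_max (- 1) f z"

lemma window_le_both_max:
 fixes f :: "real \<times> 'a::euclidean_space => ennreal"
 assumes f: "f \<in> Borel2" and A: "A \<subseteq> {s - r<..<s + r}" and r: "0 < r"
 shows "(NN \<tau>. f (\<tau>, y) * indicator A \<tau>) \<le> ennreal (2 * r) * both_max f (s, y)"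
proof -
 note window_le_line_int[OF f A, of y]
 also have "line_int 1 r f (s, y) + line_int (- 1) r f (s, y) \<le> ennreal (2 * r) * line_max 1 f (s, y) + ennreal (2 * r) * line_max (- 1) f (s, y)"
  by (intro add_mono line_int_cmult_le_max r)
 finally show ?thesis by (simp add: both_max_def distrib_left)
qed

text \<open>To compare \<open>(s, y)\<close> with \<open>(t, x)\<close>, \<open>s \<le> t\<close>, both points are moved in the \<open>t\<close>-direction to a common slice \<open>r\<close>,
 and the estimate is averaged over an interval of slices \<open>r\<close> of length comparable to the distance.
 Above \<open>3/2\<close> this interval lies to the left of \<open>t\<close>, in the cylindrical part.\<close>

lemma combine_slices_aux:
 fixes u :: "real \<times> 'a::euclidean_space => real" and D G :: "real \<times> 'a => ennreal"
 assumes U: "\<And>s t y. (s, y) \<in> U ==> s \<le> t \<or> 1 \<le> t ==> t < 2 ==> (t, y) \<in> U" "\<And>s y. (s, y) \<in> U ==> 0 < s \<and> s < 2"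
  and R: "0 \<le> R" "norm ((s, y) - (t, x)) \<le> R"
  and Dm [measurable]: "D \<in> Borel2" and Gm [measurable]: "G \<in> Borel2"
  and z: "(s, y) \<in> U" "(t, x) \<in> U" "s \<le> t" "(s, y) \<noteq> (t, x)"
  and move: "AE r in lborel. (r, y) \<in> U --> ennreal \<bar>u (s, y) - u (r, y)\<bar> \<le> (NN \<tau>. D (\<tau>, y) * indicator {min s r..max s r} \<tau>)"
   "AE r in lborel. (r, x) \<in> U --> ennreal \<bar>u (t, x) - u (r, x)\<bar> \<le> (NN \<tau>. D (\<tau>, x) * indicator {min t r..max t r} \<tau>)"
  and slice: "AE r in lborel. (r, y) \<in> U --> (r, x) \<in> U --> ennreal \<bar>u (r, y) - u (r, x)\<bar> \<le> ennreal (norm (y - x)) * (G (r, y) + G (r, x))"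
 shows "ennreal \<bar>u (s, y) - u (t, x)\<bar> \<le> ennreal (12 * (R + 1) * norm ((s, y) - (t, x))) *
  (both_max D (s, y) + both_max D (t, x) + (both_max G (s, y) + both_max G (t, x)))"
proof -
 define \<delta> where "\<delta> = norm ((s, y) - (t, x))"
 have d0: "0 < \<delta>" using z(4) by (auto simp: \<delta>_def zero_prod_def)
 have st: "t - s \<le> \<delta>" "norm (y - x) \<le> \<delta>"
  using norm_fst_le[of "s - t" "y - x"] norm_snd_le[of "y - x" "s - t"] z(3) by (auto simp: \<delta>_def)
 \<comment> \<open>Distances are at most \<open>R\<close>, so \<eta> times \<delta> is at most 1/2.
   The window therefore ends at 2 at the latest when it starts below 3/2, and stays above 1 when it
   lies to the left of a \<open>t\<close> of at least 3/2.\<close>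
 define \<eta> where "\<eta> = 1 / (2 * (R + 1))"
 have eta: "0 < \<eta>" "\<eta> \<le> 1" "\<eta> * \<delta> \<le> 1/2"
 proof -
  have "\<eta> * \<delta> \<le> \<eta> * (R + 1)" using R by (intro mult_left_mono) (auto simp: \<eta>_def \<delta>_def)
  moreover have "\<eta> * (R + 1) = 1/2" using R by (simp add: \<eta>_def field_simps)
  ultimately show "\<eta> * \<delta> \<le> 1/2" by linarith
 qed (use R in \<open>auto simp: \<eta>_def field_simps\<close>)
 define J where "J = (if t < 3/2 then {t<..<t + \<eta> * \<delta>} else {t - \<eta> * \<delta><..<t})"
 have ed: "0 < \<eta> * \<delta>" "\<eta> * \<delta> \<le> \<delta>" using eta d0 by (auto intro: mult_left_le_one_le)
 have t2: "0 < t" "t < 2" using U(2)[OF z(2)] by auto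
 have Jb [measurable]: "J \<in> sets borel" by (auto simp: J_def)
 have Jm: "emeasure lborel J = ennreal (\<eta> * \<delta>)" using ed by (auto simp: J_def)
 have JU: "(r, y) \<in> U" "(r, x) \<in> U" if "r \<in> J" for r
 proof -
  have "(t \<le> r \<or> 1 \<le> r) \<and> r < 2" using that eta(3) t2 by (auto simp: J_def split: if_splits)
  then show "(r, y) \<in> U" "(r, x) \<in> U" using U(1)[OF z(1), of r] U(1)[OF z(2), of r] z(3) by auto
 qed
 have Jd: "\<bar>r - t\<bar> < \<delta>" if "r \<in> J" for r using that ed by (auto simp: J_def split: if_splits)
 define A where "A = ennreal (6 * \<delta>) * (both_max D (s, y) + both_max D (t, x))"
 \<comment> \<open>Slices in \<open>J\<close> are within \<delta> of \<open>t\<close>, and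
   \<open>t\<close> is within \<delta> of \<open>s\<close>; three times \<delta> leaves room for
   both base points.\<close>
 have win: "{min s r..max s r} \<subseteq> {s - 3 * \<delta><..<s + 3 * \<delta>}" "{min t r..max t r} \<subseteq> {t - 3 * \<delta><..<t + 3 * \<delta>}" if "r \<in> J" for r
  using Jd[OF that] st(1) z(3) d0 by (auto simp: abs_less_iff)
 have Jwin: "J \<subseteq> {s - 3 * \<delta><..<s + 3 * \<delta>}" "J \<subseteq> {t - 3 * \<delta><..<t + 3 * \<delta>}"
  using Jd st(1) z(3) d0 by (fastforce simp: abs_less_iff)+
 have "AE r in lborel. ennreal \<bar>u (s, y) - u (t, x)\<bar> * indicator J r \<le> A * indicator J r + ennreal \<delta> * (G (r, y) * indicator J r + G (r, x) * indicator J r)"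
  using move slice
 proof eventually_elim
  case (elim r)
  show ?case
  proof (cases "r \<in> J")
   case True
   note rU = JU[OF True]
   have 1: "ennreal \<bar>u (s, y) - u (r, y)\<bar> \<le> ennreal (2 * (3 * \<delta>)) * both_max D (s, y)"
    using elim(1) rU window_le_both_max[OF Dm win(1)[OF True], of y] d0 by (auto intro: order_trans)
   have 2: "ennreal \<bar>u (t, x) - u (r, x)\<bar> \<le> ennreal (2 * (3 * \<delta>)) * both_max D (t, x)"
    using elim(2) rU window_le_both_max[OF Dm win(2)[OF True], of x] d0 by (auto intro: order_trans)
   have "ennreal \<bar>u (r, y) - u (r, x)\<bar> \<le> ennreal (norm (y - x)) * (G (r, y) + G (r, x))" using elim(3) rU by auto
   also have "\<dots> \<le> ennreal \<delta> * (G (r, y) + G (r, x))" by (intro mult_right_mono ennreal_leI st) simp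
   finally have 3: "ennreal \<bar>u (r, y) - u (r, x)\<bar> \<le> ennreal \<delta> * (G (r, y) + G (r, x))" .
   have "ennreal \<bar>u (s, y) - u (t, x)\<bar> \<le> ennreal (\<bar>u (s, y) - u (r, y)\<bar> + \<bar>u (t, x) - u (r, x)\<bar> + \<bar>u (r, y) - u (r, x)\<bar>)"
    by (intro ennreal_leI) linarith
   also have "\<dots> = ennreal \<bar>u (s, y) - u (r, y)\<bar> + ennreal \<bar>u (t, x) - u (r, x)\<bar> + ennreal \<bar>u (r, y) - u (r, x)\<bar>" by simp
   also have "\<dots> \<le> ennreal (2 * (3 * \<delta>)) * both_max D (s, y) + ennreal (2 * (3 * \<delta>)) * both_max D (t, x) + ennreal \<delta> * (G (r, y) + G (r, x))"
    by (intro add_mono 1 2 3)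
   also have "\<dots> = A + ennreal \<delta> * (G (r, y) + G (r, x))" by (simp add: A_def distrib_left)
   finally show ?thesis using True by simp
  qed simp
 qed
 then have "(NN r. ennreal \<bar>u (s, y) - u (t, x)\<bar> * indicator J r) \<le> (NN r. A * indicator J r + ennreal \<delta> * (G (r, y) * indicator J r + G (r, x) * indicator J r))"
  by (rule nn_integral_mono_AE)
 also have "\<dots> = A * ennreal (\<eta> * \<delta>) + ennreal \<delta> * ((NN r. G (r, y) * indicator J r) + (NN r. G (r, x) * indicator J r))"
  by (simp add: nn_integral_add nn_integral_cmult nn_integral_cmult_indicator Jm)
 also have "\<dots> \<le> A * ennreal (\<eta> * \<delta>) + ennreal \<delta> * (ennreal (2 * (3 * \<delta>)) * both_max G (s, y) + ennreal (2 * (3 * \<delta>)) * both_max G (t, x))"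
  using d0 by (intro add_left_mono mult_left_mono add_mono window_le_both_max Gm Jwin) auto
 finally have "ennreal \<bar>u (s, y) - u (t, x)\<bar> * ennreal (\<eta> * \<delta>) \<le> A * ennreal (\<eta> * \<delta>) + ennreal (6 * \<delta> * \<delta>) * (both_max G (s, y) + both_max G (t, x))"
  using d0 by (simp add: nn_integral_cmult_indicator Jm distrib_left ennreal_mult[symmetric] mult.assoc[symmetric] mult.commute[of \<delta>])
 then have "ennreal (1 / (\<eta> * \<delta>)) * (ennreal \<bar>u (s, y) - u (t, x)\<bar> * ennreal (\<eta> * \<delta>)) \<le> ennreal (1 / (\<eta> * \<delta>)) * (A * ennreal (\<eta> * \<delta>) + ennreal (6 * \<delta> * \<delta>) * (both_max G (s, y) + both_max G (t, x)))"
  by (rule mult_left_mono) simp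
 also have "ennreal (1 / (\<eta> * \<delta>)) * (ennreal \<bar>u (s, y) - u (t, x)\<bar> * ennreal (\<eta> * \<delta>)) = ennreal \<bar>u (s, y) - u (t, x)\<bar>"
  using eta(1) d0 by (simp add: ennreal_mult[symmetric])
 also have "ennreal (1 / (\<eta> * \<delta>)) * (A * ennreal (\<eta> * \<delta>) + ennreal (6 * \<delta> * \<delta>) * (both_max G (s, y) + both_max G (t, x))) = A + ennreal (12 * (R + 1) * \<delta>) * (both_max G (s, y) + both_max G (t, x))"
 proof -
  have "ennreal (1 / (\<eta> * \<delta>)) * (A * ennreal (\<eta> * \<delta>)) = A * (ennreal (1 / (\<eta> * \<delta>)) * ennreal (\<eta> * \<delta>))" by (simp only: mult_ac)
  also have "ennreal (1 / (\<eta> * \<delta>)) * ennreal (\<eta> * \<delta>) = 1" using eta d0 by (simp add: ennreal_mult[symmetric])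
  finally have 1: "ennreal (1 / (\<eta> * \<delta>)) * (A * ennreal (\<eta> * \<delta>)) = A" by simp
  \<comment> \<open>Dividing by the length of \<open>J\<close> costs 1/\<eta> = 2 (R + 1); with the
    6 from windows of radius 3 \<delta> this is the 12 of the statement.\<close>
  have "1 / (\<eta> * \<delta>) * (6 * \<delta> * \<delta>) = 12 * (R + 1) * \<delta>" using d0 R by (simp add: \<eta>_def field_simps)
  then have 2: "ennreal (1 / (\<eta> * \<delta>)) * ennreal (6 * \<delta> * \<delta>) = ennreal (12 * (R + 1) * \<delta>)"
   using eta d0 by (subst ennreal_mult[symmetric]) auto
  show ?thesis unfolding distrib_left[of "ennreal (1 / (\<eta> * \<delta>))"] 1 by (simp only: mult.assoc[symmetric] 2)
 qed
 also have "\<dots> \<le> ennreal (12 * (R + 1) * \<delta>) * (both_max D (s, y) + both_max D (t, x)) + ennreal (12 * (R + 1) * \<delta>) * (both_max G (s, y) + both_max G (t, x))"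
  unfolding A_def using R d0 by (intro add_right_mono mult_right_mono ennreal_leI) (auto simp: mult_right_mono)
 finally show ?thesis by (simp add: \<delta>_def distrib_left)
qed

section \<open>Slices\<close>

lemma Lnorm_top_le_iff: "Lnorm top f \<le> c \<longleftrightarrow> (AE x in lborel. f x \<le> c)"
 using Lnorm_infinity_le_iff[of f c] by simp

lemma AE_ex_in_open:
 fixes S :: "'a::euclidean_space set"
 assumes "AE x in lborel. P x" "open S" "S \<noteq> {}"
 shows "\<exists>x\<in>S. P x"
proof (rule ccontr)
 assume neg: "\<not> (\<exists>x\<in>S. P x)"
 obtain c r where r: "0 < r" "ball c r \<subseteq> S" using assms(2,3) open_contains_ball by blast
 have "AE x in lborel. \<not> x \<in> ball c r" using assms(1) by eventually_elim (use neg r in auto)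
 then have "emeasure lborel {x \<in> space lborel. x \<in> ball c r} = 0" by (rule emeasure_eq_0_AE)
 then have "emeasure lborel (ball c r) = 0" by (simp del: mem_ball)
 then have "measure lborel (ball c r) = 0" by (simp add: measure_def del: mem_ball)
 then show False using measure_ball_pos[OF r(1), of c] by simp
qed

text \<open>The essential supremum is at most \<open>c\<close> exactly if the superlevel set has
  measure zero, and that measure is a measurable function of \<open>t\<close>.\<close>

lemma measurable_slice_Lnorm_infinity:
 fixes F :: "real \<times> 'a::euclidean_space => ennreal"
 assumes F: "F \<in> Borel2"
 shows "(\<lambda>t. Lnorm \<infinity> (\<lambda>x. F (t, x))) \<in> Borel"
proof (rule borel_measurableI_le)
 fix c :: ennreal
 have [measurable]: "F \<in> borel_measurable (borel \<Otimes>\<^sub>M lborel)"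
  using F by (simp cong: measurable_cong_sets sets_pair_measure_cong)
 have "Lnorm \<infinity> (\<lambda>x. F (t, x)) \<le> c \<longleftrightarrow> (NN x. indicator {y. c < y} (F (t, x))) = 0" for t
 proof -
  have [measurable]: "(\<lambda>x. F (t, x)) \<in> Borel" by (rule slice_measurable[OF F])
  have "(NN x. indicator {y. c < y} (F (t, x))) = 0 \<longleftrightarrow> (AE x in lborel. indicator {y. c < y} (F (t, x)) = (0::ennreal))"
   by (rule nn_integral_0_iff_AE) measurable
  then show ?thesis by (simp add: Lnorm_top_le_iff indicator_def not_less)
 qed
 then have "{t \<in> space borel. Lnorm \<infinity> (\<lambda>x. F (t, x)) \<le> c} = {t \<in> space borel. (NN x. indicator {y. c < y} (F (t, x))) = 0}"
  by simp
 also have "\<dots> \<in> sets borel" by measurable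
 finally show "{t \<in> space borel. Lnorm \<infinity> (\<lambda>x. F (t, x)) \<le> c} \<in> sets borel" .
qed

text \<open>An approximant with gradient error \<open>e\<close> is within \<open>C * e\<close> of
  \<open>u\<close> almost everywhere by the Poincare inequality, and its bounded Hajlasz gradient
  makes it Lipschitz off a null set. Letting \<open>e\<close> run through 1/(m + 1) leaves the
  Lipschitz bound for \<open>u\<close> off a countable union of null sets.\<close>

lemma normalized_sob_infinity_lipschitz:
 fixes U :: "'a::euclidean_space set"
 assumes U: "open U" "bounded U" and C0: "0 \<le> C" and K0: "0 \<le> K"
  and P: "\<And>u g. normalized_sob \<infinity> U c r u g ==> nrm \<infinity> u \<le> ennreal C * nrm \<infinity> g"
  and dense: "\<And>u g b e. normalized_sob \<infinity> U c r u g ==> nrm \<infinity> g \<le> ennreal b ==> 0 < b ==> 0 < e ==>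
   \<exists>a k h. normalized_sob \<infinity> U c r a k \<and> nrm \<infinity> (\<lambda>x. g x - k x) \<le> ennreal e \<and> admissible \<infinity> U (ennreal (K * b)) a h"
  and S: "normalized_sob \<infinity> U c r u g" and n: "nrm \<infinity> g \<le> ennreal n" "0 \<le> n"
 shows "\<exists>E\<in>null_sets lborel. \<forall>x\<in>U - E. \<forall>y\<in>U - E. \<bar>u x - u y\<bar> \<le> 2 * K * n * norm (x - y)"
proof -
 have "\<exists>E. E \<in> null_sets lborel \<and> (\<forall>x\<in>U - E. \<forall>y\<in>U - E. \<bar>u x - u y\<bar> \<le> norm (x - y) * (2 * K * (n + e)) + 2 * C * e)"
  if e: "0 < e" for e :: real
 proof -
  have "nrm \<infinity> g \<le> ennreal (n + e)" using n e by (intro order_trans[OF n(1)] ennreal_leI) simp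
  then obtain a k h where a: "normalized_sob \<infinity> U c r a k" "nrm \<infinity> (\<lambda>x. g x - k x) \<le> ennreal e" "admissible \<infinity> U (ennreal (K * (n + e))) a h"
   using dense[OF S, of "n + e" e] e n by auto
  have "nrm \<infinity> (\<lambda>x. 1 * u x + (- 1) * a x) \<le> ennreal C * nrm \<infinity> (\<lambda>x. 1 *\<^sub>R g x + (- 1) *\<^sub>R k x)"
   by (intro P normalized_sob_lincomb U S a(1)) simp
  also have "\<dots> \<le> ennreal C * ennreal e" using a(2) by (intro mult_left_mono) simp_all
  finally have "nrm \<infinity> (\<lambda>x. u x - a x) \<le> ennreal (C * e)" using C0 e by (simp add: ennreal_mult)
  then have 1: "AE x in lborel. \<bar>u x - a x\<bar> \<le> C * e" using C0 e by (simp add: Lnorm_top_le_iff)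
  have 2: "AE x in lborel. h x \<le> K * (n + e)"
   using a(3) K0 n e by (auto simp: admissible_def Lnorm_top_le_iff)
  obtain E0 where E0: "E0 \<in> null_sets lborel" "\<And>x y. x \<in> U - E0 ==> y \<in> U - E0 ==> \<bar>a x - a y\<bar> \<le> norm (x - y) * (h x + h y)"
   using a(3) by (auto simp: admissible_def hajlasz_def)
  have "AE x in lborel. x \<notin> E0 \<and> \<bar>u x - a x\<bar> \<le> C * e \<and> h x \<le> K * (n + e)"
   using AE_not_in[OF E0(1)] 1 2 by eventually_elim simp
  then obtain E where E': "{x \<in> space lborel. \<not> (x \<notin> E0 \<and> \<bar>u x - a x\<bar> \<le> C * e \<and> h x \<le> K * (n + e))} \<subseteq> E"
   "emeasure lborel E = 0" "E \<in> sets lborel"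
   by (rule AE_E)
  note E = E'(1) null_setsI[OF E'(2,3)]
  show ?thesis
  proof (intro exI[of _ E] conjI ballI E(2))
   fix x y assume xy: "x \<in> U - E" "y \<in> U - E"
   have x: "x \<notin> E0" "\<bar>u x - a x\<bar> \<le> C * e" "h x \<le> K * (n + e)" using xy(1) E(1) by auto
   have y: "y \<notin> E0" "\<bar>u y - a y\<bar> \<le> C * e" "h y \<le> K * (n + e)" using xy(2) E(1) by auto
   have "\<bar>a x - a y\<bar> \<le> norm (x - y) * (h x + h y)" using E0(2)[of x y] xy x(1) y(1) by auto
   also have "\<dots> \<le> norm (x - y) * (2 * K * (n + e))" using x(3) y(3) by (intro mult_left_mono) auto
   finally show "\<bar>u x - u y\<bar> \<le> norm (x - y) * (2 * K * (n + e)) + 2 * C * e" using x(2) y(2) by linarith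
  qed
 qed
 then have "\<forall>m. \<exists>E. E \<in> null_sets lborel \<and> (\<forall>x\<in>U - E. \<forall>y\<in>U - E. \<bar>u x - u y\<bar> \<le> norm (x - y) * (2 * K * (n + inverse (real (Suc m)))) + 2 * C * inverse (real (Suc m)))"
  by simp
 from choice[OF this] obtain E where E: "\<And>m. E m \<in> null_sets lborel"
  "\<And>m x y. x \<in> U - E m ==> y \<in> U - E m ==> \<bar>u x - u y\<bar> \<le> norm (x - y) * (2 * K * (n + inverse (real (Suc m)))) + 2 * C * inverse (real (Suc m))"
  by auto
 show ?thesis
 proof (intro bexI[of _ "\<Union>m. E m"] ballI)
  show "(\<Union>m. E m) \<in> null_sets lborel" using E(1) by (intro null_sets_UN) auto
  fix x y assume xy: "x \<in> U - (\<Union>m. E m)" "y \<in> U - (\<Union>m. E m)"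
  have "(\<lambda>m. norm (x - y) * (2 * K * (n + inverse (real (Suc m)))) + 2 * C * inverse (real (Suc m))) \<longlonglongrightarrow> norm (x - y) * (2 * K * (n + 0)) + 2 * C * 0"
   by (intro tendsto_intros LIMSEQ_inverse_real_of_nat)
  moreover have "\<bar>u x - u y\<bar> \<le> norm (x - y) * (2 * K * (n + inverse (real (Suc m)))) + 2 * C * inverse (real (Suc m))" for m
   using xy by (intro E(2)) auto
  ultimately have "\<bar>u x - u y\<bar> \<le> norm (x - y) * (2 * K * (n + 0)) + 2 * C * 0"
   by (intro LIMSEQ_le_const) auto
  then show "\<bar>u x - u y\<bar> \<le> 2 * K * n * norm (x - y)" by (simp add: mult_ac)
 qed
qed

text \<open>\<open>G\<close> depends on \<open>t\<close> only, so no function has to be selected;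
  the obstacle is the exceptional sets, which vary with \<open>t\<close> in no measurable way. They
  are replaced by the set \<open>N\<close> of points that violate the Lipschitz bound against a set
  of \<open>y\<close> of positive measure. \<open>N\<close> is Borel, its slices are null, and
  points off \<open>N\<close> are compared through a nearby third point.\<close>

lemma slice_hajlasz_infinity:
 fixes U :: "'a::euclidean_space set" and v :: "real \<times> 'a => real" and f :: "real \<times> 'a => 'a"
 assumes U: "open U" "bounded U" and C0: "0 \<le> C" and K0: "0 \<le> K"
  and P: "\<And>u g. normalized_sob \<infinity> U c r u g ==> nrm \<infinity> u \<le> ennreal C * nrm \<infinity> g"
  and dense: "\<And>u g b e. normalized_sob \<infinity> U c r u g ==> nrm \<infinity> g \<le> ennreal b ==> 0 < b ==> 0 < e ==>
   \<exists>a k h. normalized_sob \<infinity> U c r a k \<and> nrm \<infinity> (\<lambda>x. g x - k x) \<le> ennreal e \<and> admissible \<infinity> U (ennreal (K * b)) a h"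
  and m [measurable]: "v \<in> Borel2" "f \<in> Borel2"
  and S: "\<And>t. normalized_sob \<infinity> U c r (\<lambda>x. v (t, x)) (\<lambda>x. f (t, x))"
 shows "\<exists>G N. G \<in> Borel2 \<and> N \<in> sets (borel \<Otimes>\<^sub>M borel) \<and> N \<in> null_sets lborel \<and>
  (\<forall>t. Lnorm \<infinity> (\<lambda>x. G (t, x)) \<le> ennreal (16 * K) * nrm \<infinity> (\<lambda>x. f (t, x))) \<and>
  (\<forall>t. \<forall>x\<in>U. \<forall>y\<in>U. (t, x) \<notin> N --> (t, y) \<notin> N -->
   ennreal \<bar>v (t, x) - v (t, y)\<bar> \<le> ennreal (norm (x - y)) * (G (t, x) + G (t, y)))"
proof -
 have Ub [measurable]: "U \<in> sets borel" using U by simp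
 define n where "n t = enn2real (nrm \<infinity> (\<lambda>x. f (t, x)))" for t
 have n0: "0 \<le> n t" for t by (simp add: n_def)
 have nt: "nrm \<infinity> (\<lambda>x. f (t, x)) = ennreal (n t)" for t
  using S[of t] by (simp add: n_def normalized_sob_def sob_def)
 have "(\<lambda>z. ennreal (norm (f z))) \<in> Borel2" by measurable
 from measurable_slice_Lnorm_infinity[OF this]
 have nm [measurable]: "n \<in> Borel" unfolding n_def[abs_def] by measurable
 have "\<exists>E\<in>null_sets lborel. \<forall>x\<in>U - E. \<forall>y\<in>U - E. \<bar>v (t, x) - v (t, y)\<bar> \<le> 2 * K * n t * norm (x - y)" for t
  by (rule normalized_sob_infinity_lipschitz[OF U C0 K0 P dense S order_eq_refl[OF nt] n0])
 then obtain E where E: "\<And>t. E t \<in> null_sets lborel"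
  "\<And>t x y. x \<in> U - E t ==> y \<in> U - E t ==> \<bar>v (t, x) - v (t, y)\<bar> \<le> 2 * K * n t * norm (x - y)"
  by metis
 define J where "J z = (NN y. (if y \<in> U \<and> 2 * K * n (fst z) * norm (snd z - y) < \<bar>v z - v (fst z, y)\<bar> then 1 else 0))" for z :: "real \<times> 'a"
 have Jm: "(\<lambda>(z, y). if y \<in> U \<and> 2 * K * n (fst z) * norm (snd z - y) < \<bar>v z - v (fst z, y)\<bar> then 1 else 0 :: ennreal)
   \<in> borel_measurable ((borel \<Otimes>\<^sub>M borel) \<Otimes>\<^sub>M lborel)"
  by measurable
 from lborel.borel_measurable_nn_integral[OF this]
 have [measurable]: "J \<in> Borel2" unfolding J_def[abs_def] by simp
 define N where "N = {z \<in> space (borel \<Otimes>\<^sub>M borel). snd z \<in> U \<and> 0 < J z}"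
 have Nm: "N \<in> sets (borel \<Otimes>\<^sub>M borel)" unfolding N_def by measurable
 have slice: "AE x in lborel. (t, x) \<notin> N" for t
  using AE_not_in[OF E(1)[of t]]
 proof eventually_elim
  case (elim x)
  have "J (t, x) = 0" if x: "x \<in> U"
  proof -
   have "AE y in lborel. (if y \<in> U \<and> 2 * K * n (fst (t, x)) * norm (snd (t, x) - y) < \<bar>v (t, x) - v (fst (t, x), y)\<bar> then 1 else 0) = (0 :: ennreal)"
    using AE_not_in[OF E(1)[of t]]
   proof eventually_elim
    case e: (elim y)
    have "\<bar>v (t, x) - v (t, y)\<bar> \<le> 2 * K * n t * norm (x - y)" if "y \<in> U" using E(2)[of x t y] x elim e that by auto
    then show ?case by (auto simp: not_less)
   qed
   then have "J (t, x) = (\<integral>\<^sup>+y. 0 \<partial>(lborel :: 'a measure))" unfolding J_def by (rule nn_integral_cong_AE)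
   then show ?thesis by simp
  qed
  then show ?case by (auto simp: N_def)
 qed
 have good: "AE y in lborel. y \<in> U --> \<bar>v (t, x) - v (t, y)\<bar> \<le> 2 * K * n t * norm (x - y)" if x: "x \<in> U" "(t, x) \<notin> N" for t x
 proof -
  have "J (t, x) = 0" using x by (auto simp: N_def space_pair_measure)
  moreover have "(\<lambda>y. if y \<in> U \<and> 2 * K * n t * norm (x - y) < \<bar>v (t, x) - v (t, y)\<bar> then 1 else 0 :: ennreal) \<in> borel_measurable lborel"
   using measurable_Pair2[OF Jm, of "(t, x)"] by (simp add: space_pair_measure)
  ultimately have "AE y in lborel. (if y \<in> U \<and> 2 * K * n t * norm (x - y) < \<bar>v (t, x) - v (t, y)\<bar> then 1 else 0) = (0 :: ennreal)"
   unfolding J_def by (subst (asm) nn_integral_0_iff_AE) simp_all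
  then show ?thesis by eventually_elim (auto split: if_splits)
 qed
 have lip: "\<bar>v (t, x) - v (t, y)\<bar> \<le> 2 * K * n t * norm (x - y)"
  if x: "x \<in> U" "(t, x) \<notin> N" and y: "y \<in> U" "(t, y) \<notin> N" for t x y
 proof (rule field_le_epsilon)
  fix e :: real assume e: "0 < e"
  define L where "L = 2 * K * n t"
  have L0: "0 \<le> L" using K0 n0 by (simp add: L_def)
  \<comment> \<open>The detour over a point \<open>w\<close> within \<open>d\<close> of
    \<open>x\<close> costs \<open>2 * L * d\<close>, which is at most \<open>e\<close>; the summand
    1 avoids division by zero.\<close>
  define d where "d = e / (2 * L + 1)"
  have d: "0 < d" "2 * L * d \<le> e" using e L0 by (simp_all add: d_def field_simps)
  have "AE w in lborel. (w \<in> U --> \<bar>v (t, x) - v (t, w)\<bar> \<le> L * norm (x - w)) \<and> (w \<in> U --> \<bar>v (t, y) - v (t, w)\<bar> \<le> L * norm (y - w))"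
   using good[OF x] good[OF y] unfolding L_def by eventually_elim simp
  moreover have "open (U \<inter> ball x d)" "U \<inter> ball x d \<noteq> {}" using U(1) x(1) d(1) by (auto intro!: exI[of _ x])
  ultimately obtain w where "w \<in> U \<inter> ball x d \<and> (w \<in> U --> \<bar>v (t, x) - v (t, w)\<bar> \<le> L * norm (x - w)) \<and> (w \<in> U --> \<bar>v (t, y) - v (t, w)\<bar> \<le> L * norm (y - w))"
   using AE_ex_in_open by blast
  then have w: "w \<in> U" "norm (x - w) < d" "\<bar>v (t, x) - v (t, w)\<bar> \<le> L * norm (x - w)" "\<bar>v (t, y) - v (t, w)\<bar> \<le> L * norm (y - w)"
   by (auto simp: dist_norm)
  have "norm (y - w) \<le> norm (x - y) + d" using norm_triangle_ineq[of "y - x" "x - w"] w(2) by (simp add: norm_minus_commute)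
  then have "L * norm (y - w) \<le> L * (norm (x - y) + d)" using L0 by (rule mult_left_mono)
  moreover have "L * norm (x - w) \<le> L * d" using L0 w(2) by (intro mult_left_mono) auto
  moreover have "L * (norm (x - y) + d) + L * d = L * norm (x - y) + 2 * L * d" by (simp add: algebra_simps)
  ultimately show "\<bar>v (t, x) - v (t, y)\<bar> \<le> 2 * K * n t * norm (x - y) + e"
   using w(3,4) d(2) unfolding L_def[symmetric] by linarith
 qed
 define G where "G z = ennreal (K * n (fst z))" for z :: "real \<times> 'a"
 have Gm: "G \<in> Borel2" unfolding G_def[abs_def] by measurable
 have GL: "Lnorm \<infinity> (\<lambda>x. G (t, x)) \<le> ennreal (16 * K) * nrm \<infinity> (\<lambda>x. f (t, x))" for t
  using K0 n0[of t] unfolding nt by (auto simp: Lnorm_top_le_iff G_def ennreal_mult[symmetric] intro!: AE_I2 ennreal_leI mult_right_mono)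
 have est: "ennreal \<bar>v (t, x) - v (t, y)\<bar> \<le> ennreal (norm (x - y)) * (G (t, x) + G (t, y))"
  if "x \<in> U" "y \<in> U" "(t, x) \<notin> N" "(t, y) \<notin> N" for t x y
 proof -
  have "ennreal \<bar>v (t, x) - v (t, y)\<bar> \<le> ennreal (norm (x - y) * (K * n t + K * n t))"
   using lip[of x t y] that by (intro ennreal_leI) (simp add: algebra_simps)
  also have "\<dots> = ennreal (norm (x - y)) * ennreal (K * n t + K * n t)"
   using K0 n0[of t] by (intro ennreal_mult) auto
  also have "ennreal (K * n t + K * n t) = G (t, x) + G (t, y)"
   unfolding G_def fst_conv using K0 n0[of t] by (intro ennreal_plus) auto
  finally show ?thesis .
 qed
 have Nn: "N \<in> null_sets lborel" by (rule null_sets_of_slices[OF Nm]) (use slice in simp)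
 show ?thesis by (rule exI[of _ G], rule exI[of _ N]) (use Gm Nm Nn GL est in blast)
qed

section \<open>Norms and null sets on the product and on slices\<close>

lemma epow_Lnorm: "p \<noteq> \<infinity> ==> 1 \<le> p ==> epow (enn2real p) (Lnorm p f) = (NN x. epow (enn2real p) (f x))"
 using enn2real_ge_1[of p] by (simp add: Lnorm_def epow_epow')

lemma AE_pair_lborel:
 fixes P :: "'a::euclidean_space \<times> 'b::euclidean_space => bool"
 shows "AE z in lborel. P z ==> AE t in lborel. AE x in lborel. P (t, x)"
 by (rule lborel_pair.AE_pair[where Q=P, unfolded lborel_prod])

text \<open>Almost every vertical line meets a null set in a null set. The measure of the
  intersection is a Borel function of the point, so this becomes a statement about almost every
  point of the product.\<close>

lemma AE_lines:
 fixes N :: "(real \<times> 'a::euclidean_space) set"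
 assumes N: "N \<in> sets (borel \<Otimes>\<^sub>M borel)" "N \<in> null_sets lborel"
 shows "AE z in (lborel :: (real \<times> 'a) measure). AE r in lborel. (r, snd z) \<notin> N"
proof -
 have N' [measurable]: "N \<in> sets (lborel \<Otimes>\<^sub>M lborel)" using N(1) by (simp cong: sets_pair_measure_cong)
 have "AE t in lborel. AE x in lborel. (t, x) \<notin> N" using AE_pair_lborel[OF AE_not_in[OF N(2)]] .
 then have 1: "AE x in lborel. AE t in lborel. (t, x) \<notin> N"
 proof (subst (asm) lborel_pair.AE_commute)
  have "{x \<in> space (lborel \<Otimes>\<^sub>M lborel). (fst x, snd x) \<notin> N} = space (lborel \<Otimes>\<^sub>M lborel) - N" by auto
  also have "\<dots> \<in> sets (lborel \<Otimes>\<^sub>M lborel)" by (rule sets.compl_sets[OF N'])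
  finally show "{x \<in> space (lborel \<Otimes>\<^sub>M lborel). (fst x, snd x) \<notin> N} \<in> sets (lborel \<Otimes>\<^sub>M lborel)" .
 qed
 define J where "J z = (NN r. indicator N (r, snd z))" for z :: "real \<times> 'a"
 have "(\<lambda>(z, r). indicator N (r, snd z) :: ennreal) \<in> borel_measurable ((borel \<Otimes>\<^sub>M borel) \<Otimes>\<^sub>M lborel)"
  using N(1) by measurable
 from lborel.borel_measurable_nn_integral[OF this]
 have [measurable]: "J \<in> Borel2" unfolding J_def[abs_def] by simp
 have m: "(\<lambda>r. indicator N (r, x) :: ennreal) \<in> borel_measurable lborel" for x
  by (rule measurable_compose[of "\<lambda>r. (r, x)" lborel "borel \<Otimes>\<^sub>M borel"]) (use N(1) in measurable)
 have J0: "J (t, x) = 0 \<longleftrightarrow> (AE r in lborel. (r, x) \<notin> N)" for t x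
  unfolding J_def by (subst nn_integral_0_iff_AE) (use m[of x] in \<open>simp_all add: indicator_eq_0_iff\<close>)
 have "{z \<in> space (borel \<Otimes>\<^sub>M borel). J z \<noteq> 0} \<in> null_sets lborel"
 proof (rule null_sets_of_slices)
  show "AE t in lborel. AE x in lborel. (t, x) \<notin> {z \<in> space (borel \<Otimes>\<^sub>M borel). J z \<noteq> 0}"
   using 1 by (simp add: J0 space_pair_measure)
 qed measurable
 from AE_not_in[OF this] show ?thesis
 proof eventually_elim
  case (elim z)
  then have "J (fst z, snd z) = 0" by (simp add: space_pair_measure)
  then show ?case unfolding J0 .
 qed
qed

lemma Lnorm_slice_finite_AE:
 fixes F :: "real \<times> 'a::euclidean_space => ennreal"
 assumes p: "1 \<le> p" and F: "F \<in> Borel2" and fin: "Lnorm p F < top"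
 shows "AE t in lborel. Lnorm p (\<lambda>x. F (t, x)) < top"
proof (cases "p = \<infinity>")
 case True
 have "AE z in lborel. F z \<le> Lnorm \<infinity> F" using Lnorm_infinity_le_iff[of F "Lnorm \<infinity> F"] by simp
 from AE_pair_lborel[OF this] show ?thesis
 proof eventually_elim
  case (elim t)
  then have "Lnorm \<infinity> (\<lambda>x. F (t, x)) \<le> Lnorm \<infinity> F" unfolding Lnorm_infinity_le_iff .
  then show ?case using fin True by (auto intro: le_less_trans)
 qed
next
 case False
 have F' [measurable]: "F \<in> borel_measurable (lborel \<Otimes>\<^sub>M lborel)"
  using F by (simp cong: measurable_cong_sets sets_pair_measure_cong)
 let ?q = "enn2real p"
 have [measurable]: "F \<in> Borel" using F by (simp add: borel_prod)
 have "(NN t. (NN x. epow ?q (F (t, x)))) = (NN z. epow ?q (F z))"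
  by (subst lborel.nn_integral_fst) (simp_all add: lborel_prod)
 also have "\<dots> = epow ?q (Lnorm p F)" by (rule epow_Lnorm[OF False p, symmetric])
 finally have "(NN t. (NN x. epow ?q (F (t, x)))) \<noteq> \<infinity>" using fin by simp
 then have "AE t in lborel. (NN x. epow ?q (F (t, x))) \<noteq> \<infinity>" by (intro nn_integral_PInf_AE) simp_all
 then show ?thesis
 proof eventually_elim
  case (elim t)
  then have "epow ?q (Lnorm p (\<lambda>x. F (t, x))) < top" unfolding epow_Lnorm[OF False p] by (simp add: less_top)
  then show ?case by simp
 qed
qed

lemma Lnorm_prod_le:
 fixes F G :: "real \<times> 'a::euclidean_space => ennreal"
 assumes p: "1 \<le> p" and F: "F \<in> Borel2" and G: "G \<in> Borel2"
  and le: "AE t in lborel. Lnorm p (\<lambda>x. F (t, x)) \<le> c * Lnorm p (\<lambda>x. G (t, x))"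
 shows "Lnorm p F \<le> c * Lnorm p G"
proof (cases "p = \<infinity>")
 case True
 have "AE z in lborel. G z \<le> Lnorm \<infinity> G" using Lnorm_infinity_le_iff[of G "Lnorm \<infinity> G"] by simp
 from AE_pair_lborel[OF this] le have "AE t in lborel. AE x in lborel. F (t, x) \<le> c * Lnorm \<infinity> G"
 proof eventually_elim
  case (elim t)
  then have "Lnorm \<infinity> (\<lambda>x. G (t, x)) \<le> Lnorm \<infinity> G" unfolding Lnorm_infinity_le_iff by simp
  then have "Lnorm \<infinity> (\<lambda>x. F (t, x)) \<le> c * Lnorm \<infinity> G"
   using elim(2) True by (intro order_trans[OF _ mult_left_mono[of "Lnorm \<infinity> (\<lambda>x. G (t, x))" "Lnorm \<infinity> G" c]]) simp_all
  then show ?case unfolding Lnorm_infinity_le_iff .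
 qed
 then have "AE t in lborel. AE x in lborel. (t, x) \<notin> {z \<in> space (borel \<Otimes>\<^sub>M borel). c * Lnorm \<infinity> G < F z}"
  by (simp add: not_less space_pair_measure)
 then have "{z \<in> space (borel \<Otimes>\<^sub>M borel). c * Lnorm \<infinity> G < F z} \<in> null_sets lborel"
  by (intro null_sets_of_slices) (use F in measurable)
 from AE_not_in[OF this] have "AE z in lborel. F z \<le> c * Lnorm \<infinity> G"
  by eventually_elim (simp add: space_pair_measure not_less)
 then show ?thesis using True by (simp add: Lnorm_top_le_iff)
next
 case False
 let ?q = "enn2real p"
 have q: "0 < ?q" using enn2real_ge_1[OF False p] by simp
 have [measurable]: "F \<in> borel_measurable (lborel \<Otimes>\<^sub>M lborel)" "G \<in> borel_measurable (lborel \<Otimes>\<^sub>M lborel)"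
  using F G by (simp_all cong: measurable_cong_sets sets_pair_measure_cong)
 have [measurable]: "F \<in> Borel" "G \<in> Borel" using F G by (simp_all add: borel_prod)
 have "(NN z. epow ?q (F z)) = (NN t. (NN x. epow ?q (F (t, x))))"
  by (subst lborel.nn_integral_fst) (simp_all add: lborel_prod)
 also have "\<dots> \<le> (NN t. epow ?q c * (NN x. epow ?q (G (t, x))))"
 proof (rule nn_integral_mono_AE)
  show "AE t in lborel. (NN x. epow ?q (F (t, x))) \<le> epow ?q c * (NN x. epow ?q (G (t, x)))"
   using le by eventually_elim (simp only: epow_Lnorm[OF False p, symmetric] epow_mult[OF q, symmetric] epow_le_iff[OF q])
 qed
 also have "\<dots> = epow ?q c * (NN t. (NN x. epow ?q (G (t, x))))" by (rule nn_integral_cmult) measurable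
 also have "(NN t. (NN x. epow ?q (G (t, x)))) = (NN z. epow ?q (G z))"
  by (subst lborel.nn_integral_fst) (simp_all add: lborel_prod)
 finally show ?thesis
  by (simp only: epow_Lnorm[OF False p, symmetric] epow_mult[OF q, symmetric] epow_le_iff[OF q])
qed

lemma Lnorm_cylinder_finite:
 fixes f :: "'a::euclidean_space => ennreal"
 assumes p: "1 \<le> p" and f [measurable]: "f \<in> Borel" and fin: "Lnorm p f < top"
 shows "Lnorm p (\<lambda>z::real \<times> 'a. indicator {0<..<2} (fst z) * f (snd z)) < top"
proof (cases "p = \<infinity>")
 case True
 have 0: "AE x in lborel. f x \<le> Lnorm \<infinity> f" using Lnorm_infinity_le_iff[of f "Lnorm \<infinity> f"] by simp
 have "{z \<in> space (borel \<Otimes>\<^sub>M borel). Lnorm \<infinity> f < f (snd z)} \<in> null_sets (lborel :: (real \<times> 'a) measure)"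
 proof (rule null_sets_of_slices)
  show "AE t in lborel. AE x in lborel. (t, x) \<notin> {z \<in> space (borel \<Otimes>\<^sub>M borel). Lnorm \<infinity> f < f (snd z)}"
   using 0 by (simp add: not_less space_pair_measure)
 qed measurable
 from AE_not_in[OF this] have "AE z in (lborel :: (real \<times> 'a) measure). indicator {0<..<2} (fst z) * f (snd z) \<le> Lnorm \<infinity> f"
  by eventually_elim (auto simp: space_pair_measure not_less split: split_indicator)
 then have "Lnorm \<infinity> (\<lambda>z::real \<times> 'a. indicator {0<..<2} (fst z) * f (snd z)) \<le> Lnorm \<infinity> f"
  by (simp add: Lnorm_top_le_iff)
 then show ?thesis using fin True by (auto intro: le_less_trans)
next
 case False
 let ?q = "enn2real p"
 have "epow ?q (Lnorm p (\<lambda>z::real \<times> 'a. indicator {0<..<2} (fst z) * f (snd z))) = (\<integral>\<^sup>+z. indicator {0<..<2} (fst z) * epow ?q (f (snd z)) \<partial>(lborel :: (real \<times> 'a) measure))"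
  unfolding epow_Lnorm[OF False p] by (intro nn_integral_cong) (auto split: split_indicator)
 also have "\<dots> = (NN t. (NN x. indicator {0<..<2::real} t * epow ?q (f x)))"
  unfolding lborel_prod[symmetric] by (subst lborel.nn_integral_fst[symmetric]) simp_all
 also have "\<dots> = (NN t. (NN x. epow ?q (f x)) * indicator {0<..<2::real} t)"
  by (intro nn_integral_cong) (subst nn_integral_cmult, simp_all add: mult.commute)
 also have "\<dots> = 2 * epow ?q (Lnorm p f)" unfolding epow_Lnorm[OF False p]
  by (subst nn_integral_cmult_indicator) (simp_all add: mult.commute)
 also have "\<dots> < top" using fin by (simp add: ennreal_mult_less_top)
 finally show ?thesis by simp
qed

text \<open>Both norms change by the same power of the dilation factor, so a norm inequality keeps
  its constant. This is what makes the estimate on the slices independent of their widths.\<close>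

lemma Lnorm_affine_mono:
 fixes F G :: "'a::euclidean_space => ennreal"
 assumes p: "1 \<le> p" and [measurable]: "F \<in> Borel" "G \<in> Borel" and c: "0 < c"
  and le: "Lnorm p F \<le> K * Lnorm p G"
 shows "Lnorm p (\<lambda>x. F (t + c *\<^sub>R x)) \<le> K * Lnorm p (\<lambda>x. G (t + c *\<^sub>R x))"
proof (cases "p = \<infinity>")
 case True
 define m where "m = Lnorm \<infinity> (\<lambda>x. G (t + c *\<^sub>R x))"
 have "AE x in lborel. G (t + c *\<^sub>R x) \<le> m" using Lnorm_infinity_le_iff[of "\<lambda>x. G (t + c *\<^sub>R x)" m] by (simp add: m_def)
 from AE_lborel_affine[OF _ this, of "inverse c" "- inverse c *\<^sub>R t"] have "AE x in lborel. G x \<le> m"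
  using c by (simp add: scaleR_add_right scaleR_diff_right)
 then have "Lnorm \<infinity> G \<le> m" by (simp add: Lnorm_top_le_iff)
 then have "Lnorm \<infinity> F \<le> K * m" using le True by (intro order_trans[OF _ mult_left_mono[of "Lnorm \<infinity> G" m K]]) simp_all
 then have "AE x in lborel. F x \<le> K * m" by (simp add: Lnorm_top_le_iff)
 from AE_lborel_affine[OF _ this, of c t] show ?thesis using c True by (simp add: Lnorm_top_le_iff m_def)
next
 case False
 let ?q = "enn2real p"
 have q: "0 < ?q" using enn2real_ge_1[OF False p] by simp
 define A where "A = ennreal (\<bar>c\<bar> ^ DIM('a))"
 have A: "(NN x. epow ?q (H x)) = A * (NN x. epow ?q (H (t + c *\<^sub>R x)))"
  if [measurable]: "H \<in> Borel" for H :: "'a => ennreal"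
  unfolding A_def using c by (intro nn_integral_lborel_affine) auto
 have "A * (NN x. epow ?q (F (t + c *\<^sub>R x))) \<le> epow ?q K * (A * (NN x. epow ?q (G (t + c *\<^sub>R x))))"
 proof -
  have "epow ?q (Lnorm p F) \<le> epow ?q K * epow ?q (Lnorm p G)" using le q by (simp add: epow_mult[OF q, symmetric])
  then show ?thesis unfolding epow_Lnorm[OF False p] A[OF assms(2)] A[OF assms(3)] .
 qed
 then have "A * (NN x. epow ?q (F (t + c *\<^sub>R x))) \<le> A * (epow ?q K * (NN x. epow ?q (G (t + c *\<^sub>R x))))"
  by (simp only: mult_ac)
 then have "(NN x. epow ?q (F (t + c *\<^sub>R x))) \<le> epow ?q K * (NN x. epow ?q (G (t + c *\<^sub>R x)))"
  using c by (subst (asm) ennreal_mult_le_mult_iff) (auto simp: A_def)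
 then show ?thesis
  by (simp only: epow_Lnorm[OF False p, symmetric] epow_mult[OF q, symmetric] epow_le_iff[OF q])
qed

text \<open>In the segment formula an affine map is a mere substitution, so the chain rule goes
  through \<open>wgrad_path\<close> and \<open>wgradI_segments\<close>, with the factor
  \<open>c\<close> from the length of the mapped step.\<close>

lemma wgrad_affine:
 fixes w :: "'a::euclidean_space => real"
 assumes V: "open V" "bounded V" and w: "integrable lborel w" and f: "integrable lborel f" and W: "wgrad V w f" and c: "0 < c"
 shows "wgrad {y. a + c *\<^sub>R y \<in> V} (\<lambda>y. w (a + c *\<^sub>R y)) (\<lambda>y. c *\<^sub>R f (a + c *\<^sub>R y))"
proof (rule wgradI_segments)
 have "continuous_on UNIV (\<lambda>y. a + c *\<^sub>R y)" by (intro continuous_intros)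
 from open_vimage[OF V(1) this] show "open {y. a + c *\<^sub>R y \<in> V}" by (simp add: vimage_def)
 show "integrable lborel (\<lambda>y. w (a + c *\<^sub>R y))" by (rule integrable_lborel_affine[OF w]) (use c in simp)
 show "integrable lborel (\<lambda>y. c *\<^sub>R f (a + c *\<^sub>R y))"
  by (intro integrable_scaleR_right integrable_lborel_affine[OF f]) (use c in simp)
 fix k :: nat and i :: 'a assume i: "i \<in> Basis"
 define h where "h = (c / real (Suc k)) *\<^sub>R i"
 have "AE x in lborel. (\<forall>t\<in>{0..1}. x + t *\<^sub>R (0 *\<^sub>R x + h) \<in> V) -->
  w (x + (0 *\<^sub>R x + h)) - w x = (\<integral>t. f (x + t *\<^sub>R (0 *\<^sub>R x + h)) \<bullet> (0 *\<^sub>R x + h) \<partial>I01)"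
  by (rule wgrad_path[OF V w f W]) simp
 from AE_lborel_affine[OF _ this, of c a]
 have "AE x in lborel. (\<forall>t\<in>{0..1}. (a + c *\<^sub>R x) + t *\<^sub>R h \<in> V) -->
  w ((a + c *\<^sub>R x) + h) - w (a + c *\<^sub>R x) = (\<integral>t. f ((a + c *\<^sub>R x) + t *\<^sub>R h) \<bullet> h \<partial>I01)" using c by simp
 then show "AE x in lborel. (\<forall>t\<in>{0..1}. x + (t / real (Suc k)) *\<^sub>R i \<in> {y. a + c *\<^sub>R y \<in> V}) -->
  w (a + c *\<^sub>R (x + (1 / real (Suc k)) *\<^sub>R i)) - w (a + c *\<^sub>R x) =
  (\<integral>t. (c *\<^sub>R f (a + c *\<^sub>R (x + (t / real (Suc k)) *\<^sub>R i))) \<bullet> i \<partial>I01) / real (Suc k)"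
 proof eventually_elim
  case (elim x)
  have e: "a + c *\<^sub>R (x + (t / real (Suc k)) *\<^sub>R i) = (a + c *\<^sub>R x) + t *\<^sub>R h" for t
   by (simp add: h_def scaleR_add_right algebra_simps)
  have e1: "a + c *\<^sub>R (x + (1 / real (Suc k)) *\<^sub>R i) = (a + c *\<^sub>R x) + h" using e[of 1] by simp
  have d: "y \<bullet> h = ((c *\<^sub>R y) \<bullet> i) / real (Suc k)" for y by (simp add: h_def)
  show ?case unfolding mem_Collect_eq e e1 using elim by (simp only: d integral_divide_zero scaleR_one)
 qed
qed

section \<open>The cusp\<close>

lemma Lnorm_affine_finite:
 fixes f :: "'a::euclidean_space => ennreal"
 assumes p: "1 \<le> p" and f: "f \<in> Borel" and c: "0 < c" and fin: "Lnorm p f < top"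
 shows "Lnorm p (\<lambda>x. f (a + c *\<^sub>R x)) < top"
proof -
 have "Lnorm p (\<lambda>x. f (a + c *\<^sub>R x)) \<le> ennreal (1 + inverse (c ^ DIM('a))) * Lnorm p f"
  by (rule Lnorm_affine_le[OF p f c]) (use c in \<open>simp_all add: field_simps\<close>)
 also have "\<dots> < top" using fin by (simp add: ennreal_mult_less_top)
 finally show ?thesis .
qed

text \<open>The constants on \<open>U\<close> as Sobolev functions; they are subtracted to normalise
  means.\<close>

lemma sob_indicator:
 assumes p: "1 \<le> p" and U: "open U" "bounded U"
 shows "sob p U (indicator U) (\<lambda>_. 0)"
proof -
 have Ub [measurable]: "U \<in> sets borel" using U by simp
 have fin: "emeasure lborel U < \<infinity>" by (rule emeasure_bounded_finite[OF U(2)])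
 have "wgrad U (indicator U :: 'a => real) (\<lambda>_. 0)"
 proof (rule wgradI_segments[OF U(1)])
  show "integrable lborel (indicator U :: 'a => real)" using fin by simp
  fix k :: nat and i :: 'a
  show "AE x in lborel. (\<forall>t\<in>{0..1}. x + (t / real (Suc k)) *\<^sub>R i \<in> U) -->
    indicator U (x + (1 / real (Suc k)) *\<^sub>R i) - indicator U x = (\<integral>t. 0 \<bullet> i \<partial>I01) / real (Suc k)"
  proof (intro AE_I2 impI)
   fix x assume "\<forall>t\<in>{0..1}. x + (t / real (Suc k)) *\<^sub>R i \<in> U"
   from bspec[OF this, of 1] bspec[OF this, of 0]
   show "indicator U (x + (1 / real (Suc k)) *\<^sub>R i) - indicator U x = (\<integral>t. 0 \<bullet> i \<partial>I01) / real (Suc k)" by simp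
  qed
 qed simp
 moreover have "nrm p (indicator U :: 'a => real) < top"
 proof (cases "p = \<infinity>")
  case True
  have "nrm \<infinity> (indicator U :: 'a => real) \<le> 1"
   unfolding Lnorm_infinity_le_iff by (intro AE_I2) (auto split: split_indicator)
  then show ?thesis using True by (auto intro: le_less_trans)
 next
  case False
  have "epow (enn2real p) (nrm p (indicator U :: 'a => real)) = (NN x. indicator U x)"
   unfolding epow_Lnorm[OF False p] by (intro nn_integral_cong) (auto split: split_indicator)
  also have "\<dots> < top" using fin by simp
  finally show ?thesis by simp
 qed
 ultimately show ?thesis using p by (simp add: sob_def)
qed

locale cusp =
 fixes \<Omega> :: "'a::euclidean_space set" and x0 :: 'a and \<psi> :: "real => real"
 assumes dom: "is_domain \<Omega>" and bdd: "bounded \<Omega>" and star: "star_center \<Omega> x0"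
  and pos: "\<forall>t\<in>{0<..1}. 0 < \<psi> t" and lc: "\<forall>t\<in>{0<..1}. continuous (at_left t) \<psi>"
  and mono: "mono_on {0<..1} \<psi>"
begin

abbreviation U :: "(real \<times> 'a) set" where "U \<equiv> cusp_domain \<Omega> x0 \<psi>"

text \<open>The width of the slice at \<open>t\<close>; the value 1 for \<open>t \<le> 0\<close> only keeps it positive.\<close>

definition W :: "real => real" where "W t = (if 0 < t then \<psi> (min t 1) else 1)"

text \<open>The dilation about \<open>x0\<close> that takes \<Omega> to the slice at
  \<open>t\<close>, written as constant plus scaled argument to match the affine lemmas;
  \<open>proj\<close> is its inverse.\<close>

definition emb :: "real => 'a => 'a" where "emb t y = (x0 - W t *\<^sub>R x0) + W t *\<^sub>R y"

definition proj :: "real => 'a => 'a" where "proj t x = (x0 - inverse (W t) *\<^sub>R x0) + inverse (W t) *\<^sub>R x"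

section \<open>Geometry of the cusp\<close>

lemma open_\<Omega>: "open \<Omega>" using dom by (simp add: is_domain_def)

lemma W_pos: "0 < W t" using pos by (auto simp: W_def)

lemma W_mono: "0 < s ==> s \<le> t \<or> 1 \<le> t ==> W s \<le> W t"
 unfolding W_def by (auto intro!: mono_onD[OF mono])

lemma W_measurable [measurable]: "W \<in> Borel"
proof -
 define M where "M t = (if 0 < t then \<psi> (min t 1) else 0)" for t
 have "mono M"
 proof (rule monoI)
  fix s t :: real assume st: "s \<le> t"
  show "M s \<le> M t"
  proof (cases "0 < s")
   case True
   then show ?thesis using st by (auto simp: M_def intro!: mono_onD[OF mono])
  next
   case False
   have "0 \<le> M t" using pos by (auto simp: M_def less_imp_le)
   then show ?thesis using False by (simp add: M_def)
  qed
 qed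
 then have [measurable]: "M \<in> Borel" by (rule borel_measurable_mono)
 have "W = (\<lambda>t. if 0 < t then M t else 1)" by (auto simp: W_def M_def)
 then show ?thesis by simp
qed

lemma proj_emb [simp]: "proj t (emb t y) = y" and emb_proj [simp]: "emb t (proj t x) = x"
 using W_pos[of t] by (simp_all add: proj_def emb_def scaleR_add_right scaleR_diff_right)

lemma proj_diff: "proj t x - proj t y = inverse (W t) *\<^sub>R (x - y)"
 by (simp add: proj_def scaleR_diff_right)

lemma mem_U: "(t, x) \<in> U \<longleftrightarrow> 0 < t \<and> t < 2 \<and> proj t x \<in> \<Omega>"
proof -
 have "proj t x = (x - x0) /\<^sub>R W t + x0" by (simp add: proj_def scaleR_diff_right)
 then show ?thesis by (cases t "1 :: real" rule: linorder_cases) (auto simp: cusp_domain_def W_def min_def)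
qed

lemma star_shrink:
 assumes "y \<in> \<Omega>" "0 \<le> c" "c \<le> 1" shows "x0 + c *\<^sub>R (y - x0) \<in> \<Omega>"
proof -
 have "x0 + c *\<^sub>R (y - x0) = (1 - (1 - c)) *\<^sub>R y + (1 - c) *\<^sub>R x0" by (simp add: algebra_simps)
 then have "x0 + c *\<^sub>R (y - x0) \<in> closed_segment y x0" using assms by (auto simp: closed_segment_def intro!: exI[of _ "1 - c"])
 then show ?thesis using star assms(1) by (auto simp: star_center_def)
qed

text \<open>Widths grow with \<open>t\<close>, and in a star-shaped set a narrower dilate lies in a
  wider one. The alternative \<open>1 \<le> t\<close> also covers moves to smaller \<open>t\<close>
  in the cylindrical part, where all slices coincide and contain the earlier ones.\<close>

lemma U_up: "(s, x) \<in> U ==> s \<le> t \<or> 1 \<le> t ==> t < 2 ==> (t, x) \<in> U"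
proof -
 assume a: "(s, x) \<in> U" "s \<le> t \<or> 1 \<le> t" "t < 2"
 have s: "0 < s" "proj s x \<in> \<Omega>" using a(1) by (auto simp: mem_U)
 have "proj t x = x0 + (W s / W t) *\<^sub>R (proj s x - x0)"
  using W_pos[of s] W_pos[of t] by (simp add: proj_def scaleR_diff_right scaleR_add_right inverse_eq_divide)
 also have "\<dots> \<in> \<Omega>" using W_mono[OF s(1) a(2)] W_pos[of s] W_pos[of t] by (intro star_shrink s) auto
 finally show "(t, x) \<in> U" using a s by (auto simp: mem_U)
qed

lemma U_range: "(s, x) \<in> U ==> 0 < s \<and> s < 2" by (simp add: mem_U)

lemma W_left_continuous: "0 < t ==> (W \<longlongrightarrow> W t) (at_left t)"
proof (cases "t \<le> 1")
 case True
 assume t: "0 < t"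
 have lim: "(\<psi> \<longlongrightarrow> \<psi> t) (at_left t)" using lc t True by (simp add: continuous_within)
 have "eventually (\<lambda>s. \<psi> s = W s) (at_left t)"
  using eventually_at_left_real[OF t] by eventually_elim (use True in \<open>auto simp: W_def\<close>)
 from tendsto_cong[OF this] lim have "(W \<longlongrightarrow> \<psi> t) (at_left t)" by blast
 moreover have "W t = \<psi> t" using t True by (simp add: W_def min_def)
 ultimately show ?thesis by simp
next
 case False
 have "eventually (\<lambda>s. W t = W s) (at_left t)"
  using eventually_at_left_real[of 1 t] False by (auto elim!: eventually_mono simp: W_def)
 then show ?thesis by (rule tendsto_eventually[OF eventually_mono]) simp
qed

lemma open_slice: "open {x. proj t x \<in> \<Omega>}"
proof -
 have "continuous_on UNIV (proj t)" unfolding proj_def[abs_def] by (intro continuous_intros)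
 from open_vimage[OF open_\<Omega> this] show ?thesis by (simp add: vimage_def)
qed

text \<open>Left continuity of the width puts a point of the slice at \<open>t\<close> already into
  the slice at some \<open>s < t\<close>. By \<open>U_up\<close> it then lies in an open cylinder
  over that slice, which is contained in the cusp.\<close>

lemma open_U: "open U"
proof -
 have "U = (\<Union>s\<in>{0<..<2}. {s<..<2} \<times> {x. proj s x \<in> \<Omega>})"
 proof (intro equalityI subsetI)
  fix z assume "z \<in> U"
  then obtain t x where z: "z = (t, x)" "0 < t" "t < 2" "proj t x \<in> \<Omega>" by (cases z) (auto simp: mem_U)
  have "((\<lambda>s. proj s x) \<longlongrightarrow> proj t x) (at_left t)"
   unfolding proj_def using W_pos[of t] by (intro tendsto_intros W_left_continuous z) simp_all
  from topological_tendstoD[OF this open_\<Omega> z(4)] eventually_at_left_real[OF z(2)]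
  have "eventually (\<lambda>s. proj s x \<in> \<Omega> \<and> s \<in> {0<..<t}) (at_left t)" by eventually_elim simp
  then obtain s where "proj s x \<in> \<Omega>" "s \<in> {0<..<t}"
   using eventually_happens[of _ "at_left t"] by (auto simp: trivial_limit_at_left_real)
  then show "z \<in> (\<Union>s\<in>{0<..<2}. {s<..<2} \<times> {x. proj s x \<in> \<Omega>})" using z by (auto intro!: bexI[of _ s])
 next
  fix z assume "z \<in> (\<Union>s\<in>{0<..<2}. {s<..<2} \<times> {x. proj s x \<in> \<Omega>})"
  then obtain s where s: "0 < s" "s < 2" "s < fst z" "fst z < 2" "proj s (snd z) \<in> \<Omega>" by auto
  then have "(s, snd z) \<in> U" by (simp add: mem_U)
  from U_up[OF this, of "fst z"] s show "z \<in> U" by simp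
 qed
 then show ?thesis by (auto intro!: open_UN open_Times open_slice)
qed

lemma bounded_U: "bounded U"
proof -
 obtain R where R: "\<And>y. y \<in> \<Omega> ==> dist x0 y \<le> R" using bdd by (auto simp: bounded_any_center[where a=x0])
 have "U \<subseteq> {0..2} \<times> cball x0 (W 1 * R)"
 proof
  fix z assume "z \<in> U"
  then obtain t x where z: "z = (t, x)" "(t, x) \<in> U" by (cases z) auto
  then have t: "0 < t" "t < 2" by (auto simp: mem_U)
  have "(1, x) \<in> U" using U_up[OF z(2), of 1] by simp
  then have p: "proj 1 x \<in> \<Omega>" by (simp add: mem_U)
  have "x - x0 = W 1 *\<^sub>R (proj 1 x - x0)" using W_pos[of 1] by (simp add: proj_def scaleR_diff_right)
  then have "norm (x - x0) \<le> W 1 * R" using R[OF p] W_pos[of 1] by (simp add: dist_norm norm_minus_commute)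
  then show "z \<in> {0..2} \<times> cball x0 (W 1 * R)" using t z by (simp add: dist_norm norm_minus_commute)
 qed
 then show ?thesis by (rule bounded_subset[rotated]) (intro bounded_Times bounded_cball bounded_closed_interval)
qed

section \<open>Sobolev functions on the cusp along slices and vertical lines\<close>

lemma emb_measurable [measurable]: "(\<lambda>z. emb (fst z) (snd z)) \<in> Borel2"
 unfolding emb_def by measurable

lemma proj_measurable [measurable]: "(\<lambda>z. proj (fst z) (snd z)) \<in> Borel2"
 unfolding proj_def by measurable

text \<open>The segment formula on the cusp in directions orthogonal to \<open>t\<close> holds on
  almost every slice, simultaneously for the countably many steps used by
  \<open>wgradI_segments\<close>. This gives the weak gradient of the slice; rescaling to \<Omega>
  multiplies it by the width.\<close>

lemma slice_sob:
 assumes p: "1 \<le> p" and S: "sob p U u g"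
 shows "AE t in lborel. t \<in> {0<..<2} --> sob p \<Omega> (\<lambda>y. u (t, emb t y)) (\<lambda>y. W t *\<^sub>R snd (g (t, emb t y)))"
proof -
 note int = sob_integrable[OF p open_U bounded_U S]
 have um: "u \<in> Borel2" and gm: "g \<in> Borel2"
  and u0: "\<And>z. z \<notin> U ==> u z = 0 \<and> g z = 0" and fin: "nrm p u < top" "nrm p g < top" and w: "wgrad U u g"
  using S by (auto simp: sob_def borel_prod)
 have nm: "(\<lambda>z. ennreal (norm (u z))) \<in> Borel2" "(\<lambda>z. ennreal (norm (g z))) \<in> Borel2"
  using um gm by measurable
 define V where "V t = {x. (t, x) \<in> U}" for t
 have V: "open (V t)" "bounded (V t)" for t
 proof -
  have "continuous_on UNIV (\<lambda>x::'a. (t, x))" by (intro continuous_intros)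
  from open_vimage[OF open_U this] show "open (V t)" by (simp add: V_def vimage_def)
  have "V t \<subseteq> snd ` U" by (force simp: V_def)
  then show "bounded (V t)" by (rule bounded_subset[OF bounded_snd[OF bounded_U]])
 qed
 have iu: "AE t in lborel. integrable lborel (\<lambda>x. u (t, x))" "AE t in lborel. integrable lborel (\<lambda>x. g (t, x))"
  using lborel_pair.AE_integrable_fst'[of u] lborel_pair.AE_integrable_fst'[of g] int by (simp_all add: lborel_prod)
 have seg: "AE t in lborel. AE x in lborel. (\<forall>\<tau>\<in>{0..1}. x + (\<tau> / real (Suc k)) *\<^sub>R i \<in> V t) -->
   u (t, x + (1 / real (Suc k)) *\<^sub>R i) - u (t, x) = (\<integral>\<tau>. snd (g (t, x + (\<tau> / real (Suc k)) *\<^sub>R i)) \<bullet> i \<partial>I01) / real (Suc k)" for k i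
 proof -
  define h :: "real \<times> 'a" where "h = (0, (1 / real (Suc k)) *\<^sub>R i)"
  have "AE z in lborel. (\<forall>\<tau>\<in>{0..1}. z + \<tau> *\<^sub>R (0 *\<^sub>R z + h) \<in> U) -->
   u (z + (0 *\<^sub>R z + h)) - u z = (\<integral>\<tau>. g (z + \<tau> *\<^sub>R (0 *\<^sub>R z + h)) \<bullet> (0 *\<^sub>R z + h) \<partial>I01)"
   by (rule wgrad_path[OF open_U bounded_U int w]) simp
  then have "AE z in lborel. (\<forall>\<tau>\<in>{0..1}. z + \<tau> *\<^sub>R h \<in> U) --> u (z + h) - u z = (\<integral>\<tau>. g (z + \<tau> *\<^sub>R h) \<bullet> h \<partial>I01)" by simp
  from AE_pair_lborel[OF this] show ?thesis
  proof eventually_elim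
   case (elim t)
   then show ?case
   proof eventually_elim
    case (elim x)
    have e: "(t, x) + \<tau> *\<^sub>R h = (t, x + (\<tau> / real (Suc k)) *\<^sub>R i)" for \<tau> by (simp add: h_def)
    have e1: "(t, x) + h = (t, x + (1 / real (Suc k)) *\<^sub>R i)" by (simp add: h_def)
    have d: "y \<bullet> h = (snd y \<bullet> i) / real (Suc k)" for y by (cases y) (simp add: h_def)
    have "(\<forall>\<tau>\<in>{0..1}. (t, x + (\<tau> / real (Suc k)) *\<^sub>R i) \<in> U) --> u (t, x + (1 / real (Suc k)) *\<^sub>R i) - u (t, x) = (\<integral>\<tau>. (snd (g (t, x + (\<tau> / real (Suc k)) *\<^sub>R i)) \<bullet> i) / real (Suc k) \<partial>I01)"
     using elim unfolding e e1 d .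
    then show ?case unfolding V_def mem_Collect_eq integral_divide_zero .
   qed
  qed
 qed
 have "AE t in lborel. \<forall>k. \<forall>i\<in>Basis. AE x in lborel. (\<forall>\<tau>\<in>{0..1}. x + (\<tau> / real (Suc k)) *\<^sub>R i \<in> V t) -->
   u (t, x + (1 / real (Suc k)) *\<^sub>R i) - u (t, x) = (\<integral>\<tau>. snd (g (t, x + (\<tau> / real (Suc k)) *\<^sub>R i)) \<bullet> i \<partial>I01) / real (Suc k)"
  unfolding AE_all_countable by (intro allI AE_finite_allI finite_Basis seg)
 with iu Lnorm_slice_finite_AE[OF p nm(1) fin(1)] Lnorm_slice_finite_AE[OF p nm(2) fin(2)] show ?thesis
 proof eventually_elim
  case (elim t)
  show ?case
  proof
   assume t: "t \<in> {0<..<2}"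
   have Vt: "emb t y \<in> V t \<longleftrightarrow> y \<in> \<Omega>" for y using t by (simp add: V_def mem_U)
   have us: "(\<lambda>x. u (t, x)) \<in> Borel" and gs: "(\<lambda>x. g (t, x)) \<in> Borel"
    by (rule slice_measurable[OF um], rule slice_measurable[OF gm])
   have gi: "integrable lborel (\<lambda>x. snd (g (t, x)))"
   proof (rule Bochner_Integration.integrable_bound[OF elim(2)])
    show "(\<lambda>x. snd (g (t, x))) \<in> borel_measurable lborel" using measurable_compose[OF gs, of snd borel] by (simp add: borel_prod[symmetric])
    show "AE x in lborel. norm (snd (g (t, x))) \<le> norm (g (t, x))" by (intro AE_I2) (metis norm_snd_le prod.collapse)
   qed
   have "wgrad (V t) (\<lambda>x. u (t, x)) (\<lambda>x. snd (g (t, x)))"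
    by (rule wgradI_segments[OF V(1) elim(1) gi]) (use elim(5) in blast)
   from wgrad_affine[OF V elim(1) gi this W_pos[of t], of "x0 - W t *\<^sub>R x0"]
   have wg: "wgrad \<Omega> (\<lambda>y. u (t, emb t y)) (\<lambda>y. W t *\<^sub>R snd (g (t, emb t y)))"
    unfolding emb_def[symmetric] Vt by simp
   have em: "emb t \<in> Borel" unfolding emb_def[abs_def] by measurable
   have m1 [measurable]: "(\<lambda>y. u (t, emb t y)) \<in> Borel" by (rule measurable_compose[OF em us])
   have m2 [measurable]: "(\<lambda>y. g (t, emb t y)) \<in> Borel" by (rule measurable_compose[OF em gs])
   have m3: "(\<lambda>y. W t *\<^sub>R snd (g (t, emb t y))) \<in> Borel"
    using measurable_compose[OF m2, of snd borel] by (simp add: borel_prod[symmetric])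
   have f1: "nrm p (\<lambda>y. u (t, emb t y)) < top"
    unfolding emb_def by (rule Lnorm_affine_finite[OF p _ W_pos elim(3)]) (use us in measurable)
   have "nrm p (\<lambda>y. g (t, emb t y)) < top"
    unfolding emb_def by (rule Lnorm_affine_finite[OF p _ W_pos elim(4)]) (use gs in measurable)
   then have "ennreal (W t) * nrm p (\<lambda>y. g (t, emb t y)) < top" by (simp add: ennreal_mult_less_top)
   moreover have "nrm p (\<lambda>y. W t *\<^sub>R snd (g (t, emb t y))) \<le> ennreal (W t) * nrm p (\<lambda>y. g (t, emb t y))"
   proof -
    have "nrm p (\<lambda>y. W t *\<^sub>R snd (g (t, emb t y))) \<le> Lnorm p (\<lambda>y. ennreal (W t) * ennreal (norm (g (t, emb t y))))"
    proof (rule Lnorm_mono[OF p])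
     fix y
     have "norm (snd (g (t, emb t y))) \<le> norm (g (t, emb t y))" by (metis norm_snd_le prod.collapse)
     then show "ennreal (norm (W t *\<^sub>R snd (g (t, emb t y)))) \<le> ennreal (W t) * ennreal (norm (g (t, emb t y)))"
      using W_pos[of t] by (simp add: ennreal_mult[symmetric] ennreal_leI mult_left_mono)
    qed
    also have "\<dots> \<le> ennreal (W t) * nrm p (\<lambda>y. g (t, emb t y))" by (rule Lnorm_cmult_le[OF p]) measurable
    finally show ?thesis .
   qed
   ultimately have f2: "nrm p (\<lambda>y. W t *\<^sub>R snd (g (t, emb t y))) < top" by (rule le_less_trans[rotated])
   have z: "u (t, emb t y) = 0 \<and> W t *\<^sub>R snd (g (t, emb t y)) = 0" if "y \<notin> \<Omega>" for y
    using u0[of "(t, emb t y)"] that t by (simp add: mem_U)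
   show "sob p \<Omega> (\<lambda>y. u (t, emb t y)) (\<lambda>y. W t *\<^sub>R snd (g (t, emb t y)))"
    unfolding sob_def using m1 m3 z f1 f2 wg by blast
  qed
 qed
qed

text \<open>For a fixed shift the path formula holds for almost every point, but the exceptional set
  depends on the shift. The estimate is jointly measurable in shift and point, so the order of the
  two quantifiers can be exchanged.\<close>

lemma vertical_move:
 assumes p: "1 \<le> p" and S: "sob p U u g"
 shows "AE z in lborel. AE r in lborel. z \<in> U --> (r, snd z) \<in> U -->
  ennreal \<bar>u z - u (r, snd z)\<bar> \<le> (NN \<tau>. ennreal (norm (g (\<tau>, snd z))) * indicator {min (fst z) r..max (fst z) r} \<tau>)"
proof -
 note int = sob_integrable[OF p open_U bounded_U S]
 have um [measurable]: "u \<in> Borel2" and gm [measurable]: "g \<in> Borel2" and w: "wgrad U u g"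
  using S by (auto simp: sob_def borel_prod)
 have Um [measurable]: "U \<in> sets (borel \<Otimes>\<^sub>M borel)" using borel_open[OF open_U] by (simp only: borel_prod)
 define I where "I z r = (NN \<tau>. ennreal (norm (g (\<tau>, snd z))) * (if min (fst z) r \<le> \<tau> \<and> \<tau> \<le> max (fst z) r then 1 else 0))" for z r
 define P where "P h z \<longleftrightarrow> (z \<in> U --> (fst z + h, snd z) \<in> U --> ennreal \<bar>u z - u (fst z + h, snd z)\<bar> \<le> I z (fst z + h))" for h z
 have fixed: "AE z in lborel. P h z" for h
 proof -
  define k :: "real \<times> 'a" where "k = (h, 0)"
  have "AE z in lborel. (\<forall>\<tau>\<in>{0..1}. z + \<tau> *\<^sub>R (0 *\<^sub>R z + k) \<in> U) -->
   u (z + (0 *\<^sub>R z + k)) - u z = (\<integral>\<tau>. g (z + \<tau> *\<^sub>R (0 *\<^sub>R z + k)) \<bullet> (0 *\<^sub>R z + k) \<partial>I01)"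
   by (rule wgrad_path[OF open_U bounded_U int w]) simp
  then have "AE z in lborel. (\<forall>\<tau>\<in>{0..1}. z + \<tau> *\<^sub>R k \<in> U) --> u (z + k) - u z = (\<integral>\<tau>. g (z + \<tau> *\<^sub>R k) \<bullet> k \<partial>I01)" by simp
  then show ?thesis
  proof eventually_elim
   case (elim z)
   obtain s y where z: "z = (s, y)" by (cases z)
   have e: "(s, y) + \<tau> *\<^sub>R k = (s + h * \<tau>, y)" for \<tau> by (simp add: k_def mult.commute)
   have e1: "(s, y) + k = (s + h, y)" by (simp add: k_def)
   have "ennreal \<bar>u (s, y) - u (s + h, y)\<bar> \<le> I (s, y) (s + h)" if zU: "(s, y) \<in> U" "(s + h, y) \<in> U"
   proof (cases "h = 0")
    case False
    \<comment> \<open>The lower of the two end points lies in \<open>U\<close>, and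
      \<open>U_up\<close> carries it over the rest of the segment.\<close>
    have "(s + h * \<tau>, y) \<in> U" if t: "\<tau> \<in> {0..1}" for \<tau>
    proof (cases "0 \<le> h")
     case True
     have "h * \<tau> \<le> h" using True t by (auto intro: mult_left_le)
     then show ?thesis using U_up[OF zU(1), of "s + h * \<tau>"] U_range[OF zU(2)] True t by auto
    next
     case h: False
     have "h * 1 \<le> h * \<tau>" using h t by (intro mult_left_mono_neg) auto
     moreover have "h * \<tau> \<le> 0" using h t by (simp add: mult_nonpos_nonneg)
     ultimately show ?thesis using U_up[OF zU(2), of "s + h * \<tau>"] U_range[OF zU(1)] by auto
    qed
    then have "u (s + h, y) - u (s, y) = (\<integral>\<tau>. g (s + h * \<tau>, y) \<bullet> k \<partial>I01)" using elim unfolding z e e1 by blast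
    then have "ennreal \<bar>u (s, y) - u (s + h, y)\<bar> = ennreal \<bar>\<integral>\<tau>. g (s + h * \<tau>, y) \<bullet> k \<partial>I01\<bar>" by (simp add: abs_minus_commute)
    also have "\<dots> \<le> (\<integral>\<^sup>+\<tau>. ennreal \<bar>g (s + h * \<tau>, y) \<bullet> k\<bar> \<partial>I01)" by (rule ennreal_abs_integral_le)
    also have "\<dots> \<le> (\<integral>\<^sup>+\<tau>. ennreal \<bar>h\<bar> * ennreal (norm (g (s + h * \<tau>, y))) \<partial>I01)"
    proof (rule nn_integral_mono)
     fix \<tau>
     have "\<bar>g (s + h * \<tau>, y) \<bullet> k\<bar> \<le> norm (g (s + h * \<tau>, y)) * norm k" by (rule Cauchy_Schwarz_ineq2)
     then show "ennreal \<bar>g (s + h * \<tau>, y) \<bullet> k\<bar> \<le> ennreal \<bar>h\<bar> * ennreal (norm (g (s + h * \<tau>, y)))"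
      by (simp add: ennreal_mult[symmetric] k_def mult.commute ennreal_leI)
    qed
    also have "\<dots> = (NN \<tau>. ennreal \<bar>h\<bar> * ennreal (norm (g (s + h * \<tau>, y))) * indicator {0..1} \<tau>)"
     by (rule nn_integral_I01) measurable
    also have "\<dots> \<le> (NN \<tau>. ennreal \<bar>h\<bar> * (ennreal (norm (g (s + h * \<tau>, y))) * (if min s (s + h) \<le> s + h * \<tau> \<and> s + h * \<tau> \<le> max s (s + h) then 1 else 0)))"
    proof (rule nn_integral_mono)
     fix \<tau> :: real
     have "min s (s + h) \<le> s + h * \<tau> \<and> s + h * \<tau> \<le> max s (s + h)" if t: "\<tau> \<in> {0..1}"
     proof (cases "0 \<le> h")
      case True
      have "h * \<tau> \<le> h" "0 \<le> h * \<tau>" using True t by (auto intro: mult_left_le)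
      then show ?thesis by auto
     next
      case h: False
      have "h * 1 \<le> h * \<tau>" using h t by (intro mult_left_mono_neg) auto
      moreover have "h * \<tau> \<le> 0" using h t by (simp add: mult_nonpos_nonneg)
      ultimately show ?thesis by auto
     qed
     then show "ennreal \<bar>h\<bar> * ennreal (norm (g (s + h * \<tau>, y))) * indicator {0..1} \<tau> \<le> ennreal \<bar>h\<bar> * (ennreal (norm (g (s + h * \<tau>, y))) * (if min s (s + h) \<le> s + h * \<tau> \<and> s + h * \<tau> \<le> max s (s + h) then 1 else 0))"
      by (cases "\<tau> \<in> {0..1}") simp_all
    qed
    also have "\<dots> = ennreal \<bar>h\<bar> * (NN \<tau>. (ennreal (norm (g (s + h * \<tau>, y))) * (if min s (s + h) \<le> s + h * \<tau> \<and> s + h * \<tau> \<le> max s (s + h) then 1 else 0)))"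
     by (rule nn_integral_cmult) measurable
    also have "\<dots> = I (s, y) (s + h)"
     unfolding I_def fst_conv snd_conv by (rule nn_integral_real_affine[OF _ False, symmetric]) measurable
    finally show ?thesis .
   qed simp
   then show ?case by (simp add: P_def z)
  qed
 qed
 have "(\<lambda>(w, \<tau>). ennreal (norm (g (\<tau>, snd (snd w)))) * (if min (fst (snd w)) (fst (snd w) + fst w) \<le> \<tau> \<and> \<tau> \<le> max (fst (snd w)) (fst (snd w) + fst w) then 1 else 0))
   \<in> borel_measurable ((borel \<Otimes>\<^sub>M (borel \<Otimes>\<^sub>M borel)) \<Otimes>\<^sub>M lborel)" by measurable
 from lborel.borel_measurable_nn_integral[OF this]
 have Im [measurable]: "(\<lambda>w. I (snd w) (fst (snd w) + fst w)) \<in> borel_measurable (borel \<Otimes>\<^sub>M (borel \<Otimes>\<^sub>M borel))"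
  unfolding I_def by simp
 have Pm: "Measurable.pred (borel \<Otimes>\<^sub>M (borel \<Otimes>\<^sub>M borel)) (\<lambda>w. P (fst w) (snd w))"
  unfolding P_def by measurable
 have "{w \<in> space (lborel \<Otimes>\<^sub>M lborel). P (fst w) (snd w)} \<in> sets (lborel \<Otimes>\<^sub>M (lborel :: (real \<times> 'a) measure))"
 proof -
  have "sets (lborel \<Otimes>\<^sub>M (lborel :: (real \<times> 'a) measure)) = sets (borel \<Otimes>\<^sub>M (borel :: (real \<times> 'a) measure))"
   by (rule sets_pair_measure_cong) simp_all
  also have "\<dots> = sets (borel \<Otimes>\<^sub>M (borel \<Otimes>\<^sub>M borel))" by (simp only: borel_prod)
  finally have eq: "sets (lborel \<Otimes>\<^sub>M (lborel :: (real \<times> 'a) measure)) = sets (borel \<Otimes>\<^sub>M (borel \<Otimes>\<^sub>M borel))" .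
  have sp: "space (lborel \<Otimes>\<^sub>M (lborel :: (real \<times> 'a) measure)) = space (borel \<Otimes>\<^sub>M (borel \<Otimes>\<^sub>M borel))"
   by (rule sets_eq_imp_space_eq[OF eq])
  show ?thesis unfolding eq sp using Pm unfolding pred_def .
 qed
 from lborel_pair.AE_commute[OF this] fixed have "AE z in lborel. AE h in lborel. P h z" by simp
 then show ?thesis
 proof eventually_elim
  case (elim z)
  from AE_lborel_affine[OF _ this, of 1 "- fst z"] have "AE r in lborel. P (- fst z + r) z" by simp
  then show ?case
  proof eventually_elim
   case (elim r)
   have "ennreal \<bar>u z - u (r, snd z)\<bar> \<le> I z r" if "z \<in> U" "(r, snd z) \<in> U" using elim that by (simp add: P_def)
   moreover have "I z r = (NN \<tau>. ennreal (norm (g (\<tau>, snd z))) * indicator {min (fst z) r..max (fst z) r} \<tau>)"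
    unfolding I_def by (intro nn_integral_cong) (simp add: indicator_def)
   ultimately show ?case by simp
  qed
 qed
qed

end

section \<open>Horizontal control and the Hajlasz gradient on the cusp\<close>

lemma both_max_measurable:
 fixes F :: "real \<times> 'a::euclidean_space => ennreal"
 assumes "F \<in> Borel2"
 shows "both_max F \<in> Borel"
proof -
 have [measurable]: "line_max s F \<in> Borel" for s
  using line_max_measurable[OF assms] by (simp add: borel_prod)
 show ?thesis unfolding both_max_def[abs_def] by measurable
qed

lemma both_max_finite:
 fixes F :: "real \<times> 'a::euclidean_space => ennreal"
 assumes p: "1 < p" and F: "F \<in> Borel2" and fin: "Lnorm p F < top"
 shows "Lnorm p (both_max F) < top"
proof -
 have p1: "1 \<le> p" using p by simp
 have m: "line_max s F \<in> Borel" for s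
  using line_max_measurable[OF F] by (simp add: borel_prod)
 obtain C where C: "\<And>s. Lnorm p (line_max s F) \<le> ennreal C * Lnorm p F"
  using line_max_strong[OF p, where 'a='a] F by blast
 have "Lnorm p (both_max F) \<le> Lnorm p (line_max 1 F) + Lnorm p (line_max (- 1) F)"
  unfolding both_max_def[abs_def] by (rule Lnorm_add_le[OF p1 m m])
 also have "\<dots> \<le> ennreal C * Lnorm p F + ennreal C * Lnorm p F" by (intro add_mono C)
 also have "\<dots> < top" using fin by (simp add: ennreal_mult_less_top)
 finally show ?thesis .
qed

context cusp begin

lemma slice_hajlasz_exists:
 assumes p: "1 \<le> p" and H: "\<forall>u g. sob p \<Omega> u g --> (\<exists>h. \<exists>N<top. admissible p \<Omega> N u h)"
  and r: "0 < r" "ball x0 r \<subseteq> \<Omega>"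
 shows "\<exists>K\<ge>0. \<forall>(v :: real \<times> 'a => real) f. v \<in> Borel2 --> f \<in> Borel2 -->
  (\<forall>t. normalized_sob p \<Omega> x0 r (\<lambda>x. v (t, x)) (\<lambda>x. f (t, x))) -->
  (\<exists>G N. G \<in> Borel2 \<and> N \<in> sets (borel \<Otimes>\<^sub>M borel) \<and> N \<in> null_sets lborel \<and>
   (\<forall>t. Lnorm p (\<lambda>x. G (t, x)) \<le> ennreal K * nrm p (\<lambda>x. f (t, x))) \<and>
   (\<forall>t. \<forall>x\<in>\<Omega>. \<forall>y\<in>\<Omega>. (t, x) \<notin> N --> (t, y) \<notin> N -->
    ennreal \<bar>v (t, x) - v (t, y)\<bar> \<le> ennreal (norm (x - y)) * (G (t, x) + G (t, y))))"
proof -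
 obtain C where C: "0 \<le> C" "\<And>u g. sob p \<Omega> u g ==> Lnorm p (\<lambda>x. ennreal \<bar>u x - ball_mean x0 r u\<bar> * indicator \<Omega> x) \<le> ennreal C * nrm p g"
  using poincare_star[OF p open_\<Omega> bdd star r] by blast
 have P: "nrm p u \<le> ennreal C * nrm p g" if S: "normalized_sob p \<Omega> x0 r u g" for u g
 proof -
  have eq: "ennreal \<bar>u x - ball_mean x0 r u\<bar> * indicator \<Omega> x = ennreal (norm (u x))" for x
   using S by (auto simp: normalized_sob_def sob_def split: split_indicator)
  have "sob p \<Omega> u g" using S by (simp only: normalized_sob_def)
  from C(2)[OF this] show ?thesis by (simp only: eq)
 qed
 have "\<exists>K\<ge>0. \<forall>u g b e. normalized_sob p \<Omega> x0 r u g --> nrm p g \<le> ennreal b --> 0 < b --> 0 < e -->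
  (\<exists>a k h. normalized_sob p \<Omega> x0 r a k \<and> nrm p (\<lambda>x. g x - k x) \<le> ennreal e \<and> admissible p \<Omega> (ennreal (K * b)) a h)"
  by (rule admissible_dense[OF p open_\<Omega> bdd P H[rule_format]])
 then obtain K where K: "0 \<le> K" "\<And>u g b e. normalized_sob p \<Omega> x0 r u g ==> nrm p g \<le> ennreal b ==> 0 < b ==> 0 < e ==>
  \<exists>a k h. normalized_sob p \<Omega> x0 r a k \<and> nrm p (\<lambda>x. g x - k x) \<le> ennreal e \<and> admissible p \<Omega> (ennreal (K * b)) a h"
  by blast
 show ?thesis
 proof (intro exI[of _ "16 * K"] conjI allI impI)
  show "0 \<le> 16 * K" using K(1) by simp
  fix v :: "real \<times> 'a => real" and f :: "real \<times> 'a => 'a"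
  assume m: "v \<in> Borel2" "f \<in> Borel2"
   and S: "\<forall>t. normalized_sob p \<Omega> x0 r (\<lambda>x. v (t, x)) (\<lambda>x. f (t, x))"
  show "\<exists>G N. G \<in> Borel2 \<and> N \<in> sets (borel \<Otimes>\<^sub>M borel) \<and> N \<in> null_sets lborel \<and>
   (\<forall>t. Lnorm p (\<lambda>x. G (t, x)) \<le> ennreal (16 * K) * nrm p (\<lambda>x. f (t, x))) \<and>
   (\<forall>t. \<forall>x\<in>\<Omega>. \<forall>y\<in>\<Omega>. (t, x) \<notin> N --> (t, y) \<notin> N -->
    ennreal \<bar>v (t, x) - v (t, y)\<bar> \<le> ennreal (norm (x - y)) * (G (t, x) + G (t, y)))"
  proof (cases "p = \<infinity>")
   case True
   show ?thesis unfolding True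
    by (rule slice_hajlasz_infinity[OF open_\<Omega> bdd C(1) K(1) P[unfolded True] K(2)[unfolded True] m S[unfolded True, rule_format]])
  next
   case False
   show ?thesis
    by (rule slice_hajlasz_finite[OF p False open_\<Omega> bdd C(1) K(1) P K(2) m S[rule_format]])
  qed
 qed
qed

text \<open>Each slice is rescaled to \<Omega>, reduced to mean zero and treated by the measurable
  selection; then everything is scaled back. The width from the rescaled gradient cancels against
  the inverse width of the Hajlasz gradient, so the norm of \<open>G'\<close> on every slice is
  bounded by that of \<open>g\<close>, however thin the slice is.\<close>

lemma horizontal_estimate:
 assumes p: "1 \<le> p" and H: "\<forall>u g. sob p \<Omega> u g --> (\<exists>h. \<exists>N<top. admissible p \<Omega> N u h)" and S: "sob p U u g"
 shows "\<exists>G N. G \<in> Borel2 \<and> Lnorm p G < top \<and>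
  N \<in> sets (borel \<Otimes>\<^sub>M borel) \<and> N \<in> null_sets lborel \<and>
  (AE r in lborel. \<forall>x y. (r, x) \<in> U - N --> (r, y) \<in> U - N -->
   ennreal \<bar>u (r, x) - u (r, y)\<bar> \<le> ennreal (norm (x - y)) * (G (r, x) + G (r, y)))"
proof -
 have um [measurable]: "u \<in> Borel2" and gm [measurable]: "g \<in> Borel2" and fin: "nrm p g < top"
  using S by (auto simp: sob_def borel_prod)
 obtain r where r: "0 < r" "ball x0 r \<subseteq> \<Omega>" using open_\<Omega> star by (auto simp: star_center_def open_contains_ball)
 obtain K where K: "0 \<le> K" and KG: "\<And>(v :: real \<times> 'a => real) f. v \<in> Borel2 ==> f \<in> Borel2 ==>
  (\<forall>t. normalized_sob p \<Omega> x0 r (\<lambda>x. v (t, x)) (\<lambda>x. f (t, x))) ==>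
  (\<exists>G N. G \<in> Borel2 \<and> N \<in> sets (borel \<Otimes>\<^sub>M borel) \<and> N \<in> null_sets lborel \<and>
   (\<forall>t. Lnorm p (\<lambda>x. G (t, x)) \<le> ennreal K * nrm p (\<lambda>x. f (t, x))) \<and>
   (\<forall>t. \<forall>x\<in>\<Omega>. \<forall>y\<in>\<Omega>. (t, x) \<notin> N --> (t, y) \<notin> N -->
    ennreal \<bar>v (t, x) - v (t, y)\<bar> \<le> ennreal (norm (x - y)) * (G (t, x) + G (t, y))))"
  using slice_hajlasz_exists[OF p H r] by blast
 obtain B where B: "{t \<in> space lborel. \<not> (t \<in> {0<..<2} --> sob p \<Omega> (\<lambda>y. u (t, emb t y)) (\<lambda>y. W t *\<^sub>R snd (g (t, emb t y))))} \<subseteq> B"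
   "emeasure lborel B = 0" "B \<in> sets lborel"
  by (rule AE_E[OF slice_sob[OF p S]])
 have Bn: "B \<in> null_sets lborel" using B(2,3) by (rule null_setsI)
 \<comment> \<open>The good heights. On the others \<open>v\<close> and \<open>f\<close> are set to
   zero, so that the normalisation holds for every \<open>t\<close>, as the selection
   requires.\<close>
 define T where "T = {0<..<2} - B"
 have Tm [measurable]: "T \<in> sets borel" using B(3) by (simp add: T_def)
 have TS: "sob p \<Omega> (\<lambda>y. u (t, emb t y)) (\<lambda>y. W t *\<^sub>R snd (g (t, emb t y)))" if "t \<in> T" for t
  using that B(1) by (auto simp: T_def)
 have Om [measurable]: "\<Omega> \<in> sets borel" using open_\<Omega> by simp
 define m where "m t = ball_mean x0 r (\<lambda>y. u (t, emb t y))" for t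
 have ue [measurable]: "(\<lambda>z. u (fst z, emb (fst z) (snd z))) \<in> Borel2"
  and ge [measurable]: "(\<lambda>z. g (fst z, emb (fst z) (snd z))) \<in> Borel2"
  by measurable
 have mm [measurable]: "m \<in> Borel"
 proof -
  have [measurable]: "(\<lambda>z. u (fst z, emb (fst z) (snd z))) \<in> borel_measurable (borel \<Otimes>\<^sub>M lborel)"
   using ue by (simp cong: measurable_cong_sets sets_pair_measure_cong)
  have [measurable]: "ball x0 r \<in> sets borel" by simp
  have "(\<lambda>(t, y). u (t, emb t y) * indicator (ball x0 r) y) \<in> borel_measurable (borel \<Otimes>\<^sub>M lborel)"
   unfolding case_prod_beta by measurable
  from lborel.borel_measurable_lebesgue_integral[OF this] show ?thesis
   unfolding m_def[abs_def] ball_mean_def by measurable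
 qed
 define v where "v z = (if fst z \<in> T then u (fst z, emb (fst z) (snd z)) - m (fst z) * indicator \<Omega> (snd z) else 0)" for z
 define f where "f z = (if fst z \<in> T then W (fst z) *\<^sub>R snd (g (fst z, emb (fst z) (snd z))) else 0)" for z
 have vm: "v \<in> Borel2" unfolding v_def[abs_def] by measurable
 have fm: "f \<in> Borel2"
 proof -
  have "(snd :: real \<times> 'a => 'a) \<in> Borel"
   by (intro borel_measurable_continuous_onI continuous_intros)
  from measurable_compose[OF ge this]
  have [measurable]: "(\<lambda>z. snd (g (fst z, emb (fst z) (snd z)))) \<in> Borel2" .
  show ?thesis unfolding f_def[abs_def] by measurable
 qed
 have N: "normalized_sob p \<Omega> x0 r (\<lambda>x. v (t, x)) (\<lambda>x. f (t, x))" for t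
 proof (cases "t \<in> T")
  case True
  note I = sob_indicator[OF p open_\<Omega> bdd]
  have "sob p \<Omega> (\<lambda>x. 1 * u (t, emb t x) + (- m t) * indicator \<Omega> x) (\<lambda>x. 1 *\<^sub>R (W t *\<^sub>R snd (g (t, emb t x))) + (- m t) *\<^sub>R 0)"
   by (rule sob_lincomb[OF p open_\<Omega> bdd TS[OF True] I])
  moreover have "ball_mean x0 r (indicator \<Omega>) = 1"
  proof -
   have "(BB y. indicator \<Omega> y * indicator (ball x0 r) y) = (\<integral>y. (indicator (ball x0 r) y :: real) \<partial>(lborel :: 'a measure))"
    using r(2) by (intro Bochner_Integration.integral_cong) (auto split: split_indicator)
   also have "\<dots> = measure lborel (ball x0 r)" by simp
   finally show ?thesis using measure_ball_pos[OF r(1), of x0] by (simp add: ball_mean_def)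
  qed
  then have "ball_mean x0 r (\<lambda>x. 1 * u (t, emb t x) + (- m t) * indicator \<Omega> x) = 0"
   unfolding ball_mean_lincomb[OF sob_integrable(1)[OF p open_\<Omega> bdd TS[OF True]] sob_integrable(1)[OF p open_\<Omega> bdd I]]
   by (simp add: m_def)
  ultimately show ?thesis using True by (simp add: normalized_sob_def v_def f_def)
 qed (use normalized_sob_zero[OF p] in \<open>simp add: v_def f_def\<close>)
 obtain G N where Gm [measurable]: "G \<in> Borel2" and Nm [measurable]: "N \<in> sets (borel \<Otimes>\<^sub>M borel)" and Nn: "N \<in> null_sets lborel"
  and GL: "\<And>t. Lnorm p (\<lambda>x. G (t, x)) \<le> ennreal K * nrm p (\<lambda>x. f (t, x))"
  and GH: "\<And>t x y. x \<in> \<Omega> ==> y \<in> \<Omega> ==> (t, x) \<notin> N ==> (t, y) \<notin> N ==>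
    ennreal \<bar>v (t, x) - v (t, y)\<bar> \<le> ennreal (norm (x - y)) * (G (t, x) + G (t, y))"
  using KG[OF vm fm] N by blast
 define G' where "G' z = (if fst z \<in> T then ennreal (inverse (W (fst z))) * G (fst z, proj (fst z) (snd z)) else 0)" for z
 define N' where "N' = {z \<in> space (borel \<Otimes>\<^sub>M borel). fst z \<in> T \<and> (fst z, proj (fst z) (snd z)) \<in> N}"
 have G'm: "G' \<in> Borel2" unfolding G'_def[abs_def] by measurable
 have N'm: "N' \<in> sets (borel \<Otimes>\<^sub>M borel)" unfolding N'_def by measurable
 have N'n: "N' \<in> null_sets lborel"
 proof (rule null_sets_of_slices[OF N'm])
  show "AE t in lborel. AE x in lborel. (t, x) \<notin> N'"
   using AE_pair_lborel[OF AE_not_in[OF Nn]]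
  proof eventually_elim
   case (elim t)
   from AE_lborel_affine[OF _ this, of "inverse (W t)" "x0 - inverse (W t) *\<^sub>R x0"] W_pos[of t]
   have "AE x in lborel. (t, proj t x) \<notin> N" unfolding proj_def by simp
   then show ?case by eventually_elim (simp add: N'_def)
  qed
 qed
 have L: "Lnorm p (\<lambda>x. G' (t, x)) \<le> ennreal K * nrm p (\<lambda>x. g (t, x))" for t
 proof (cases "t \<in> T")
  case True
  have gs: "(\<lambda>x. g (t, x)) \<in> Borel" by (rule slice_measurable[OF gm])
  have Gs: "(\<lambda>x. G (t, x)) \<in> Borel" by (rule slice_measurable[OF Gm])
  have fs: "(\<lambda>x. f (t, x)) \<in> Borel" by (rule slice_measurable[OF fm])
  have pm: "proj t \<in> Borel" unfolding proj_def[abs_def] by measurable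
  have W: "0 < inverse (W t)" using W_pos[of t] by simp
  have "(\<lambda>x. ennreal (norm (f (t, x)))) \<in> Borel" using fs by measurable
  from Lnorm_affine_mono[OF p Gs this W GL[of t], where t="x0 - inverse (W t) *\<^sub>R x0"]
  have "Lnorm p (\<lambda>x. G (t, proj t x)) \<le> ennreal K * nrm p (\<lambda>x. f (t, proj t x))" unfolding proj_def .
  also have "nrm p (\<lambda>x. f (t, proj t x)) \<le> Lnorm p (\<lambda>x. ennreal (W t) * ennreal (norm (g (t, x))))"
  proof (rule Lnorm_mono[OF p])
   fix x
   have "norm (snd (g (t, x))) \<le> norm (g (t, x))" by (metis norm_snd_le prod.collapse)
   then show "ennreal (norm (f (t, proj t x))) \<le> ennreal (W t) * ennreal (norm (g (t, x)))"
    using W_pos[of t] True by (simp add: f_def ennreal_mult[symmetric] ennreal_leI mult_left_mono)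
  qed
  also have "\<dots> \<le> ennreal (W t) * nrm p (\<lambda>x. g (t, x))" by (rule Lnorm_cmult_le[OF p]) (use gs in measurable)
  finally have 1: "Lnorm p (\<lambda>x. G (t, proj t x)) \<le> ennreal K * (ennreal (W t) * nrm p (\<lambda>x. g (t, x)))"
   by (simp add: mult_left_mono)
  have "Lnorm p (\<lambda>x. G' (t, x)) = Lnorm p (\<lambda>x. ennreal (inverse (W t)) * G (t, proj t x))" using True by (simp add: G'_def)
  also have "\<dots> \<le> ennreal (inverse (W t)) * Lnorm p (\<lambda>x. G (t, proj t x))"
   by (rule Lnorm_cmult_le[OF p]) (rule measurable_compose[OF pm Gs])
  also have "\<dots> \<le> ennreal (inverse (W t)) * (ennreal K * (ennreal (W t) * nrm p (\<lambda>x. g (t, x))))"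
   using 1 by (rule mult_left_mono) simp
  also have "\<dots> = (ennreal (inverse (W t)) * ennreal (W t)) * (ennreal K * nrm p (\<lambda>x. g (t, x)))" by (simp only: mult_ac)
  also have "ennreal (inverse (W t)) * ennreal (W t) = 1" using W_pos[of t] by (simp add: ennreal_mult[symmetric])
  finally show ?thesis by simp
 qed (simp add: G'_def Lnorm_zero[OF p])
 have "Lnorm p G' \<le> ennreal K * nrm p g"
  by (rule Lnorm_prod_le[OF p G'm]) (use gm L in \<open>measurable, simp\<close>)
 also have "\<dots> < top" using fin by (simp add: ennreal_mult_less_top)
 finally have G'L: "Lnorm p G' < top" .
 have est: "ennreal \<bar>u (t, x) - u (t, y)\<bar> \<le> ennreal (norm (x - y)) * (G' (t, x) + G' (t, y))"
  if t: "t \<notin> B" and xy: "(t, x) \<in> U - N'" "(t, y) \<in> U - N'" for t x y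
 proof -
  have tT: "t \<in> T" using t xy by (auto simp: T_def mem_U)
  have x: "proj t x \<in> \<Omega>" "(t, proj t x) \<notin> N" and y: "proj t y \<in> \<Omega>" "(t, proj t y) \<notin> N"
   using xy tT by (auto simp: mem_U N'_def space_pair_measure)
  have "ennreal \<bar>u (t, x) - u (t, y)\<bar> = ennreal \<bar>v (t, proj t x) - v (t, proj t y)\<bar>"
   using tT x y by (simp add: v_def)
  also have "\<dots> \<le> ennreal (norm (proj t x - proj t y)) * (G (t, proj t x) + G (t, proj t y))" by (intro GH x y)
  also have "\<dots> = ennreal (norm (x - y)) * (G' (t, x) + G' (t, y))"
   using W_pos[of t] tT by (simp add: proj_diff G'_def ennreal_mult distrib_left mult_ac)
  finally show ?thesis .
 qed
 have AEr: "AE t in lborel. \<forall>x y. (t, x) \<in> U - N' --> (t, y) \<in> U - N' -->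
   ennreal \<bar>u (t, x) - u (t, y)\<bar> \<le> ennreal (norm (x - y)) * (G' (t, x) + G' (t, y))"
  using AE_not_in[OF Bn] by eventually_elim (use est in blast)
 show ?thesis by (rule exI[of _ G'], rule exI[of _ N']) (use G'm G'L N'm N'n AEr in blast)
qed

lemma cusp_admissible:
 assumes p: "1 < p" and H: "\<forall>u g. sob p \<Omega> u g --> (\<exists>h. \<exists>N<top. admissible p \<Omega> N u h)" and S: "sob p U u g"
 shows "\<exists>h. \<exists>N<top. admissible p U N u h"
proof -
 have p1: "1 \<le> p" using p by simp
 have gm [measurable]: "g \<in> Borel2" and fin: "nrm p g < top"
  using S by (auto simp: sob_def borel_prod)
 obtain G N where Gm: "G \<in> Borel2" and GL: "Lnorm p G < top"
  and Nm: "N \<in> sets (borel \<Otimes>\<^sub>M borel)" and Nn: "N \<in> null_sets lborel"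
  and slice: "AE r in lborel. \<forall>x y. (r, x) \<in> U - N --> (r, y) \<in> U - N -->
   ennreal \<bar>u (r, x) - u (r, y)\<bar> \<le> ennreal (norm (x - y)) * (G (r, x) + G (r, y))"
  using horizontal_estimate[OF p1 H S] by blast
 define D where "D z = ennreal (norm (g z))" for z
 have Dm: "D \<in> Borel2" unfolding D_def[abs_def] by measurable
 have DL: "Lnorm p D < top" using fin by (simp add: D_def[abs_def])
 obtain R where R: "\<And>z. z \<in> U ==> norm z \<le> R" using bounded_U by (auto simp: bounded_iff)
 define M where "M z = both_max D z + both_max G z" for z
 \<comment> \<open>The constant of \<open>combine_slices_aux\<close> with
   \<open>2 * \<bar>R\<bar>\<close> as bound for the distance of two points of the cusp.\<close>
 define c where "c = ennreal (12 * (2 * \<bar>R\<bar> + 1))"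
 have Mm [measurable]: "M \<in> Borel"
  unfolding M_def[abs_def] using both_max_measurable[OF Dm] both_max_measurable[OF Gm] by measurable
 have "Lnorm p M \<le> Lnorm p (both_max D) + Lnorm p (both_max G)"
  unfolding M_def[abs_def] by (rule Lnorm_add_le[OF p1 both_max_measurable[OF Dm] both_max_measurable[OF Gm]])
 also have "\<dots> < top" using both_max_finite[OF p Dm DL] both_max_finite[OF p Gm GL] by simp
 finally have Mfin: "Lnorm p M < top" .
 \<comment> \<open>The excluded points: those with a bad vertical estimate, those whose vertical
   line meets \<open>N\<close> in positive measure, and those where the maximal functions are
   infinite.\<close>
 obtain E where E: "{z \<in> space lborel. \<not> ((AE r in lborel. z \<in> U --> (r, snd z) \<in> U -->
  ennreal \<bar>u z - u (r, snd z)\<bar> \<le> (NN \<tau>. D (\<tau>, snd z) * indicator {min (fst z) r..max (fst z) r} \<tau>)) \<and>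
  (AE r in lborel. (r, snd z) \<notin> N) \<and> M z < top)} \<subseteq> E" "emeasure lborel E = 0" "E \<in> sets lborel"
 proof (rule AE_E)
  show "AE z in lborel. (AE r in lborel. z \<in> U --> (r, snd z) \<in> U -->
   ennreal \<bar>u z - u (r, snd z)\<bar> \<le> (NN \<tau>. D (\<tau>, snd z) * indicator {min (fst z) r..max (fst z) r} \<tau>)) \<and>
   (AE r in lborel. (r, snd z) \<notin> N) \<and> M z < top"
   using vertical_move[OF p1 S] AE_lines[OF Nm Nn] Lnorm_finite_AE[OF p1 Mm Mfin]
   by eventually_elim (simp add: D_def)
 qed
 have good: "AE r in lborel. z \<in> U --> (r, snd z) \<in> U -->
  ennreal \<bar>u z - u (r, snd z)\<bar> \<le> (NN \<tau>. D (\<tau>, snd z) * indicator {min (fst z) r..max (fst z) r} \<tau>)"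
  "AE r in lborel. (r, snd z) \<notin> N" "M z < top" if "z \<notin> E" for z
  using that E(1) by auto
 have ordered: "ennreal \<bar>u z - u w\<bar> \<le> ennreal (norm (z - w)) * (c * M z + c * M w)"
  if zw: "z \<in> U - E" "w \<in> U - E" "fst z \<le> fst w" "z \<noteq> w" for z w
 proof -
  obtain s y t x where z: "z = (s, y)" and w: "w = (t, x)" by (cases z, cases w) auto
  have nR: "norm ((s, y) - (t, x)) \<le> 2 * \<bar>R\<bar>"
   using norm_triangle_ineq4[of z w] R[of z] R[of w] zw by (auto simp: z w)
  have mv: "AE r in lborel. (r, y) \<in> U --> ennreal \<bar>u (s, y) - u (r, y)\<bar> \<le> (NN \<tau>. D (\<tau>, y) * indicator {min s r..max s r} \<tau>)"
   "AE r in lborel. (r, x) \<in> U --> ennreal \<bar>u (t, x) - u (r, x)\<bar> \<le> (NN \<tau>. D (\<tau>, x) * indicator {min t r..max t r} \<tau>)"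
   using good(1)[of z] good(1)[of w] zw by (simp_all add: z w)
  have nN: "AE r in lborel. (r, y) \<notin> N" "AE r in lborel. (r, x) \<notin> N"
   using good(2)[of z] good(2)[of w] zw by (simp_all add: z w)
  have sl: "AE r in lborel. (r, y) \<in> U --> (r, x) \<in> U --> ennreal \<bar>u (r, y) - u (r, x)\<bar> \<le> ennreal (norm (y - x)) * (G (r, y) + G (r, x))"
   using slice nN by eventually_elim blast
  have "ennreal \<bar>u (s, y) - u (t, x)\<bar> \<le> ennreal (12 * (2 * \<bar>R\<bar> + 1) * norm ((s, y) - (t, x))) *
   (both_max D (s, y) + both_max D (t, x) + (both_max G (s, y) + both_max G (t, x)))"
   by (rule combine_slices_aux[OF U_up U_range _ nR Dm Gm _ _ _ _ mv sl]) (use zw in \<open>auto simp: z w\<close>)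
  also have "both_max D (s, y) + both_max D (t, x) + (both_max G (s, y) + both_max G (t, x)) = M z + M w"
   by (simp add: M_def z w add_ac)
  also have "ennreal (12 * (2 * \<bar>R\<bar> + 1) * norm ((s, y) - (t, x))) = ennreal (norm (z - w)) * c"
   unfolding c_def z w by (subst ennreal_mult[symmetric]) (simp_all add: mult.commute)
  finally show ?thesis by (simp add: z w distrib_left mult.assoc)
 qed
 \<comment> \<open>Off \<open>E\<close> the value \<open>c * M z\<close> is finite, so nothing is
   lost there; on \<open>E\<close> an infinite value is turned into 0.\<close>
 define h where "h z = enn2real (c * M z)" for z
 have hM: "c * M z = ennreal (h z)" if "z \<notin> E" for z
  using good(3)[OF that] by (simp add: h_def c_def ennreal_mult_less_top)
 have "hajlasz U u h"
  unfolding hajlasz_def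
 proof (intro bexI[of _ E] ballI)
  show "E \<in> null_sets lborel" using E(2,3) by (rule null_setsI)
  fix z w assume zw: "z \<in> U - E" "w \<in> U - E"
  have h0: "0 \<le> h z" "0 \<le> h w" by (simp_all add: h_def)
  have "ennreal \<bar>u z - u w\<bar> \<le> ennreal (norm (z - w)) * (c * M z + c * M w)"
  proof (cases "z = w")
   case False
   show ?thesis
   proof (cases "fst z \<le> fst w")
    case True
    show ?thesis by (rule ordered[OF zw True False])
   next
    case F: False
    have "fst w \<le> fst z" using F by simp
    from ordered[OF zw(2,1) this] False show ?thesis by (simp add: norm_minus_commute abs_minus_commute add.commute)
   qed
  qed simp
  also have "\<dots> = ennreal (norm (z - w) * (h z + h w))" using zw h0 by (simp add: hM ennreal_mult)
  finally show "\<bar>u z - u w\<bar> \<le> norm (z - w) * (h z + h w)" using h0 by simp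
 qed
 moreover have "h \<in> Borel" unfolding h_def[abs_def] by measurable
 moreover have "nrm p h \<le> c * Lnorm p M"
 proof -
  have "nrm p h \<le> Lnorm p (\<lambda>z. c * M z)"
  proof (rule Lnorm_mono[OF p1])
   fix z show "ennreal (norm (h z)) \<le> c * M z" by (cases "c * M z") (simp_all add: h_def)
  qed
  also have "\<dots> \<le> c * Lnorm p M" by (rule Lnorm_cmult_le[OF p1 Mm])
  finally show ?thesis .
 qed
 moreover have "c * Lnorm p M < top" using Mfin by (simp add: c_def ennreal_mult_less_top)
 ultimately have "admissible p U (c * Lnorm p M) u h" "c * Lnorm p M < top" by (auto simp: admissible_def h_def)
 then show ?thesis by blast
qed

text \<open>The lift is built over the slice at height 1, which contains the horizontal projection
  of every point of the cusp, so that the thin part needs no separate definition.\<close>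

lemma base_admissible:
 assumes p: "1 \<le> p" and H: "\<forall>u g. sob p U u g --> (\<exists>h. \<exists>N<top. admissible p U N u h)" and S: "sob p \<Omega> u g"
 shows "\<exists>h. \<exists>N<top. admissible p \<Omega> N u h"
proof -
 note int = sob_integrable[OF p open_\<Omega> bdd S]
 have um: "u \<in> Borel" and gm: "g \<in> Borel"
  and u0: "\<And>x. x \<notin> \<Omega> ==> u x = 0 \<and> g x = 0" and fin: "nrm p u < top" "nrm p g < top" and wu: "wgrad \<Omega> u g"
  using S by (auto simp: sob_def)
 define c where "c = inverse (W 1)"
 have c: "0 < c" using W_pos[of 1] by (simp add: c_def)
 define w where "w x = u (proj 1 x)" for x
 define k where "k x = c *\<^sub>R g (proj 1 x)" for x
 define V where "V = {x. proj 1 x \<in> \<Omega>}"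
 have V: "open V" unfolding V_def by (rule open_slice)
 have VU: "x \<in> V" if "(t, x) \<in> U" for t x using U_up[OF that, of 1] by (simp add: mem_U V_def)
 have Vb: "bounded V"
 proof -
  have "V \<subseteq> snd ` U" using mem_U by (force simp: V_def intro: image_eqI[of _ _ "(1, _)"])
  then show ?thesis by (rule bounded_subset[OF bounded_snd[OF bounded_U]])
 qed
 have pm: "proj 1 \<in> Borel" unfolding proj_def[abs_def] by measurable
 have wm [measurable]: "w \<in> Borel" unfolding w_def by (rule measurable_compose[OF pm um])
 have gp [measurable]: "(\<lambda>x. g (proj 1 x)) \<in> Borel" by (rule measurable_compose[OF pm gm])
 have km [measurable]: "k \<in> Borel" unfolding k_def[abs_def] by measurable
 have wL: "nrm p w < top" unfolding w_def proj_def
  by (rule Lnorm_affine_finite[OF p _ c[unfolded c_def] fin(1)]) (use um in measurable)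
 have kL: "nrm p k < top"
 proof -
  have "nrm p (\<lambda>x. g (proj 1 x)) < top" unfolding proj_def
   by (rule Lnorm_affine_finite[OF p _ c[unfolded c_def] fin(2)]) (use gm in measurable)
  then have 1: "ennreal c * nrm p (\<lambda>x. g (proj 1 x)) < top" by (simp add: ennreal_mult_less_top)
  have eq: "ennreal (norm (k x)) = ennreal c * ennreal (norm (g (proj 1 x)))" for x using c by (simp add: k_def ennreal_mult)
  have "nrm p k \<le> ennreal c * nrm p (\<lambda>x. g (proj 1 x))" unfolding eq by (rule Lnorm_cmult_le[OF p]) measurable
  then show ?thesis using 1 by (rule le_less_trans)
 qed
 have w0: "w x = 0 \<and> k x = 0" if "x \<notin> V" for x using u0[of "proj 1 x"] that by (simp add: V_def w_def k_def)
 have Vbm: "V \<in> sets borel" using V by simp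
 have wi: "integrable lborel w" "integrable lborel k"
  using finite_nrm_integrable[OF p Vbm Vb wm _ wL] finite_nrm_integrable[OF p Vbm Vb km _ kL] w0 by auto
 have wk: "wgrad V w k"
  using wgrad_affine[OF open_\<Omega> bdd int wu c, of "x0 - inverse (W 1) *\<^sub>R x0"]
  unfolding w_def k_def V_def proj_def c_def .
 define v where "v z = indicator U z * w (snd z)" for z
 define f :: "real \<times> 'a => real \<times> 'a" where "f z = indicator U z *\<^sub>R (0, k (snd z))" for z
 have Um [measurable]: "U \<in> sets (borel \<Otimes>\<^sub>M borel)" using borel_open[OF open_U] by (simp only: borel_prod)
 have vm: "v \<in> Borel" unfolding v_def[abs_def] borel_prod[symmetric] by measurable
 have fm: "f \<in> Borel"
 proof -
  have a: "(\<lambda>z::real \<times> 'a. 0 :: real) \<in> Borel2" by simp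
  have b: "(\<lambda>z. indicator U z *\<^sub>R k (snd z)) \<in> Borel2" by measurable
  have "f = (\<lambda>z. (0, indicator U z *\<^sub>R k (snd z)))" by (auto simp: f_def fun_eq_iff zero_prod_def)
  then show ?thesis using measurable_Pair[OF a b] by (simp only: borel_prod)
 qed
 have vL: "nrm p v < top"
 proof (rule le_less_trans[OF Lnorm_mono[OF p]])
  show "Lnorm p (\<lambda>z::real \<times> 'a. indicator {0<..<2} (fst z) * ennreal (norm (w (snd z)))) < top"
   by (rule Lnorm_cylinder_finite[OF p _ wL]) measurable
  show "ennreal (norm (v z)) \<le> indicator {0<..<2} (fst z) * ennreal (norm (w (snd z)))" for z
   using U_range[of "fst z" "snd z"] by (auto simp: v_def split: split_indicator)
 qed
 have fL: "nrm p f < top"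
 proof (rule le_less_trans[OF Lnorm_mono[OF p]])
  show "Lnorm p (\<lambda>z::real \<times> 'a. indicator {0<..<2} (fst z) * ennreal (norm (k (snd z)))) < top"
   by (rule Lnorm_cylinder_finite[OF p _ kL]) measurable
  show "ennreal (norm (f z)) \<le> indicator {0<..<2} (fst z) * ennreal (norm (k (snd z)))" for z
   using U_range[of "fst z" "snd z"] by (auto simp: f_def split: split_indicator)
 qed
 have z0: "v z = 0 \<and> f z = 0" if "z \<notin> U" for z using that by (simp add: v_def f_def zero_prod_def)
 have Ub: "U \<in> sets borel" using open_U by simp
 have vi: "integrable lborel v" "integrable lborel f"
  using finite_nrm_integrable[OF p Ub bounded_U vm _ vL] finite_nrm_integrable[OF p Ub bounded_U fm _ fL] z0 by auto
 have "wgrad U v f"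
 proof (rule wgradI_segments[OF open_U vi])
  fix n :: nat and i :: "real \<times> 'a" assume i: "i \<in> Basis"
  define h where "h = (1 / real (Suc n)) *\<^sub>R snd i"
  have "AE x in lborel. (\<forall>t\<in>{0..1}. x + t *\<^sub>R (0 *\<^sub>R x + h) \<in> V) -->
   w (x + (0 *\<^sub>R x + h)) - w x = (\<integral>t. k (x + t *\<^sub>R (0 *\<^sub>R x + h)) \<bullet> (0 *\<^sub>R x + h) \<partial>I01)"
   by (rule wgrad_path[OF V Vb wi wk]) simp
  then have "AE x in lborel. (\<forall>t\<in>{0..1}. x + t *\<^sub>R h \<in> V) --> w (x + h) - w x = (\<integral>t. k (x + t *\<^sub>R h) \<bullet> h \<partial>I01)" by simp
  then obtain N0 where N0: "{x \<in> space lborel. \<not> ((\<forall>t\<in>{0..1}. x + t *\<^sub>R h \<in> V) --> w (x + h) - w x = (\<integral>t. k (x + t *\<^sub>R h) \<bullet> h \<partial>I01))} \<subseteq> N0"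
   "emeasure lborel N0 = 0" "N0 \<in> sets lborel" by (rule AE_E)
  have N0b [measurable]: "N0 \<in> sets borel" using N0(3) by simp
  \<comment> \<open>The segment formula for the lift can fail only over the exceptional set
    \<open>N0\<close> of the formula for \<open>w\<close>, and the cylinder over a null set is
    null.\<close>
  have "{z \<in> space (borel \<Otimes>\<^sub>M borel). snd z \<in> N0} \<in> null_sets (lborel :: (real \<times> 'a) measure)"
  proof (rule null_sets_of_slices)
   show "AE t in lborel. AE x in lborel. (t, x) \<notin> {z \<in> space (borel \<Otimes>\<^sub>M borel). snd z \<in> N0}"
    using AE_not_in[OF null_setsI[OF N0(2,3)]] by (simp add: space_pair_measure)
  qed measurable
  from AE_not_in[OF this]
  show "AE z in lborel. (\<forall>t\<in>{0..1}. z + (t / real (Suc n)) *\<^sub>R i \<in> U) -->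
   v (z + (1 / real (Suc n)) *\<^sub>R i) - v z = (\<integral>t. f (z + (t / real (Suc n)) *\<^sub>R i) \<bullet> i \<partial>I01) / real (Suc n)"
  proof eventually_elim
   case (elim z)
   show ?case
   proof
    assume seg: "\<forall>t\<in>{0..1}. z + (t / real (Suc n)) *\<^sub>R i \<in> U"
    have zU: "z \<in> U" "z + (1 / real (Suc n)) *\<^sub>R i \<in> U" using bspec[OF seg, of 0] bspec[OF seg, of 1] by simp_all
    have s: "snd (z + (t / real (Suc n)) *\<^sub>R i) = snd z + t *\<^sub>R h" for t by (simp add: h_def)
    have s1: "snd (z + (1 / real (Suc n)) *\<^sub>R i) = snd z + h" by (simp add: h_def)
    have segV: "\<forall>t\<in>{0..1}. snd z + t *\<^sub>R h \<in> V"
    proof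
     fix t :: real assume "t \<in> {0..1}"
     with seg have "z + (t / real (Suc n)) *\<^sub>R i \<in> U" by blast
     then have "(fst (z + (t / real (Suc n)) *\<^sub>R i), snd (z + (t / real (Suc n)) *\<^sub>R i)) \<in> U" by (simp only: prod.collapse)
     from VU[OF this] show "snd z + t *\<^sub>R h \<in> V" unfolding s .
    qed
    have "snd z \<notin> N0" using elim by (simp add: space_pair_measure)
    then have "w (snd z + h) - w (snd z) = (\<integral>t. k (snd z + t *\<^sub>R h) \<bullet> h \<partial>I01)" using N0(1) segV by auto
    also have "\<dots> = (\<integral>t. (f (z + (t / real (Suc n)) *\<^sub>R i) \<bullet> i) / real (Suc n) \<partial>I01)"
    proof (rule integral_cong_AE)
     show "AE t in I01. k (snd z + t *\<^sub>R h) \<bullet> h = (f (z + (t / real (Suc n)) *\<^sub>R i) \<bullet> i) / real (Suc n)"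
     proof (rule AE_I01I)
      fix t :: real assume "0 \<le> t" "t \<le> 1"
      then have "z + (t / real (Suc n)) *\<^sub>R i \<in> U" using seg by simp
      then have "f (z + (t / real (Suc n)) *\<^sub>R i) = (0, k (snd z + t *\<^sub>R h))" unfolding f_def s by simp
      then show "k (snd z + t *\<^sub>R h) \<bullet> h = (f (z + (t / real (Suc n)) *\<^sub>R i) \<bullet> i) / real (Suc n)"
       by (simp add: inner_prod_def h_def)
     qed
     show "(\<lambda>t. k (snd z + t *\<^sub>R h) \<bullet> h) \<in> borel_measurable I01" by measurable
     have "(\<lambda>t. z + (t / real (Suc n)) *\<^sub>R i) \<in> Borel" by measurable
     from measurable_compose[OF this fm]
     show "(\<lambda>t. (f (z + (t / real (Suc n)) *\<^sub>R i) \<bullet> i) / real (Suc n)) \<in> borel_measurable I01" by measurable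
    qed
    finally show "v (z + (1 / real (Suc n)) *\<^sub>R i) - v z = (\<integral>t. f (z + (t / real (Suc n)) *\<^sub>R i) \<bullet> i \<partial>I01) / real (Suc n)"
     using zU unfolding v_def s1 by simp
   qed
  qed
 qed
 then have "sob p U v f" using vm fm z0 vL fL unfolding sob_def by blast
 from H[rule_format, OF this] obtain h N where N: "N < top" and A: "admissible p U N v h" by blast
 have hm: "h \<in> Borel" and h0: "\<And>z. 0 \<le> h z" and hL: "nrm p h < top"
  using A N by (auto simp: admissible_def)
 obtain E where E: "E \<in> null_sets lborel" "\<And>z w. z \<in> U - E ==> w \<in> U - E ==> \<bar>v z - v w\<bar> \<le> norm (z - w) * (h z + h w)"
  using A unfolding admissible_def hajlasz_def by blast
 have hm': "(\<lambda>z. ennreal (norm (h z))) \<in> Borel2" using hm unfolding borel_prod by measurable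
 have "AE t in lborel. (AE x in lborel. (t, x) \<notin> E) \<and> nrm p (\<lambda>x. h (t, x)) < top"
  using AE_pair_lborel[OF AE_not_in[OF E(1)]] Lnorm_slice_finite_AE[OF p hm' hL] by eventually_elim simp
 \<comment> \<open>Above height 1 the slice is the full dilate of \<Omega>. Almost every such height
   has a null exceptional set and a finite slice norm of \<open>h\<close>.\<close>
 from AE_ex_in_open[OF this, of "{1<..<2}"] obtain t
  where t: "1 < t" "t < 2" "AE x in lborel. (t, x) \<notin> E" "nrm p (\<lambda>x. h (t, x)) < top" by auto
 have Wt: "proj t = proj 1" using t by (auto simp: proj_def[abs_def] W_def)
 have tU: "(t, emb 1 y) \<in> U" if "y \<in> \<Omega>" for y using that t by (simp add: mem_U Wt)
 from AE_lborel_affine[OF _ t(3), of "W 1" "x0 - W 1 *\<^sub>R x0"] W_pos[of 1]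
 have "AE y in lborel. (t, emb 1 y) \<notin> E" by (simp add: emb_def)
 then obtain F where F: "{y \<in> space lborel. \<not> (t, emb 1 y) \<notin> E} \<subseteq> F" "emeasure lborel F = 0" "F \<in> sets lborel" by (rule AE_E)
 define q where "q y = W 1 * h (t, emb 1 y)" for y
 have hs: "(\<lambda>x. h (t, x)) \<in> Borel" using slice_measurable[of h] hm by (simp add: borel_prod)
 have em: "emb 1 \<in> Borel" unfolding emb_def[abs_def] by measurable
 have he [measurable]: "(\<lambda>y. h (t, emb 1 y)) \<in> Borel" by (rule measurable_compose[OF em hs])
 have qm: "q \<in> Borel" unfolding q_def[abs_def] by measurable
 have "nrm p (\<lambda>y. h (t, emb 1 y)) < top" unfolding emb_def
  by (rule Lnorm_affine_finite[OF p _ W_pos t(4)]) (use hs in measurable)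
 then have 1: "ennreal (W 1) * nrm p (\<lambda>y. h (t, emb 1 y)) < top" by (simp add: ennreal_mult_less_top)
 have eq: "ennreal (norm (q y)) = ennreal (W 1) * ennreal (norm (h (t, emb 1 y)))" for y
  using W_pos[of 1] by (simp add: q_def abs_mult ennreal_mult)
 have qL: "nrm p q \<le> ennreal (W 1) * nrm p (\<lambda>y. h (t, emb 1 y))" unfolding eq by (rule Lnorm_cmult_le[OF p]) measurable
 have "hajlasz \<Omega> u q"
  unfolding hajlasz_def
 proof (intro bexI[of _ F] ballI)
  show "F \<in> null_sets lborel" using F(2,3) by (rule null_setsI)
  fix x y assume xy: "x \<in> \<Omega> - F" "y \<in> \<Omega> - F"
  then have "(t, emb 1 x) \<in> U - E" "(t, emb 1 y) \<in> U - E" using F(1) tU by auto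
  from E(2)[OF this] this
  have "\<bar>u x - u y\<bar> \<le> norm ((t, emb 1 x) - (t, emb 1 y)) * (h (t, emb 1 x) + h (t, emb 1 y))"
   by (simp add: v_def w_def)
  \<comment> \<open>Both points have the same height, so only the horizontal distance counts; its
    factor \<open>W 1\<close> is absorbed in \<open>q\<close>.\<close>
  also have "norm ((t, emb 1 x) - (t, emb 1 y)) = W 1 * norm (x - y)"
   using W_pos[of 1] by (simp add: emb_def norm_Pair scaleR_diff_right[symmetric])
  finally show "\<bar>u x - u y\<bar> \<le> norm (x - y) * (q x + q y)" by (simp add: q_def algebra_simps)
 qed
 then have "admissible p \<Omega> (ennreal (W 1) * nrm p (\<lambda>y. h (t, emb 1 y))) u q"
  using qm qL h0 W_pos[of 1] by (auto simp: admissible_def q_def less_imp_le)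
 then show ?thesis using 1 by blast
qed

end

section \<open>Representatives\<close>

lemma AE_lebesgue_on_iff: "U \<in> sets borel ==> (AE x in lebesgue_on U. P x) \<longleftrightarrow> (AE x in lborel. x \<in> U --> P x)"
 by (subst AE_restrict_space_iff) (simp_all add: AE_completion_iff)

lemma borel_measurable_lebesgue_onI:
 fixes f :: "'a::euclidean_space => 'b::euclidean_space"
 assumes U: "U \<in> sets borel" and f': "f' \<in> Borel" and eq: "AE x in lborel. x \<in> U --> f x = f' x"
 shows "(\<lambda>x. indicator U x *\<^sub>R f x) \<in> borel_measurable lebesgue" "f \<in> borel_measurable (lebesgue_on U)"
proof -
 have "(\<lambda>x. indicator U x *\<^sub>R f' x) \<in> Borel" using U f' by measurable
 then have m: "(\<lambda>x. indicator U x *\<^sub>R f' x) \<in> borel_measurable lebesgue" by (intro measurable_completion) simp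
 have "AE x in lebesgue. indicator U x *\<^sub>R f' x = indicator U x *\<^sub>R f x"
  using eq unfolding AE_completion_iff by eventually_elim (auto split: split_indicator)
 from borel_measurable_AE[OF m this] show 1: "(\<lambda>x. indicator U x *\<^sub>R f x) \<in> borel_measurable lebesgue" .
 show "f \<in> borel_measurable (lebesgue_on U)"
  by (subst borel_measurable_restrict_space_iff) (use U 1 in auto)
qed

lemma borel_representative:
 fixes f :: "'a::euclidean_space => 'b::euclidean_space"
 assumes U: "U \<in> sets borel" and f: "f \<in> borel_measurable (lebesgue_on U)"
 shows "\<exists>f'. f' \<in> Borel \<and> (\<forall>x. x \<notin> U --> f' x = 0) \<and> (AE x in lborel. x \<in> U --> f x = f' x)"
proof -
 define g where "g x = indicator U x *\<^sub>R f x" for x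
 have "g \<in> borel_measurable lebesgue"
  using f U unfolding g_def[abs_def] by (subst (asm) borel_measurable_restrict_space_iff) auto
 then have gb: "(\<lambda>x. g x \<bullet> b) \<in> borel_measurable lebesgue" for b by measurable
 have "\<forall>b. \<exists>k. k \<in> borel_measurable lborel \<and> (AE x in lborel. g x \<bullet> b = k x)"
  using completion_ex_borel_measurable_real[OF gb] by blast
 from choice[OF this] obtain k where k: "\<And>b. k b \<in> borel_measurable lborel" "\<And>b. AE x in lborel. g x \<bullet> b = k b x" by auto
 have km [measurable]: "k b \<in> Borel" for b using k(1)[of b] by simp
 define f' where "f' x = indicator U x *\<^sub>R (\<Sum>b\<in>Basis. k b x *\<^sub>R b)" for x
 have "f' \<in> Borel" unfolding f'_def[abs_def] using U by measurable
 moreover have "AE x in lborel. \<forall>b\<in>Basis. g x \<bullet> b = k b x" by (intro AE_finite_allI finite_Basis k(2))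
 then have "AE x in lborel. x \<in> U --> f x = f' x"
 proof eventually_elim
  case (elim x)
  have "(\<Sum>b\<in>Basis. k b x *\<^sub>R b) = (\<Sum>b\<in>Basis. (g x \<bullet> b) *\<^sub>R b)" using elim by (intro sum.cong) auto
  then show ?case by (simp add: f'_def g_def euclidean_representation)
 qed
 ultimately show ?thesis by (intro exI[of _ f']) (simp add: f'_def)
qed

lemma Lp_iff_nrm:
 fixes f :: "'a::euclidean_space => 'b::euclidean_space"
 assumes p: "1 \<le> p" and U: "U \<in> sets borel" and f': "f' \<in> Borel" and 0: "\<And>x. x \<notin> U ==> f' x = 0"
  and eq: "AE x in lborel. x \<in> U --> f x = f' x"
 shows "f \<in> Lp p U \<longleftrightarrow> nrm p f' < top"
proof (cases "p = \<infinity>")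
 case True
 have "(\<exists>C. AE x in lborel. x \<in> U --> norm (f x) \<le> C) \<longleftrightarrow> nrm top f' < top"
 proof
  assume "\<exists>C. AE x in lborel. x \<in> U --> norm (f x) \<le> C"
  then obtain C where "AE x in lborel. x \<in> U --> norm (f x) \<le> C" by blast
  with eq have "AE x in lborel. ennreal (norm (f' x)) \<le> ennreal (max 0 C)"
   by eventually_elim (metis 0 ennreal_leI max.cobounded1 max.coboundedI2 norm_zero)
  then have "nrm top f' \<le> ennreal (max 0 C)" unfolding Lnorm_top_le_iff .
  then show "nrm top f' < top" by (rule le_less_trans) simp
 next
  assume "nrm top f' < top"
  then obtain C where C: "nrm top f' = ennreal C" "0 \<le> C" by (cases "nrm top f'") auto
  have "AE x in lborel. ennreal (norm (f' x)) \<le> ennreal C" using Lnorm_top_le_iff[of "\<lambda>x. ennreal (norm (f' x))" "ennreal C"] C(1) by simp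
  with eq have "AE x in lborel. x \<in> U --> norm (f x) \<le> C" by eventually_elim (use C(2) in auto)
  then show "\<exists>C. AE x in lborel. x \<in> U --> norm (f x) \<le> C" by blast
 qed
 then show ?thesis using True borel_measurable_lebesgue_onI(2)[OF U f' eq] by (simp add: Lp_def AE_lebesgue_on_iff[OF U])
next
 case False
 define q where "q = enn2real p"
 have q: "1 \<le> q" using enn2real_ge_1[OF False p] by (simp add: q_def)
 have m': "(\<lambda>x. norm (f' x) powr q) \<in> Borel" using f' by measurable
 have eq': "AE x in lborel. x \<in> U --> norm (f x) powr q = norm (f' x) powr q" using eq by eventually_elim auto
 have "integrable (lebesgue_on U) (\<lambda>x. norm (f x) powr q) \<longleftrightarrow> integrable lebesgue (\<lambda>x. indicator U x *\<^sub>R (norm (f x) powr q))"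
  using U by (intro integrable_restrict_space) auto
 also have "\<dots> \<longleftrightarrow> integrable lebesgue (\<lambda>x. norm (f' x) powr q)"
 proof (rule integrable_cong_AE)
  show "(\<lambda>x. indicator U x *\<^sub>R (norm (f x) powr q)) \<in> borel_measurable lebesgue"
   by (rule borel_measurable_lebesgue_onI(1)[OF U m' eq'])
  show "(\<lambda>x. norm (f' x) powr q) \<in> borel_measurable lebesgue" using m' by (intro measurable_completion) simp
  show "AE x in lebesgue. indicator U x *\<^sub>R (norm (f x) powr q) = norm (f' x) powr q"
   using eq' unfolding AE_completion_iff by eventually_elim (use 0 in \<open>auto split: split_indicator\<close>)
 qed
 also have "\<dots> \<longleftrightarrow> integrable lborel (\<lambda>x. norm (f' x) powr q)" using m' by (intro integrable_completion) simp
 also have "\<dots> \<longleftrightarrow> (NN x. epow q (ennreal (norm (f' x)))) < top"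
  using m' by (simp add: integrable_iff_bounded epow_ennreal)
 also have "\<dots> \<longleftrightarrow> nrm p f' < top" unfolding q_def epow_Lnorm[OF False p, symmetric] by simp
 finally show ?thesis using False borel_measurable_lebesgue_onI(2)[OF U f' eq] by (simp add: Lp_def q_def)
qed

lemma Lp_representative:
 fixes f :: "'a::euclidean_space => 'b::euclidean_space"
 assumes p: "1 \<le> p" and U: "U \<in> sets borel" and f: "f \<in> Lp p U"
 shows "\<exists>f'. f' \<in> Borel \<and> (\<forall>x. x \<notin> U --> f' x = 0) \<and> nrm p f' < top \<and> (AE x in lborel. x \<in> U --> f x = f' x)"
proof -
 have "f \<in> borel_measurable (lebesgue_on U)" using f by (simp add: Lp_def)
 from borel_representative[OF U this] obtain f' where f': "f' \<in> Borel" "\<And>x. x \<notin> U ==> f' x = 0" "AE x in lborel. x \<in> U --> f x = f' x"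
  by blast
 then show ?thesis using Lp_iff_nrm[OF p U f'] f by blast
qed

lemma integral_lebesgue_on_eq:
 fixes a a' :: "'a::euclidean_space => real"
 assumes U: "U \<in> sets borel" and a': "a' \<in> Borel" and 0: "\<And>x. x \<notin> U ==> a' x = 0"
  and eq: "AE x in lborel. x \<in> U --> a x = a' x"
 shows "(\<integral>x. a x \<partial>lebesgue_on U) = (BB x. a' x)"
proof -
 have "(\<integral>x. a x \<partial>lebesgue_on U) = (\<integral>x. indicator U x *\<^sub>R a x \<partial>lebesgue)"
  using U by (intro integral_restrict_space) auto
 also have "\<dots> = (\<integral>x. a' x \<partial>lebesgue)"
 proof (rule integral_cong_AE)
  show "(\<lambda>x. indicator U x *\<^sub>R a x) \<in> borel_measurable lebesgue" by (rule borel_measurable_lebesgue_onI(1)[OF U a' eq])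
  show "a' \<in> borel_measurable lebesgue" using a' by (intro measurable_completion) simp
  show "AE x in lebesgue. indicator U x *\<^sub>R a x = a' x"
   using eq unfolding AE_completion_iff by eventually_elim (use 0 in \<open>auto split: split_indicator\<close>)
 qed
 also have "\<dots> = (BB x. a' x)" using a' by (intro integral_completion) simp
 finally show ?thesis .
qed

lemma weak_gradient_iff_wgrad:
 fixes u :: "'a::euclidean_space => real"
 assumes U: "U \<in> sets borel" and m: "u' \<in> Borel" "g' \<in> Borel"
  and 0: "\<And>x. x \<notin> U ==> u' x = 0 \<and> g' x = 0"
  and eq: "AE x in lborel. x \<in> U --> u x = u' x" "AE x in lborel. x \<in> U --> g x = g' x"
 shows "weak_gradient U u g \<longleftrightarrow> wgrad U u' g'"
proof -
 have "(\<integral>x. u x * pard \<phi> i x \<partial>lebesgue_on U) = (BB x. u' x * pard \<phi> i x)"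
  "(\<integral>x. (g x \<bullet> i) * \<phi> x \<partial>lebesgue_on U) = (BB x. (g' x \<bullet> i) * \<phi> x)"
  if \<phi>: "\<phi> \<in> test_functions U" and i: "i \<in> Basis" for \<phi> i
 proof -
  note [measurable] = m test_function_partial_measurable[OF \<phi> i] test_functions_measurable[OF \<phi>]
  show "(\<integral>x. u x * pard \<phi> i x \<partial>lebesgue_on U) = (BB x. u' x * pard \<phi> i x)"
  proof (rule integral_lebesgue_on_eq[OF U])
   show "AE x in lborel. x \<in> U --> u x * pard \<phi> i x = u' x * pard \<phi> i x"
    using eq(1) by eventually_elim simp
  qed (use 0 in \<open>measurable, simp\<close>)
  show "(\<integral>x. (g x \<bullet> i) * \<phi> x \<partial>lebesgue_on U) = (BB x. (g' x \<bullet> i) * \<phi> x)"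
  proof (rule integral_lebesgue_on_eq[OF U])
   show "AE x in lborel. x \<in> U --> (g x \<bullet> i) * \<phi> x = (g' x \<bullet> i) * \<phi> x"
    using eq(2) by eventually_elim simp
  qed (use 0 in \<open>measurable, simp\<close>)
 qed
 then show ?thesis unfolding weak_gradient_def wgrad_def by simp
qed

lemma W1p_iff_sob:
 fixes u :: "'a::euclidean_space => real"
 assumes p: "1 \<le> p" and U: "open U"
 shows "u \<in> W1p p U \<longleftrightarrow> (\<exists>u' g'. sob p U u' g' \<and> (AE x in lborel. x \<in> U --> u x = u' x))"
proof
 have Ub: "U \<in> sets borel" using U by simp
 assume "u \<in> W1p p U"
 then obtain g where ug: "u \<in> Lp p U" "g \<in> Lp p U" "weak_gradient U u g" by (auto simp: W1p_def)
 obtain u' where u': "u' \<in> Borel" "\<And>x. x \<notin> U ==> u' x = 0" "nrm p u' < top" "AE x in lborel. x \<in> U --> u x = u' x"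
  using Lp_representative[OF p Ub ug(1)] by blast
 obtain g' where g': "g' \<in> Borel" "\<And>x. x \<notin> U ==> g' x = 0" "nrm p g' < top" "AE x in lborel. x \<in> U --> g x = g' x"
  using Lp_representative[OF p Ub ug(2)] by blast
 have "wgrad U u' g'"
  using weak_gradient_iff_wgrad[OF Ub u'(1) g'(1) _ u'(4) g'(4)] u'(2) g'(2) ug(3) by simp
 then have "sob p U u' g'" using u' g' by (simp add: sob_def)
 then show "\<exists>u' g'. sob p U u' g' \<and> (AE x in lborel. x \<in> U --> u x = u' x)" using u'(4) by blast
next
 have Ub: "U \<in> sets borel" using U by simp
 assume "\<exists>u' g'. sob p U u' g' \<and> (AE x in lborel. x \<in> U --> u x = u' x)"
 then obtain u' g' where S: "sob p U u' g'" and eq: "AE x in lborel. x \<in> U --> u x = u' x" by blast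
 have m: "u' \<in> Borel" "g' \<in> Borel" and 0: "\<And>x. x \<notin> U ==> u' x = 0" "\<And>x. x \<notin> U ==> g' x = 0"
  and fin: "nrm p u' < top" "nrm p g' < top" and w: "wgrad U u' g'"
  using S by (auto simp: sob_def)
 have "u \<in> Lp p U" using Lp_iff_nrm[OF p Ub m(1) 0(1) eq] fin(1) by simp
 moreover have "g' \<in> Lp p U" using Lp_iff_nrm[OF p Ub m(2) 0(2), of g'] fin(2) by simp
 moreover have "weak_gradient U u g'"
  using weak_gradient_iff_wgrad[OF Ub m _ eq, of g'] 0 w by simp
 ultimately show "u \<in> W1p p U" by (auto simp: W1p_def)
qed

lemma M1p_iff_admissible:
 fixes u :: "'a::euclidean_space => real"
 assumes p: "1 \<le> p" and U: "open U"
 shows "u \<in> M1p p U \<longleftrightarrow> (\<exists>u' h N. u' \<in> Borel \<and> (\<forall>x. x \<notin> U --> u' x = 0) \<and> nrm p u' < top \<and>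
  N < top \<and> admissible p U N u' h \<and> (AE x in lborel. x \<in> U --> u x = u' x))" (is "_ \<longleftrightarrow> ?R")
proof
 have Ub: "U \<in> sets borel" using U by simp
 assume "u \<in> M1p p U"
 then obtain g E where ug: "u \<in> Lp p U" "g \<in> Lp p U" "\<And>z. z \<in> U ==> 0 \<le> g z" and E: "E \<in> null_sets lebesgue"
  "\<And>z w. z \<in> U - E ==> w \<in> U - E ==> \<bar>u z - u w\<bar> \<le> norm (z - w) * (g z + g w)"
  by (auto simp: M1p_def Hajlasz_gradients_def)
 obtain u' where u': "u' \<in> Borel" "\<And>x. x \<notin> U ==> u' x = 0" "nrm p u' < top" "AE x in lborel. x \<in> U --> u x = u' x"
  using Lp_representative[OF p Ub ug(1)] by blast
 obtain g' where g': "g' \<in> Borel" "\<And>x. x \<notin> U ==> g' x = 0" "nrm p g' < top" "AE x in lborel. x \<in> U --> g x = g' x"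
  using Lp_representative[OF p Ub ug(2)] by blast
 obtain E' where E': "E' \<in> null_sets lborel" "E \<subseteq> E'" using E(1) unfolding null_sets_completion_iff2 by (elim bexE)
 have "AE x in lborel. x \<in> U --> x \<notin> E' \<and> u x = u' x \<and> g x = g' x"
  using u'(4) g'(4) AE_not_in[OF E'(1)] by eventually_elim simp
 then obtain F where F: "{x \<in> space lborel. \<not> (x \<in> U --> x \<notin> E' \<and> u x = u' x \<and> g x = g' x)} \<subseteq> F" "emeasure lborel F = 0" "F \<in> sets lborel"
  by (rule AE_E)
 have "hajlasz U u' (\<lambda>x. \<bar>g' x\<bar>)"
  unfolding hajlasz_def
 proof (intro bexI[of _ F] ballI)
  show "F \<in> null_sets lborel" using F(2,3) by (rule null_setsI)
  fix x y assume xy: "x \<in> U - F" "y \<in> U - F"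
  have x: "x \<in> U - E" "u x = u' x" "g x = g' x" and y: "y \<in> U - E" "u y = u' y" "g y = g' y"
   using xy F(1) E'(2) by auto
  show "\<bar>u' x - u' y\<bar> \<le> norm (x - y) * (\<bar>g' x\<bar> + \<bar>g' y\<bar>)"
   using E(2)[OF x(1) y(1)] ug(3)[of x] ug(3)[of y] xy by (simp add: x y)
 qed
 then have "admissible p U (nrm p g') u' (\<lambda>x. \<bar>g' x\<bar>)"
  using g'(1) by (simp add: admissible_def)
 then show ?R using u' g'(3) by blast
next
 have Ub: "U \<in> sets borel" using U by simp
 assume ?R
 then obtain u' h N where u': "u' \<in> Borel" "\<And>x. x \<notin> U ==> u' x = 0" "nrm p u' < top" and N: "N < top"
  and A: "admissible p U N u' h" and eq: "AE x in lborel. x \<in> U --> u x = u' x" by blast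
 have hm: "h \<in> Borel" and h0: "\<And>x. 0 \<le> h x" and hL: "nrm p h < top"
  using A N by (auto simp: admissible_def)
 obtain E where E: "E \<in> null_sets lborel" "\<And>z w. z \<in> U - E ==> w \<in> U - E ==> \<bar>u' z - u' w\<bar> \<le> norm (z - w) * (h z + h w)"
  using A by (auto simp: admissible_def hajlasz_def)
 have uL: "u \<in> Lp p U" using Lp_iff_nrm[OF p Ub u'(1,2) eq] u'(3) by simp
 have hLp: "h \<in> Lp p U"
 proof -
  define k where "k x = indicator U x * h x" for x
  have "nrm p k \<le> nrm p h" by (rule Lnorm_mono[OF p]) (auto simp: k_def split: split_indicator)
  then have "nrm p k < top" using hL by (rule le_less_trans)
  moreover have "k \<in> Borel" unfolding k_def[abs_def] using hm Ub by measurable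
  ultimately show ?thesis using Lp_iff_nrm[OF p Ub, of k h] by (simp add: k_def)
 qed
 obtain F where F: "{x \<in> space lborel. \<not> (x \<in> U --> u x = u' x)} \<subseteq> F" "emeasure lborel F = 0" "F \<in> sets lborel"
  by (rule AE_E[OF eq])
 have "E \<union> F \<in> null_sets lborel" using E(1) null_setsI[OF F(2,3)] by (rule null_sets.Un)
 then have "U \<inter> (E \<union> F) \<in> null_sets lborel" by (rule null_set_Int1) (use Ub in simp)
 then have null: "U \<inter> (E \<union> F) \<in> null_sets lebesgue" by (rule null_sets_completionI)
 have est: "\<bar>u z - u w\<bar> \<le> norm (z - w) * (h z + h w)" if "z \<in> U - U \<inter> (E \<union> F)" "w \<in> U - U \<inter> (E \<union> F)" for z w
 proof -
  have "u z = u' z" "u w = u' w" using F(1) that by auto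
  then show ?thesis using E(2)[of z w] that by auto
 qed
 have "h \<in> Hajlasz_gradients p U u"
  unfolding Hajlasz_gradients_def
 proof (intro CollectI conjI ballI bexI[of _ "U \<inter> (E \<union> F)"])
  show "\<bar>u z - u w\<bar> \<le> norm (z - w) * (h z + h w)" if "z \<in> U - U \<inter> (E \<union> F)" "w \<in> U - U \<inter> (E \<union> F)" for z w
   using that by (rule est)
 qed (use hLp h0 null in simp_all)
 then show "u \<in> M1p p U" using uL by (auto simp: M1p_def)
qed

text \<open>Boundedness of \<open>U\<close> makes the function and its Hajlasz gradient integrable,
  so a weak gradient exists; its pointwise bound by the Hajlasz gradient puts it in L^p.\<close>

lemma M1p_subset_W1p:
 fixes U :: "'a::euclidean_space set"
 assumes p: "1 \<le> p" and U: "open U" "bounded U"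
 shows "M1p p U \<subseteq> W1p p U"
proof
 have Ub [measurable]: "U \<in> sets borel" using U by simp
 fix u assume "u \<in> M1p p U"
 then obtain u' h N where u': "u' \<in> Borel" "\<And>x. x \<notin> U ==> u' x = 0" "nrm p u' < top" and N: "N < top"
  and A: "admissible p U N u' h" and eq: "AE x in lborel. x \<in> U --> u x = u' x"
  unfolding M1p_iff_admissible[OF p U(1)] by blast
 define k where "k x = indicator U x * h x" for x
 have hm [measurable]: "h \<in> Borel" and h0: "\<And>x. 0 \<le> h x" and hL: "nrm p h < top"
  using A N by (auto simp: admissible_def)
 have km [measurable]: "k \<in> Borel" unfolding k_def[abs_def] by measurable
 have "nrm p k \<le> nrm p h" by (rule Lnorm_mono[OF p]) (auto simp: k_def split: split_indicator)
 then have kL: "nrm p k < top" using hL by (rule le_less_trans)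
 have k0: "0 \<le> k x" for x using h0[of x] by (simp add: k_def)
 have ki: "integrable lborel k" by (rule finite_nrm_integrable[OF p Ub U(2) km _ kL]) (simp add: k_def)
 have ui: "integrable lborel u'" by (rule finite_nrm_integrable[OF p Ub U(2) u'(1) u'(2) u'(3)])
 have "hajlasz U u' k" using A by (auto simp: admissible_def hajlasz_def k_def)
 from hajlasz_imp_wgrad[OF U(1) ui ki k0 this] obtain w where w: "integrable lborel w" "wgrad U u' w"
  "AE x in lborel. x \<in> U --> norm (w x) \<le> 2 * real DIM('a) * k x" by blast
 have wm [measurable]: "w \<in> Borel" using borel_measurable_integrable[OF w(1)] by simp
 define g where "g x = indicator U x *\<^sub>R w x" for x
 have gm: "g \<in> Borel" unfolding g_def[abs_def] by measurable
 have "wgrad U u' g"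
  unfolding wgrad_def
 proof (intro ballI)
  fix \<phi> and i :: 'a assume \<phi>: "\<phi> \<in> test_functions U" and i: "i \<in> Basis"
  have e: "(g x \<bullet> i) * \<phi> x = (w x \<bullet> i) * \<phi> x" for x
   using test_functions_D(4)[OF \<phi>, of x] by (cases "x \<in> U") (auto simp: g_def)
  show "(BB x. u' x * pard \<phi> i x) = - (BB x. (g x \<bullet> i) * \<phi> x)"
   using w(2) \<phi> i unfolding wgrad_def e by blast
 qed
 moreover have "nrm p g < top"
 proof -
  have "nrm p g \<le> Lnorm p (\<lambda>x. ennreal (2 * real DIM('a)) * ennreal (norm (k x)))"
  proof (rule Lnorm_mono_AE[OF p])
   show "AE x in lborel. ennreal (norm (g x)) \<le> ennreal (2 * real DIM('a)) * ennreal (norm (k x))"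
    using w(3)
   proof eventually_elim
    case (elim x)
    have "norm (g x) \<le> 2 * real DIM('a) * k x" using elim k0[of x] by (cases "x \<in> U") (simp_all add: g_def)
    then show ?case using k0[of x] by (simp add: ennreal_mult[symmetric] ennreal_leI)
   qed
  qed
  also have "\<dots> \<le> ennreal (2 * real DIM('a)) * nrm p k" by (rule Lnorm_cmult_le[OF p]) measurable
  also have "\<dots> < top" using kL by (simp add: ennreal_mult_less_top)
  finally show ?thesis .
 qed
 ultimately have "sob p U u' g" using u' gm by (simp add: sob_def g_def)
 then show "u \<in> W1p p U" using eq unfolding W1p_iff_sob[OF p U(1)] by blast
qed

text \<open>A saturated set is the union of its classes and is thus recovered from its
  quotient.\<close>

lemma quotient_eq_iff:
 assumes refl: "\<And>u. (u, u) \<in> r" and A: "\<And>u v. u \<in> A ==> (u, v) \<in> r ==> v \<in> A" and B: "\<And>u v. u \<in> B ==> (u, v) \<in> r ==> v \<in> B"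
 shows "A // r = B // r \<longleftrightarrow> A = B"
proof
 have "\<Union>(A // r) = A" using refl A unfolding quotient_def by blast
 moreover have "\<Union>(B // r) = B" using refl B unfolding quotient_def by blast
 moreover assume "A // r = B // r"
 ultimately show "A = B" by metis
qed simp

text \<open>Both spaces are saturated under almost-everywhere equality, and one inclusion always
  holds on a bounded open set. What remains is a statement about Borel pairs alone, which is the
  form in which the base and the cusp are compared.\<close>

lemma W1p_eq_M1p_iff:
 fixes U :: "'a::euclidean_space set"
 assumes p: "1 \<le> p" and U: "open U" "bounded U"
 shows "W1p_eq_M1p p U \<longleftrightarrow> (\<forall>u g. sob p U u g --> (\<exists>h. \<exists>N<top. admissible p U N u h))"
proof -
 have Ub: "U \<in> sets borel" using U by simp
 have rel: "(u, v) \<in> ae_eq_rel U \<longleftrightarrow> (AE x in lborel. x \<in> U --> u x = v x)" for u v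
  by (simp add: ae_eq_rel_def AE_lebesgue_on_iff[OF Ub])
 have "W1p_eq_M1p p U \<longleftrightarrow> W1p p U = M1p p U"
  unfolding W1p_eq_M1p_def
 proof (rule quotient_eq_iff)
  show "(u, u) \<in> ae_eq_rel U" for u by (simp add: rel)
  have trans: "AE x in lborel. x \<in> U --> v x = w x"
   if "AE x in lborel. x \<in> U --> u x = v x" "AE x in lborel. x \<in> U --> u x = w x" for u v w :: "'a => real"
   using that by eventually_elim simp
  show "v \<in> W1p p U" if "u \<in> W1p p U" "(u, v) \<in> ae_eq_rel U" for u v
   using that trans unfolding W1p_iff_sob[OF p U(1)] rel by blast
  show "v \<in> M1p p U" if "u \<in> M1p p U" "(u, v) \<in> ae_eq_rel U" for u v
   using that trans unfolding M1p_iff_admissible[OF p U(1)] rel by blast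
 qed
 also have "\<dots> \<longleftrightarrow> W1p p U \<subseteq> M1p p U" using M1p_subset_W1p[OF p U] by blast
 also have "\<dots> \<longleftrightarrow> (\<forall>u g. sob p U u g --> (\<exists>h. \<exists>N<top. admissible p U N u h))"
 proof (intro iffI allI impI subsetI)
  fix u g assume sub: "W1p p U \<subseteq> M1p p U" and S: "sob p U u g"
  have "AE x in lborel. x \<in> U --> u x = u x" by simp
  then have "u \<in> W1p p U" using S unfolding W1p_iff_sob[OF p U(1)] by blast
  then have "u \<in> M1p p U" using sub by blast
  then obtain u' h N where N: "N < top" and A: "admissible p U N u' h" and eq: "AE x in lborel. x \<in> U --> u x = u' x"
   unfolding M1p_iff_admissible[OF p U(1)] by blast
  obtain E where E: "E \<in> null_sets lborel" "\<And>z w. z \<in> U - E ==> w \<in> U - E ==> \<bar>u' z - u' w\<bar> \<le> norm (z - w) * (h z + h w)"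
   using A by (auto simp: admissible_def hajlasz_def)
  obtain F where F: "{x \<in> space lborel. \<not> (x \<in> U --> u x = u' x)} \<subseteq> F" "emeasure lborel F = 0" "F \<in> sets lborel"
   by (rule AE_E[OF eq])
  have "hajlasz U u h"
   unfolding hajlasz_def
  proof (intro bexI[of _ "E \<union> F"] ballI)
   show "E \<union> F \<in> null_sets lborel" using E(1) null_setsI[OF F(2,3)] by (rule null_sets.Un)
   fix x y assume xy: "x \<in> U - (E \<union> F)" "y \<in> U - (E \<union> F)"
   then have "u x = u' x" "u y = u' y" using F(1) by auto
   then show "\<bar>u x - u y\<bar> \<le> norm (x - y) * (h x + h y)" using E(2)[of x y] xy by auto
  qed
  then have "admissible p U N u h" using A unfolding admissible_def by blast
  then show "\<exists>h. \<exists>N<top. admissible p U N u h" using N by blast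
 next
  fix u assume H: "\<forall>u g. sob p U u g --> (\<exists>h. \<exists>N<top. admissible p U N u h)" and "u \<in> W1p p U"
  then obtain u' g' where S: "sob p U u' g'" and eq: "AE x in lborel. x \<in> U --> u x = u' x"
   unfolding W1p_iff_sob[OF p U(1)] by blast
  obtain h N where A: "N < top" "admissible p U N u' h" using H S by blast
  have u': "u' \<in> Borel" "\<forall>x. x \<notin> U --> u' x = 0" "nrm p u' < top" using S by (auto simp: sob_def)
  show "u \<in> M1p p U" unfolding M1p_iff_admissible[OF p U(1)] using u' A eq by blast
 qed
 finally show ?thesis .
qed

theorem theorem1p2:
  fixes \<Omega> :: "(real ^ 'd) set" and x0 :: "real ^ 'd" and \<psi> :: "real \<Rightarrow> real"
  assumes "is_domain \<Omega>" and "bounded \<Omega>" and "star_center \<Omega> x0"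
    and "\<forall>t\<in>{0<..1}. 0 < \<psi> t"
    and "\<forall>t\<in>{0<..1}. continuous (at_left t) \<psi>"
    and "mono_on {0<..1} \<psi>"
  shows "\<forall>p::ennreal. 1 < p \<and> p \<le> \<infinity> \<longrightarrow>
    (W1p_eq_M1p p (cusp_domain \<Omega> x0 \<psi>) \<longleftrightarrow> W1p_eq_M1p p \<Omega>)"
proof (intro allI impI)
  fix p :: ennreal assume "1 < p \<and> p \<le> \<infinity>"
  then have p: "1 < p" "1 \<le> p" by auto
  interpret cusp \<Omega> x0 \<psi> using assms by unfold_locales
  have "(\<forall>u g. sob p U u g \<longrightarrow> (\<exists>h. \<exists>N<top. admissible p U N u h)) \<longleftrightarrow>
    (\<forall>u g. sob p \<Omega> u g \<longrightarrow> (\<exists>h. \<exists>N<top. admissible p \<Omega> N u h))"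
    using cusp_admissible[OF p(1)] base_admissible[OF p(2)] by blast
  then show "W1p_eq_M1p p (cusp_domain \<Omega> x0 \<psi>) \<longleftrightarrow> W1p_eq_M1p p \<Omega>"
    unfolding W1p_eq_M1p_iff[OF p(2) open_U bounded_U] W1p_eq_M1p_iff[OF p(2) open_\<Omega> bdd] .
qed

end
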